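(* Let $1<q<\infty$, $m\in\mathbb{R}$, $0\le\delta\le\rho\le1$ and $\delta<1$. Then every pseudo-differential operator $\sigma(X,D)$ with symbol $\sigma\in S^m_{\rho,\delta}$ is bounded on $M^{2,q}(\mathbb{R}^n)$ (i.e. there is $C>0$ with $\|\sigma(X,D)f\|_{M^{2,q}}\le C\|f\|_{M^{2,q}}$ for all $f\in\mathcal{S}(\mathbb{R}^n)$) if and only if $m\le -|1/q-1/2|\,\delta n$.
   Context: Fourier transform: $\hat f(\xi)=\int_{\mathbb{R}^n}e^{-i\xi\cdot x}f(x)\,dx$. For a fixed window $\gamma\in\mathcal{S}(\mathbb{R}^n)\setminus\{0\}$, the short-time Fourier transform of $f\in\mathcal{S}'(\mathbb{R}^n)$ is $V_\gamma f(x,\xi)=(f,M_\xi T_x\gamma)$, where $M_\xi\gamma(t)=e^{i\xi\cdot t}\gamma(t)$, $T_x\gamma(t)=\gamma(t-x)$ and $(\cdot,\cdot)$ is the $L^2$ inner product. For $1\le p,q\le\infty$, the modulation space $M^{p,q}(\mathbb{R}^n)$ is the set of $f\in\mathcal{S}'(\mathbb{R}^n)$ with $\|f\|_{M^{p,q}}=\big(\int(\int|V_\gamma f(x,\xi)|^p dx)^{q/p}d\xi\big)^{1/q}<\infty$ (usual modification if $p$ or $q=\infty$); different windows give equivalent norms. For $m\in\mathbb{R}$, $0\le\delta\le\rho\le1$, the symbol class $S^m_{\rho,\delta}$ consists of all $\sigma\in C^\infty(\mathbb{R}^n\times\mathbb{R}^n)$ with $|\partial_\xi^\alpha\partial_x^\beta\sigma(x,\xi)|\le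 C_{\alpha,\beta}(1+|\xi|)^{m-\rho|\alpha|+\delta|\beta|}$ for all multi-indices $\alpha,\beta$, and $\sigma(X,D)f(x)=(2\pi)^{-n}\int e^{ix\cdot\xi}\sigma(x,\xi)\hat f(\xi)\,d\xi$ for $f\in\mathcal{S}(\mathbb{R}^n)$. *)

theory Defs
  imports "HOL-Analysis.Analysis"
begin

definition dderiv :: "'a::real_normed_vector \<Rightarrow> ('a \<Rightarrow> 'b::real_normed_vector) \<Rightarrow> 'a \<Rightarrow> 'b" where
  "dderiv v g x = frechet_derivative g (at x) v"

fun iter_dderiv :: "'a::real_normed_vector list \<Rightarrow> ('a \<Rightarrow> 'b::real_normed_vector) \<Rightarrow> 'a \<Rightarrow> 'b" where
  "iter_dderiv [] g = g"
| "iter_dderiv (v # vs) g = dderiv v (iter_dderiv vs g)"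

definition smooth_fun :: "('a::real_normed_vector \<Rightarrow> 'b::real_normed_vector) \<Rightarrow> bool" where
  "smooth_fun g \<longleftrightarrow> (\<forall>vs x. iter_dderiv vs g differentiable (at x))"

text \<open>Schwartz class on R^n (multi-index derivatives as lists of coordinate directions).\<close>
definition schwartz :: "(real^'n \<Rightarrow> complex) \<Rightarrow> bool" where
  "schwartz f \<longleftrightarrow> smooth_fun f \<and>
     (\<forall>(is :: 'n list) (k::nat). \<exists>C. \<forall>x.
        (1 + norm x) ^ k * norm (iter_dderiv (map (\<lambda>i. axis i 1) is) f x) \<le> C)"

text \<open>Hoermander symbol class S^m_{rho,delta}; alpha = list of xi-directions, beta = list of x-directions.\<close>
definition symbol_class :: "real \<Rightarrow> real \<Rightarrow> real \<Rightarrow> (real^'n \<Rightarrow> real^'n \<Rightarrow> complex) set" where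
  "symbol_class m \<rho> \<delta> = {\<sigma>. smooth_fun (\<lambda>(x, \<xi>). \<sigma> x \<xi>) \<and>
     (\<forall>(as :: 'n list) (bs :: 'n list). \<exists>C. \<forall>x \<xi>.
        norm (iter_dderiv (map (\<lambda>i. (0, axis i 1)) as @ map (\<lambda>j. (axis j 1, 0)) bs)
                (\<lambda>(x, \<xi>). \<sigma> x \<xi>) (x, \<xi>))
        \<le> C * (1 + norm \<xi>) powr (m - \<rho> * real (length as) + \<delta> * real (length bs)))}"

definition fourier :: "(real^'n \<Rightarrow> complex) \<Rightarrow> real^'n \<Rightarrow> complex" where
  "fourier f \<xi> = (\<integral>x. cis (- (\<xi> \<bullet> x)) * f x \<partial>lborel)"

definition psido :: "(real^'n \<Rightarrow> real^'n \<Rightarrow> complex) \<Rightarrow> (real^'n \<Rightarrow> complex) \<Rightarrow> real^'n \<Rightarrow> complex" where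
  "psido \<sigma> f x = complex_of_real ((2 * pi) powr (- real CARD('n))) *
     (\<integral>\<xi>. cis (x \<bullet> \<xi>) * \<sigma> x \<xi> * fourier f \<xi> \<partial>lborel)"

definition stft :: "(real^'n \<Rightarrow> complex) \<Rightarrow> (real^'n \<Rightarrow> complex) \<Rightarrow> real^'n \<Rightarrow> real^'n \<Rightarrow> complex" where
  "stft \<gamma> g x \<xi> = (\<integral>t. g t * cnj (cis (\<xi> \<bullet> t) * \<gamma> (t - x)) \<partial>lborel)"

text \<open>Fixed Gaussian window (any nonzero Schwartz window gives an equivalent norm).\<close>
definition gauss_window :: "real^'n \<Rightarrow> complex" where
  "gauss_window t = complex_of_real (exp (- ((norm t)\<^sup>2)))"

definition enn_powr :: "ennreal \<Rightarrow> real \<Rightarrow> ennreal" where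
  "enn_powr a p = (if a = \<infinity> then \<infinity> else ennreal (enn2real a powr p))"

definition mod_norm_2q :: "real \<Rightarrow> (real^'n \<Rightarrow> complex) \<Rightarrow> ennreal" where
  "mod_norm_2q q g = enn_powr
     (\<integral>\<^sup>+\<xi>. enn_powr (\<integral>\<^sup>+x. ennreal ((cmod (stft gauss_window g x \<xi>))\<^sup>2) \<partial>lborel) (q / 2) \<partial>lborel)
     (1 / q)"

definition bounded_on_M2q :: "real \<Rightarrow> ((real^'n \<Rightarrow> complex) \<Rightarrow> (real^'n \<Rightarrow> complex)) \<Rightarrow> bool" where
  "bounded_on_M2q q T \<longleftrightarrow> (\<exists>C>0. \<forall>f. schwartz f \<longrightarrow>
      mod_norm_2q q (T f) \<le> ennreal C * mod_norm_2q q f)"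

end

(*
  Sufficiency. The frequency space is covered by boxes of side |xi|^delta, on each of which
  the operator is bounded on L^2 by a rescaled Calderon-Vaillancourt argument; the pieces are
  almost orthogonal, and the number |xi|^(delta n) of unit cubes in such a box costs the factor
  |xi|^(delta n |1/q - 1/2|) in passing between l^2 and l^q.
  Necessity. The symbol sum_k 4^(km) P_k(x) chi(xi / 4^k), with P_k a tensor product of normalised
  Rudin-Shapiro polynomials of degree about 4^(k delta), lies in the class because these
  polynomials are flat; tested on a single bump (q < 2) or on a sum of bumps (q > 2) it spreads or
  collects about 4^(k delta n) unit frequency cubes, which forces the bound on m.
*)
theory Submission
  imports Defs "HOL-Probability.Probability"
begin

text \<open>The side |xi|^delta is the scale at which the cost |xi|^delta of an x-derivative of the
  symbol and the gain, at least |xi|^(-delta) as \<delta> \<le> \<rho>, of a xi-derivative balance,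
  so that on a box the symbol is a rescaled S^0_{0,0} symbol with uniform constants. \<delta> < 1
  keeps |xi| comparable over a box and makes levels far from |xi| decouple geometrically.
  Derivatives fall only on the symbol and the window, never on f hat, which may therefore be cut by
  indicators of the pieces. The inner exponent 2 turns the x-integral of the short-time Fourier
  transform into a local L^2 mass of the Fourier transform; everything becomes sums over unit
  frequency cubes with effective exponent r = q/2. For the necessity, a sum of N unimodular
  exponentials can be as large as N; it has to be of order sqrt N, so that coefficients of size
  N^(-1/2) give a bounded symbol. The operator then spreads the mass of one cube evenly over N
  cubes, or collects it if the input carries the same coefficients, and the norm changes by N^(|1/q
  - 1/2|) per coordinate.\<close>

section \<open>Gaussian integrals and tensor products\<close>

lemma borel_measurable_cis [measurable]:
 "f \<in> borel_measurable M ==> (%x. cis (f x)) \<in> borel_measurable M"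
 by (rule measurable_compose[of f M borel cis borel])
   (auto intro!: borel_measurable_continuous_onI continuous_intros)

text \<open>\<open>lborel\<close> on a Euclidean space is the image of a finite product of line
  measures over \<open>Basis\<close>, so the product theorems of \<open>product_sigma_finite\<close>
  transfer along that map.\<close>

lemma
 fixes f :: "'a::euclidean_space => real => complex"
 assumes f: "\<And>b. b \<in> Basis ==> integrable lborel (f b)"
 shows integrable_lborel_prod: "integrable lborel (%x::'a. \<Prod>b\<in>Basis. f b (x \<bullet> b))"
  and integral_lborel_prod: "(\<integral>x. (\<Prod>b\<in>Basis. f b (x \<bullet> b)) \<partial>lborel) = (\<Prod>b\<in>Basis. (\<integral>x. f b x \<partial>lborel))"
proof -
 interpret product_sigma_finite "%_::'a. interval_measure (%x. x)"
  by (simp add: product_sigma_finite_def sigma_finite_interval_measure)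
 have f': "integrable (interval_measure (%x. x)) (f b)" if "b \<in> Basis" for b
  using f[OF that] by (simp add: lborel_eq_real)
 have m: "f b \<in> borel_measurable borel" if "b \<in> Basis" for b
  using f[OF that] by (auto dest: borel_measurable_integrable)
 have [measurable]: "(%x::'a. \<Prod>b\<in>Basis. f b (x \<bullet> b)) \<in> borel_measurable borel"
  by (intro borel_measurable_prod measurable_compose[OF _ m]) measurable
 have eq: "(\<Prod>b\<in>Basis. f b ((\<Sum>b\<in>Basis. x b *\<^sub>R b) \<bullet> b)) = (\<Prod>b\<in>Basis. f b (x b))" for x :: "'a => real"
  by (intro prod.cong) auto
 have T[measurable]: "(%x. \<Sum>b\<in>Basis. x b *\<^sub>R b) \<in> (\<Pi>\<^sub>M b\<in>Basis. interval_measure (%x. x)) \<rightarrow>\<^sub>M (borel :: 'a measure)"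
  by measurable
 show "integrable lborel (%x::'a. \<Prod>b\<in>Basis. f b (x \<bullet> b))"
  unfolding lborel_def
  by (subst integrable_distr_eq) (auto simp: eq simp del: inner_sum_left_Basis intro!: product_integrable_prod f')
 show "(\<integral>x. (\<Prod>b\<in>Basis. f b (x \<bullet> b)) \<partial>lborel) = (\<Prod>b\<in>Basis. (\<integral>x. f b x \<partial>lborel))"
  unfolding lborel_def[where 'a='a]
  by (subst integral_distr) (auto simp: eq simp del: inner_sum_left_Basis intro!: product_integral_prod f' simp: lborel_eq_real)
qed

text \<open>A rescaled form of the characteristic function of the standard normal law.\<close>

lemma
 fixes t :: real
 assumes "e > 0"
 shows integrable_gauss1: "integrable lborel (%s. complex_of_real (exp (- e * s\<^sup>2)) * cis (s * t))"
  and integral_gauss1: "(\<integral>s. complex_of_real (exp (- e * s\<^sup>2)) * cis (s * t) \<partial>lborel)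
    = complex_of_real (sqrt (pi / e) * exp (- t\<^sup>2 / (4 * e)))"
proof -
 \<comment> \<open>With c^2 = 2 e the dilation by c turns exp (- e s^2) into sqrt (2 pi) times
   \<open>std_normal_density\<close>.\<close>
 define c where "c = sqrt (2 * e)"
 have c: "c > 0" "c\<^sup>2 = 2 * e" using assms by (auto simp: c_def)
 have base: "integrable lborel (%s. complex_of_real (std_normal_density s) * cis (s * u))" for u
  by (rule Bochner_Integration.integrable_bound[OF integrable_normal_density[of 1 0]]) (auto simp: norm_mult)
 have val: "(\<integral>s. complex_of_real (std_normal_density s) * cis (s * u) \<partial>lborel) = complex_of_real (exp (- u\<^sup>2 / 2))" for u
 proof -
  have "(\<integral>s. complex_of_real (std_normal_density s) * cis (s * u) \<partial>lborel) = char std_normal_distribution u"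
   unfolding char_def by (subst integral_density) (auto simp: scaleR_conv_of_real cis_conv_exp mult_ac)
  then show ?thesis by (simp only: char_std_normal_distribution)
 qed
 have eq: "complex_of_real (exp (- e * s\<^sup>2)) * cis (s * t) =
   sqrt (2 * pi) * (complex_of_real (std_normal_density (0 + c * s)) * cis ((0 + c * s) * (t / c)))" for s
  using c by (simp add: std_normal_density_def power_mult_distrib)
 show "integrable lborel (%s. complex_of_real (exp (- e * s\<^sup>2)) * cis (s * t))"
  unfolding eq using c by (intro integrable_mult_right lborel_integrable_real_affine base) auto
 have "(\<integral>s. complex_of_real (exp (- e * s\<^sup>2)) * cis (s * t) \<partial>lborel) =
   sqrt (2 * pi) * (\<integral>s. complex_of_real (std_normal_density (0 + c * s)) * cis ((0 + c * s) * (t / c)) \<partial>lborel)"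
  unfolding eq by simp
 also have "(\<integral>s. complex_of_real (std_normal_density (0 + c * s)) * cis ((0 + c * s) * (t / c)) \<partial>lborel)
   = (\<integral>s. complex_of_real (std_normal_density s) * cis (s * (t / c)) \<partial>lborel) / c"
  using c lborel_integral_real_affine[of c "%s. complex_of_real (std_normal_density s) * cis (s * (t / c))" 0]
  by (simp add: scaleR_conv_of_real)
 also have "\<dots> = complex_of_real (exp (- (t/c)\<^sup>2 / 2) / c)"
  unfolding val by (simp only: of_real_divide)
 also have "sqrt (2 * pi) * (complex_of_real (exp (- (t/c)\<^sup>2 / 2) / c)) = complex_of_real (sqrt (pi / e) * exp (- t\<^sup>2 / (4 * e)))"
 proof -
  have 1: "sqrt (2 * pi) / c = sqrt (pi / e)" using assms by (simp add: c_def real_sqrt_divide[symmetric])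
  have 2: "- (t/c)\<^sup>2 / 2 = - t\<^sup>2 / (4 * e)" using c by (simp add: power_divide)
  have "sqrt (2 * pi) * (exp (- (t/c)\<^sup>2 / 2) / c) = (sqrt (2 * pi) / c) * exp (- t\<^sup>2 / (4 * e))"
   unfolding 2 by simp
  then show ?thesis unfolding 1 by (simp only: of_real_mult[symmetric])
 qed
 finally show "(\<integral>s. complex_of_real (exp (- e * s\<^sup>2)) * cis (s * t) \<partial>lborel)
    = complex_of_real (sqrt (pi / e) * exp (- t\<^sup>2 / (4 * e)))" .
qed

lemma norm_eq_sum_Basis: "(norm (x::'a::euclidean_space))\<^sup>2 = (\<Sum>b\<in>Basis. (x \<bullet> b)\<^sup>2)"
 by (subst euclidean_inner[of x x, folded power2_norm_eq_inner]) (simp add: power2_eq_square)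

lemma prod_cis: "finite A ==> (\<Prod>i\<in>A. cis (f i)) = cis (\<Sum>i\<in>A. f i)"
 by (induction A rule: finite_induct) (auto simp: cis_mult)

lemma gauss_tensor:
 fixes x y :: "'a::euclidean_space"
 shows "complex_of_real (exp (- e * (norm x)\<^sup>2)) * cis (x \<bullet> y) =
  (\<Prod>b\<in>Basis. complex_of_real (exp (- e * (x \<bullet> b)\<^sup>2)) * cis ((x \<bullet> b) * (y \<bullet> b)))"
proof -
 have "exp (- e * (norm x)\<^sup>2) = (\<Prod>b\<in>Basis. exp (- e * (x \<bullet> b)\<^sup>2))"
  by (simp add: norm_eq_sum_Basis exp_sum[symmetric] sum_distrib_left sum_negf)
 moreover have "cis (x \<bullet> y) = (\<Prod>b\<in>Basis. cis ((x \<bullet> b) * (y \<bullet> b)))"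
  by (subst euclidean_inner) (simp add: prod_cis)
 ultimately show ?thesis by (simp add: prod.distrib)
qed

lemma
 fixes y :: "'a::euclidean_space"
 assumes "e > 0"
 shows integrable_gauss: "integrable lborel (%x. complex_of_real (exp (- e * (norm x)\<^sup>2)) * cis (x \<bullet> y))"
  and integral_gauss: "(\<integral>x. complex_of_real (exp (- e * (norm x)\<^sup>2)) * cis (x \<bullet> y) \<partial>lborel)
    = complex_of_real (sqrt (pi / e) ^ DIM('a) * exp (- (norm y)\<^sup>2 / (4 * e)))"
proof -
 show "integrable lborel (%x. complex_of_real (exp (- e * (norm x)\<^sup>2)) * cis (x \<bullet> y))"
  unfolding gauss_tensor
  using integrable_lborel_prod[of "%b s. complex_of_real (exp (- e * s\<^sup>2)) * cis (s * (y \<bullet> b))"]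
   integrable_gauss1[OF assms] by auto
 have "(\<integral>x. complex_of_real (exp (- e * (norm x)\<^sup>2)) * cis (x \<bullet> y) \<partial>lborel)
   = (\<Prod>b\<in>Basis. complex_of_real (sqrt (pi / e) * exp (- (y \<bullet> b)\<^sup>2 / (4 * e))))"
  unfolding gauss_tensor
  using integral_lborel_prod[of "%b s. complex_of_real (exp (- e * s\<^sup>2)) * cis (s * (y \<bullet> b))"]
   integrable_gauss1[OF assms] integral_gauss1[OF assms] by auto
 also have "\<dots> = complex_of_real (sqrt (pi / e) ^ DIM('a) * exp (- (norm y)\<^sup>2 / (4 * e)))"
  unfolding of_real_prod[symmetric] prod.distrib
  by (simp add: norm_eq_sum_Basis exp_sum[symmetric] sum_divide_distrib sum_negf)
 finally show "(\<integral>x. complex_of_real (exp (- e * (norm x)\<^sup>2)) * cis (x \<bullet> y) \<partial>lborel)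
    = complex_of_real (sqrt (pi / e) ^ DIM('a) * exp (- (norm y)\<^sup>2 / (4 * e)))" .
qed

lemma
 assumes "e > 0"
 shows integrable_gauss_real: "integrable lborel (%x. exp (- e * (norm (x::'a::euclidean_space))\<^sup>2))"
  and integral_gauss_real: "(\<integral>x. exp (- e * (norm (x::'a))\<^sup>2) \<partial>lborel) = sqrt (pi / e) ^ DIM('a)"
proof -
 have 1: "integrable lborel (%x::'a. complex_of_real (exp (- e * (norm x)\<^sup>2)))"
  using integrable_gauss[OF assms, of "0::'a"] by simp
 then show 2: "integrable lborel (%x. exp (- e * (norm (x::'a::euclidean_space))\<^sup>2))"
  by (simp add: complex_of_real_integrable_eq)
 have "complex_of_real (\<integral>x. exp (- e * (norm (x::'a))\<^sup>2) \<partial>lborel) = complex_of_real (sqrt (pi / e) ^ DIM('a))"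
  using integral_gauss[OF assms, of "0::'a"] by simp
 then show "(\<integral>x. exp (- e * (norm (x::'a))\<^sup>2) \<partial>lborel) = sqrt (pi / e) ^ DIM('a)"
  by (simp only: of_real_eq_iff)
qed

lemma borel_measurable_cnj [measurable]:
 "f \<in> borel_measurable M ==> (%x. cnj (f x)) \<in> borel_measurable M"
 by (rule measurable_compose[of f M borel cnj borel])
   (auto intro!: borel_measurable_continuous_onI continuous_intros)

section \<open>The heat kernel, Bessel and Plancherel estimates, Fourier inversion\<close>

text \<open>The Fourier transform of exp (- e |x|^2). Its mass (2 pi)^n does not depend on e and
  concentrates at 0 as e tends to 0: a regularised multiple of the delta function.\<close>

definition heat :: "real => 'a::euclidean_space => real" where
 "heat e z = sqrt (pi / e) ^ DIM('a) * exp (- (norm z)\<^sup>2 / (4 * e))"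

lemma heat_measurable [measurable]: "heat e \<in> borel_measurable borel"
 unfolding heat_def[abs_def] by measurable

lemma heat_nonneg: "e > 0 ==> 0 \<le> heat e z"
 by (simp add: heat_def)

lemma heat_minus: "heat e (x - y) = heat e (y - x)"
 by (simp add: heat_def norm_minus_commute)

lemma
 assumes "e > 0"
 shows integrable_heat: "integrable lborel (heat e :: 'a::euclidean_space => real)"
  and integral_heat: "(\<integral>z. heat e (z::'a) \<partial>lborel) = (2 * pi) ^ DIM('a)"
proof -
 have eq: "heat e z = sqrt (pi / e) ^ DIM('a) * exp (- (1 / (4 * e)) * (norm z)\<^sup>2)" for z :: 'a
  by (simp add: heat_def)
 show "integrable lborel (heat e :: 'a => real)"
  unfolding eq[abs_def] using assms by (intro integrable_mult_right integrable_gauss_real) auto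
 have "(\<integral>z. heat e (z::'a) \<partial>lborel) = sqrt (pi / e) ^ DIM('a) * sqrt (pi / (1 / (4 * e))) ^ DIM('a)"
  unfolding eq integral_mult_right_zero using assms by (subst integral_gauss_real) auto
 also have "\<dots> = (2 * pi) ^ DIM('a)"
 proof -
  have "pi / e * (pi / (1 / (4 * e))) = (2 * pi)\<^sup>2"
   using assms by (simp add: power2_eq_square)
  then have "sqrt (pi / e) * sqrt (pi / (1 / (4 * e))) = 2 * pi"
   by (simp only: real_sqrt_mult[symmetric] real_sqrt_abs) simp
  then show ?thesis by (simp only: power_mult_distrib[symmetric])
 qed
 finally show "(\<integral>z. heat e (z::'a) \<partial>lborel) = (2 * pi) ^ DIM('a)" .
qed

lemma gauss_cis_eq_heat:
 assumes "e > 0"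
 shows "(\<integral>y. complex_of_real (exp (- e * (norm y)\<^sup>2)) * cis (y \<bullet> z) \<partial>lborel) = complex_of_real (heat e z)"
 using integral_gauss[OF assms, of z] by (simp add: heat_def)

lemma lborel_integral_shift:
 fixes f :: "'a::euclidean_space => 'b::{banach, second_countable_topology}"
 assumes "f \<in> borel_measurable borel"
 shows "(\<integral>x. f (x + a) \<partial>lborel) = (\<integral>x. f x \<partial>lborel)"
proof -
 have "(\<integral>x. f (x + a) \<partial>lborel) = (\<integral>x. f (a + x) \<partial>lborel)" by (simp add: add.commute)
 also have "\<dots> = (\<integral>x. f x \<partial>distr lborel borel ((+) a))"
  using assms by (subst integral_distr) auto
 finally show ?thesis by (simp add: lborel_distr_plus)
qed

lemma lborel_integrable_shift:
 fixes f :: "'a::euclidean_space => 'b::{banach, second_countable_topology}"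
 assumes "integrable lborel f"
 shows "integrable lborel (%x. f (x + a))"
proof -
 have "integrable (distr lborel borel ((+) a)) f" using assms by (simp add: lborel_distr_plus)
 then show ?thesis by (subst (asm) integrable_distr_eq) (use assms in \<open>auto simp: add.commute\<close>)
qed

lemma lborel_nn_integral_shift:
 fixes f :: "'a::euclidean_space => ennreal"
 assumes "f \<in> borel_measurable borel"
 shows "(\<integral>\<^sup>+x. f (x + a) \<partial>lborel) = (\<integral>\<^sup>+x. f x \<partial>lborel)"
proof -
 have "(\<integral>\<^sup>+x. f (x + a) \<partial>lborel) = (\<integral>\<^sup>+x. f (a + x) \<partial>lborel)" by (simp add: add.commute)
 also have "\<dots> = (\<integral>\<^sup>+x. f x \<partial>distr lborel borel ((+) a))"
  using assms by (subst nn_integral_distr) auto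
 finally show ?thesis by (simp add: lborel_distr_plus)
qed

lemma nn_integral_heat:
 fixes a :: "'a::euclidean_space"
 assumes "e > 0"
 shows "(\<integral>\<^sup>+z. heat e (z - a) \<partial>lborel) = ennreal ((2 * pi) ^ DIM('a))"
proof -
 have "(\<integral>\<^sup>+z. heat e (z - a) \<partial>lborel) = (\<integral>\<^sup>+z. heat e (z + (- a)) \<partial>lborel)" by simp
 also have "\<dots> = (\<integral>\<^sup>+z. heat e (z::'a) \<partial>lborel)"
  by (rule lborel_nn_integral_shift) measurable
 also have "\<dots> = ennreal (\<integral>z. heat e (z::'a) \<partial>lborel)"
  by (rule nn_integral_eq_integral[OF integrable_heat]) (use assms heat_nonneg in auto)
 finally show ?thesis using assms by (simp add: integral_heat)
qed

lemma fourier_integral_measurable [measurable]: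
 fixes H :: "'a::euclidean_space => complex"
 assumes [measurable]: "H \<in> borel_measurable borel"
 shows "(%y. \<integral>x. cis (y \<bullet> x) * H x \<partial>lborel) \<in> borel_measurable borel"
 by measurable

lemma norm_fourier_integral_le:
 fixes H :: "'a::euclidean_space => complex"
 shows "norm (\<integral>x. cis (y \<bullet> x) * H x \<partial>lborel) \<le> (\<integral>x. norm (H x) \<partial>lborel)"
 by (rule order_trans[OF integral_norm_bound]) (simp add: norm_mult)

lemma integrable_cis_mult:
 assumes "integrable M H" "f \<in> borel_measurable M"
 shows "integrable M (%x. cis (f x) * (H x :: complex))"
 using assms by (intro Bochner_Integration.integrable_bound[OF assms(1)]) (auto simp: norm_mult)

lemma integrable_tensor_lborel:
 fixes f :: "'a::euclidean_space => complex" and g :: "'b::euclidean_space => complex"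
 assumes f: "integrable lborel f" and g: "integrable lborel g"
 shows "integrable (lborel \<Otimes>\<^sub>M lborel) (%(x,y). f x * g y)"
proof (rule lborel_pair.Fubini_integrable)
 have [measurable]: "f \<in> borel_measurable borel" "g \<in> borel_measurable borel" using f g by auto
 show "(%(x,y). f x * g y) \<in> borel_measurable (lborel \<Otimes>\<^sub>M lborel)" by measurable
 have "(\<integral>y. norm (case (x, y) of (x, y) => f x * g y) \<partial>lborel) = norm (f x) * (\<integral>y. norm (g y) \<partial>lborel)" for x
  by (simp add: norm_mult)
 then show "integrable lborel (%x. \<integral>y. norm (case (x, y) of (x, y) => f x * g y) \<partial>lborel)"
  using f by simp
 show "AE x in lborel. integrable lborel (%y. case (x, y) of (x, y) => f x * g y)"
  using g by simp
qed

text \<open>The Gaussian factor makes the y-integral absolutely convergent for merely integrable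
  \<open>H\<close>; expanding the square and integrating y first leaves \<open>heat e\<close> as
  kernel. Both directions of Plancherel come from letting e tend to 0 here.\<close>

lemma gauss_regularised_norm:
 fixes H :: "'a::euclidean_space => complex"
 assumes H: "integrable lborel H" and e: "e > 0"
 shows "integrable lborel (%y. (norm (\<integral>x. cis (y \<bullet> x) * H x \<partial>lborel))\<^sup>2 * exp (- e * (norm y)\<^sup>2))"
  and "complex_of_real (\<integral>y. (norm (\<integral>x. cis (y \<bullet> x) * H x \<partial>lborel))\<^sup>2 * exp (- e * (norm y)\<^sup>2) \<partial>lborel)
   = (\<integral>x. H x * (\<integral>z. cnj (H z) * heat e (x - z) \<partial>lborel) \<partial>lborel)"
proof -
 let ?F = "%y. \<integral>x. cis (y \<bullet> x) * H x \<partial>lborel"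
 have [measurable]: "H \<in> borel_measurable borel" using H by auto
 show int: "integrable lborel (%y. (norm (?F y))\<^sup>2 * exp (- e * (norm y)\<^sup>2))"
 proof (rule Bochner_Integration.integrable_bound)
  show "integrable lborel (%y. (\<integral>x. norm (H x) \<partial>lborel)\<^sup>2 * exp (- e * (norm (y::'a))\<^sup>2))"
   by (intro integrable_mult_right integrable_gauss_real e)
  show "AE y in lborel. norm ((norm (?F y))\<^sup>2 * exp (- e * (norm y)\<^sup>2)) \<le> norm ((\<integral>x. norm (H x) \<partial>lborel)\<^sup>2 * exp (- e * (norm y)\<^sup>2))"
   using norm_fourier_integral_le[of _ H] by (auto simp: norm_mult abs_mult intro!: mult_right_mono power_mono)
 qed measurable
 have g: "integrable lborel (%y::'a. complex_of_real (exp (- e * (norm y)\<^sup>2)))"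
  using integrable_gauss_real[OF e] by (rule integrable_of_real)
 have c1: "complex_of_real ((norm (?F y))\<^sup>2 * exp (- e * (norm y)\<^sup>2)) = 
   (\<integral>x. H x * (\<integral>z. cnj (H z) * (cis (y \<bullet> (x - z)) * complex_of_real (exp (- e * (norm y)\<^sup>2))) \<partial>lborel) \<partial>lborel)" for y
 proof -
  have "complex_of_real ((norm (?F y))\<^sup>2 * exp (- e * (norm y)\<^sup>2)) = ?F y * (cnj (?F y) * complex_of_real (exp (- e * (norm y)\<^sup>2)))"
   by (simp only: complex_norm_square of_real_mult mult.assoc)
  also have "cnj (?F y) = (\<integral>z. cnj (cis (y \<bullet> z) * H z) \<partial>lborel)"
   by (rule Bochner_Integration.integral_cnj[symmetric])
  also have "?F y * (\<dots> * complex_of_real (exp (- e * (norm y)\<^sup>2))) =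
   (\<integral>x. cis (y \<bullet> x) * H x * ((\<integral>z. cnj (cis (y \<bullet> z) * H z) \<partial>lborel) * complex_of_real (exp (- e * (norm y)\<^sup>2))) \<partial>lborel)"
   by (rule integral_mult_left_zero[symmetric])
  also have "\<dots> = (\<integral>x. H x * (\<integral>z. cnj (H z) * (cis (y \<bullet> (x - z)) * complex_of_real (exp (- e * (norm y)\<^sup>2))) \<partial>lborel) \<partial>lborel)"
  proof (intro Bochner_Integration.integral_cong refl)
   fix x
   have cd: "cis (y \<bullet> (x - z)) = cis (y \<bullet> x) * cnj (cis (y \<bullet> z))" for z
    by (simp add: inner_diff_right cis_cnj cis_mult)
   have "(\<integral>z. cnj (H z) * (cis (y \<bullet> (x - z)) * complex_of_real (exp (- e * (norm y)\<^sup>2))) \<partial>lborel)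
    = (\<integral>z. (cis (y \<bullet> x) * complex_of_real (exp (- e * (norm y)\<^sup>2))) * cnj (cis (y \<bullet> z) * H z) \<partial>lborel)"
    by (intro Bochner_Integration.integral_cong refl) (simp only: cd complex_cnj_mult mult_ac)
   also have "\<dots> = (cis (y \<bullet> x) * complex_of_real (exp (- e * (norm y)\<^sup>2))) * (\<integral>z. cnj (cis (y \<bullet> z) * H z) \<partial>lborel)"
    by (rule integral_mult_right_zero)
   finally show "cis (y \<bullet> x) * H x * ((\<integral>z. cnj (cis (y \<bullet> z) * H z) \<partial>lborel) * complex_of_real (exp (- e * (norm y)\<^sup>2))) = 
    H x * (\<integral>z. cnj (H z) * (cis (y \<bullet> (x - z)) * complex_of_real (exp (- e * (norm y)\<^sup>2))) \<partial>lborel)"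
    by (simp add: mult_ac)
  qed
  finally show ?thesis .
 qed
 \<comment> \<open>Two exchanges follow, y with x and then y with z; each has a Gaussian in y times
   |H| as majorant.\<close>
 let ?K = "%y x z. cnj (H z) * (cis (y \<bullet> (x - z)) * complex_of_real (exp (- e * (norm y)\<^sup>2)))"
 have yz: "integrable (lborel \<Otimes>\<^sub>M lborel) (%(y,z). ?K y x z)" for x
 proof (rule Bochner_Integration.integrable_bound)
  show "integrable (lborel \<Otimes>\<^sub>M lborel) (%(y,z). complex_of_real (exp (- e * (norm (y::'a))\<^sup>2)) * cnj (H z))"
   using g H by (intro integrable_tensor_lborel) (auto simp: complex_integrable_cnj)
  show "(%(y, z). ?K y x z) \<in> borel_measurable (lborel \<Otimes>\<^sub>M lborel)" by measurable
 qed (auto simp: norm_mult)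
 have yxz: "integrable (lborel \<Otimes>\<^sub>M lborel) (%(y,x). H x * (\<integral>z. ?K y x z \<partial>lborel))"
 proof (rule Bochner_Integration.integrable_bound)
  show "integrable (lborel \<Otimes>\<^sub>M lborel) (%(y,x). complex_of_real (exp (- e * (norm (y::'a))\<^sup>2) * (\<integral>z. norm (H z) \<partial>lborel)) * H x)"
   using g H by (intro integrable_tensor_lborel) auto
  have "norm (\<integral>z. ?K y x z \<partial>lborel) \<le> exp (- e * (norm y)\<^sup>2) * (\<integral>z. norm (H z) \<partial>lborel)" for y x
   by (rule order_trans[OF integral_norm_bound]) (simp add: norm_mult mult_ac)
  then show "AE x in lborel \<Otimes>\<^sub>M lborel. norm (case x of (y, x) => H x * (\<integral>z. ?K y x z \<partial>lborel))
   \<le> norm (case x of (y, x) => complex_of_real (exp (- e * (norm y)\<^sup>2) * (\<integral>z. norm (H z) \<partial>lborel)) * H x)"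
   by (auto simp: norm_mult intro!: mult_left_mono AE_I2 simp: mult.commute)
 qed measurable
 have "complex_of_real (\<integral>y. (norm (?F y))\<^sup>2 * exp (- e * (norm y)\<^sup>2) \<partial>lborel) = 
  (\<integral>y. complex_of_real ((norm (?F y))\<^sup>2 * exp (- e * (norm y)\<^sup>2)) \<partial>lborel)"
  by (rule integral_of_real[OF int, symmetric])
 also have "\<dots> = (\<integral>y. (\<integral>x. H x * (\<integral>z. ?K y x z \<partial>lborel) \<partial>lborel) \<partial>lborel)" unfolding c1 ..
 also have "\<dots> = (\<integral>x. (\<integral>y. H x * (\<integral>z. ?K y x z \<partial>lborel) \<partial>lborel) \<partial>lborel)"
  by (rule lborel_pair.Fubini_integral[symmetric]) (use yxz in simp)
 also have "\<dots> = (\<integral>x. H x * (\<integral>y. (\<integral>z. ?K y x z \<partial>lborel) \<partial>lborel) \<partial>lborel)" by simp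
 also have "\<dots> = (\<integral>x. H x * (\<integral>z. (\<integral>y. ?K y x z \<partial>lborel) \<partial>lborel) \<partial>lborel)"
  by (intro Bochner_Integration.integral_cong refl arg_cong2[of _ _ _ _ "(*)"] lborel_pair.Fubini_integral[symmetric] yz)
 also have "\<dots> = (\<integral>x. H x * (\<integral>z. cnj (H z) * heat e (x - z) \<partial>lborel) \<partial>lborel)"
  
  by (intro Bochner_Integration.integral_cong refl arg_cong2[of _ _ _ _ "(*)"])
    (simp only: integral_mult_right_zero gauss_cis_eq_heat[OF e, symmetric] mult.commute[of "cis _"])
 finally show "complex_of_real (\<integral>y. (norm (?F y))\<^sup>2 * exp (- e * (norm y)\<^sup>2) \<partial>lborel) = 
  (\<integral>x. H x * (\<integral>z. cnj (H z) * heat e (x - z) \<partial>lborel) \<partial>lborel)" .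
qed

lemma norm_integral_le_nn_integral:
 fixes f :: "'a => 'b::{banach, second_countable_topology}"
 shows "ennreal (norm (\<integral>x. f x \<partial>M)) \<le> (\<integral>\<^sup>+x. norm (f x) \<partial>M)"
proof (cases "integrable M f")
 case True
 then show ?thesis by (rule integral_norm_bound_ennreal)
qed (simp add: not_integrable_integral_eq)

text \<open>Schur's test for the symmetric kernel \<open>heat e\<close>, of mass (2 pi)^n, bounds
  the regularised norm uniformly in e, and Fatou removes the regularisation. The right side may be
  infinite.\<close>

lemma bessel_fourier:
 fixes H :: "'a::euclidean_space => complex"
 assumes H: "integrable lborel H"
 shows "(\<integral>\<^sup>+y. ennreal ((norm (\<integral>x. cis (y \<bullet> x) * H x \<partial>lborel))\<^sup>2) \<partial>lborel)
  \<le> ennreal ((2 * pi) ^ DIM('a)) * (\<integral>\<^sup>+x. ennreal ((norm (H x))\<^sup>2) \<partial>lborel)"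
  (is "?L \<le> ?R")
proof -
 let ?F = "%y. \<integral>x. cis (y \<bullet> x) * H x \<partial>lborel"
 have [measurable]: "H \<in> borel_measurable borel" using H by auto
 define e :: "nat => real" where "e k = 1 / Suc k" for k
 have e: "e k > 0" for k by (simp add: e_def)
 have e0: "e \<longlonglongrightarrow> 0" unfolding e_def[abs_def] by (rule LIMSEQ_Suc[OF lim_1_over_n])
 have bound: "(\<integral>\<^sup>+y. ennreal ((norm (?F y))\<^sup>2 * exp (- e k * (norm y)\<^sup>2)) \<partial>lborel) \<le> ?R" for k
 proof -
  have "(\<integral>\<^sup>+y. ennreal ((norm (?F y))\<^sup>2 * exp (- e k * (norm y)\<^sup>2)) \<partial>lborel)
   = ennreal (\<integral>y. (norm (?F y))\<^sup>2 * exp (- e k * (norm y)\<^sup>2) \<partial>lborel)"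
   by (rule nn_integral_eq_integral[OF gauss_regularised_norm(1)[OF H e]]) auto
  also have "\<dots> = ennreal (norm (complex_of_real (\<integral>y. (norm (?F y))\<^sup>2 * exp (- e k * (norm y)\<^sup>2) \<partial>lborel)))"
   by (subst norm_of_real) (simp add: Bochner_Integration.integral_nonneg)
  also have "\<dots> = ennreal (norm (\<integral>x. H x * (\<integral>z. cnj (H z) * heat (e k) (x - z) \<partial>lborel) \<partial>lborel))"
   unfolding gauss_regularised_norm(2)[OF H e] ..
  also have "\<dots> \<le> (\<integral>\<^sup>+x. norm (H x * (\<integral>z. cnj (H z) * heat (e k) (x - z) \<partial>lborel)) \<partial>lborel)"
   by (rule norm_integral_le_nn_integral) 
  also have "\<dots> \<le> (\<integral>\<^sup>+x. (\<integral>\<^sup>+z. ennreal (norm (H x) * norm (H z) * heat (e k) (x - z)) \<partial>lborel) \<partial>lborel)"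
  proof (rule nn_integral_mono)
   fix x
   have "ennreal (norm (H x * (\<integral>z. cnj (H z) * heat (e k) (x - z) \<partial>lborel))) =
     ennreal (norm (H x)) * ennreal (norm (\<integral>z. cnj (H z) * heat (e k) (x - z) \<partial>lborel))"
    by (simp add: norm_mult ennreal_mult)
   also have "\<dots> \<le> ennreal (norm (H x)) * (\<integral>\<^sup>+z. norm (cnj (H z) * heat (e k) (x - z)) \<partial>lborel)"
    by (intro mult_left_mono norm_integral_le_nn_integral) auto
   also have "\<dots> = (\<integral>\<^sup>+z. ennreal (norm (H x) * norm (H z) * heat (e k) (x - z)) \<partial>lborel)"
    by (subst nn_integral_cmult[symmetric])
      (auto simp: norm_mult ennreal_mult mult.assoc heat_nonneg[OF e] intro!: nn_integral_cong)
   finally show "ennreal (norm (H x * (\<integral>z. cnj (H z) * heat (e k) (x - z) \<partial>lborel)))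
    \<le> (\<integral>\<^sup>+z. ennreal (norm (H x) * norm (H z) * heat (e k) (x - z)) \<partial>lborel)" .
  qed
  also have "\<dots> \<le> (\<integral>\<^sup>+x. (\<integral>\<^sup>+z. ennreal (1/2) * (ennreal ((norm (H x))\<^sup>2) * heat (e k) (z - x) + ennreal ((norm (H z))\<^sup>2) * heat (e k) (x - z)) \<partial>lborel) \<partial>lborel)"
  proof (intro nn_integral_mono)
   fix x z
   \<comment> \<open>The Schur step: after ab \<le> (a^2 + b^2) / 2 each summand leaves one variable
     in the kernel alone, which is then integrated out.\<close>
   have "norm (H x) * norm (H z) * heat (e k) (x - z) \<le> 1/2 * ((norm (H x))\<^sup>2 + (norm (H z))\<^sup>2) * heat (e k) (x - z)"
    using sum_squares_bound[of "norm (H x)" "norm (H z)"]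
    by (intro mult_right_mono heat_nonneg e) auto
   then have "ennreal (norm (H x) * norm (H z) * heat (e k) (x - z)) \<le> ennreal (1/2 * ((norm (H x))\<^sup>2 * heat (e k) (z - x) + (norm (H z))\<^sup>2 * heat (e k) (x - z)))"
    by (intro ennreal_leI) (simp add: heat_minus[of _ x z] algebra_simps)
   also have "ennreal (1/2 * ((norm (H x))\<^sup>2 * heat (e k) (z - x) + (norm (H z))\<^sup>2 * heat (e k) (x - z)))
    = ennreal (1/2) * ennreal ((norm (H x))\<^sup>2 * heat (e k) (z - x) + (norm (H z))\<^sup>2 * heat (e k) (x - z))"
    by (rule ennreal_mult) (auto simp: heat_nonneg[OF e])
   also have "ennreal ((norm (H x))\<^sup>2 * heat (e k) (z - x) + (norm (H z))\<^sup>2 * heat (e k) (x - z))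
     = ennreal ((norm (H x))\<^sup>2) * heat (e k) (z - x) + ennreal ((norm (H z))\<^sup>2) * heat (e k) (x - z)"
    by (simp add: ennreal_plus ennreal_mult heat_nonneg[OF e])
   finally show "ennreal (norm (H x) * norm (H z) * heat (e k) (x - z)) \<le> ennreal (1/2) * (ennreal ((norm (H x))\<^sup>2) * heat (e k) (z - x) + ennreal ((norm (H z))\<^sup>2) * heat (e k) (x - z))" .
  qed
  also have "\<dots> = ennreal (1/2) * ((\<integral>\<^sup>+x. \<integral>\<^sup>+z. ennreal ((norm (H x))\<^sup>2) * heat (e k) (z - x) \<partial>lborel \<partial>lborel)
    + (\<integral>\<^sup>+x. \<integral>\<^sup>+z. ennreal ((norm (H z))\<^sup>2) * heat (e k) (x - z) \<partial>lborel \<partial>lborel))"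
   by (simp add: nn_integral_cmult nn_integral_add)
  also have "(\<integral>\<^sup>+x. \<integral>\<^sup>+z. ennreal ((norm (H z))\<^sup>2) * heat (e k) (x - z) \<partial>lborel \<partial>lborel) = 
    (\<integral>\<^sup>+z. \<integral>\<^sup>+x. ennreal ((norm (H z))\<^sup>2) * heat (e k) (x - z) \<partial>lborel \<partial>lborel)"
   by (rule lborel_pair.Fubini') measurable
  also have "ennreal (1/2) * ((\<integral>\<^sup>+x. \<integral>\<^sup>+z. ennreal ((norm (H x))\<^sup>2) * heat (e k) (z - x) \<partial>lborel \<partial>lborel) + \<dots>) = 
    ennreal (1/2) * (2 * ?R)"
   by (simp add: nn_integral_cmult nn_integral_heat[OF e] nn_integral_multc mult.commute mult_2)
  also have "\<dots> = ?R"
   by (simp add: mult.assoc[symmetric] ennreal_mult'[symmetric] ennreal_numeral[symmetric] del: ennreal_numeral ennreal_half)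
  finally show ?thesis .
 qed
 have "?L = (\<integral>\<^sup>+y. liminf (%k. ennreal ((norm (?F y))\<^sup>2 * exp (- e k * (norm y)\<^sup>2))) \<partial>lborel)"
 proof (intro nn_integral_cong)
  fix y
  have "(%k. ennreal ((norm (?F y))\<^sup>2 * exp (- e k * (norm y)\<^sup>2))) \<longlonglongrightarrow> ennreal ((norm (?F y))\<^sup>2 * exp (- 0 * (norm y)\<^sup>2))"
   by (intro tendsto_intros e0)
  then show "ennreal ((norm (?F y))\<^sup>2) = liminf (%k. ennreal ((norm (?F y))\<^sup>2 * exp (- e k * (norm y)\<^sup>2)))"
   by (intro lim_imp_Liminf[symmetric]) auto
 qed
 also have "\<dots> \<le> liminf (%k. (\<integral>\<^sup>+y. ennreal ((norm (?F y))\<^sup>2 * exp (- e k * (norm y)\<^sup>2)) \<partial>lborel))"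
  by (rule nn_integral_liminf) measurable
 also have "\<dots> \<le> ?R"
  by (rule Liminf_le) (use bound in auto)
 finally show ?thesis .
qed

lemma bessel_fourier_minus:
 fixes H :: "'a::euclidean_space => complex"
 assumes H: "integrable lborel H"
 shows "(\<integral>\<^sup>+y. ennreal ((norm (\<integral>x. cis (- (y \<bullet> x)) * H x \<partial>lborel))\<^sup>2) \<partial>lborel)
  \<le> ennreal ((2 * pi) ^ DIM('a)) * (\<integral>\<^sup>+x. ennreal ((norm (H x))\<^sup>2) \<partial>lborel)"
proof -
 have "norm (\<integral>x. cis (- (y \<bullet> x)) * H x \<partial>lborel) = norm (\<integral>x. cis (y \<bullet> x) * cnj (H x) \<partial>lborel)" for y
 proof -
  have "(\<integral>x. cis (- (y \<bullet> x)) * H x \<partial>lborel) = (\<integral>x. cnj (cis (y \<bullet> x) * cnj (H x)) \<partial>lborel)"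
   by (simp add: cis_cnj)
  also have "\<dots> = cnj (\<integral>x. cis (y \<bullet> x) * cnj (H x) \<partial>lborel)" by (rule Bochner_Integration.integral_cnj)
  finally show ?thesis by simp
 qed
 then show ?thesis using bessel_fourier[of "%x. cnj (H x)"] H by (simp add: complex_integrable_cnj)
qed

text \<open>Substituting z = x + sqrt e u replaces the moving kernel by the fixed density
  \<open>heat 1\<close>; continuity and dominated convergence give the limit.\<close>

lemma heat_approximate_identity:
 fixes H :: "'a::euclidean_space => complex"
 assumes cont: "continuous_on UNIV H" and B: "\<And>x. norm (H x) \<le> B"
  and e: "\<And>k. e k > 0" "e \<longlonglongrightarrow> (0::real)"
 shows "(%k. \<integral>z. H z * heat (e k) (x - z) \<partial>lborel) \<longlonglongrightarrow> (2 * pi) ^ DIM('a) * H x"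
  and "norm (\<integral>z. H z * heat (e k) (x - z) \<partial>lborel) \<le> B * (2 * pi) ^ DIM('a)"
proof -
 have [measurable]: "H \<in> borel_measurable borel" using cont by (rule borel_measurable_continuous_onI)
 have B0: "0 \<le> B" using B[of 0] norm_ge_zero order_trans by blast
 have eq: "(\<integral>z. H z * heat (e k) (x - z) \<partial>lborel) = (\<integral>u. H (x + sqrt (e k) *\<^sub>R u) * heat 1 u \<partial>lborel)" for k
 proof -
  have "sqrt (e k) ~= 0" using e(1)[of k] by simp
  \<comment> \<open>The Jacobian of the dilation cancels the normalisation of
    \<open>heat (e k)\<close>.\<close>
  have hs: "sqrt (e k) ^ DIM('a) * heat (e k) (- sqrt (e k) *\<^sub>R u) = heat 1 (u::'a)" for u
  proof -
   have "sqrt (e k) * sqrt (pi / e k) = sqrt pi" using e(1)[of k] by (simp only: real_sqrt_mult[symmetric]) simp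
   then have "sqrt (e k) ^ DIM('a) * sqrt (pi / e k) ^ DIM('a) = sqrt pi ^ DIM('a)" by (simp only: power_mult_distrib[symmetric])
   moreover have "(norm (- sqrt (e k) *\<^sub>R u))\<^sup>2 / (4 * e k) = (norm u)\<^sup>2 / 4" using e(1)[of k] by (simp add: power_mult_distrib)
   ultimately show ?thesis unfolding heat_def by (simp add: mult.assoc[symmetric])
  qed
  have "(\<integral>z. H z * heat (e k) (x - z) \<partial>lborel) = 
   (\<integral>z. H z * heat (e k) (x - z) \<partial>(density (distr lborel borel (%u. x + sqrt (e k) *\<^sub>R u)) (%_. ennreal (\<bar>sqrt (e k)\<bar> ^ DIM('a)))))"
   using lborel_affine[OF \<open>sqrt (e k) ~= 0\<close>, where t=x] by simp
  also have "\<dots> = (\<integral>u. (sqrt (e k)) ^ DIM('a) *\<^sub>R (H (x + sqrt (e k) *\<^sub>R u) * heat (e k) (x - (x + sqrt (e k) *\<^sub>R u))) \<partial>lborel)"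
   using e(1)[of k] by (subst integral_density) (auto simp: integral_distr)
  also have "\<dots> = (\<integral>u. H (x + sqrt (e k) *\<^sub>R u) * heat 1 u \<partial>lborel)"
  proof (intro Bochner_Integration.integral_cong refl)
   fix u
   show "(sqrt (e k)) ^ DIM('a) *\<^sub>R (H (x + sqrt (e k) *\<^sub>R u) * heat (e k) (x - (x + sqrt (e k) *\<^sub>R u))) = H (x + sqrt (e k) *\<^sub>R u) * heat 1 u"
    unfolding hs[of u, symmetric] by (simp add: scaleR_conv_of_real)
  qed
  finally show ?thesis .
 qed
 have int: "integrable lborel (%u::'a. B * heat 1 u)" by (intro integrable_mult_right integrable_heat) simp
 have le: "norm (H (x + sqrt (e k) *\<^sub>R u) * heat 1 u) \<le> B * heat 1 u" for k u
  using B[of "x + sqrt (e k) *\<^sub>R u"] by (simp add: norm_mult heat_nonneg mult_right_mono)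
 have "(%k. \<integral>u. H (x + sqrt (e k) *\<^sub>R u) * heat 1 u \<partial>lborel) \<longlonglongrightarrow> (\<integral>u. H x * heat 1 (u::'a) \<partial>lborel)"
 proof (rule integral_dominated_convergence[OF _ _ int])
  show "AE u in lborel. (%k. H (x + sqrt (e k) *\<^sub>R u) * complex_of_real (heat 1 u)) \<longlonglongrightarrow> H x * complex_of_real (heat 1 u)"
  proof (rule AE_I2)
   fix u :: 'a
   have "(%k. x + sqrt (e k) *\<^sub>R u) \<longlonglongrightarrow> x + sqrt 0 *\<^sub>R u" by (intro tendsto_intros e)
   moreover have "isCont H x" using cont by (simp add: continuous_on_eq_continuous_at)
   ultimately have "(%k. H (x + sqrt (e k) *\<^sub>R u)) \<longlonglongrightarrow> H x" using isCont_tendsto_compose by fastforce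
   then show "(%k. H (x + sqrt (e k) *\<^sub>R u) * complex_of_real (heat 1 u)) \<longlonglongrightarrow> H x * complex_of_real (heat 1 u)"
    by (intro tendsto_intros)
  qed
  show "AE u in lborel. norm (H (x + sqrt (e k) *\<^sub>R u) * complex_of_real (heat 1 u)) \<le> B * heat 1 u" for k
   using le by simp
 qed measurable
 moreover have "(\<integral>u. H x * heat 1 (u::'a) \<partial>lborel) = (2 * pi) ^ DIM('a) * H x"
  by (simp only: integral_mult_right_zero integral_complex_of_real integral_heat[OF zero_less_one]) (simp add: mult.commute)
 ultimately show "(%k. \<integral>z. H z * heat (e k) (x - z) \<partial>lborel) \<longlonglongrightarrow> (2 * pi) ^ DIM('a) * H x"
  unfolding eq by (simp only:)
 have "norm (\<integral>u. H (x + sqrt (e k) *\<^sub>R u) * heat 1 u \<partial>lborel) \<le> (\<integral>u. B * heat 1 (u::'a) \<partial>lborel)"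
  by (rule order_trans[OF integral_norm_bound integral_mono'[OF int]]) (use le B0 heat_nonneg[of 1] in \<open>auto intro!: mult_nonneg_nonneg\<close>)
 then show "norm (\<integral>z. H z * heat (e k) (x - z) \<partial>lborel) \<le> B * (2 * pi) ^ DIM('a)"
  unfolding eq by (simp add: integral_heat)
qed

text \<open>For continuous bounded \<open>H\<close> the kernel \<open>heat e\<close> acts as an
  approximate identity, so the regularised norms converge to (2 pi)^n times the squared L^2 norm,
  while each of them stays below the integral without Gaussian factor.\<close>

lemma plancherel_lower:
 fixes H :: "'a::euclidean_space => complex"
 assumes H: "integrable lborel H" and cont: "continuous_on UNIV H" and B: "\<And>x. norm (H x) \<le> B"
 shows "ennreal ((2 * pi) ^ DIM('a)) * (\<integral>\<^sup>+x. ennreal ((norm (H x))\<^sup>2) \<partial>lborel) \<le> 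
  (\<integral>\<^sup>+y. ennreal ((norm (\<integral>x. cis (y \<bullet> x) * H x \<partial>lborel))\<^sup>2) \<partial>lborel)"
  (is "?R \<le> ?L")
proof -
 let ?F = "%y. \<integral>x. cis (y \<bullet> x) * H x \<partial>lborel"
 have [measurable]: "H \<in> borel_measurable borel" using H by auto
 define e :: "nat => real" where "e k = 1 / Suc k" for k
 have e: "e k > 0" for k by (simp add: e_def)
 have e0: "e \<longlonglongrightarrow> 0" unfolding e_def[abs_def] by (rule LIMSEQ_Suc[OF lim_1_over_n])
 have B0: "0 \<le> B" using B[of 0] norm_ge_zero order_trans by blast
 note ai = heat_approximate_identity[of "%z. cnj (H z)" B e, OF _ _ e e0]
 have ccont: "continuous_on UNIV (%z. cnj (H z))" using cont by (intro continuous_intros)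
 let ?I = "%k x. \<integral>z. cnj (H z) * heat (e k) (x - z) \<partial>lborel"
 have ai1: "(%k. ?I k x) \<longlonglongrightarrow> (2 * pi) ^ DIM('a) * cnj (H x)" for x
  by (rule ai(1)[OF ccont]) (simp add: B)
 have ai2: "norm (?I k x) \<le> B * (2 * pi) ^ DIM('a)" for k x
  by (rule ai(2)[OF ccont]) (simp add: B)
 have lim: "(%k. \<integral>x. H x * ?I k x \<partial>lborel) \<longlonglongrightarrow> (\<integral>x. H x * ((2 * pi) ^ DIM('a) * cnj (H x)) \<partial>lborel)"
 proof (rule integral_dominated_convergence)
  show "integrable lborel (%x. norm (H x) * (B * (2 * pi) ^ DIM('a)))"
   using H by auto
  show "AE x in lborel. (%k. H x * ?I k x) \<longlonglongrightarrow> H x * ((2 * pi) ^ DIM('a) * cnj (H x))"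
   by (intro AE_I2 tendsto_mult tendsto_const ai1)
  show "AE x in lborel. norm (H x * ?I k x) \<le> norm (H x) * (B * (2 * pi) ^ DIM('a))" for k
   unfolding norm_mult by (intro AE_I2 mult_left_mono ai2) simp
 qed measurable
 have H2: "integrable lborel (%x. (norm (H x))\<^sup>2)"
 proof (rule Bochner_Integration.integrable_bound)
  show "integrable lborel (%x. B * norm (H x))" using H by auto
  show "AE x in lborel. norm ((norm (H x))\<^sup>2) \<le> norm (B * norm (H x))"
   using B B0 by (auto simp: power2_eq_square intro!: mult_right_mono)
 qed measurable
 have Req: "?R = ennreal ((2 * pi) ^ DIM('a) * (\<integral>x. (norm (H x))\<^sup>2 \<partial>lborel))"
  by (subst nn_integral_eq_integral[OF H2]) (auto simp: ennreal_mult)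
 have val: "(\<integral>x. H x * ((2 * pi) ^ DIM('a) * cnj (H x)) \<partial>lborel) = complex_of_real ((2 * pi) ^ DIM('a) * (\<integral>x. (norm (H x))\<^sup>2 \<partial>lborel))"
 proof -
  have "H x * ((2 * pi) ^ DIM('a) * cnj (H x)) = complex_of_real ((2 * pi) ^ DIM('a) * (norm (H x))\<^sup>2)" for x
   by (simp only: of_real_mult complex_norm_square) simp
  then show ?thesis using H2 by (simp del: of_real_mult of_real_power)
 qed
 have "(%k. Re (\<integral>x. H x * ?I k x \<partial>lborel)) \<longlonglongrightarrow> (2 * pi) ^ DIM('a) * (\<integral>x. (norm (H x))\<^sup>2 \<partial>lborel)"
  using tendsto_Re[OF lim] unfolding val by simp
 then have lim': "(%k. ennreal (Re (\<integral>x. H x * ?I k x \<partial>lborel))) \<longlonglongrightarrow> ?R"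
  unfolding Req by (rule tendsto_ennrealI)
 have "ennreal (Re (\<integral>x. H x * ?I k x \<partial>lborel)) \<le> ?L" for k
 proof -
  have "ennreal (Re (\<integral>x. H x * ?I k x \<partial>lborel)) = ennreal (\<integral>y. (norm (?F y))\<^sup>2 * exp (- e k * (norm y)\<^sup>2) \<partial>lborel)"
   by (simp only: gauss_regularised_norm(2)[OF H e, symmetric] Re_complex_of_real)
  also have "\<dots> = (\<integral>\<^sup>+y. ennreal ((norm (?F y))\<^sup>2 * exp (- e k * (norm y)\<^sup>2)) \<partial>lborel)"
   by (rule nn_integral_eq_integral[OF gauss_regularised_norm(1)[OF H e], symmetric]) auto
  also have "\<dots> \<le> ?L"
   using e[of k] by (intro nn_integral_mono ennreal_leI mult_left_le) auto
  finally show ?thesis .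
 qed
 then show ?thesis by (intro LIMSEQ_le_const2[OF lim']) auto
qed

text \<open>Inserting exp (- e |x|^2) and exchanging the integrals gives a heat average of
  \<open>H\<close>, which tends to (2 pi)^n \<open>H y\<close>; the left side converges because the
  transform is assumed integrable. It serves to produce Schwartz functions with prescribed compactly
  supported Fourier transform.\<close>

lemma fourier_inversion:
 fixes H :: "'a::euclidean_space => complex"
 assumes H: "integrable lborel H" and cont: "continuous_on UNIV H" and B: "\<And>x. norm (H x) \<le> B"
  and g: "integrable lborel (%x. \<integral>z. cis (x \<bullet> z) * H z \<partial>lborel)"
 shows "(\<integral>x. cis (- (y \<bullet> x)) * (\<integral>z. cis (x \<bullet> z) * H z \<partial>lborel) \<partial>lborel) = (2 * pi) ^ DIM('a) * H y"
proof -
 let ?g = "%x. \<integral>z. cis (x \<bullet> z) * H z \<partial>lborel"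
 have [measurable]: "H \<in> borel_measurable borel" using H by auto
 define e :: "nat => real" where "e k = 1 / Suc k" for k
 have e: "e k > 0" for k by (simp add: e_def)
 have e0: "e \<longlonglongrightarrow> 0" unfolding e_def[abs_def] by (rule LIMSEQ_Suc[OF lim_1_over_n])
 note ai = heat_approximate_identity[OF cont B e e0]
 have eq: "(\<integral>x. cis (- (y \<bullet> x)) * ?g x * complex_of_real (exp (- e k * (norm x)\<^sup>2)) \<partial>lborel) = (\<integral>z. H z * heat (e k) (y - z) \<partial>lborel)" for k
 proof -
  let ?K = "%x z. H z * (complex_of_real (exp (- e k * (norm x)\<^sup>2)) * cis (x \<bullet> (z - y)))"
  have gi: "integrable lborel (%y::'a. complex_of_real (exp (- e k * (norm y)\<^sup>2)))"
   using integrable_gauss_real[OF e] by (rule integrable_of_real)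
  have K: "integrable (lborel \<Otimes>\<^sub>M lborel) (%(x,z). ?K x z)"
  proof (rule Bochner_Integration.integrable_bound)
   show "integrable (lborel \<Otimes>\<^sub>M lborel) (%(x,z). complex_of_real (exp (- e k * (norm (x::'a))\<^sup>2)) * H z)"
    using gi H by (intro integrable_tensor_lborel) auto
   show "(%(x,z). ?K x z) \<in> borel_measurable (lborel \<Otimes>\<^sub>M lborel)" by measurable
  qed (auto simp: norm_mult)
  have "cis (- (y \<bullet> x)) * ?g x * complex_of_real (exp (- e k * (norm x)\<^sup>2)) = (\<integral>z. ?K x z \<partial>lborel)" for x
  proof -
   have c: "cis (x \<bullet> (z - y)) = cis (- (y \<bullet> x)) * cis (x \<bullet> z)" for z
    by (simp add: cis_mult inner_diff_right inner_commute)
   have "(\<integral>z. ?K x z \<partial>lborel) = (\<integral>z. (cis (- (y \<bullet> x)) * complex_of_real (exp (- e k * (norm x)\<^sup>2))) * (cis (x \<bullet> z) * H z) \<partial>lborel)"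
    by (intro Bochner_Integration.integral_cong refl) (simp only: c mult_ac)
   also have "\<dots> = (cis (- (y \<bullet> x)) * complex_of_real (exp (- e k * (norm x)\<^sup>2))) * ?g x"
    by (rule integral_mult_right_zero)
   finally show ?thesis by (simp only: mult_ac)
  qed
  then have "(\<integral>x. cis (- (y \<bullet> x)) * ?g x * complex_of_real (exp (- e k * (norm x)\<^sup>2)) \<partial>lborel) = (\<integral>x. (\<integral>z. ?K x z \<partial>lborel) \<partial>lborel)"
   by simp
  also have "\<dots> = (\<integral>z. (\<integral>x. ?K x z \<partial>lborel) \<partial>lborel)"
   by (rule lborel_pair.Fubini_integral[symmetric]) (rule K)
  also have "\<dots> = (\<integral>z. H z * heat (e k) (y - z) \<partial>lborel)"
   by (simp only: integral_mult_right_zero gauss_cis_eq_heat[OF e] heat_minus[of _ y])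
  finally show ?thesis .
 qed
 have "(%k. \<integral>x. cis (- (y \<bullet> x)) * ?g x * complex_of_real (exp (- e k * (norm x)\<^sup>2)) \<partial>lborel) \<longlonglongrightarrow> (\<integral>x. cis (- (y \<bullet> x)) * ?g x \<partial>lborel)"
 proof (rule integral_dominated_convergence)
  show "integrable lborel (%x. norm (?g x))" using g by simp
  show "AE x in lborel. (%k. cis (- (y \<bullet> x)) * ?g x * complex_of_real (exp (- e k * (norm x)\<^sup>2))) \<longlonglongrightarrow> cis (- (y \<bullet> x)) * ?g x"
  proof (rule AE_I2)
   fix x
   have "(%k. cis (- (y \<bullet> x)) * ?g x * complex_of_real (exp (- e k * (norm x)\<^sup>2))) \<longlonglongrightarrow> cis (- (y \<bullet> x)) * ?g x * complex_of_real (exp (- 0 * (norm x)\<^sup>2))"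
    by (intro tendsto_intros e0)
   then show "(%k. cis (- (y \<bullet> x)) * ?g x * complex_of_real (exp (- e k * (norm x)\<^sup>2))) \<longlonglongrightarrow> cis (- (y \<bullet> x)) * ?g x" by simp
  qed
  show "AE x in lborel. norm (cis (- (y \<bullet> x)) * ?g x * complex_of_real (exp (- e k * (norm x)\<^sup>2))) \<le> norm (?g x)" for k
   using e[of k] by (intro AE_I2) (auto simp: norm_mult intro!: mult_left_le)
 qed measurable
 then show ?thesis unfolding eq using ai(1)[of y] LIMSEQ_unique by blast
qed

section \<open>Coordinates, boxes and the local Calderon-Vaillancourt estimate\<close>

lemma prod_Basis_vec: "(\<Prod>b\<in>(Basis::(real^'n) set). f b) = (\<Prod>i\<in>UNIV. f (axis i 1))"
proof -
 have B: "(Basis::(real^'n) set) = (%i. axis i 1) ` UNIV" by (auto simp: Basis_vec_def)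
 show ?thesis unfolding B by (subst prod.reindex) (auto simp: inj_on_def axis_eq_axis)
qed

lemma borel_measurable_vec:
 fixes f :: "'a => real^'n"
 assumes "\<And>i. (%x. f x $ i) \<in> borel_measurable M"
 shows "f \<in> borel_measurable M"
 by (rule borel_measurable_euclidean_space[THEN iffD2]) (auto simp: Basis_vec_def inner_axis assms)

lemma borel_measurable_vec_nth [measurable]:
 fixes f :: "'a => real^'n"
 assumes "f \<in> borel_measurable M"
 shows "(%x. f x $ i) \<in> borel_measurable M"
 by (rule measurable_compose[OF assms]) (auto intro!: borel_measurable_continuous_onI continuous_intros)

definition upd :: "real^'n => 'n => real => real^'n" where
 "upd z i s = (\<chi> k. if k = i then s else z $ k)"

text \<open>In the freezing argument \<open>T\<close> holds the coordinates already frozen, the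
  first point their values and the second the running frequency.\<close>

definition mix :: "'n set => real^'n => real^'n => real^'n" where
 "mix T z w = (\<chi> k. if k \<in> T then z $ k else w $ k)"

lemma upd_nth [simp]: "upd z i s $ k = (if k = i then s else z $ k)"
 by (simp add: upd_def)

lemma mix_nth [simp]: "mix T z w $ k = (if k \<in> T then z $ k else w $ k)"
 by (simp add: mix_def)

lemma upd_measurable [measurable]:
 assumes [measurable]: "f \<in> borel_measurable M" "g \<in> borel_measurable M"
 shows "(%x. upd (f x) i (g x)) \<in> borel_measurable M"
 by (rule borel_measurable_vec) simp

lemma mix_measurable [measurable]:
 assumes [measurable]: "f \<in> borel_measurable M" "g \<in> borel_measurable M"
 shows "(%x. mix T (f x) (g x)) \<in> borel_measurable M"
 by (rule borel_measurable_vec) simp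

definition vbox :: "real^'n => real => (real^'n) set" where
 "vbox c R = {z. \<forall>i. c $ i \<le> z $ i \<and> z $ i \<le> c $ i + R}"

lemma vbox_cbox: "vbox c R = cbox c (c + (\<chi> i. R))"
 by (auto simp: vbox_def mem_box_cart)

lemma vbox_sets [measurable]: "vbox c R \<in> sets borel"
 by (simp add: vbox_cbox)

lemma emeasure_vbox_finite: "emeasure lborel (vbox c R) < \<infinity>"
 unfolding vbox_cbox by (simp add: emeasure_lborel_cbox_eq)

lemma upd_vbox: "z \<in> vbox c R ==> c $ i \<le> s ==> s \<le> c $ i + R ==> upd z i s \<in> vbox c R"
 by (auto simp: vbox_def)

lemma mix_vbox: "z \<in> vbox c R ==> w \<in> vbox c R ==> mix T z w \<in> vbox c R"
 by (auto simp: vbox_def)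

lemma integrable_bounded_support:
 fixes f :: "'a => complex"
 assumes "f \<in> borel_measurable M" "S \<in> sets M" "emeasure M S < \<infinity>"
  and "\<And>x. x \<in> space M ==> norm (f x) \<le> B" "\<And>x. x \<in> space M ==> x \<notin> S ==> f x = 0"
 shows "integrable M f"
proof (rule Bochner_Integration.integrable_bound)
 show "integrable M (%x. B * indicator S x)" using assms by auto
 show "AE x in M. norm (f x) \<le> norm (B * indicator S x)"
 proof (rule AE_I2)
  fix x assume x: "x \<in> space M"
  show "norm (f x) \<le> norm (B * indicator S x)"
   using assms(4)[OF x] assms(5)[OF x] by (cases "x \<in> S") auto
 qed
qed fact

lemma norm_sum_power2: "(norm (a + b :: complex))\<^sup>2 \<le> 2 * (norm a)\<^sup>2 + 2 * (norm b)\<^sup>2"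
proof -
 have "(norm (a + b))\<^sup>2 \<le> (norm a + norm b)\<^sup>2" by (intro power_mono norm_triangle_ineq) auto
 also have "\<dots> \<le> 2 * (norm a)\<^sup>2 + 2 * (norm b)\<^sup>2"
  using sum_squares_bound[of "norm a" "norm b"] by (simp add: power2_sum)
 finally show ?thesis .
qed

text \<open>Local Calderon-Vaillancourt estimate without cut-offs: each frequency variable is frozen
 in turn by the fundamental theorem of calculus, at the cost of one derivative and of one
 factor given by the side of the box.\<close>

lemma local_calderon_vaillancourt:
 fixes A :: "'n::finite list => real^'n => real^'n => complex" and c :: "real^'n"
 assumes meas [measurable]: "\<And>as. case_prod (A as) \<in> borel_measurable (borel \<Otimes>\<^sub>M borel)"
  and cont: "\<And>as x. continuous_on UNIV (A as x)"
  and deriv: "\<And>as i x z s. ((%s. A as x (upd z i s)) has_vector_derivative A (i # as) x (upd z i s)) (at s)"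
  and bound: "\<And>as x z. length as \<le> CARD('n) ==> z \<in> vbox c R ==> norm (A as x z) \<le> K * (1 / R) ^ length as"
  and R: "R > 0"
  and H [measurable]: "H \<in> borel_measurable borel" and HB: "\<And>z. norm (H z) \<le> B" and Hs: "\<And>z. z \<notin> vbox c R ==> H z = 0"
 shows "(\<integral>\<^sup>+x. ennreal ((norm (\<integral>z. cis (x \<bullet> z) * A [] x z * H z \<partial>lborel))\<^sup>2) \<partial>lborel) \<le>
  ennreal (4 ^ CARD('n) * (2 * pi) ^ CARD('n) * K\<^sup>2) * (\<integral>\<^sup>+z. ennreal ((norm (H z))\<^sup>2) \<partial>lborel)"
proof -
 let ?n = "CARD('n)"
 have cbox: "c \<in> vbox c R" using R by (simp add: vbox_def)
 have K: "0 \<le> K" using order_trans[OF norm_ge_zero bound[of "[]" c]] cbox by simp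
 have B0: "0 \<le> B" using order_trans[OF norm_ge_zero HB] .
 \<comment> \<open>\<open>m\<close> counts the coordinates still free. The list \<open>as\<close>
   grows by at most one entry whenever a coordinate is frozen, hence the invariant length as + m
   \<le> n, and only derivatives up to order n occur.\<close>
 have claim: "(\<integral>\<^sup>+x. ennreal ((norm (\<integral>z. cis (x \<bullet> z) * A as x (mix T v z) * H z \<partial>lborel))\<^sup>2) \<partial>lborel) \<le>
   ennreal (4 ^ m * (2 * pi) ^ ?n * (K * (1 / R) ^ length as)\<^sup>2) * (\<integral>\<^sup>+z. ennreal ((norm (H z))\<^sup>2) \<partial>lborel)"
  if "card (- T) = m" "length as + m \<le> ?n" "v \<in> vbox c R" "H \<in> borel_measurable borel" "\<And>z. norm (H z) \<le> B" "\<And>z. z \<notin> vbox c R ==> H z = 0"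
  for m T as v H
  using that
 proof (induction m arbitrary: T as v H)
  case 0
  then have T: "T = UNIV" by auto
  note [measurable] = 0(4)
  \<comment> \<open>With every coordinate frozen the symbol depends on x alone, comes out of the
    integral and leaves a plain Fourier integral for Bessel.\<close>
  have mx: "mix T v z = v" for z unfolding T by (simp add: vec_eq_iff)
  have iH: "integrable lborel H"
   by (rule integrable_bounded_support[of _ _ "vbox c R" B]) (use 0 emeasure_vbox_finite in auto)
  have "(\<integral>\<^sup>+x. ennreal ((norm (\<integral>z. cis (x \<bullet> z) * A as x (mix T v z) * H z \<partial>lborel))\<^sup>2) \<partial>lborel) \<le>
    (\<integral>\<^sup>+x. ennreal ((K * (1 / R) ^ length as)\<^sup>2) * ennreal ((norm (\<integral>z. cis (x \<bullet> z) * H z \<partial>lborel))\<^sup>2) \<partial>lborel)"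
  proof (rule nn_integral_mono)
   fix x
   have "(\<integral>z. cis (x \<bullet> z) * A as x (mix T v z) * H z \<partial>lborel) = (\<integral>z. A as x v * (cis (x \<bullet> z) * H z) \<partial>lborel)"
    unfolding mx by (simp only: mult_ac)
   also have "\<dots> = A as x v * (\<integral>z. cis (x \<bullet> z) * H z \<partial>lborel)" by (rule integral_mult_right_zero)
   finally have "(norm (\<integral>z. cis (x \<bullet> z) * A as x (mix T v z) * H z \<partial>lborel))\<^sup>2 = (norm (A as x v))\<^sup>2 * (norm (\<integral>z. cis (x \<bullet> z) * H z \<partial>lborel))\<^sup>2"
    by (simp add: norm_mult power_mult_distrib)
   also have "\<dots> \<le> (K * (1 / R) ^ length as)\<^sup>2 * (norm (\<integral>z. cis (x \<bullet> z) * H z \<partial>lborel))\<^sup>2"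
    using 0 by (intro mult_right_mono power_mono bound) auto
   finally show "ennreal ((norm (\<integral>z. cis (x \<bullet> z) * A as x (mix T v z) * H z \<partial>lborel))\<^sup>2) \<le>
     ennreal ((K * (1 / R) ^ length as)\<^sup>2) * ennreal ((norm (\<integral>z. cis (x \<bullet> z) * H z \<partial>lborel))\<^sup>2)"
    by (subst ennreal_mult[symmetric]) (auto intro: ennreal_leI)
  qed
  also have "\<dots> = ennreal ((K * (1 / R) ^ length as)\<^sup>2) * (\<integral>\<^sup>+x. ennreal ((norm (\<integral>z. cis (x \<bullet> z) * H z \<partial>lborel))\<^sup>2) \<partial>lborel)"
   by (rule nn_integral_cmult) measurable
  also have "\<dots> \<le> ennreal ((K * (1 / R) ^ length as)\<^sup>2) * (ennreal ((2 * pi) ^ ?n) * (\<integral>\<^sup>+z. ennreal ((norm (H z))\<^sup>2) \<partial>lborel))"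
   using bessel_fourier[OF iH] by (intro mult_left_mono) auto
  also have "\<dots> = ennreal (4 ^ 0 * (2 * pi) ^ ?n * (K * (1 / R) ^ length as)\<^sup>2) * (\<integral>\<^sup>+z. ennreal ((norm (H z))\<^sup>2) \<partial>lborel)"
   by (subst mult.assoc[symmetric], subst ennreal_mult[symmetric]) (auto simp: mult.commute)
  finally show ?case .
 next
  case (Suc m)
  note [measurable] = Suc.prems(4)
  from Suc.prems(1) have "- T ~= {}" by auto
  then obtain i where i: "i \<notin> T" by auto
  define T' where "T' = insert i T"
  have cT': "card (- T') = m" using Suc.prems(1) i by (simp add: T'_def Compl_insert)
  have len: "length as + m \<le> ?n" "length (i # as) + m \<le> ?n" using Suc.prems(2) by auto
  let ?I = "{c $ i .. c $ i + R}"
  let ?u1 = "%x. \<integral>z. cis (x \<bullet> z) * A as x (mix T' (upd v i (c $ i)) z) * H z \<partial>lborel"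
  \<comment> \<open>The upper limit z $ i of the fundamental theorem of calculus becomes the cut-off
    s \<le> z $ i on the amplitude. The result is still bounded, measurable and supported in the
    box, which is all that the induction hypothesis asks.\<close>
  define Hc where "Hc s z = (if s \<le> z $ i then H z else 0)" for s and z
  let ?us = "%s x. \<integral>z. cis (x \<bullet> z) * A (i # as) x (mix T' (upd v i s) z) * Hc s z \<partial>lborel"
  have Hc_m [measurable]: "(%(s, z). Hc s z) \<in> borel_measurable (borel \<Otimes>\<^sub>M borel)"
   unfolding Hc_def by measurable
  have Hc_m' [measurable]: "Hc s \<in> borel_measurable borel" for s
   unfolding Hc_def by measurable
  have HcB: "norm (Hc s z) \<le> B" for s z using Suc.prems(5) B0 by (simp add: Hc_def)
  have Hcs: "z \<notin> vbox c R ==> Hc s z = 0" for s z using Suc.prems(6) by (simp add: Hc_def)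
  have mixu: "mix T' (upd v i s) z = upd (mix T v z) i s" for s z
   using i by (auto simp: vec_eq_iff T'_def)
  have vI: "upd v i s \<in> vbox c R" if "s \<in> ?I" for s
   using that Suc.prems(3) by (auto intro: upd_vbox)
  have FTC: "A as x (mix T v z) = A as x (mix T' (upd v i (c $ i)) z) +
     (\<integral>s. indicator ?I s *\<^sub>R (if s \<le> z $ i then A (i # as) x (mix T' (upd v i s) z) else 0) \<partial>lborel)"
   if z: "z \<in> vbox c R" for x z
  proof -
   let ?w = "mix T v z"
   have ci: "c $ i \<le> z $ i" "z $ i \<le> c $ i + R" using z by (auto simp: vbox_def)
   have "continuous_on {c $ i .. z $ i} (%s. A (i # as) x (upd ?w i s))"
    using deriv by (intro continuous_at_imp_continuous_on ballI has_vector_derivative_continuous)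
   then have "(\<integral>s. indicator {c $ i .. z $ i} s *\<^sub>R A (i # as) x (upd ?w i s) \<partial>lborel) = A as x (upd ?w i (z $ i)) - A as x (upd ?w i (c $ i))"
    using ci deriv by (intro integral_FTC_atLeastAtMost) (auto intro: has_vector_derivative_at_within)
   moreover have "upd ?w i (z $ i) = ?w" using i by (simp add: vec_eq_iff)
   moreover have "indicator ?I s *\<^sub>R (if s \<le> z $ i then A (i # as) x (mix T' (upd v i s) z) else 0) =
     indicator {c $ i .. z $ i} s *\<^sub>R A (i # as) x (upd ?w i s)" for s
    using ci by (auto simp: mixu indicator_def)
   ultimately show ?thesis by (simp add: mixu)
  qed
  have K1: "norm (A as x (mix T' (upd v i s) z)) \<le> K * (1 / R) ^ length as" if "z \<in> vbox c R" "s \<in> ?I" for s x z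
   using len vI[OF that(2)] that(1) by (intro bound mix_vbox) auto
  have K2: "norm (A (i # as) x (mix T' (upd v i s) z)) \<le> K * (1 / R) ^ length (i # as)" if "z \<in> vbox c R" "s \<in> ?I" for s x z
   using len vI[OF that(2)] that(1) by (intro bound mix_vbox) auto
  have KR: "0 \<le> K * (1 / R) ^ l" for l using K R by simp
  have cI: "c $ i \<in> ?I" using R by simp
  have pairint: "integrable (lborel \<Otimes>\<^sub>M lborel) (%(s, z). indicator ?I s *\<^sub>R (cis (x \<bullet> z) * A (i # as) x (mix T' (upd v i s) z) * Hc s z))" for x
  proof (rule integrable_bounded_support[of _ _ "?I \<times> vbox c R" "K * (1 / R) ^ length (i # as) * B"])
   show "?I \<times> vbox c R \<in> sets (lborel \<Otimes>\<^sub>M lborel)" by (intro pair_measureI) auto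
   show "emeasure (lborel \<Otimes>\<^sub>M lborel) (?I \<times> vbox c R) < \<infinity>"
    using emeasure_vbox_finite[of c R] R
    by (subst lborel.emeasure_pair_measure_Times) (auto simp: ennreal_mult_less_top)
   show "norm (case p of (s, z) => indicator ?I s *\<^sub>R (cis (x \<bullet> z) * A (i # as) x (mix T' (upd v i s) z) * Hc s z)) \<le> K * (1 / R) ^ length (i # as) * B" for p
   proof (cases p)
    case (Pair s z)
    show ?thesis
    proof (cases "s \<in> ?I \<and> z \<in> vbox c R")
     case True
     then show ?thesis using mult_mono[OF K2[of z s x] HcB[of s z] KR norm_ge_zero]
      by (auto simp: Pair norm_mult)
    next
     case False
     then show ?thesis using Hcs[of z s] mult_nonneg_nonneg[OF KR[of "length (i # as)"] B0] by (auto simp: Pair)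
    qed
   qed
   show "(%(s, z). indicator ?I s *\<^sub>R (cis (x \<bullet> z) * A (i # as) x (mix T' (upd v i s) z) * Hc s z)) \<in> borel_measurable (lborel \<Otimes>\<^sub>M lborel)"
    by measurable
   show "(case p of (s, z) => indicator ?I s *\<^sub>R (cis (x \<bullet> z) * A (i # as) x (mix T' (upd v i s) z) * Hc s z)) = 0"
    if "p \<notin> ?I \<times> vbox c R" for p
   proof (cases p)
    case (Pair s z)
    show ?thesis
    proof (cases "s \<in> ?I")
     case True
     then have "z \<notin> vbox c R" using that Pair by auto
     then show ?thesis by (simp add: Pair Hcs)
    next
     case False
     then show ?thesis by (simp add: Pair)
    qed
   qed
  qed
  have split: "(\<integral>z. cis (x \<bullet> z) * A as x (mix T v z) * H z \<partial>lborel) = ?u1 x + (\<integral>s. indicator ?I s *\<^sub>R ?us s x \<partial>lborel)" for x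
  proof -
   have pt: "cis (x \<bullet> z) * A as x (mix T v z) * H z = cis (x \<bullet> z) * A as x (mix T' (upd v i (c $ i)) z) * H z +
     (\<integral>s. indicator ?I s *\<^sub>R (cis (x \<bullet> z) * A (i # as) x (mix T' (upd v i s) z) * Hc s z) \<partial>lborel)" for z
   proof (cases "z \<in> vbox c R")
    case True
    have "(\<integral>s. indicator ?I s *\<^sub>R (cis (x \<bullet> z) * A (i # as) x (mix T' (upd v i s) z) * Hc s z) \<partial>lborel) = 
      (\<integral>s. (cis (x \<bullet> z) * H z) * (indicator ?I s *\<^sub>R (if s \<le> z $ i then A (i # as) x (mix T' (upd v i s) z) else 0)) \<partial>lborel)"
     by (intro Bochner_Integration.integral_cong) (auto simp: Hc_def indicator_def)
    also have "\<dots> = (cis (x \<bullet> z) * H z) * (\<integral>s. indicator ?I s *\<^sub>R (if s \<le> z $ i then A (i # as) x (mix T' (upd v i s) z) else 0) \<partial>lborel)"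
     by (rule integral_mult_right_zero)
    finally show ?thesis unfolding FTC[OF True, of x] by (simp add: algebra_simps)
   next
    case False
    then show ?thesis using Hcs[of z] Suc.prems(6) by simp
   qed
   have i1: "integrable lborel (%z. cis (x \<bullet> z) * A as x (mix T' (upd v i (c $ i)) z) * H z)"
   proof (rule integrable_bounded_support[of _ _ "vbox c R" "K * (1 / R) ^ length as * B"])
    show "norm (cis (x \<bullet> z) * A as x (mix T' (upd v i (c $ i)) z) * H z) \<le> K * (1 / R) ^ length as * B" for z
     using mult_mono[OF K1[OF _ cI, of z x] Suc.prems(5)[of z] KR norm_ge_zero] Suc.prems(6)[of z]
      mult_nonneg_nonneg[OF KR[of "length as"] B0]
     by (cases "z \<in> vbox c R") (auto simp: norm_mult)
   qed (use Suc.prems(6) emeasure_vbox_finite in auto)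
   have i2: "integrable lborel (%z. \<integral>s. indicator ?I s *\<^sub>R (cis (x \<bullet> z) * A (i # as) x (mix T' (upd v i s) z) * Hc s z) \<partial>lborel)"
    using lborel_pair.integrable_snd[OF pairint] by simp
   have "(\<integral>z. cis (x \<bullet> z) * A as x (mix T v z) * H z \<partial>lborel) = ?u1 x +
     (\<integral>z. (\<integral>s. indicator ?I s *\<^sub>R (cis (x \<bullet> z) * A (i # as) x (mix T' (upd v i s) z) * Hc s z) \<partial>lborel) \<partial>lborel)"
    unfolding pt by (rule Bochner_Integration.integral_add[OF i1 i2])
   also have "(\<integral>z. (\<integral>s. indicator ?I s *\<^sub>R (cis (x \<bullet> z) * A (i # as) x (mix T' (upd v i s) z) * Hc s z) \<partial>lborel) \<partial>lborel)
     = (\<integral>s. (\<integral>z. indicator ?I s *\<^sub>R (cis (x \<bullet> z) * A (i # as) x (mix T' (upd v i s) z) * Hc s z) \<partial>lborel) \<partial>lborel)"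
    by (rule lborel_pair.Fubini_integral) (rule pairint)
   finally show ?thesis by simp
  qed
  let ?N = "\<integral>\<^sup>+z. ennreal ((norm (H z))\<^sup>2) \<partial>lborel"
  let ?Q = "4 ^ m * (2 * pi) ^ ?n * (K * (1 / R) ^ length as)\<^sup>2"
  have Q0: "0 \<le> ?Q" by simp
  have e1: "(\<integral>\<^sup>+x. ennreal ((norm (?u1 x))\<^sup>2) \<partial>lborel) \<le> ennreal ?Q * ?N"
   by (rule Suc.IH[OF cT' len(1) vI[OF cI]]) (use Suc.prems in auto)
  have e2: "(\<integral>\<^sup>+x. ennreal ((norm (?us s x))\<^sup>2) \<partial>lborel) \<le> ennreal (?Q / R\<^sup>2) * ?N" if "s \<in> ?I" for s
  proof -
   have "(\<integral>\<^sup>+x. ennreal ((norm (?us s x))\<^sup>2) \<partial>lborel) \<le> ennreal (4 ^ m * (2 * pi) ^ ?n * (K * (1 / R) ^ length (i # as))\<^sup>2) * (\<integral>\<^sup>+z. ennreal ((norm (Hc s z))\<^sup>2) \<partial>lborel)"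
    by (rule Suc.IH[OF cT' len(2) vI[OF that]]) (use HcB Hcs in auto)
   also have "4 ^ m * (2 * pi) ^ ?n * (K * (1 / R) ^ length (i # as))\<^sup>2 = ?Q / R\<^sup>2"
    by (simp add: power_mult_distrib power_divide)
   also have "ennreal (?Q / R\<^sup>2) * (\<integral>\<^sup>+z. ennreal ((norm (Hc s z))\<^sup>2) \<partial>lborel) \<le> ennreal (?Q / R\<^sup>2) * ?N"
    by (intro mult_left_mono nn_integral_mono) (auto simp: Hc_def)
   finally show ?thesis .
  qed
  have us_m [measurable]: "(%(s, x). ?us s x) \<in> borel_measurable (borel \<Otimes>\<^sub>M borel)"
   by measurable
  \<comment> \<open>Cauchy-Schwarz over an interval of length R costs R, and integrating the
    estimate over s costs R again; together they cancel the factor (1 / R)^2 from the additional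
    frequency derivative.\<close>
  have e3: "ennreal ((norm (\<integral>s. indicator ?I s *\<^sub>R ?us s x \<partial>lborel))\<^sup>2) \<le> ennreal R * (\<integral>\<^sup>+s. indicator ?I s * ennreal ((norm (?us s x))\<^sup>2) \<partial>lborel)" for x
  proof -
   have us_m' [measurable]: "(%s. ?us s x) \<in> borel_measurable borel"
    by measurable
   have "ennreal ((norm (\<integral>s. indicator ?I s *\<^sub>R ?us s x \<partial>lborel))\<^sup>2) = (ennreal (norm (\<integral>s. indicator ?I s *\<^sub>R ?us s x \<partial>lborel)))\<^sup>2"
    by (simp add: ennreal_power)
   also have "\<dots> \<le> (\<integral>\<^sup>+s. ennreal (norm (indicator ?I s *\<^sub>R ?us s x)) \<partial>lborel)\<^sup>2"
    by (intro power_mono norm_integral_le_nn_integral) auto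
   also have "(\<integral>\<^sup>+s. ennreal (norm (indicator ?I s *\<^sub>R ?us s x)) \<partial>lborel) = (\<integral>\<^sup>+s. indicator ?I s * (indicator ?I s * ennreal (norm (?us s x))) \<partial>lborel)"
    by (intro nn_integral_cong) (auto simp: indicator_def)
   also have "\<dots>\<^sup>2 \<le> (\<integral>\<^sup>+s. (indicator ?I s)\<^sup>2 \<partial>lborel) * (\<integral>\<^sup>+s. (indicator ?I s * ennreal (norm (?us s x)))\<^sup>2 \<partial>lborel)"
    by (rule Cauchy_Schwarz_nn_integral) measurable
   also have "(\<integral>\<^sup>+s. (indicator ?I s)\<^sup>2 \<partial>lborel) = (\<integral>\<^sup>+s. indicator ?I s \<partial>lborel)"
    by (intro nn_integral_cong) (auto simp: indicator_def)
   also have "\<dots> = ennreal R" using R by simp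
   also have "(\<integral>\<^sup>+s. (indicator ?I s * ennreal (norm (?us s x)))\<^sup>2 \<partial>lborel) = (\<integral>\<^sup>+s. indicator ?I s * ennreal ((norm (?us s x))\<^sup>2) \<partial>lborel)"
    by (intro nn_integral_cong) (auto simp: indicator_def ennreal_power)
   finally show ?thesis .
  qed
  have "(\<integral>\<^sup>+x. ennreal ((norm (\<integral>s. indicator ?I s *\<^sub>R ?us s x \<partial>lborel))\<^sup>2) \<partial>lborel) \<le>
    (\<integral>\<^sup>+x. ennreal R * (\<integral>\<^sup>+s. indicator ?I s * ennreal ((norm (?us s x))\<^sup>2) \<partial>lborel) \<partial>lborel)"
   by (intro nn_integral_mono e3)
  also have "\<dots> = ennreal R * (\<integral>\<^sup>+x. (\<integral>\<^sup>+s. indicator ?I s * ennreal ((norm (?us s x))\<^sup>2) \<partial>lborel) \<partial>lborel)"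
   by (rule nn_integral_cmult) measurable
  also have "(\<integral>\<^sup>+x. (\<integral>\<^sup>+s. indicator ?I s * ennreal ((norm (?us s x))\<^sup>2) \<partial>lborel) \<partial>lborel) = (\<integral>\<^sup>+s. (\<integral>\<^sup>+x. indicator ?I s * ennreal ((norm (?us s x))\<^sup>2) \<partial>lborel) \<partial>lborel)"
   by (rule lborel_pair.Fubini') measurable
  also have "\<dots> = (\<integral>\<^sup>+s. indicator ?I s * (\<integral>\<^sup>+x. ennreal ((norm (?us s x))\<^sup>2) \<partial>lborel) \<partial>lborel)"
   by (intro nn_integral_cong nn_integral_cmult) measurable
  also have "\<dots> \<le> (\<integral>\<^sup>+s. indicator ?I s * (ennreal (?Q / R\<^sup>2) * ?N) \<partial>lborel)"
   using e2 by (intro nn_integral_mono) (auto simp: indicator_def)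
  also have "\<dots> = ennreal R * (ennreal (?Q / R\<^sup>2) * ?N)"
   using R by (subst nn_integral_multc) auto
  also have "ennreal R * \<dots> = ennreal ?Q * ?N"
  proof -
   have "ennreal R * (ennreal R * ennreal (?Q / R\<^sup>2)) = ennreal (R * (R * (?Q / R\<^sup>2)))"
    using R Q0 by (simp only: ennreal_mult divide_nonneg_nonneg zero_le_power2 less_imp_le mult_nonneg_nonneg)
   also have "R * (R * (?Q / R\<^sup>2)) = ?Q" using R by (simp add: power2_eq_square)
   finally show ?thesis by (simp only: mult.assoc[symmetric])
  qed
  finally have e4: "(\<integral>\<^sup>+x. ennreal ((norm (\<integral>s. indicator ?I s *\<^sub>R ?us s x \<partial>lborel))\<^sup>2) \<partial>lborel) \<le> ennreal ?Q * ?N"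
   by (simp add: mult_left_mono)
  have "(\<integral>\<^sup>+x. ennreal ((norm (\<integral>z. cis (x \<bullet> z) * A as x (mix T v z) * H z \<partial>lborel))\<^sup>2) \<partial>lborel) \<le>
    (\<integral>\<^sup>+x. 2 * ennreal ((norm (?u1 x))\<^sup>2) + 2 * ennreal ((norm (\<integral>s. indicator ?I s *\<^sub>R ?us s x \<partial>lborel))\<^sup>2) \<partial>lborel)"
  proof (rule nn_integral_mono)
   fix x
   show "ennreal ((norm (\<integral>z. cis (x \<bullet> z) * A as x (mix T v z) * H z \<partial>lborel))\<^sup>2) \<le>
    2 * ennreal ((norm (?u1 x))\<^sup>2) + 2 * ennreal ((norm (\<integral>s. indicator ?I s *\<^sub>R ?us s x \<partial>lborel))\<^sup>2)"
    unfolding split[of x]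
    by (rule order_trans[OF ennreal_leI[OF norm_sum_power2]]) (simp add: ennreal_plus ennreal_mult)
  qed
  also have "\<dots> = 2 * (\<integral>\<^sup>+x. ennreal ((norm (?u1 x))\<^sup>2) \<partial>lborel) + 2 * (\<integral>\<^sup>+x. ennreal ((norm (\<integral>s. indicator ?I s *\<^sub>R ?us s x \<partial>lborel))\<^sup>2) \<partial>lborel)"
   by (simp add: nn_integral_add nn_integral_cmult)
  also have "\<dots> \<le> 2 * (ennreal ?Q * ?N) + 2 * (ennreal ?Q * ?N)"
   by (intro add_mono mult_left_mono e1 e4) auto
  \<comment> \<open>The square of a two-term sum costs 2 and both terms obey the same bound: a
    factor 4 for each coordinate.\<close>
  also have "\<dots> = 4 * (ennreal ?Q * ?N)" by (simp add: distrib_right[symmetric])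
  also have "\<dots> = ennreal (4 * ?Q) * ?N"
   by (simp only: mult.assoc[of 4 "ennreal ?Q", symmetric] ennreal_mult[OF zero_le_numeral Q0] ennreal_numeral)
  also have "4 * ?Q = 4 ^ Suc m * (2 * pi) ^ ?n * (K * (1 / R) ^ length as)\<^sup>2" by simp
  finally show ?case .
 qed
 have "mix {} c z = z" for z :: "real^'n" by (simp add: vec_eq_iff)
 then show ?thesis using claim[of "{}" ?n "[]" c H] cbox HB Hs by simp
qed

section \<open>Short-time Fourier transforms with general windows\<close>

lemma lborel_nn_integral_reflect:
 fixes f :: "'a::euclidean_space => ennreal"
 assumes "f \<in> borel_measurable borel"
 shows "(\<integral>\<^sup>+x. f (t - x) \<partial>lborel) = (\<integral>\<^sup>+x. f x \<partial>lborel)"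
proof -
 have "(lborel :: 'a measure) = distr lborel borel (%x. t - x)"
  using lborel_affine[of "-1::real" t] by (simp add: density_1)
 then have "(\<integral>\<^sup>+x. f x \<partial>lborel) = (\<integral>\<^sup>+x. f x \<partial>distr lborel borel (%x. t - x))" by simp
 also have "\<dots> = (\<integral>\<^sup>+x. f (t - x) \<partial>lborel)" using assms by (subst nn_integral_distr) auto
 finally show ?thesis by simp
qed

lemma lborel_nn_integral_shift_minus:
 fixes f :: "'a::euclidean_space => ennreal"
 assumes "f \<in> borel_measurable borel"
 shows "(\<integral>\<^sup>+x. f (x - t) \<partial>lborel) = (\<integral>\<^sup>+x. f x \<partial>lborel)"
 using lborel_nn_integral_shift[OF assms, of "- t"] by simp

text \<open>The short-time Fourier transform with an arbitrary real window: integration by parts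
  puts derivatives of the Gaussian in the place of the Gaussian.\<close>

definition wav :: "(real^'n => real) => (real^'n => complex) => real^'n => real^'n => complex" where
 "wav \<psi> u x \<xi> = (\<integral>t. complex_of_real (\<psi> (t - x)) * cis (- (\<xi> \<bullet> t)) * u t \<partial>lborel)"

lemma wav_measurable [measurable]:
 assumes [measurable]: "\<psi> \<in> borel_measurable borel" "u \<in> borel_measurable borel"
 shows "(%(x, \<xi>). wav \<psi> u x \<xi>) \<in> borel_measurable (borel \<Otimes>\<^sub>M borel)"
 unfolding wav_def by measurable

text \<open>Young's inequality, after Cauchy-Schwarz has split |\<psi>| into two square roots. The
  bound is uniform in \<xi> and complements \<open>wav_L2\<close>, which integrates over
  \<xi>.\<close>

lemma wav_sup:
 assumes [measurable]: "\<psi> \<in> borel_measurable borel" "u \<in> borel_measurable borel"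
 shows "(\<integral>\<^sup>+x. ennreal ((norm (wav \<psi> u x \<xi>))\<^sup>2) \<partial>lborel) \<le> (\<integral>\<^sup>+t. ennreal \<bar>\<psi> t\<bar> \<partial>lborel)\<^sup>2 * (\<integral>\<^sup>+t. ennreal ((norm (u t))\<^sup>2) \<partial>lborel)"
proof -
 let ?p = "\<integral>\<^sup>+t. ennreal \<bar>\<psi> t\<bar> \<partial>lborel"
 have "ennreal ((norm (wav \<psi> u x \<xi>))\<^sup>2) \<le> ?p * (\<integral>\<^sup>+t. ennreal \<bar>\<psi> (t - x)\<bar> * ennreal ((norm (u t))\<^sup>2) \<partial>lborel)" for x
 proof -
  have "ennreal ((norm (wav \<psi> u x \<xi>))\<^sup>2) = (ennreal (norm (wav \<psi> u x \<xi>)))\<^sup>2" by (simp add: ennreal_power)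
  also have "\<dots> \<le> (\<integral>\<^sup>+t. ennreal (norm (complex_of_real (\<psi> (t - x)) * cis (- (\<xi> \<bullet> t)) * u t)) \<partial>lborel)\<^sup>2"
   unfolding wav_def by (intro power_mono norm_integral_le_nn_integral) auto
  also have "(\<integral>\<^sup>+t. ennreal (norm (complex_of_real (\<psi> (t - x)) * cis (- (\<xi> \<bullet> t)) * u t)) \<partial>lborel) = 
    (\<integral>\<^sup>+t. ennreal (sqrt \<bar>\<psi> (t - x)\<bar>) * ennreal (sqrt \<bar>\<psi> (t - x)\<bar> * norm (u t)) \<partial>lborel)"
   by (intro nn_integral_cong) (simp add: norm_mult ennreal_mult[symmetric] mult.assoc[symmetric] del: mult.assoc)
  also have "\<dots>\<^sup>2 \<le> (\<integral>\<^sup>+t. (ennreal (sqrt \<bar>\<psi> (t - x)\<bar>))\<^sup>2 \<partial>lborel) * (\<integral>\<^sup>+t. (ennreal (sqrt \<bar>\<psi> (t - x)\<bar> * norm (u t)))\<^sup>2 \<partial>lborel)"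
   by (rule Cauchy_Schwarz_nn_integral) measurable
  also have "(\<integral>\<^sup>+t. (ennreal (sqrt \<bar>\<psi> (t - x)\<bar>))\<^sup>2 \<partial>lborel) = (\<integral>\<^sup>+t. ennreal \<bar>\<psi> (t - x)\<bar> \<partial>lborel)"
   by (simp add: ennreal_power)
  also have "\<dots> = ?p" by (rule lborel_nn_integral_shift_minus) measurable
  also have "(\<integral>\<^sup>+t. (ennreal (sqrt \<bar>\<psi> (t - x)\<bar> * norm (u t)))\<^sup>2 \<partial>lborel) = (\<integral>\<^sup>+t. ennreal \<bar>\<psi> (t - x)\<bar> * ennreal ((norm (u t))\<^sup>2) \<partial>lborel)"
   by (intro nn_integral_cong) (simp add: ennreal_power power_mult_distrib ennreal_mult)
  finally show ?thesis .
 qed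
 then have "(\<integral>\<^sup>+x. ennreal ((norm (wav \<psi> u x \<xi>))\<^sup>2) \<partial>lborel) \<le> (\<integral>\<^sup>+x. ?p * (\<integral>\<^sup>+t. ennreal \<bar>\<psi> (t - x)\<bar> * ennreal ((norm (u t))\<^sup>2) \<partial>lborel) \<partial>lborel)"
  by (rule nn_integral_mono)
 also have "\<dots> = ?p * (\<integral>\<^sup>+x. (\<integral>\<^sup>+t. ennreal \<bar>\<psi> (t - x)\<bar> * ennreal ((norm (u t))\<^sup>2) \<partial>lborel) \<partial>lborel)"
  by (rule nn_integral_cmult) measurable
 also have "(\<integral>\<^sup>+x. (\<integral>\<^sup>+t. ennreal \<bar>\<psi> (t - x)\<bar> * ennreal ((norm (u t))\<^sup>2) \<partial>lborel) \<partial>lborel) = 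
   (\<integral>\<^sup>+t. (\<integral>\<^sup>+x. ennreal \<bar>\<psi> (t - x)\<bar> * ennreal ((norm (u t))\<^sup>2) \<partial>lborel) \<partial>lborel)"
  by (rule lborel_pair.Fubini') measurable
 also have "\<dots> = (\<integral>\<^sup>+t. ?p * ennreal ((norm (u t))\<^sup>2) \<partial>lborel)"
  by (simp add: nn_integral_multc lborel_nn_integral_reflect[of "%s. ennreal \<bar>\<psi> s\<bar>"])
 also have "\<dots> = ?p * (\<integral>\<^sup>+t. ennreal ((norm (u t))\<^sup>2) \<partial>lborel)"
  by (rule nn_integral_cmult) measurable
 finally show ?thesis by (simp add: power2_eq_square mult.assoc)
qed

text \<open>Bessel in \<xi> at fixed x, after which x occurs only in the window and is integrated
  out: the upper half of the Moyal identity.\<close>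

lemma wav_L2:
 assumes [measurable]: "\<psi> \<in> borel_measurable borel" "u \<in> borel_measurable borel"
  and int: "\<And>x. integrable lborel (%t. complex_of_real (\<psi> (t - x)) * u t)"
 shows "(\<integral>\<^sup>+\<xi>. \<integral>\<^sup>+x. ennreal ((norm (wav \<psi> u x \<xi>))\<^sup>2) \<partial>lborel \<partial>lborel) \<le> 
   ennreal ((2 * pi) ^ CARD('n)) * (\<integral>\<^sup>+t. ennreal ((\<psi> t)\<^sup>2) \<partial>lborel) * (\<integral>\<^sup>+t. ennreal ((norm (u (t::real^'n)))\<^sup>2) \<partial>lborel)"
proof -
 let ?p = "\<integral>\<^sup>+t. ennreal ((\<psi> t)\<^sup>2) \<partial>lborel"
 let ?c = "ennreal ((2 * pi) ^ CARD('n))"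
 have "(\<integral>\<^sup>+\<xi>. \<integral>\<^sup>+x. ennreal ((norm (wav \<psi> u x \<xi>))\<^sup>2) \<partial>lborel \<partial>lborel) = (\<integral>\<^sup>+x. \<integral>\<^sup>+\<xi>. ennreal ((norm (wav \<psi> u x \<xi>))\<^sup>2) \<partial>lborel \<partial>lborel)"
  by (rule lborel_pair.Fubini') measurable
 also have "\<dots> \<le> (\<integral>\<^sup>+x. ?c * (\<integral>\<^sup>+t. ennreal ((\<psi> (t - x))\<^sup>2) * ennreal ((norm (u t))\<^sup>2) \<partial>lborel) \<partial>lborel)"
 proof (rule nn_integral_mono)
  fix x :: "real^'n"
  have eq: "wav \<psi> u x \<xi> = (\<integral>t. cis (- (\<xi> \<bullet> t)) * (complex_of_real (\<psi> (t - x)) * u t) \<partial>lborel)" for \<xi>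
   unfolding wav_def by (intro Bochner_Integration.integral_cong refl) (simp only: mult_ac)
  show "(\<integral>\<^sup>+\<xi>. ennreal ((norm (wav \<psi> u x \<xi>))\<^sup>2) \<partial>lborel) \<le> ?c * (\<integral>\<^sup>+t. ennreal ((\<psi> (t - x))\<^sup>2) * ennreal ((norm (u t))\<^sup>2) \<partial>lborel)"
   unfolding eq using bessel_fourier_minus[OF int[of x]]
   by (simp add: norm_mult power_mult_distrib ennreal_mult)
 qed
 also have "\<dots> = ?c * (\<integral>\<^sup>+x. (\<integral>\<^sup>+t. ennreal ((\<psi> (t - x))\<^sup>2) * ennreal ((norm (u t))\<^sup>2) \<partial>lborel) \<partial>lborel)"
  by (rule nn_integral_cmult) measurable
 also have "(\<integral>\<^sup>+x. (\<integral>\<^sup>+t. ennreal ((\<psi> (t - x))\<^sup>2) * ennreal ((norm (u t))\<^sup>2) \<partial>lborel) \<partial>lborel) = 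
   (\<integral>\<^sup>+t. (\<integral>\<^sup>+x. ennreal ((\<psi> (t - x))\<^sup>2) * ennreal ((norm (u t))\<^sup>2) \<partial>lborel) \<partial>lborel)"
  by (rule lborel_pair.Fubini') measurable
 also have "\<dots> = (\<integral>\<^sup>+t. ?p * ennreal ((norm (u t))\<^sup>2) \<partial>lborel)"
  by (simp add: nn_integral_multc lborel_nn_integral_reflect[of "%s. ennreal ((\<psi> s)\<^sup>2)"])
 also have "\<dots> = ?p * (\<integral>\<^sup>+t. ennreal ((norm (u t))\<^sup>2) \<partial>lborel)"
  by (rule nn_integral_cmult) measurable
 finally show ?thesis by (simp add: mult.assoc)
qed

lemma upd_add_axis: "upd t i (t $ i + s) = t + s *\<^sub>R axis i 1"
 by (simp add: vec_eq_iff axis_def)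

text \<open>Translation by a unit vector preserves the integral of \<open>G\<close>, while the
  difference is an integral of \<open>G'\<close> along the unit segment; Fubini turns it into the
  integral of \<open>G'\<close> itself. Integrability takes the place of decay at infinity.\<close>

lemma integral_partial_eq_0:
 fixes G G' :: "real^'n => complex"
 assumes G: "integrable lborel G" and G': "integrable lborel G'"
  and deriv: "\<And>t s. ((%s. G (upd t i s)) has_vector_derivative G' (upd t i s)) (at s)"
  and cont: "continuous_on UNIV G'"
 shows "(\<integral>t. G' t \<partial>lborel) = 0"
proof -
 have [measurable]: "G' \<in> borel_measurable borel" "G \<in> borel_measurable borel" using G G' by auto
 let ?e = "axis i 1 :: real^'n"
 have FTC: "G (t + ?e) - G t = (\<integral>s. indicator {0..1} s *\<^sub>R G' (t + s *\<^sub>R ?e) \<partial>lborel)" for t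
 proof -
  have "((%s. G (upd t i (t $ i + s))) has_vector_derivative G' (upd t i (t $ i + s))) (at s within {0..1})" for s
  proof -
   have "((%s. t $ i + s) has_vector_derivative 1) (at s)" by (auto intro!: derivative_eq_intros simp: has_real_derivative_iff_has_vector_derivative[symmetric])
   from vector_diff_chain_at[OF this deriv[of t "t $ i + s"]]
   show ?thesis by (simp add: o_def has_vector_derivative_at_within)
  qed
  then have d: "((%s. G (t + s *\<^sub>R ?e)) has_vector_derivative G' (t + s *\<^sub>R ?e)) (at s within {0..1})" for s
   by (simp add: upd_add_axis)
  have "continuous_on {0..1} (%s. G' (t + s *\<^sub>R ?e))"
   by (rule continuous_on_compose2[OF cont]) (auto intro!: continuous_intros)
  with d show ?thesis by (subst integral_FTC_atLeastAtMost) auto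
 qed
 have int: "integrable (lborel \<Otimes>\<^sub>M lborel) (%(s, t). indicator {0..1} s *\<^sub>R G' (t + s *\<^sub>R ?e))"
 proof (rule lborel_pair.Fubini_integrable)
  show "(%(s, t). indicator {0..1} s *\<^sub>R G' (t + s *\<^sub>R ?e)) \<in> borel_measurable (lborel \<Otimes>\<^sub>M lborel)" by measurable
  have "(\<integral>t. norm (case (s, t) of (s, t) => indicator {0..1} s *\<^sub>R G' (t + s *\<^sub>R ?e)) \<partial>lborel) = indicator {0..1::real} s * (\<integral>t. norm (G' t) \<partial>lborel)" for s
   using lborel_integral_shift[of "%t. norm (G' t)" "s *\<^sub>R ?e"] by simp
  then show "integrable lborel (%s. \<integral>t. norm (case (s, t) of (s, t) => indicator {0..1} s *\<^sub>R G' (t + s *\<^sub>R ?e)) \<partial>lborel)"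
   by (simp only:) simp
  show "AE s in lborel. integrable lborel (%t. case (s, t) of (s, t) => indicator {0..1} s *\<^sub>R G' (t + s *\<^sub>R ?e))"
   using lborel_integrable_shift[OF G'] by simp
 qed
 have "0 = (\<integral>t. G (t + ?e) - G t \<partial>lborel)"
  using lborel_integrable_shift[OF G, of ?e] G lborel_integral_shift[of G ?e] by simp
 also have "\<dots> = (\<integral>t. (\<integral>s. indicator {0..1} s *\<^sub>R G' (t + s *\<^sub>R ?e) \<partial>lborel) \<partial>lborel)" unfolding FTC ..
 also have "\<dots> = (\<integral>s. (\<integral>t. indicator {0..1} s *\<^sub>R G' (t + s *\<^sub>R ?e) \<partial>lborel) \<partial>lborel)"
  by (rule lborel_pair.Fubini_integral) (rule int)
 also have "\<dots> = (\<integral>s. indicator {0..1::real} s *\<^sub>R (\<integral>t. G' t \<partial>lborel) \<partial>lborel)"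
  using lborel_integral_shift[of G'] by simp
 also have "\<dots> = (\<integral>t. G' t \<partial>lborel)" by simp
 finally show ?thesis by simp
qed

section \<open>Gaussian windows with polynomial factors\<close>

text \<open>The family contains the Gaussian, for p = 1, and is closed under differentiation in
  coordinate i, with \<open>pdwin\<close> as the effect on the polynomial; repeated integration by
  parts in a fixed coordinate stays inside it.\<close>

definition pwin :: "'n => real poly => real^'n => real" where
 "pwin i p t = poly p (t $ i) * exp (- (norm t)\<^sup>2)"

lemma continuous_pwin: "continuous_on S (pwin i p)"
 unfolding pwin_def by (intro continuous_intros)

lemma pwin_measurable [measurable]: "pwin i p \<in> borel_measurable borel"
 by (intro borel_measurable_continuous_onI continuous_pwin)

text \<open>Induction on the polynomial with e arbitrary: half of the exponent absorbs the new
  factor s, the other half the remaining polynomial.\<close>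

lemma poly_bound_gauss:
 assumes "e > 0"
 shows "\<exists>C\<ge>0. \<forall>s::real. \<bar>poly p s\<bar> \<le> C * exp (e * s\<^sup>2)"
 using assms
proof (induction p arbitrary: e rule: pCons_induct)
 case 0
 then show ?case by (intro exI[of _ 0]) auto
next
 case (pCons a p)
 from pCons.IH[of "e/2"] pCons.prems obtain C where C: "C \<ge> 0" "\<And>s::real. \<bar>poly p s\<bar> \<le> C * exp (e / 2 * s\<^sup>2)" by auto
 define D where "D = 1 + 2 / e"
 have D: "\<bar>s\<bar> \<le> D * exp (e / 2 * s\<^sup>2)" for s :: real
 proof -
  have "\<bar>s\<bar> \<le> 1 + s\<^sup>2"
   using sum_squares_bound[of "\<bar>s\<bar>" 1] by simp
  also have "\<dots> \<le> D * (1 + e / 2 * s\<^sup>2)"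
   using pCons.prems by (simp add: D_def algebra_simps add_divide_distrib)
  also have "\<dots> \<le> D * exp (e / 2 * s\<^sup>2)"
   using pCons.prems by (intro mult_left_mono exp_ge_add_one_self) (auto simp: D_def)
  finally show ?thesis .
 qed
 have "\<bar>poly (pCons a p) s\<bar> \<le> (\<bar>a\<bar> + D * C) * exp (e * s\<^sup>2)" for s
 proof -
  have "\<bar>poly (pCons a p) s\<bar> \<le> \<bar>a\<bar> + \<bar>s\<bar> * \<bar>poly p s\<bar>" by (simp add: abs_triangle_ineq[THEN order_trans] abs_mult)
  also have "\<dots> \<le> \<bar>a\<bar> * exp (e * s\<^sup>2) + (D * exp (e / 2 * s\<^sup>2)) * (C * exp (e / 2 * s\<^sup>2))"
   using pCons.prems D C by (intro add_mono mult_mono) (auto simp: mult_le_cancel_left1 D_def)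
  also have "\<dots> = (\<bar>a\<bar> + D * C) * exp (e * s\<^sup>2)"
   by (simp add: algebra_simps exp_add[symmetric])
  finally show ?thesis .
 qed
 moreover have "0 \<le> \<bar>a\<bar> + D * C" using C pCons.prems by (simp add: D_def)
 ultimately show ?case by blast
qed

lemma pwin_bound: "\<exists>C\<ge>0. \<forall>t. \<bar>pwin i p t\<bar> \<le> C * exp (- (1/2) * (norm t)\<^sup>2)"
proof -
 from poly_bound_gauss[of "1/2" p] obtain C where C: "C \<ge> 0" "\<And>s::real. \<bar>poly p s\<bar> \<le> C * exp (1/2 * s\<^sup>2)" by auto
 have "\<bar>pwin i p t\<bar> \<le> C * exp (- (1/2) * (norm t)\<^sup>2)" for t
 proof -
  have "\<bar>t $ i\<bar> \<le> norm t" by (rule component_le_norm_cart)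
  then have "\<bar>t $ i\<bar>\<^sup>2 \<le> (norm t)\<^sup>2" by (rule power_mono) simp
  then have *: "exp (1/2 * (t $ i)\<^sup>2) \<le> exp (1/2 * (norm t)\<^sup>2)" by simp
  have "\<bar>pwin i p t\<bar> \<le> (C * exp (1/2 * (t $ i)\<^sup>2)) * exp (- (norm t)\<^sup>2)"
   unfolding pwin_def abs_mult using C by (intro mult_mono) auto
  also have "\<dots> \<le> (C * exp (1/2 * (norm t)\<^sup>2)) * exp (- (norm t)\<^sup>2)"
   using C * by (intro mult_right_mono mult_left_mono) auto
  also have "\<dots> = C * exp (- (1/2) * (norm t)\<^sup>2)" by (simp add: exp_add[symmetric] mult.assoc)
  finally show ?thesis .
 qed
 with C show ?thesis by blast
qed

lemma pwin_integrable: "integrable lborel (pwin i p)"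
proof -
 obtain C where C: "C \<ge> 0" "\<And>t. \<bar>pwin i p t\<bar> \<le> C * exp (- (1/2) * (norm t)\<^sup>2)" using pwin_bound[of i p] by blast
 show ?thesis
 proof (rule Bochner_Integration.integrable_bound)
  show "integrable lborel (%t::real^'a. C * exp (- (1/2) * (norm t)\<^sup>2))"
   by (intro integrable_mult_right integrable_gauss_real) simp
  show "AE t in lborel. norm (pwin i p t) \<le> norm (C * exp (- (1/2) * (norm t)\<^sup>2))"
   using C by (intro AE_I2) auto
 qed measurable
qed

lemma pwin_L1: "(\<integral>\<^sup>+t. ennreal \<bar>pwin i p t\<bar> \<partial>lborel) < \<infinity>"
 using pwin_integrable[of i p] unfolding integrable_iff_bounded by simp

lemma pwin_L2: "(\<integral>\<^sup>+t. ennreal ((pwin i p t)\<^sup>2) \<partial>lborel) < \<infinity>"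
proof -
 obtain C where C: "C \<ge> 0" "\<And>t. \<bar>pwin i p t\<bar> \<le> C * exp (- (1/2) * (norm t)\<^sup>2)" using pwin_bound[of i p] by blast
 have "(pwin i p t)\<^sup>2 \<le> C * \<bar>pwin i p t\<bar>" for t
 proof -
  have "C * exp (- (1/2) * (norm t)\<^sup>2) \<le> C" using C(1) by (intro mult_left_le) auto
  then have "\<bar>pwin i p t\<bar> \<le> C" using C(2)[of t] by linarith
  then have "\<bar>pwin i p t\<bar> * \<bar>pwin i p t\<bar> \<le> C * \<bar>pwin i p t\<bar>" by (rule mult_right_mono) simp
  then show ?thesis by (simp add: power2_eq_square)
 qed
 then have "(\<integral>\<^sup>+t. ennreal ((pwin i p t)\<^sup>2) \<partial>lborel) \<le> (\<integral>\<^sup>+t. ennreal C * ennreal \<bar>pwin i p t\<bar> \<partial>lborel)"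
  using C by (intro nn_integral_mono) (simp add: ennreal_mult[symmetric] ennreal_leI)
 also have "\<dots> = ennreal C * (\<integral>\<^sup>+t. ennreal \<bar>pwin i p t\<bar> \<partial>lborel)" by (rule nn_integral_cmult) measurable
 also have "\<dots> < \<infinity>" using pwin_L1[of i p] by (simp add: ennreal_mult_less_top)
 finally show ?thesis .
qed

text \<open>From (p(s) exp (- s^2))' = (p'(s) - 2 s p(s)) exp (- s^2).\<close>

definition pdwin :: "real poly => real poly" where
 "pdwin p = pderiv p - [:0, 2:] * p"

lemma norm_upd_power2: "(norm (upd t i s))\<^sup>2 = s\<^sup>2 + (\<Sum>k\<in>UNIV - {i}. (t $ k)\<^sup>2)"
proof -
 have "(norm (upd t i s))\<^sup>2 = (\<Sum>k\<in>UNIV. (upd t i s $ k)\<^sup>2)"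
  by (simp add: norm_vec_def L2_set_def sum_nonneg)
 also have "\<dots> = (upd t i s $ i)\<^sup>2 + (\<Sum>k\<in>UNIV - {i}. (upd t i s $ k)\<^sup>2)"
  by (rule sum.remove) auto
 finally show ?thesis by simp
qed

lemma pwin_deriv:
 "((%s. pwin i p (upd t i s - x)) has_real_derivative pwin i (pdwin p) (upd t i s - x)) (at s)"
proof -
 have eq: "upd t i s - x = upd (t - x) i (s - x $ i)" for s by (simp add: vec_eq_iff)
 show ?thesis unfolding eq pwin_def norm_upd_power2 pdwin_def
  by (auto intro!: derivative_eq_intros simp: algebra_simps)
qed

lemma has_vector_derivative_cis_affine:
 "((%s. cis (a + s * b)) has_vector_derivative (\<i> * complex_of_real b * cis (a + s * b))) (at s)"
proof -
 have "((%z. exp (\<i> * (of_real a + z * of_real b))) has_field_derivative (\<i> * of_real b * exp (\<i> * (of_real a + of_real s * of_real b)))) (at (of_real s))"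
  by (auto intro!: derivative_eq_intros)
 from has_vector_derivative_real_field[OF this] show ?thesis by (simp add: cis_conv_exp)
qed

lemma inner_upd: "upd t i s \<bullet> w = upd t i 0 \<bullet> w + s * w $ i"
proof -
 have "upd t i s = upd t i 0 + s *\<^sub>R axis i 1" by (simp add: vec_eq_iff axis_def)
 then show ?thesis by (simp add: inner_add_left inner_axis' )
qed

section \<open>Oscillatory integrals localised to a frequency box\<close>

text \<open>Amplitudes may be discontinuous, so a Fourier transform cut off by the indicator of a
  piece qualifies.\<close>

definition ok_amp :: "real^'n => real => (real^'n => complex) => bool" where
 "ok_amp c R H \<longleftrightarrow> H \<in> borel_measurable borel \<and> (\<exists>B. \<forall>z. norm (H z) \<le> B) \<and> (\<forall>z. z \<notin> vbox c R --> H z = 0)"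

text \<open>Lebesgue measure and all point masses. One estimate against every member yields both the
  integrated bound in \<xi> and the bound at each single \<xi>.\<close>

definition slice_measures :: "(real^'n) measure set" where
 "slice_measures = insert lborel (range (return borel))"

lemma sets_slice_measures: "\<nu> \<in> slice_measures ==> sets \<nu> = sets borel"
 by (auto simp: slice_measures_def)

text \<open>\<open>A as bs\<close> stands for the symbol differentiated along \<open>as\<close> in
  frequency and along \<open>bs\<close> in space; \<open>G\<close> lists corner, side and symbol
  size of the boxes. \<open>bnd\<close> says that the symbol divided by L and rescaled by R lies in
  S^0_{0,0} on the box, with constants that do not depend on the box.\<close>

locale symbol_boxes =
 fixes A :: "'n::finite list => 'n list => real^'n => real^'n => complex" and G :: "((real^'n) \<times> real \<times> real) set"
 assumes cont: "\<And>as bs. continuous_on UNIV (%(x, z). A as bs x z)"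
  and deriv_freq: "\<And>as bs i x z s. ((%s. A as bs x (upd z i s)) has_vector_derivative A (i # as) bs x (upd z i s)) (at s)"
  and deriv_space: "\<And>bs i x z s. ((%s. A [] bs (upd x i s) z) has_vector_derivative A [] (i # bs) (upd x i s) z) (at s)"
  and bnd: "\<And>as bs. \<exists>K\<ge>0. \<forall>c R L. (c, R, L) \<in> G --> (\<forall>x. \<forall>z\<in>vbox c R. norm (A as bs x z) \<le> K * L * R ^ length bs * (1 / R) ^ length as)"
  and G_ge: "\<And>c R L. (c, R, L) \<in> G ==> R \<ge> 1 \<and> L \<ge> 0"
begin

lemma A_measurable [measurable]: "case_prod (A as bs) \<in> borel_measurable (borel \<Otimes>\<^sub>M borel)"
 using cont[of as bs] by (subst borel_prod) (rule borel_measurable_continuous_onI, simp)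

lemma cont_freq: "continuous_on UNIV (A as bs x)"
proof -
 have "continuous_on UNIV (Pair x)" by (intro continuous_on_Pair continuous_on_const continuous_on_id)
 from continuous_on_compose2[OF cont[of as bs] this] show ?thesis by simp
qed

lemma cont_space: "continuous_on UNIV (%x. A as bs x z)"
proof -
 have "continuous_on UNIV (%x. (x, z))" by (intro continuous_on_Pair continuous_on_const continuous_on_id)
 from continuous_on_compose2[OF cont[of as bs] this] show ?thesis by simp
qed

text \<open>The operator, without its factor (2 pi)^(-n), applied to a function with Fourier
  transform \<open>H\<close>, the symbol being differentiated in space along
  \<open>bs\<close>.\<close>

definition osc :: "'n list => (real^'n => complex) => real^'n => complex" where
 "osc bs H t = (\<integral>z. cis (t \<bullet> z) * A [] bs t z * H z \<partial>lborel)"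

lemma osc_measurable [measurable]:
 assumes [measurable]: "H \<in> borel_measurable borel"
 shows "osc bs H \<in> borel_measurable borel"
 unfolding osc_def[abs_def] by measurable

text \<open>For fixed \<open>bs\<close> the functions \<open>A as bs\<close> behave like a symbol of
  size L R^|bs|, so \<open>local_calderon_vaillancourt\<close> applies. Its constant is the sum of
  those for the finitely many frequency lists of length at most n.\<close>

lemma osc_L2:
 "\<exists>C\<ge>0. \<forall>c R L. (c, R, L) \<in> G --> (\<forall>H. ok_amp c R H -->
   (\<integral>\<^sup>+t. ennreal ((norm (osc bs H t))\<^sup>2) \<partial>lborel) \<le> ennreal (C * (L * R ^ length bs)\<^sup>2) * (\<integral>\<^sup>+z. ennreal ((norm (H z))\<^sup>2) \<partial>lborel))"
proof -
 obtain K where K0: "\<And>as. K as \<ge> 0" and K: "\<And>as c R L x z. (c, R, L) \<in> G ==> z \<in> vbox c R ==> norm (A as bs x z) \<le> K as * L * R ^ length bs * (1 / R) ^ length as"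
  using bnd[of _ bs] by metis
 define S where "S = {as::'n list. length as \<le> CARD('n)}"
 have finS: "finite S" unfolding S_def using finite_lists_length_le[of "UNIV :: 'n set"] by simp
 define KK where "KK = sum K S"
 have KK: "K as \<le> KK" if "length as \<le> CARD('n)" for as
  unfolding KK_def using that finS K0 by (intro member_le_sum) (auto simp: S_def)
 have KK0: "0 \<le> KK" unfolding KK_def by (intro sum_nonneg K0)
 let ?C = "4 ^ CARD('n) * (2 * pi) ^ CARD('n) * KK\<^sup>2"
 show ?thesis
 proof (intro exI[of _ ?C] conjI allI impI)
  show "0 \<le> ?C" by simp
  fix c R L H assume g: "(c, R, L) \<in> G" and H: "ok_amp c R H"
  have R: "R \<ge> 1" "L \<ge> 0" using G_ge[OF g] by auto
  from H obtain B where B: "\<And>z. norm (H z) \<le> B" by (auto simp: ok_amp_def)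
  have "(\<integral>\<^sup>+t. ennreal ((norm (\<integral>z. cis (t \<bullet> z) * A [] bs t z * H z \<partial>lborel))\<^sup>2) \<partial>lborel)
    \<le> ennreal (4 ^ CARD('n) * (2 * pi) ^ CARD('n) * (KK * (L * R ^ length bs))\<^sup>2) * (\<integral>\<^sup>+z. ennreal ((norm (H z))\<^sup>2) \<partial>lborel)"
  proof (rule local_calderon_vaillancourt[where A = "%as. A as bs" and c = c and R = R and B = B])
   show "norm (A as bs x z) \<le> KK * (L * R ^ length bs) * (1 / R) ^ length as" if "length as \<le> CARD('n)" "z \<in> vbox c R" for as x z
   proof -
    have "norm (A as bs x z) \<le> K as * (L * R ^ length bs * (1 / R) ^ length as)" using K[OF g that(2)] by (simp add: mult.assoc)
    also have "\<dots> \<le> KK * (L * R ^ length bs * (1 / R) ^ length as)" using KK[OF that(1)] R by (intro mult_right_mono) auto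
    finally show ?thesis by (simp add: mult.assoc)
   qed
  qed (use H B R deriv_freq cont_freq in \<open>auto simp: ok_amp_def\<close>)
  then show "(\<integral>\<^sup>+t. ennreal ((norm (osc bs H t))\<^sup>2) \<partial>lborel) \<le> ennreal (?C * (L * R ^ length bs)\<^sup>2) * (\<integral>\<^sup>+z. ennreal ((norm (H z))\<^sup>2) \<partial>lborel)"
   unfolding osc_def by (simp add: power_mult_distrib mult.assoc)
 qed
qed

lemma bnd_Nil:
 assumes g: "(c, R, L) \<in> G"
 obtains K where "K \<ge> 0" "\<And>x z. z \<in> vbox c R ==> norm (A [] bs x z) \<le> K * L * R ^ length bs"
proof -
 obtain K where K: "K \<ge> 0" "\<forall>c R L. (c, R, L) \<in> G --> (\<forall>x. \<forall>z\<in>vbox c R. norm (A [] bs x z) \<le> K * L * R ^ length bs * (1 / R) ^ length ([] :: 'n list))"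
  using bnd[of "[]" bs] by blast
 show ?thesis
 proof (rule that[OF K(1)])
  fix x z assume "z \<in> vbox c R"
  then show "norm (A [] bs x z) \<le> K * L * R ^ length bs" using K(2)[rule_format, OF g, of z x] by simp
 qed
qed

lemma amp_bound:
 assumes g: "(c, R, L) \<in> G" and H: "ok_amp c R H"
 shows "\<exists>D\<ge>0. \<forall>t z. norm (A [] bs t z * H z) \<le> D * indicator (vbox c R) z"
proof -
 obtain K where K: "K \<ge> 0" "\<And>x z. z \<in> vbox c R ==> norm (A [] bs x z) \<le> K * L * R ^ length bs"
  by (rule bnd_Nil[OF g, where bs = bs]) blast
 from H obtain B where B: "\<And>z. norm (H z) \<le> B" by (auto simp: ok_amp_def)
 have B0: "0 \<le> B" using B[of 0] norm_ge_zero order_trans by blast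
 have D0: "0 \<le> K * L * R ^ length bs" using K G_ge[OF g] by simp
 have "norm (A [] bs t z * H z) \<le> (K * L * R ^ length bs * B) * indicator (vbox c R) z" for t z
 proof (cases "z \<in> vbox c R")
  case True
  then show ?thesis using mult_mono[OF K(2)[of z t] B[of z] D0 norm_ge_zero] by (simp add: norm_mult)
 next
  case False
  then show ?thesis using H by (simp add: ok_amp_def)
 qed
 then show ?thesis using mult_nonneg_nonneg[OF D0 B0] by blast
qed

text \<open>The kernel against which \<open>H\<close> is integrated in
  \<open>wav (pwin i q) (osc bs H) x \<xi>\<close>: a Fourier integral at frequency \<xi> - z of
  window times symbol. Its decay in \<xi> - z is the source of the almost orthogonality.\<close>

definition Jint :: "'n => real poly => 'n list => real^'n => real^'n => real^'n => complex" where
 "Jint i q bs x \<xi> z = (\<integral>t. complex_of_real (pwin i q (t - x)) * cis (t \<bullet> (z - \<xi>)) * A [] bs t z \<partial>lborel)"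

lemma pwin_shift_integrable: "integrable lborel (%t. complex_of_real (pwin i q (t - x)))"
 using integrable_of_real[OF lborel_integrable_shift[OF pwin_integrable[of i q], of "- x"]] by simp

text \<open>Fubini, with the window securing the t-integral and the bounded support of
  \<open>H\<close> the z-integral.\<close>

lemma
 assumes g: "(c, R, L) \<in> G" and H: "ok_amp c R H"
 shows wav_osc: "wav (pwin i q) (osc bs H) x \<xi> = (\<integral>z. H z * Jint i q bs x \<xi> z \<partial>lborel)"
  and wav_osc_integrable: "integrable lborel (%z. H z * Jint i q bs x \<xi> z)"
  and osc_win_integrable: "integrable lborel (%t. complex_of_real (pwin i q (t - x)) * osc bs H t)"
  and wav_osc_integrable_pair: "integrable (lborel \<Otimes>\<^sub>M lborel) (%(t, z). complex_of_real (pwin i q (t - x)) * cis (- (\<xi> \<bullet> t)) * (cis (t \<bullet> z) * A [] bs t z * H z))"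
proof -
 have [measurable]: "H \<in> borel_measurable borel" using H by (auto simp: ok_amp_def)
 obtain D where D: "D \<ge> 0" "\<And>t z. norm (A [] bs t z * H z) \<le> D * indicator (vbox c R) z"
  using amp_bound[OF g H, of bs] by blast
 let ?\<Phi> = "%\<xi> t z. complex_of_real (pwin i q (t - x)) * cis (- (\<xi> \<bullet> t)) * (cis (t \<bullet> z) * A [] bs t z * H z)"
 have pint: "integrable (lborel \<Otimes>\<^sub>M lborel) (%(t, z). ?\<Phi> \<xi> t z)" for \<xi>
 proof (rule Bochner_Integration.integrable_bound)
  have "integrable lborel (%z. complex_of_real (D * indicator (vbox c R) z))"
   using emeasure_vbox_finite[of c R] by (intro integrable_of_real integrable_mult_right integrable_real_indicator) auto
  then show "integrable (lborel \<Otimes>\<^sub>M lborel) (%(t, z). complex_of_real (pwin i q (t - x)) * complex_of_real (D * indicator (vbox c R) z))"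
   by (intro integrable_tensor_lborel pwin_shift_integrable)
  show "(%(t, z). ?\<Phi> \<xi> t z) \<in> borel_measurable (lborel \<Otimes>\<^sub>M lborel)" by measurable
  have "norm (?\<Phi> \<xi> t z) \<le> norm (complex_of_real (pwin i q (t - x)) * complex_of_real (D * indicator (vbox c R) z))" for t z
  proof -
   have "norm (?\<Phi> \<xi> t z) = \<bar>pwin i q (t - x)\<bar> * norm (A [] bs t z * H z)" by (simp add: norm_mult mult.assoc)
   also have "\<dots> \<le> \<bar>pwin i q (t - x)\<bar> * (D * indicator (vbox c R) z)" by (intro mult_left_mono D) auto
   finally show ?thesis using D(1) by (simp add: norm_mult abs_mult)
  qed
  then show "AE p in lborel \<Otimes>\<^sub>M lborel. norm (case p of (t, z) => ?\<Phi> \<xi> t z) \<le> norm (case p of (t, z) => complex_of_real (pwin i q (t - x)) * complex_of_real (D * indicator (vbox c R) z))"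
   by (intro AE_I2) auto
 qed
 then show "integrable (lborel \<Otimes>\<^sub>M lborel) (%(t, z). ?\<Phi> \<xi> t z)" .
 have inner: "(\<integral>t. ?\<Phi> \<xi> t z \<partial>lborel) = H z * Jint i q bs x \<xi> z" for z
 proof -
  have e: "?\<Phi> \<xi> t z = H z * (complex_of_real (pwin i q (t - x)) * cis (t \<bullet> (z - \<xi>)) * A [] bs t z)" for t
  proof -
   have "cis (t \<bullet> (z - \<xi>)) = cis (- (\<xi> \<bullet> t)) * cis (t \<bullet> z)" by (simp add: cis_mult inner_diff_right inner_commute)
   then show ?thesis by (simp only: mult_ac)
  qed
  show ?thesis unfolding e Jint_def by (rule integral_mult_right_zero)
 qed
 have "wav (pwin i q) (osc bs H) x \<xi> = (\<integral>t. (\<integral>z. ?\<Phi> \<xi> t z \<partial>lborel) \<partial>lborel)"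
  unfolding wav_def osc_def by simp
 also have "\<dots> = (\<integral>z. (\<integral>t. ?\<Phi> \<xi> t z \<partial>lborel) \<partial>lborel)"
  by (rule lborel_pair.Fubini_integral[symmetric]) (rule pint)
 also have "\<dots> = (\<integral>z. H z * Jint i q bs x \<xi> z \<partial>lborel)" unfolding inner ..
 finally show "wav (pwin i q) (osc bs H) x \<xi> = (\<integral>z. H z * Jint i q bs x \<xi> z \<partial>lborel)" .
 show "integrable lborel (%z. H z * Jint i q bs x \<xi> z)"
  using lborel_pair.integrable_snd[OF pint[of \<xi>]] unfolding inner by simp
 have "integrable lborel (%t. \<integral>z. ?\<Phi> 0 t z \<partial>lborel)" using lborel_pair.integrable_fst[OF pint[of 0]] by simp
 then show "integrable lborel (%t. complex_of_real (pwin i q (t - x)) * osc bs H t)"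
  by (simp add: osc_def)
qed

lemma J_integrand_integrable:
 assumes g: "(c, R, L) \<in> G" and z: "z \<in> vbox c R"
 shows "integrable lborel (%t. complex_of_real (pwin i q (t - x)) * cis (t \<bullet> (z - \<xi>)) * A [] bs t z)"
proof -
 obtain K where K: "K \<ge> 0" "\<And>x. norm (A [] bs x z) \<le> K * L * R ^ length bs"
  by (rule bnd_Nil[OF g, where bs = bs]) (use z in blast)
 have D0: "0 \<le> K * L * R ^ length bs" using K G_ge[OF g] by simp
 have [measurable]: "(%t. A [] bs t z) \<in> borel_measurable borel"
  using cont_space by (rule borel_measurable_continuous_onI)
 show ?thesis
 proof (rule Bochner_Integration.integrable_bound)
  show "integrable lborel (%t. complex_of_real (pwin i q (t - x)) * complex_of_real (K * L * R ^ length bs))"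
   by (intro integrable_mult_left pwin_shift_integrable)
  show "AE t in lborel. norm (complex_of_real (pwin i q (t - x)) * cis (t \<bullet> (z - \<xi>)) * A [] bs t z) \<le> norm (complex_of_real (pwin i q (t - x)) * complex_of_real (K * L * R ^ length bs))"
   using K(2) D0 by (intro AE_I2) (simp add: norm_mult mult_left_mono del: of_real_mult)
 qed measurable
qed

text \<open>The i-th derivative in t of window times exponential times symbol integrates to 0; the
  exponential contributes the factor \<xi>_i - z_i, the other two factors give the right
  side.\<close>

lemma J_by_parts:
 assumes g: "(c, R, L) \<in> G" and z: "z \<in> vbox c R"
 shows "\<i> * complex_of_real (\<xi> $ i - z $ i) * Jint i p bs x \<xi> z = Jint i p (i # bs) x \<xi> z + Jint i (pdwin p) bs x \<xi> z"
proof -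
 let ?E = "%q bs t. complex_of_real (pwin i q (t - x)) * cis (t \<bullet> (z - \<xi>)) * A [] bs t z"
 let ?k = "\<i> * complex_of_real ((z - \<xi>) $ i)"
 let ?G' = "%t. ?k * ?E p bs t + ?E p (i # bs) t + ?E (pdwin p) bs t"
 have ints: "integrable lborel (?E q bs)" for q bs by (rule J_integrand_integrable[OF g z])
 have cE: "continuous_on UNIV (?E q bs)" for q bs
 proof -
  have 1: "continuous_on UNIV (%t. pwin i q (t - x))"
   by (rule continuous_on_compose2[OF continuous_pwin[of UNIV]]) (auto intro!: continuous_intros)
  have 2: "continuous_on UNIV (%t. cis (t \<bullet> (z - \<xi>)))" by (intro continuous_intros)
  show ?thesis by (intro continuous_on_mult continuous_on_of_real 1 2 cont_space)
 qed
 have "(\<integral>t. ?G' t \<partial>lborel) = 0"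
 proof (rule integral_partial_eq_0[of "?E p bs" _ i])
  show "integrable lborel (?E p bs)" by (rule ints)
  show "integrable lborel ?G'" by (intro Bochner_Integration.integrable_add integrable_mult_right ints)
  show "continuous_on UNIV ?G'" by (intro continuous_on_add continuous_on_mult continuous_on_const cE)
  fix t s
  have d1: "((%s. complex_of_real (pwin i p (upd t i s - x))) has_vector_derivative complex_of_real (pwin i (pdwin p) (upd t i s - x))) (at s)"
   using pwin_deriv[of i p t x s] by (intro has_vector_derivative_of_real) (simp add: has_real_derivative_iff_has_vector_derivative)
  have d2: "((%s. cis (upd t i s \<bullet> (z - \<xi>))) has_vector_derivative ?k * cis (upd t i s \<bullet> (z - \<xi>))) (at s)"
  proof -
   define a where "a = upd t i 0 \<bullet> (z - \<xi>)"
   have e: "upd t i s \<bullet> (z - \<xi>) = a + s * (z - \<xi>) $ i" for s unfolding a_def by (rule inner_upd)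
   show ?thesis unfolding e by (rule has_vector_derivative_cis_affine)
  qed
  have "((%s. ?E p bs (upd t i s)) has_vector_derivative 
    (complex_of_real (pwin i p (upd t i s - x)) * cis (upd t i s \<bullet> (z - \<xi>))) * A [] (i # bs) (upd t i s) z +
    (complex_of_real (pwin i p (upd t i s - x)) * (?k * cis (upd t i s \<bullet> (z - \<xi>))) + complex_of_real (pwin i (pdwin p) (upd t i s - x)) * cis (upd t i s \<bullet> (z - \<xi>))) * A [] bs (upd t i s) z) (at s)"
   by (intro has_vector_derivative_mult d1 d2 deriv_space)
  then show "((%s. ?E p bs (upd t i s)) has_vector_derivative ?G' (upd t i s)) (at s)"
   by (rule has_vector_derivative_eq_rhs) (simp only: ring_distribs mult_ac add_ac)
 qed
 also have "(\<integral>t. ?G' t \<partial>lborel) = ?k * Jint i p bs x \<xi> z + Jint i p (i # bs) x \<xi> z + Jint i (pdwin p) bs x \<xi> z"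
  unfolding Jint_def
  by (simp only: Bochner_Integration.integral_add Bochner_Integration.integrable_add integrable_mult_right ints integral_mult_right_zero)
 finally have h: "?k * Jint i p bs x \<xi> z + Jint i p (i # bs) x \<xi> z + Jint i (pdwin p) bs x \<xi> z = 0" .
 have k: "\<i> * complex_of_real (\<xi> $ i - z $ i) = - ?k" by (simp add: algebra_simps)
 from h show ?thesis unfolding k by algebra
qed

text \<open>On the support z lies in the box, so |z_i - c_i| \<le> R.\<close>

lemma ok_amp_mult:
 assumes R: "R \<ge> 0" and H: "ok_amp c R H"
 shows "ok_amp c R (%z. \<i> * complex_of_real (z $ i - c $ i) * H z)"
  and "(\<integral>\<^sup>+z. ennreal ((norm (\<i> * complex_of_real (z $ i - c $ i) * H z))\<^sup>2) \<partial>lborel) \<le> ennreal (R\<^sup>2) * (\<integral>\<^sup>+z. ennreal ((norm (H z))\<^sup>2) \<partial>lborel)"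
proof -
 from H obtain B where B: "\<And>z. norm (H z) \<le> B" by (auto simp: ok_amp_def)
 have [measurable]: "H \<in> borel_measurable borel" using H by (auto simp: ok_amp_def)
 have b: "norm (\<i> * complex_of_real (z $ i - c $ i) * H z) \<le> R * norm (H z)" for z
 proof (cases "z \<in> vbox c R")
  case True
  then have "c $ i \<le> z $ i" "z $ i \<le> c $ i + R" by (auto simp: vbox_def)
  then have "\<bar>z $ i - c $ i\<bar> \<le> R" by linarith
  then show ?thesis by (simp add: norm_mult mult_right_mono del: of_real_diff)
 next
  case False
  then show ?thesis using H by (simp add: ok_amp_def)
 qed
 have "norm (\<i> * complex_of_real (z $ i - c $ i) * H z) \<le> R * B" for z
  using b[of z] mult_left_mono[OF B[of z] R] by linarith
 then show "ok_amp c R (%z. \<i> * complex_of_real (z $ i - c $ i) * H z)"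
  using H unfolding ok_amp_def by (auto simp del: of_real_diff)
 have "(\<integral>\<^sup>+z. ennreal ((norm (\<i> * complex_of_real (z $ i - c $ i) * H z))\<^sup>2) \<partial>lborel) \<le> (\<integral>\<^sup>+z. ennreal (R\<^sup>2) * ennreal ((norm (H z))\<^sup>2) \<partial>lborel)"
 proof (intro nn_integral_mono)
  fix z
  have "(norm (\<i> * complex_of_real (z $ i - c $ i) * H z))\<^sup>2 \<le> (R * norm (H z))\<^sup>2" by (intro power_mono b) auto
  then show "ennreal ((norm (\<i> * complex_of_real (z $ i - c $ i) * H z))\<^sup>2) \<le> ennreal (R\<^sup>2) * ennreal ((norm (H z))\<^sup>2)"
   by (simp add: ennreal_mult[symmetric] power_mult_distrib ennreal_leI del: of_real_diff)
 qed
 also have "\<dots> = ennreal (R\<^sup>2) * (\<integral>\<^sup>+z. ennreal ((norm (H z))\<^sup>2) \<partial>lborel)" by (rule nn_integral_cmult) measurable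
 finally show "(\<integral>\<^sup>+z. ennreal ((norm (\<i> * complex_of_real (z $ i - c $ i) * H z))\<^sup>2) \<partial>lborel) \<le> ennreal (R\<^sup>2) * (\<integral>\<^sup>+z. ennreal ((norm (H z))\<^sup>2) \<partial>lborel)" .
qed

text \<open>Split \<xi>_i - c_i = (\<xi>_i - z_i) + (z_i - c_i). The second part goes into the
  amplitude at cost R; the first is integrated by parts and falls on the symbol, again at cost R, or
  on the window, at cost 1. After division by R one factor of the weight costs a constant.\<close>

lemma wav_step:
 assumes g: "(c, R, L) \<in> G" and H: "ok_amp c R H"
 shows "\<i> * complex_of_real (\<xi> $ i - c $ i) * wav (pwin i p) (osc bs H) x \<xi> =
   wav (pwin i p) (osc bs (%z. \<i> * complex_of_real (z $ i - c $ i) * H z)) x \<xi> + wav (pwin i p) (osc (i # bs) H) x \<xi> + wav (pwin i (pdwin p)) (osc bs H) x \<xi>"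
proof -
 let ?H' = "%z. \<i> * complex_of_real (z $ i - c $ i) * H z"
 have R: "R \<ge> 0" using G_ge[OF g] by simp
 note H' = ok_amp_mult(1)[OF R H, of i]
 have pt: "\<i> * complex_of_real (\<xi> $ i - c $ i) * (H z * Jint i p bs x \<xi> z) =
   ?H' z * Jint i p bs x \<xi> z + H z * Jint i p (i # bs) x \<xi> z + H z * Jint i (pdwin p) bs x \<xi> z" for z
 proof (cases "z \<in> vbox c R")
  case True
  have "\<i> * complex_of_real (\<xi> $ i - c $ i) * (H z * Jint i p bs x \<xi> z) = ?H' z * Jint i p bs x \<xi> z + H z * (\<i> * complex_of_real (\<xi> $ i - z $ i) * Jint i p bs x \<xi> z)"
   by (simp add: algebra_simps)
  then show ?thesis unfolding J_by_parts[OF g True] by (simp add: algebra_simps)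
 next
  case False
  then show ?thesis using H by (simp add: ok_amp_def)
 qed
 have "\<i> * complex_of_real (\<xi> $ i - c $ i) * wav (pwin i p) (osc bs H) x \<xi> = (\<integral>z. \<i> * complex_of_real (\<xi> $ i - c $ i) * (H z * Jint i p bs x \<xi> z) \<partial>lborel)"
  unfolding wav_osc[OF g H] by (rule integral_mult_right_zero[symmetric])
 also have "\<dots> = (\<integral>z. ?H' z * Jint i p bs x \<xi> z + H z * Jint i p (i # bs) x \<xi> z + H z * Jint i (pdwin p) bs x \<xi> z \<partial>lborel)"
  unfolding pt ..
 also have "\<dots> = (\<integral>z. ?H' z * Jint i p bs x \<xi> z \<partial>lborel) + (\<integral>z. H z * Jint i p (i # bs) x \<xi> z \<partial>lborel) + (\<integral>z. H z * Jint i (pdwin p) bs x \<xi> z \<partial>lborel)"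
  by (simp only: Bochner_Integration.integral_add Bochner_Integration.integrable_add wav_osc_integrable[OF g H'] wav_osc_integrable[OF g H])
 finally show ?thesis unfolding wav_osc[OF g H] wav_osc[OF g H'] .
qed

end

section \<open>Weighted estimates: decay of the output of a box away from the box\<close>

lemma norm_sum3_power2: "(norm (a + b + c :: complex))\<^sup>2 \<le> 3 * (norm a)\<^sup>2 + 3 * (norm b)\<^sup>2 + 3 * (norm c)\<^sup>2"
proof -
 have "(norm (a + b + c))\<^sup>2 \<le> (norm a + norm b + norm c)\<^sup>2"
  by (intro power_mono) (auto intro: norm_triangle_le norm_triangle_mono)
 also have "\<dots> \<le> 3 * (norm a)\<^sup>2 + 3 * (norm b)\<^sup>2 + 3 * (norm c)\<^sup>2"
  using sum_squares_bound[of "norm a" "norm b"] sum_squares_bound[of "norm a" "norm c"] sum_squares_bound[of "norm b" "norm c"]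
  by (simp add: power2_eq_square algebra_simps)
 finally show ?thesis .
qed

lemma power_add_le: "(a + b) ^ M \<le> 2 ^ M * (a ^ M + b ^ M)" if "0 \<le> a" "0 \<le> b" for a b :: real
proof -
 have "(a + b) ^ M \<le> (2 * max a b) ^ M" using that by (intro power_mono) auto
 also have "\<dots> = 2 ^ M * (max a b) ^ M" by (simp add: power_mult_distrib)
 also have "(max a b) ^ M \<le> a ^ M + b ^ M" using that by (auto simp: max_def)
 finally show ?thesis by simp
qed

lemma power_sum_le:
 assumes "finite S" "\<And>k. k \<in> S ==> 0 \<le> (a k :: real)" "S ~= {}"
 shows "(sum a S) ^ M \<le> real (card S) ^ M * (\<Sum>k\<in>S. a k ^ M)"
proof -
 define m where "m = Max (a ` S)"
 have m: "m \<in> a ` S" unfolding m_def using assms by (intro Max_in) auto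
 then obtain k where k: "k \<in> S" "m = a k" by auto
 have "sum a S \<le> real (card S) * m"
  using sum_bounded_above[of S a m] assms by (simp add: m_def)
 then have "(sum a S) ^ M \<le> (real (card S) * m) ^ M" using assms by (intro power_mono sum_nonneg) auto
 also have "\<dots> = real (card S) ^ M * a k ^ M" by (simp add: power_mult_distrib k)
 also have "\<dots> \<le> real (card S) ^ M * (\<Sum>k\<in>S. a k ^ M)"
  using assms k by (intro mult_left_mono member_le_sum[of k S "%k. a k ^ M"]) auto
 finally show ?thesis .
qed

lemma power_shift_aux: "(x / r) ^ (2 * M) / r\<^sup>2 * (x\<^sup>2 * w) = (x / r) ^ (2 * Suc M) * w" for x r w :: real
proof -
 have "(x / r) ^ (2 * Suc M) = x\<^sup>2 / r\<^sup>2 * (x / r) ^ (2 * M)"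
  unfolding mult_Suc_right power_add power_divide[of x r 2] ..
 then show ?thesis by simp
qed

text \<open>The distance from \<xi> to the corner in units of the side, squared and made at least
  1.\<close>

definition wgt :: "real^'n => real => real^'n => real" where
 "wgt c R \<xi> = 1 + (norm (\<xi> - c))\<^sup>2 / R\<^sup>2"

lemma wgt_measurable [measurable]: "wgt c R \<in> borel_measurable borel"
 unfolding wgt_def[abs_def] by measurable

lemma wgt_ge_1: "1 \<le> wgt c R \<xi>"
 by (simp add: wgt_def)

text \<open>The right side contains only pure powers of one coordinate at a time, so integration by
  parts can be iterated within a single coordinate.\<close>

lemma wgt_power_le:
 fixes c :: "real^'n"
 shows "wgt c R \<xi> ^ M \<le> (2 * real CARD('n)) ^ M * (1 + (\<Sum>i\<in>UNIV. ((\<xi> $ i - c $ i) / R) ^ (2 * M)))"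
proof -
 have e: "(norm (\<xi> - c))\<^sup>2 / R\<^sup>2 = (\<Sum>i\<in>UNIV. ((\<xi> $ i - c $ i) / R)\<^sup>2)"
  by (simp add: norm_vec_def L2_set_def sum_nonneg sum_divide_distrib power_divide)
 have n1: "1 \<le> real CARD('n)" using zero_less_card_finite[where 'a='n] by linarith
 have "(\<Sum>i\<in>UNIV. ((\<xi> $ i - c $ i) / R)\<^sup>2) ^ M \<le> real CARD('n) ^ M * (\<Sum>i\<in>UNIV. (((\<xi> $ i - c $ i) / R)\<^sup>2) ^ M)"
  by (rule power_sum_le) auto
 then have "1 ^ M + (\<Sum>i\<in>UNIV. ((\<xi> $ i - c $ i) / R)\<^sup>2) ^ M \<le> real CARD('n) ^ M * (1 + (\<Sum>i\<in>UNIV. (((\<xi> $ i - c $ i) / R)\<^sup>2) ^ M))"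
  unfolding distrib_left power_one mult_1_right by (rule add_mono[OF one_le_power[OF n1]])
 then have "2 ^ M * (1 ^ M + (\<Sum>i\<in>UNIV. ((\<xi> $ i - c $ i) / R)\<^sup>2) ^ M) \<le> 2 ^ M * (real CARD('n) ^ M * (1 + (\<Sum>i\<in>UNIV. (((\<xi> $ i - c $ i) / R)\<^sup>2) ^ M)))"
  by (intro mult_left_mono) auto
 moreover have "wgt c R \<xi> ^ M \<le> 2 ^ M * (1 ^ M + (\<Sum>i\<in>UNIV. ((\<xi> $ i - c $ i) / R)\<^sup>2) ^ M)"
  unfolding wgt_def e by (rule power_add_le) (auto intro: sum_nonneg)
 ultimately have "wgt c R \<xi> ^ M \<le> 2 ^ M * (real CARD('n) ^ M * (1 + (\<Sum>i\<in>UNIV. (((\<xi> $ i - c $ i) / R)\<^sup>2) ^ M)))"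
  by (rule order_trans[rotated])
 then show ?thesis by (simp add: power_mult_distrib power_mult mult.assoc)
qed

context symbol_boxes
begin

text \<open>\<open>wav_L2\<close> handles Lebesgue measure and \<open>wav_sup\<close> the point
  masses, with \<open>E\<close> covering both constants; \<open>osc_L2\<close> then bounds the
  remaining L^2 norm.\<close>

lemma weighted_base:
 "\<exists>C\<ge>0. \<forall>c R L. (c, R, L) \<in> G --> (\<forall>H. ok_amp c R H --> (\<forall>\<nu>\<in>slice_measures.
   (\<integral>\<^sup>+\<xi>. (\<integral>\<^sup>+x. ennreal ((norm (wav (pwin i p) (osc bs H) x \<xi>))\<^sup>2) \<partial>lborel) \<partial>\<nu>) \<le>
   ennreal (C * (L * R ^ length bs)\<^sup>2) * (\<integral>\<^sup>+z. ennreal ((norm (H z))\<^sup>2) \<partial>lborel)))"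
proof -
 obtain C where C: "C \<ge> 0" and CL: "\<And>c R L H. (c, R, L) \<in> G ==> ok_amp c R H ==>
   (\<integral>\<^sup>+t. ennreal ((norm (osc bs H t))\<^sup>2) \<partial>lborel) \<le> ennreal (C * (L * R ^ length bs)\<^sup>2) * (\<integral>\<^sup>+z. ennreal ((norm (H z))\<^sup>2) \<partial>lborel)"
  using osc_L2[of bs] by blast
 obtain p1 where p1: "p1 \<ge> 0" "(\<integral>\<^sup>+t. ennreal \<bar>pwin i p t\<bar> \<partial>lborel) = ennreal p1"
  using pwin_L1[of i p] by (auto simp: less_top_ennreal)
 obtain p2 where p2: "p2 \<ge> 0" "(\<integral>\<^sup>+t. ennreal ((pwin i p t)\<^sup>2) \<partial>lborel) = ennreal p2"
  using pwin_L2[of i p] by (auto simp: less_top_ennreal)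
 define E where "E = p1\<^sup>2 + (2 * pi) ^ CARD('n) * p2"
 have E: "0 \<le> E" using p1 p2 by (simp add: E_def)
 show ?thesis
 proof (intro exI[of _ "E * C"] conjI allI impI ballI)
  show "0 \<le> E * C" using E C by simp
  fix c R L H \<nu> assume g: "(c, R, L) \<in> G" and H: "ok_amp c R H" and nu: "\<nu> \<in> (slice_measures :: (real^'n) measure set)"
  have [measurable]: "H \<in> borel_measurable borel" using H by (auto simp: ok_amp_def)
  have "(\<integral>\<^sup>+\<xi>. (\<integral>\<^sup>+x. ennreal ((norm (wav (pwin i p) (osc bs H) x \<xi>))\<^sup>2) \<partial>lborel) \<partial>\<nu>) \<le> ennreal E * (\<integral>\<^sup>+t. ennreal ((norm (osc bs H t))\<^sup>2) \<partial>lborel)"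
   using nu unfolding slice_measures_def
  proof (elim insertE rangeE)
   assume \<nu>: "\<nu> = lborel"
   have "(\<integral>\<^sup>+\<xi>. (\<integral>\<^sup>+x. ennreal ((norm (wav (pwin i p) (osc bs H) x \<xi>))\<^sup>2) \<partial>lborel) \<partial>lborel) \<le> 
    ennreal ((2 * pi) ^ CARD('n)) * ennreal p2 * (\<integral>\<^sup>+t. ennreal ((norm (osc bs H t))\<^sup>2) \<partial>lborel)"
    using wav_L2[of "pwin i p" "osc bs H"] osc_win_integrable[OF g H] p2 by simp
   also have "ennreal ((2 * pi) ^ CARD('n)) * ennreal p2 \<le> ennreal E"
    using p1 p2 by (subst ennreal_mult[symmetric]) (auto simp: E_def intro!: ennreal_leI)
   finally show ?thesis unfolding \<nu> by (simp add: mult_right_mono)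
  next
   fix \<xi>0 assume \<nu>: "\<nu> = return borel \<xi>0"
   have "(\<integral>\<^sup>+\<xi>. (\<integral>\<^sup>+x. ennreal ((norm (wav (pwin i p) (osc bs H) x \<xi>))\<^sup>2) \<partial>lborel) \<partial>\<nu>) = (\<integral>\<^sup>+x. ennreal ((norm (wav (pwin i p) (osc bs H) x \<xi>0))\<^sup>2) \<partial>lborel)"
    unfolding \<nu> by (rule nn_integral_return) auto
   also have "\<dots> \<le> (ennreal p1)\<^sup>2 * (\<integral>\<^sup>+t. ennreal ((norm (osc bs H t))\<^sup>2) \<partial>lborel)"
    using wav_sup[of "pwin i p" "osc bs H" \<xi>0] p1 by simp
   also have "(ennreal p1)\<^sup>2 \<le> ennreal E"
    using p1 p2 by (subst ennreal_power) (auto simp: E_def intro!: ennreal_leI)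
   finally show ?thesis by (simp add: mult_right_mono)
  qed
  also have "\<dots> \<le> ennreal E * (ennreal (C * (L * R ^ length bs)\<^sup>2) * (\<integral>\<^sup>+z. ennreal ((norm (H z))\<^sup>2) \<partial>lborel))"
   by (intro mult_left_mono CL[OF g H]) auto
  also have "\<dots> = ennreal (E * C * (L * R ^ length bs)\<^sup>2) * (\<integral>\<^sup>+z. ennreal ((norm (H z))\<^sup>2) \<partial>lborel)"
   using E C by (subst mult.assoc[symmetric], subst ennreal_mult[symmetric]) (auto simp: mult.assoc)
  finally show "(\<integral>\<^sup>+\<xi>. (\<integral>\<^sup>+x. ennreal ((norm (wav (pwin i p) (osc bs H) x \<xi>))\<^sup>2) \<partial>lborel) \<partial>\<nu>) \<le> ennreal (E * C * (L * R ^ length bs)\<^sup>2) * (\<integral>\<^sup>+z. ennreal ((norm (H z))\<^sup>2) \<partial>lborel)" .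
 qed
qed

text \<open>Induction on M by means of \<open>wav_step\<close>. The step alters the window
  polynomial, the list of space derivatives and the amplitude, so all three are kept
  general.\<close>

lemma weighted:
 "\<exists>C\<ge>0. \<forall>c R L. (c, R, L) \<in> G --> (\<forall>H. ok_amp c R H --> (\<forall>\<nu>\<in>slice_measures.
   (\<integral>\<^sup>+\<xi>. ennreal (((\<xi> $ i - c $ i) / R) ^ (2 * M)) * (\<integral>\<^sup>+x. ennreal ((norm (wav (pwin i p) (osc bs H) x \<xi>))\<^sup>2) \<partial>lborel) \<partial>\<nu>) \<le>
   ennreal (C * (L * R ^ length bs)\<^sup>2) * (\<integral>\<^sup>+z. ennreal ((norm (H z))\<^sup>2) \<partial>lborel)))"
proof (induction M arbitrary: p bs)
 case 0
 then show ?case using weighted_base[of i p bs] by simp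
next
 case (Suc M)
 let ?V = "%p bs H x \<xi>. ennreal ((norm (wav (pwin i p) (osc bs H) x \<xi>))\<^sup>2)"
 let ?v = "%c R \<xi>. ((\<xi> $ i - c $ i) / R)"
 obtain C1 where C1: "C1 \<ge> 0" and b1: "\<And>c R L H \<nu>. (c, R, L) \<in> G ==> ok_amp c R H ==> \<nu> \<in> slice_measures ==>
   (\<integral>\<^sup>+\<xi>. ennreal (?v c R \<xi> ^ (2 * M)) * (\<integral>\<^sup>+x. ?V p bs H x \<xi> \<partial>lborel) \<partial>\<nu>) \<le> ennreal (C1 * (L * R ^ length bs)\<^sup>2) * (\<integral>\<^sup>+z. ennreal ((norm (H z))\<^sup>2) \<partial>lborel)"
  using Suc.IH[of p bs] by blast
 obtain C2 where C2: "C2 \<ge> 0" and b2: "\<And>c R L H \<nu>. (c, R, L) \<in> G ==> ok_amp c R H ==> \<nu> \<in> slice_measures ==>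
   (\<integral>\<^sup>+\<xi>. ennreal (?v c R \<xi> ^ (2 * M)) * (\<integral>\<^sup>+x. ?V p (i # bs) H x \<xi> \<partial>lborel) \<partial>\<nu>) \<le> ennreal (C2 * (L * R ^ length (i # bs))\<^sup>2) * (\<integral>\<^sup>+z. ennreal ((norm (H z))\<^sup>2) \<partial>lborel)"
  using Suc.IH[of p "i # bs"] by blast
 obtain C3 where C3: "C3 \<ge> 0" and b3: "\<And>c R L H \<nu>. (c, R, L) \<in> G ==> ok_amp c R H ==> \<nu> \<in> slice_measures ==>
   (\<integral>\<^sup>+\<xi>. ennreal (?v c R \<xi> ^ (2 * M)) * (\<integral>\<^sup>+x. ?V (pdwin p) bs H x \<xi> \<partial>lborel) \<partial>\<nu>) \<le> ennreal (C3 * (L * R ^ length bs)\<^sup>2) * (\<integral>\<^sup>+z. ennreal ((norm (H z))\<^sup>2) \<partial>lborel)"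
  using Suc.IH[of "pdwin p" bs] by blast
 show ?case
 proof (intro exI[of _ "3 * (C1 + C2 + C3)"] conjI allI impI ballI)
  show "0 \<le> 3 * (C1 + C2 + C3)" using C1 C2 C3 by simp
  fix c R L H \<nu> assume g: "(c, R, L) \<in> G" and H: "ok_amp c R H" and nu: "\<nu> \<in> (slice_measures :: (real^'n) measure set)"
  have R: "R \<ge> 1" "L \<ge> 0" using G_ge[OF g] by auto
  define H' where "H' = (%z. \<i> * complex_of_real (z $ i - c $ i) * H z)"
  have H': "ok_amp c R H'" "(\<integral>\<^sup>+z. ennreal ((norm (H' z))\<^sup>2) \<partial>lborel) \<le> ennreal (R\<^sup>2) * (\<integral>\<^sup>+z. ennreal ((norm (H z))\<^sup>2) \<partial>lborel)"
   unfolding H'_def using ok_amp_mult[OF _ H, of i] R by auto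
  have [measurable]: "H \<in> borel_measurable borel" "H' \<in> borel_measurable borel" using H H' by (auto simp: ok_amp_def)
  note [measurable_cong] = sets_slice_measures[OF nu]
  let ?N = "\<integral>\<^sup>+z. ennreal ((norm (H z))\<^sup>2) \<partial>lborel"
  let ?I = "%p bs H. \<integral>\<^sup>+\<xi>. ennreal (?v c R \<xi> ^ (2 * M)) * (\<integral>\<^sup>+x. ?V p bs H x \<xi> \<partial>lborel) \<partial>\<nu>"
  \<comment> \<open>Two of the 2 (M + 1) powers of \<xi>_i - c_i are spent on
    \<open>wav_step\<close>; their denominator R^2 is kept in front.\<close>
  have pt: "ennreal (?v c R \<xi> ^ (2 * Suc M)) * ?V p bs H x \<xi> \<le>
    ennreal (3 / R\<^sup>2) * (ennreal (?v c R \<xi> ^ (2 * M)) * (?V p bs H' x \<xi> + ?V p (i # bs) H x \<xi> + ?V (pdwin p) bs H x \<xi>))" for x \<xi>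
  proof -
   let ?w = "%p bs H. norm (wav (pwin i p) (osc bs H) x \<xi>)"
   have "(\<xi> $ i - c $ i)\<^sup>2 * (?w p bs H)\<^sup>2 = (norm (\<i> * complex_of_real (\<xi> $ i - c $ i) * wav (pwin i p) (osc bs H) x \<xi>))\<^sup>2"
    by (simp add: norm_mult power_mult_distrib del: of_real_diff)
   also have "\<dots> \<le> 3 * (?w p bs H')\<^sup>2 + 3 * (?w p (i # bs) H)\<^sup>2 + 3 * (?w (pdwin p) bs H)\<^sup>2"
    unfolding wav_step[OF g H] H'_def by (rule norm_sum3_power2)
   finally have "?v c R \<xi> ^ (2 * M) / R\<^sup>2 * ((\<xi> $ i - c $ i)\<^sup>2 * (?w p bs H)\<^sup>2) \<le> ?v c R \<xi> ^ (2 * M) / R\<^sup>2 * (3 * (?w p bs H')\<^sup>2 + 3 * (?w p (i # bs) H)\<^sup>2 + 3 * (?w (pdwin p) bs H)\<^sup>2)"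
    by (intro mult_left_mono) auto
   moreover have "?v c R \<xi> ^ (2 * M) / R\<^sup>2 * ((\<xi> $ i - c $ i)\<^sup>2 * (?w p bs H)\<^sup>2) = ?v c R \<xi> ^ (2 * Suc M) * (?w p bs H)\<^sup>2"
    by (rule power_shift_aux)
   moreover have "?v c R \<xi> ^ (2 * M) / R\<^sup>2 * (3 * (?w p bs H')\<^sup>2 + 3 * (?w p (i # bs) H)\<^sup>2 + 3 * (?w (pdwin p) bs H)\<^sup>2) = 
     3 / R\<^sup>2 * (?v c R \<xi> ^ (2 * M) * ((?w p bs H')\<^sup>2 + (?w p (i # bs) H)\<^sup>2 + (?w (pdwin p) bs H)\<^sup>2))"
    unfolding divide_inverse by (simp only: distrib_left mult_ac)
   ultimately have le: "?v c R \<xi> ^ (2 * Suc M) * (?w p bs H)\<^sup>2 \<le> 3 / R\<^sup>2 * (?v c R \<xi> ^ (2 * M) * ((?w p bs H')\<^sup>2 + (?w p (i # bs) H)\<^sup>2 + (?w (pdwin p) bs H)\<^sup>2))"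
    by linarith
   have v0: "0 \<le> ?v c R \<xi> ^ (2 * M)" "0 \<le> ?v c R \<xi> ^ (2 * Suc M)" by (rule zero_le_even_power, simp)+
   have "ennreal (?v c R \<xi> ^ (2 * Suc M)) * ?V p bs H x \<xi> = ennreal (?v c R \<xi> ^ (2 * Suc M) * (?w p bs H)\<^sup>2)"
    by (rule ennreal_mult[symmetric]) (use v0 in auto)
   also have "\<dots> \<le> ennreal (3 / R\<^sup>2 * (?v c R \<xi> ^ (2 * M) * ((?w p bs H')\<^sup>2 + (?w p (i # bs) H)\<^sup>2 + (?w (pdwin p) bs H)\<^sup>2)))"
    by (rule ennreal_leI[OF le])
   also have "\<dots> = ennreal (3 / R\<^sup>2) * (ennreal (?v c R \<xi> ^ (2 * M)) * (?V p bs H' x \<xi> + ?V p (i # bs) H x \<xi> + ?V (pdwin p) bs H x \<xi>))"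
    using v0(1) by (simp only: ennreal_mult ennreal_plus add_nonneg_nonneg zero_le_power2 mult_nonneg_nonneg divide_nonneg_nonneg zero_le_numeral)
   finally show ?thesis .
  qed
  have "(\<integral>\<^sup>+\<xi>. ennreal (?v c R \<xi> ^ (2 * Suc M)) * (\<integral>\<^sup>+x. ?V p bs H x \<xi> \<partial>lborel) \<partial>\<nu>) = (\<integral>\<^sup>+\<xi>. (\<integral>\<^sup>+x. ennreal (?v c R \<xi> ^ (2 * Suc M)) * ?V p bs H x \<xi> \<partial>lborel) \<partial>\<nu>)"
   by (intro nn_integral_cong nn_integral_cmult[symmetric]) measurable
  also have "\<dots> \<le> (\<integral>\<^sup>+\<xi>. (\<integral>\<^sup>+x. ennreal (3 / R\<^sup>2) * (ennreal (?v c R \<xi> ^ (2 * M)) * (?V p bs H' x \<xi> + ?V p (i # bs) H x \<xi> + ?V (pdwin p) bs H x \<xi>)) \<partial>lborel) \<partial>\<nu>)"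
   by (intro nn_integral_mono pt)
  also have "\<dots> = (\<integral>\<^sup>+\<xi>. ennreal (3 / R\<^sup>2) * (ennreal (?v c R \<xi> ^ (2 * M)) * (\<integral>\<^sup>+x. ?V p bs H' x \<xi> \<partial>lborel) + ennreal (?v c R \<xi> ^ (2 * M)) * (\<integral>\<^sup>+x. ?V p (i # bs) H x \<xi> \<partial>lborel) + ennreal (?v c R \<xi> ^ (2 * M)) * (\<integral>\<^sup>+x. ?V (pdwin p) bs H x \<xi> \<partial>lborel)) \<partial>\<nu>)"
   by (intro nn_integral_cong) (simp add: nn_integral_cmult nn_integral_add distrib_left)
  also have "\<dots> = ennreal (3 / R\<^sup>2) * (?I p bs H' + ?I p (i # bs) H + ?I (pdwin p) bs H)"
   by (simp add: nn_integral_cmult nn_integral_add)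
  also have "\<dots> \<le> ennreal (3 / R\<^sup>2) * (ennreal (C1 * (L * R ^ length bs)\<^sup>2) * (ennreal (R\<^sup>2) * ?N) + ennreal (C2 * (L * R ^ length (i # bs))\<^sup>2) * ?N + ennreal (C3 * (L * R ^ length bs)\<^sup>2) * ?N)"
   by (intro mult_left_mono add_mono b2[OF g H nu] b3[OF g H nu] order_trans[OF b1[OF g H'(1) nu]] H'(2)) auto
  also have "\<dots> = ennreal (3 / R\<^sup>2 * (C1 * (L * R ^ length bs)\<^sup>2 * R\<^sup>2 + C2 * (L * R ^ length (i # bs))\<^sup>2 + C3 * (L * R ^ length bs)\<^sup>2)) * ?N"
   using C1 C2 C3 by (simp only: ennreal_mult ennreal_plus add_nonneg_nonneg mult_nonneg_nonneg zero_le_power2 divide_nonneg_nonneg zero_le_numeral distrib_right mult.assoc)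
  also have "\<dots> \<le> ennreal (3 * (C1 + C2 + C3) * (L * R ^ length bs)\<^sup>2) * ?N"
  proof (intro mult_right_mono ennreal_leI)
   let ?Q = "(L * R ^ length bs)\<^sup>2"
   have "3 / R\<^sup>2 * (C1 * ?Q * R\<^sup>2 + C2 * (L * R ^ length (i # bs))\<^sup>2 + C3 * ?Q) = 3 * C1 * ?Q + 3 * C2 * ?Q + 3 * C3 * ?Q / R\<^sup>2"
    using R by (simp add: distrib_left add_divide_distrib power_mult_distrib)
   \<comment> \<open>The term with differentiated window has no factor R^2 to cancel the
     denominator; R \<ge> 1 takes care of it.\<close>
   also have "3 * C3 * ?Q / R\<^sup>2 \<le> 3 * C3 * ?Q / 1"
    using C3 one_le_power[OF R(1), of 2] by (intro divide_left_mono) auto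
   finally show "3 / R\<^sup>2 * (C1 * ?Q * R\<^sup>2 + C2 * (L * R ^ length (i # bs))\<^sup>2 + C3 * ?Q) \<le> 3 * (C1 + C2 + C3) * ?Q"
    by (simp add: algebra_simps)
  qed simp
  finally show "(\<integral>\<^sup>+\<xi>. ennreal (?v c R \<xi> ^ (2 * Suc M)) * (\<integral>\<^sup>+x. ?V p bs H x \<xi> \<partial>lborel) \<partial>\<nu>) \<le> ennreal (3 * (C1 + C2 + C3) * (L * R ^ length bs)\<^sup>2) * ?N" .
 qed
qed

text \<open>The pure coordinate powers of \<open>weighted\<close> combine to a power of
  \<open>wgt\<close>. The Gaussian is \<open>pwin i 1\<close> for every i, so one window serves all
  coordinates.\<close>

lemma box_estimate:
 "\<exists>C\<ge>0. \<forall>c R L. (c, R, L) \<in> G --> (\<forall>H. ok_amp c R H --> (\<forall>\<nu>\<in>slice_measures.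
   (\<integral>\<^sup>+\<xi>. ennreal (wgt c R \<xi> ^ M) * (\<integral>\<^sup>+x. ennreal ((norm (wav (%t. exp (- (norm t)\<^sup>2)) (osc [] H) x \<xi>))\<^sup>2) \<partial>lborel) \<partial>\<nu>) \<le>
   ennreal (C * L\<^sup>2) * (\<integral>\<^sup>+z. ennreal ((norm (H z))\<^sup>2) \<partial>lborel)))"
proof -
 have pw: "(%t. exp (- (norm t)\<^sup>2)) = pwin i 1" for i :: 'n by (simp add: pwin_def fun_eq_iff)
 define P where "P i M C \<longleftrightarrow> C \<ge> 0 \<and> (\<forall>c R L. (c, R, L) \<in> G --> (\<forall>H. ok_amp c R H --> (\<forall>\<nu>\<in>slice_measures.
   (\<integral>\<^sup>+\<xi>. ennreal (((\<xi> $ i - c $ i) / R) ^ (2 * M)) * (\<integral>\<^sup>+x. ennreal ((norm (wav (%t. exp (- (norm t)\<^sup>2)) (osc [] H) x \<xi>))\<^sup>2) \<partial>lborel) \<partial>\<nu>) \<le>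
   ennreal (C * L\<^sup>2) * (\<integral>\<^sup>+z. ennreal ((norm (H z))\<^sup>2) \<partial>lborel))))" for i M C
 have "\<exists>C. P i M C" for i M
  using weighted[of i M 1 "[]"] unfolding P_def pw[of i] by simp
 then obtain C where PC: "\<And>i M. P i M (C i M)" by metis
 have C0: "\<And>i M. C i M \<ge> 0" and C: "\<And>i M c R L H \<nu>. (c, R, L) \<in> G ==> ok_amp c R H ==> \<nu> \<in> slice_measures ==>
   (\<integral>\<^sup>+\<xi>. ennreal (((\<xi> $ i - c $ i) / R) ^ (2 * M)) * (\<integral>\<^sup>+x. ennreal ((norm (wav (%t. exp (- (norm t)\<^sup>2)) (osc [] H) x \<xi>))\<^sup>2) \<partial>lborel) \<partial>\<nu>) \<le>
   ennreal (C i M * L\<^sup>2) * (\<integral>\<^sup>+z. ennreal ((norm (H z))\<^sup>2) \<partial>lborel)"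
  using PC unfolding P_def by blast+
 \<comment> \<open>\<open>C undefined 0\<close> bounds the integral without weight: for M = 0 any
   coordinate may be taken.\<close>
 define D where "D = (2 * real CARD('n)) ^ M * (C undefined 0 + (\<Sum>i\<in>UNIV. C i M))"
 show ?thesis
 proof (intro exI[of _ D] conjI allI impI ballI)
  show "0 \<le> D" unfolding D_def by (intro mult_nonneg_nonneg add_nonneg_nonneg sum_nonneg C0) auto
  fix c R L H \<nu> assume g: "(c, R, L) \<in> G" and H: "ok_amp c R H" and nu: "\<nu> \<in> (slice_measures :: (real^'n) measure set)"
  have [measurable]: "H \<in> borel_measurable borel" using H by (auto simp: ok_amp_def)
  note [measurable_cong] = sets_slice_measures[OF nu]
  let ?N = "\<integral>\<^sup>+z. ennreal ((norm (H z))\<^sup>2) \<partial>lborel"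
  let ?b = "%\<xi>. \<integral>\<^sup>+x. ennreal ((norm (wav (%t. exp (- (norm t)\<^sup>2)) (osc [] H) x \<xi>))\<^sup>2) \<partial>lborel"
  have [measurable]: "?b \<in> borel_measurable borel" unfolding pw[of undefined] by measurable
  let ?v = "%i \<xi>. ((\<xi> $ i - c $ i) / R) ^ (2 * M)"
  let ?k = "(2 * real CARD('n)) ^ M"
  have v0: "0 \<le> ?v i \<xi>" for i \<xi> by (auto intro!: zero_le_even_power)
  have "(\<integral>\<^sup>+\<xi>. ennreal (wgt c R \<xi> ^ M) * ?b \<xi> \<partial>\<nu>) \<le> (\<integral>\<^sup>+\<xi>. ennreal ?k * (?b \<xi> + (\<Sum>i\<in>UNIV. ennreal (?v i \<xi>) * ?b \<xi>)) \<partial>\<nu>)"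
  proof (rule nn_integral_mono)
   fix \<xi>
   have "ennreal (wgt c R \<xi> ^ M) \<le> ennreal (?k * (1 + (\<Sum>i\<in>UNIV. ?v i \<xi>)))" by (intro ennreal_leI wgt_power_le)
   also have "\<dots> = ennreal ?k * (1 + (\<Sum>i\<in>UNIV. ennreal (?v i \<xi>)))"
    using v0 by (simp add: ennreal_mult sum_nonneg)
   finally have "ennreal (wgt c R \<xi> ^ M) * ?b \<xi> \<le> ennreal ?k * (1 + (\<Sum>i\<in>UNIV. ennreal (?v i \<xi>))) * ?b \<xi>"
    by (rule mult_right_mono) simp
   then show "ennreal (wgt c R \<xi> ^ M) * ?b \<xi> \<le> ennreal ?k * (?b \<xi> + (\<Sum>i\<in>UNIV. ennreal (?v i \<xi>) * ?b \<xi>))"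
    by (simp only: mult.assoc distrib_right mult_1_left sum_distrib_right)
  qed
  also have "\<dots> = ennreal ?k * ((\<integral>\<^sup>+\<xi>. ?b \<xi> \<partial>\<nu>) + (\<Sum>i\<in>UNIV. \<integral>\<^sup>+\<xi>. ennreal (?v i \<xi>) * ?b \<xi> \<partial>\<nu>))"
   by (simp add: nn_integral_cmult nn_integral_add nn_integral_sum)
  also have "\<dots> \<le> ennreal ?k * (ennreal (C undefined 0 * L\<^sup>2) * ?N + (\<Sum>i\<in>UNIV. ennreal (C i M * L\<^sup>2) * ?N))"
  proof -
   have c0: "(\<integral>\<^sup>+\<xi>. ?b \<xi> \<partial>\<nu>) \<le> ennreal (C undefined 0 * L\<^sup>2) * ?N" using C[OF g H nu, of undefined 0] by simp
   have cM: "(\<integral>\<^sup>+\<xi>. ennreal (?v i \<xi>) * ?b \<xi> \<partial>\<nu>) \<le> ennreal (C i M * L\<^sup>2) * ?N" for i by (rule C[OF g H nu])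
   show ?thesis by (intro mult_left_mono add_mono sum_mono c0 cM) simp
  qed
  also have "\<dots> = ennreal (D * L\<^sup>2) * ?N"
  proof -
   have S: "(\<Sum>i\<in>UNIV. ennreal (C i M * L\<^sup>2)) = ennreal (\<Sum>i\<in>UNIV. C i M * L\<^sup>2)"
    using C0 by (intro sum_ennreal) auto
   have "ennreal (C undefined 0 * L\<^sup>2) * ?N + (\<Sum>i\<in>UNIV. ennreal (C i M * L\<^sup>2) * ?N) = ennreal (C undefined 0 * L\<^sup>2 + (\<Sum>i\<in>UNIV. C i M * L\<^sup>2)) * ?N"
    using C0 by (simp only: sum_distrib_right[symmetric, where r = ?N] S ennreal_plus distrib_right sum_nonneg mult_nonneg_nonneg zero_le_power2)
   also have "ennreal ?k * \<dots> = ennreal (?k * (C undefined 0 * L\<^sup>2 + (\<Sum>i\<in>UNIV. C i M * L\<^sup>2))) * ?N"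
    using C0 by (subst ennreal_mult) (auto simp: mult.assoc sum_nonneg)
   also have "?k * (C undefined 0 * L\<^sup>2 + (\<Sum>i\<in>UNIV. C i M * L\<^sup>2)) = D * L\<^sup>2"
    unfolding D_def sum_distrib_right[symmetric, where r = "L\<^sup>2"] by (simp only: distrib_right distrib_left mult.assoc)
   finally show ?thesis .
  qed
  finally show "(\<integral>\<^sup>+\<xi>. ennreal (wgt c R \<xi> ^ M) * ?b \<xi> \<partial>\<nu>) \<le> ennreal (D * L\<^sup>2) * ?N" .
 qed
qed

end

section \<open>Powers of extended nonnegative reals\<close>

lemma enn_powr_ennreal [simp]: "0 \<le> a ==> enn_powr (ennreal a) r = ennreal (a powr r)"
 by (simp add: enn_powr_def)

lemma enn_powr_top [simp]: "enn_powr \<top> r = \<top>"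
 by (simp add: enn_powr_def)

lemma enn_powr_0 [simp]: "enn_powr 0 r = 0"
 by (simp add: enn_powr_def)

lemma enn_powr_measurable [measurable]:
 assumes [measurable]: "f \<in> borel_measurable M"
 shows "(%x. enn_powr (f x) r) \<in> borel_measurable M"
 unfolding enn_powr_def by measurable

lemma enn_powr_mono:
 assumes "a \<le> b" "0 \<le> r"
 shows "enn_powr a r \<le> enn_powr b r"
 using assms by (cases a; cases b) (auto simp: powr_mono2 intro!: ennreal_leI simp: top_unique)

lemma enn_powr_mult:
 assumes "0 < r"
 shows "enn_powr (a * b) r = enn_powr a r * enn_powr b r"
proof (cases a; cases b)
 fix x y assume "0 \<le> x" "a = ennreal x" "0 \<le> y" "b = ennreal y"
 then show ?thesis by (simp add: ennreal_mult[symmetric] powr_mult)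
next
 fix x assume h: "0 \<le> x" "a = ennreal x" "b = \<top>"
 then show ?thesis by (cases "x = 0") (auto simp: ennreal_mult_top)
next
 fix x assume h: "0 \<le> x" "b = ennreal x" "a = \<top>"
 then show ?thesis by (cases "x = 0") (auto simp: ennreal_top_mult)
qed simp

lemma enn_powr_powr:
 assumes "0 < r" "0 < s"
 shows "enn_powr (enn_powr a r) s = enn_powr a (r * s)"
 using assms by (cases a) (auto simp: powr_powr)

lemma enn_powr_1 [simp]: "enn_powr a 1 = a"
 by (cases a) auto

lemma enn_powr_add:
 assumes "0 < r" "0 < s"
 shows "enn_powr a (r + s) = enn_powr a r * enn_powr a s"
proof (cases a)
 case (real x)
 then show ?thesis by (simp add: ennreal_mult[symmetric] powr_add)
qed simp

text \<open>With T the sum of the r-th powers, each term satisfies x = x^(1-r) x^r \<le> T^((1-r)/r)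
  x^r; summing and raising to the power r returns T. This works over any index set.\<close>

lemma enn_powr_nn_integral_le:
 assumes r: "0 < r" "r \<le> 1"
 shows "enn_powr (\<integral>\<^sup>+p. X p \<partial>count_space I) r \<le> (\<integral>\<^sup>+p. enn_powr (X p) r \<partial>count_space I)"
proof (cases "(\<integral>\<^sup>+p. enn_powr (X p) r \<partial>count_space I)")
 case (real T)
 have le: "enn_powr (X p) r \<le> ennreal T" if "p \<in> I" for p
  unfolding real(2)[symmetric] using that by (rule nn_integral_ge_point)
 have "X p \<le> ennreal (T powr ((1 - r) / r)) * enn_powr (X p) r" if p: "p \<in> I" for p
 proof (cases "X p")
  case (real x)
  have "x powr r \<le> T" using le[OF p] real \<open>0 \<le> T\<close> by simp
  then have "(x powr r) powr ((1 - r) / r) \<le> T powr ((1 - r) / r)" using r by (intro powr_mono2) auto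
  then have "x powr (1 - r) \<le> T powr ((1 - r) / r)" using r by (simp add: powr_powr)
  then have "x powr (1 - r) * x powr r \<le> T powr ((1 - r) / r) * x powr r" by (rule mult_right_mono) simp
  moreover have "x powr (1 - r) * x powr r = x" using real(1) r by (cases "x = 0") (auto simp: powr_add[symmetric])
  ultimately show ?thesis using real by (simp add: ennreal_mult[symmetric] ennreal_leI)
 next
  case top
  then show ?thesis using le[OF p] by (simp add: top_unique)
 qed
 then have "(\<integral>\<^sup>+p. X p \<partial>count_space I) \<le> (\<integral>\<^sup>+p. ennreal (T powr ((1 - r) / r)) * enn_powr (X p) r \<partial>count_space I)"
  by (intro nn_integral_mono) simp
 also have "\<dots> = ennreal (T powr ((1 - r) / r)) * ennreal T"
  unfolding real(2)[symmetric] by (rule nn_integral_cmult) simp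
 also have "\<dots> = ennreal (T powr (1 / r))"
 proof (cases "T = 0")
  case False
  then have "T powr ((1 - r) / r) * T = T powr ((1 - r) / r + 1)" using real(1) by (simp add: powr_add)
  also have "(1 - r) / r + 1 = 1 / r" using r by (simp add: field_simps)
  finally show ?thesis using real(1) by (simp add: ennreal_mult[symmetric])
 qed simp
 finally have "enn_powr (\<integral>\<^sup>+p. X p \<partial>count_space I) r \<le> enn_powr (ennreal (T powr (1 / r))) r"
  using r by (intro enn_powr_mono) auto
 also have "\<dots> = ennreal T" using r real(1) by (simp add: powr_powr)
 finally show ?thesis unfolding real(2) .
next
 case top
 then show ?thesis by simp
qed

text \<open>Jensen with a spare factor 2^r, from the pointwise bound z \<le> l + l^(1-r) z^r. The
  level l with l^r = T / K makes both contributions equal after integration.\<close>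

lemma enn_powr_jensen:
 assumes r: "1 \<le> r" and K: "0 < K" "emeasure M (space M) \<le> ennreal K"
  and [measurable]: "Z \<in> borel_measurable M"
 shows "enn_powr (\<integral>\<^sup>+x. Z x \<partial>M) r \<le> ennreal (2 powr r * K powr (r - 1)) * (\<integral>\<^sup>+x. enn_powr (Z x) r \<partial>M)"
proof (cases "(\<integral>\<^sup>+x. enn_powr (Z x) r \<partial>M)")
 case (real T)
 show ?thesis
 proof (cases "T = 0")
  case True
  then have "AE x in M. enn_powr (Z x) r = 0" using real by (simp add: nn_integral_0_iff_AE)
  then have "AE x in M. Z x = 0"
  proof (rule AE_mp, intro AE_I2 impI)
   fix x assume "enn_powr (Z x) r = 0"
   then show "Z x = 0" by (cases "Z x") auto
  qed
  then have "(\<integral>\<^sup>+x. Z x \<partial>M) = 0" by (simp add: nn_integral_0_iff_AE)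
  then show ?thesis by simp
 next
  case False
  then have T: "T > 0" using real by simp
  define l where "l = (T / K) powr (1 / r)"
  have l: "l > 0" using T K by (simp add: l_def)
  have lr: "l powr r = T / K" using T K r by (simp add: l_def powr_powr)
  have "Z x \<le> ennreal l + ennreal (l powr (1 - r)) * enn_powr (Z x) r" for x
  proof (cases "Z x")
   case (real z)
   have "z \<le> l + l powr (1 - r) * z powr r"
   proof (cases "z \<le> l")
    case True
    then show ?thesis by (simp add: add_increasing2)
   next
    case False
    then have "z powr (1 - r) \<le> l powr (1 - r)" using l r by (intro powr_mono2') auto
    then have "z powr (1 - r) * z powr r \<le> l powr (1 - r) * z powr r" by (rule mult_right_mono) simp
    moreover have "z powr (1 - r) * z powr r = z" using False l by (simp add: powr_add[symmetric])
    ultimately show ?thesis using l by simp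
   qed
   then have "ennreal z \<le> ennreal (l + l powr (1 - r) * z powr r)" by (rule ennreal_leI)
   then show ?thesis using real l by (simp add: ennreal_plus ennreal_mult)
  next
   case top
   then show ?thesis using l by (simp add: ennreal_mult_top)
  qed
  then have "(\<integral>\<^sup>+x. Z x \<partial>M) \<le> (\<integral>\<^sup>+x. ennreal l + ennreal (l powr (1 - r)) * enn_powr (Z x) r \<partial>M)"
   by (intro nn_integral_mono)
  also have "\<dots> = ennreal l * emeasure M (space M) + ennreal (l powr (1 - r)) * ennreal T"
   by (simp add: nn_integral_add nn_integral_cmult real)
  also have "\<dots> \<le> ennreal l * ennreal K + ennreal (l powr (1 - r)) * ennreal T"
   using K by (intro add_mono mult_left_mono) auto
  also have "\<dots> = ennreal (2 * l * K)"
  proof -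
   have "T = l powr r * K" using K by (simp add: lr)
   then have "l powr (1 - r) * T = (l powr (1 - r) * l powr r) * K" by simp
   also have "l powr (1 - r) * l powr r = l" using l by (simp add: powr_add[symmetric])
   finally show ?thesis using l K T by (simp add: ennreal_mult[symmetric] ennreal_plus[symmetric] del: ennreal_plus)
  qed
  finally have "enn_powr (\<integral>\<^sup>+x. Z x \<partial>M) r \<le> enn_powr (ennreal (2 * l * K)) r"
   using r by (intro enn_powr_mono) auto
  also have "\<dots> = ennreal (2 powr r * K powr (r - 1)) * ennreal T"
  proof -
   have "(2 * l * K) powr r = 2 powr r * l powr r * K powr r" using l K by (simp add: powr_mult)
   also have "\<dots> = 2 powr r * (T / K) * K powr r" by (simp add: lr)
   also have "\<dots> = 2 powr r * K powr (r - 1) * T" using K by (simp add: powr_diff)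
   finally show ?thesis using l K T by (simp add: ennreal_mult[symmetric])
  qed
  finally show ?thesis unfolding real(2) .
 qed
next
 case top
 have "0 < 2 powr r * K powr (r - 1)" using K by simp
 then have "ennreal (2 powr r * K powr (r - 1)) ~= 0" by (simp only: ennreal_eq_0_iff not_le)
 then have "ennreal (2 powr r * K powr (r - 1)) * \<top> = \<top>" by (simp only: ennreal_mult_eq_top_iff) blast
 then show ?thesis unfolding top by (simp only: top_greatest)
qed

section \<open>Summing the contributions of the boxes\<close>

lemma borel_measurable_nn_integral_count_space:
 fixes f :: "'p => 'x => ennreal"
 assumes I: "countable I" and f: "\<And>p. f p \<in> borel_measurable M"
 shows "(%x. \<integral>\<^sup>+p. f p x \<partial>count_space I) \<in> borel_measurable M"
proof -
 interpret sigma_finite_measure "count_space I" by (rule sigma_finite_measure_count_space_countable[OF I])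
 have "(%(p, x). f p x) \<in> borel_measurable (count_space I \<Otimes>\<^sub>M M)"
  using f by (intro measurable_pair_measure_countable1 I) auto
 from measurable_compose[OF measurable_pair_swap' this]
 show ?thesis by (intro borel_measurable_nn_integral) (simp add: split_beta')
qed

text \<open>For r \<le> 1 the r-th power is subadditive over the boxes. A single box spreads its
  mass N over an effective volume V, for which Hoelder would give V^(1-r) N^r; a pointwise splitting
  produces the same with weights. It rests on 2 r \<ge> 1, that is q \<ge> 1.\<close>

lemma assembly_small_exponent:
 fixes w :: "'p => 'x => real" and \<beta> :: "'p => 'x => ennreal"
 assumes r: "1 / 2 \<le> r" "r \<le> 1" and I: "countable I" and C: "C \<ge> 0"
  and [measurable]: "\<And>p. w p \<in> borel_measurable M" "\<And>p. \<beta> p \<in> borel_measurable M"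
  and w1: "\<And>p x. 1 \<le> w p x"
  and L2: "\<And>p. p \<in> I ==> (\<integral>\<^sup>+x. ennreal (w p x ^ (3 * s)) * \<beta> p x \<partial>M) \<le> ennreal C * N p"
  and sup: "\<And>p x. p \<in> I ==> \<beta> p x \<le> ennreal C * N p"
  and V: "\<And>p. p \<in> I ==> (\<integral>\<^sup>+x. ennreal (1 / w p x ^ s) \<partial>M) \<le> ennreal (C * V p)" and V0: "\<And>p. V p > 0"
  and N: "\<And>p. p \<in> I ==> N p < \<top>"
  and b: "\<And>x. b x \<le> ennreal C * (\<integral>\<^sup>+p. ennreal (w p x ^ s) * \<beta> p x \<partial>count_space I)"
 shows "(\<integral>\<^sup>+x. enn_powr (b x) r \<partial>M) \<le> ennreal (C powr r * (2 * C)) * (\<integral>\<^sup>+p. ennreal (V p powr (1 - r)) * enn_powr (N p) r \<partial>count_space I)"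
proof -
 have r0: "0 < r" using r by simp
 have tm: "(\<integral>\<^sup>+x. enn_powr (ennreal (w p x ^ s) * \<beta> p x) r \<partial>M) \<le> ennreal (2 * C) * (ennreal (V p powr (1 - r)) * enn_powr (N p) r)" if p: "p \<in> I" for p
 proof -
  obtain a where a: "a \<ge> 0" "N p = ennreal a" using N[OF p] by (auto simp: less_top_ennreal)
  show ?thesis
  proof (cases "a = 0")
   case True
   then have "\<beta> p x = 0" for x using sup[OF p, of x] a by simp
   then show ?thesis by simp
  next
   case False
   then have a0: "a > 0" using a by simp
   \<comment> \<open>The mean density of the mass over the box; this level equalises the two
     integrals below.\<close>
   define l where "l = a / V p"
   have l: "l > 0" using a0 V0[of p] by (simp add: l_def)
   have pt: "enn_powr (ennreal (w p x ^ s) * \<beta> p x) r \<le> ennreal (l powr (r - 1)) * (ennreal (w p x ^ (3 * s)) * \<beta> p x) + ennreal (l powr r) * ennreal (1 / w p x ^ s)" for x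
   proof -
    obtain y where y: "y \<ge> 0" "\<beta> p x = ennreal y" using sup[OF p, of x] a C
     by (cases "\<beta> p x") (auto simp: top_unique ennreal_mult[symmetric])
    define u where "u = w p x ^ s"
    have u: "u \<ge> 1" unfolding u_def by (rule one_le_power[OF w1])
    have u3: "w p x ^ (3 * s) = u * u\<^sup>2" unfolding u_def by (simp add: power_mult[symmetric] power_add[symmetric] mult.commute)
    \<comment> \<open>Split at u y = l / u^2. Above, lowering the exponent from 1 to r costs l^(r-1)
      u^(2 (1-r)) \<le> l^(r-1) u^2; below, (l / u^2)^r \<le> l^r / u because u \<ge> 1 and 2 r
      \<ge> 1.\<close>
    have "(u * y) powr r \<le> l powr (r - 1) * (u * u\<^sup>2 * y) + l powr r * (1 / u)"
    proof (cases "u * y \<ge> l / u\<^sup>2")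
     case True
     have "0 < l / u\<^sup>2" using l u by simp
     then have uy: "u * y > 0" using True by linarith
     have "(u * y) powr (r - 1) \<le> (l / u\<^sup>2) powr (r - 1)"
      using True l u r by (intro powr_mono2') auto
     also have "\<dots> = l powr (r - 1) * (u\<^sup>2) powr (1 - r)"
      using l u powr_minus_divide[of "u\<^sup>2" "1 - r"] by (simp add: powr_divide)
     also have "\<dots> \<le> l powr (r - 1) * (u\<^sup>2) powr 1"
      using u r by (intro mult_left_mono powr_mono) auto
     also have "\<dots> = l powr (r - 1) * u\<^sup>2" using u by simp
     finally have "(u * y) * (u * y) powr (r - 1) \<le> (u * y) * (l powr (r - 1) * u\<^sup>2)"
      using uy by (intro mult_left_mono) auto
     moreover have "(u * y) * (u * y) powr (r - 1) = (u * y) powr r"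
      using uy by (simp add: powr_diff)
     ultimately have "(u * y) powr r \<le> l powr (r - 1) * (u * u\<^sup>2 * y)" by (simp add: mult_ac)
     moreover have "0 \<le> l powr r * (1 / u)" using u by simp
     ultimately show ?thesis by linarith
    next
     case False
     then have "(u * y) powr r \<le> (l / u\<^sup>2) powr r" using u y r0 by (intro powr_mono2) auto
     also have "(l / u\<^sup>2) powr r = l powr r * (1 / u powr (2 * r))"
     proof -
      have "u\<^sup>2 = u powr 2" using u by simp
      then have "(u\<^sup>2) powr r = u powr (2 * r)" by (simp only: powr_powr)
      then show ?thesis using l u by (simp add: powr_divide)
     qed
     also have "\<dots> \<le> l powr r * (1 / u powr 1)" using u r by (intro mult_left_mono divide_left_mono powr_mono) auto
     also have "\<dots> = l powr r * (1 / u)" using u by simp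
     finally have "(u * y) powr r \<le> l powr r * (1 / u)" .
     moreover have "0 \<le> l powr (r - 1) * (u * u\<^sup>2 * y)" using u y by simp
     ultimately show ?thesis by linarith
    qed
    then have "ennreal ((u * y) powr r) \<le> ennreal (l powr (r - 1) * (u * u\<^sup>2 * y) + l powr r * (1 / u))" by (rule ennreal_leI)
    also have "\<dots> = ennreal (l powr (r - 1)) * (ennreal (u * u\<^sup>2) * ennreal y) + ennreal (l powr r) * ennreal (1 / u)"
     using u y by (simp only: ennreal_plus ennreal_mult powr_ge_zero mult_nonneg_nonneg zero_le_power2 zero_le_divide_1_iff order_trans[OF zero_le_one u])
    finally show ?thesis using u y by (simp only: y(2) u3 u_def[symmetric] ennreal_mult[symmetric, of u y] order_trans[OF zero_le_one u] enn_powr_ennreal mult_nonneg_nonneg)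
   qed
   have "(\<integral>\<^sup>+x. enn_powr (ennreal (w p x ^ s) * \<beta> p x) r \<partial>M) \<le> (\<integral>\<^sup>+x. ennreal (l powr (r - 1)) * (ennreal (w p x ^ (3 * s)) * \<beta> p x) + ennreal (l powr r) * ennreal (1 / w p x ^ s) \<partial>M)"
    by (intro nn_integral_mono pt)
   also have "\<dots> = ennreal (l powr (r - 1)) * (\<integral>\<^sup>+x. ennreal (w p x ^ (3 * s)) * \<beta> p x \<partial>M) + ennreal (l powr r) * (\<integral>\<^sup>+x. ennreal (1 / w p x ^ s) \<partial>M)"
    by (simp add: nn_integral_add nn_integral_cmult)
   also have "\<dots> \<le> ennreal (l powr (r - 1)) * (ennreal C * N p) + ennreal (l powr r) * ennreal (C * V p)"
    by (intro add_mono mult_left_mono L2 V p) auto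
   also have "\<dots> = ennreal (l powr (r - 1) * (C * a) + l powr r * (C * V p))"
    using a C V0[of p] by (simp add: ennreal_mult ennreal_plus)
   also have "l powr (r - 1) * (C * a) + l powr r * (C * V p) = 2 * C * (V p powr (1 - r) * a powr r)"
   proof -
    have 1: "l powr r * V p = V p powr (1 - r) * a powr r"
     using a0 V0[of p] by (simp add: l_def powr_divide powr_diff)
    have "l powr (r - 1) * a = l powr r / l * a" using l by (simp add: powr_diff)
    also have "\<dots> = l powr r * V p" using a0 V0[of p] by (simp add: l_def)
    finally have 2: "l powr (r - 1) * a = V p powr (1 - r) * a powr r" using 1 by simp
    have "l powr (r - 1) * (C * a) + l powr r * (C * V p) = C * (l powr (r - 1) * a) + C * (l powr r * V p)" by (simp add: mult_ac)
    then show ?thesis unfolding 1 2 by simp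
   qed
   also have "ennreal (2 * C * (V p powr (1 - r) * a powr r)) = ennreal (2 * C) * (ennreal (V p powr (1 - r)) * enn_powr (N p) r)"
    using C a by (simp add: ennreal_mult)
   finally show ?thesis .
  qed
 qed
 have "(\<integral>\<^sup>+x. enn_powr (b x) r \<partial>M) \<le> (\<integral>\<^sup>+x. ennreal (C powr r) * (\<integral>\<^sup>+p. enn_powr (ennreal (w p x ^ s) * \<beta> p x) r \<partial>count_space I) \<partial>M)"
 proof (rule nn_integral_mono)
  fix x
  have "enn_powr (b x) r \<le> enn_powr (ennreal C * (\<integral>\<^sup>+p. ennreal (w p x ^ s) * \<beta> p x \<partial>count_space I)) r"
   using r0 by (intro enn_powr_mono b) auto
  also have "\<dots> = ennreal (C powr r) * enn_powr (\<integral>\<^sup>+p. ennreal (w p x ^ s) * \<beta> p x \<partial>count_space I) r"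
   using C by (simp add: enn_powr_mult[OF r0])
  also have "\<dots> \<le> ennreal (C powr r) * (\<integral>\<^sup>+p. enn_powr (ennreal (w p x ^ s) * \<beta> p x) r \<partial>count_space I)"
   by (intro mult_left_mono enn_powr_nn_integral_le r0 r) auto
  finally show "enn_powr (b x) r \<le> ennreal (C powr r) * (\<integral>\<^sup>+p. enn_powr (ennreal (w p x ^ s) * \<beta> p x) r \<partial>count_space I)" .
 qed
 also have "\<dots> = ennreal (C powr r) * (\<integral>\<^sup>+x. (\<integral>\<^sup>+p. enn_powr (ennreal (w p x ^ s) * \<beta> p x) r \<partial>count_space I) \<partial>M)"
  using I by (intro nn_integral_cmult borel_measurable_nn_integral_count_space) measurable
 also have "(\<integral>\<^sup>+x. (\<integral>\<^sup>+p. enn_powr (ennreal (w p x ^ s) * \<beta> p x) r \<partial>count_space I) \<partial>M) = (\<integral>\<^sup>+p. (\<integral>\<^sup>+x. enn_powr (ennreal (w p x ^ s) * \<beta> p x) r \<partial>M) \<partial>count_space I)"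
  by (rule nn_integral_count_space_nn_integral[OF I]) measurable
 also have "\<dots> \<le> (\<integral>\<^sup>+p. ennreal (2 * C) * (ennreal (V p powr (1 - r)) * enn_powr (N p) r) \<partial>count_space I)"
  by (intro nn_integral_mono tm) simp
 also have "\<dots> = ennreal (2 * C) * (\<integral>\<^sup>+p. ennreal (V p powr (1 - r)) * enn_powr (N p) r \<partial>count_space I)"
  by (rule nn_integral_cmult) simp
 finally show ?thesis using C by (simp add: ennreal_mult mult.assoc mult_left_mono)
qed

text \<open>For r \<ge> 1 the sum over the boxes is an integral against the weights 1 / w^s, of
  total mass at most D at every point, so Jensen applies. On one box the r-th power is interpolated
  between the sup bound and the integral bound, both of size N; no volume factor appears.\<close>

lemma assembly_large_exponent:
 fixes w :: "'p => 'x => real" and \<beta> :: "'p => 'x => ennreal"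
 assumes r: "1 \<le> r" and I: "countable I" and C: "C > 0" and D: "D > 0"
  and [measurable]: "\<And>p. w p \<in> borel_measurable M" "\<And>p. \<beta> p \<in> borel_measurable M"
  and w1: "\<And>p x. 1 \<le> w p x"
  and S: "\<And>x. (\<integral>\<^sup>+p. ennreal (1 / w p x ^ s) \<partial>count_space I) \<le> ennreal D"
  and L2: "\<And>p. p \<in> I ==> (\<integral>\<^sup>+x. ennreal (w p x ^ (2 * s)) * \<beta> p x \<partial>M) \<le> ennreal C * N p"
  and sup: "\<And>p x. p \<in> I ==> ennreal (w p x ^ (2 * s)) * \<beta> p x \<le> ennreal C * N p"
  and N: "\<And>p. p \<in> I ==> N p < \<top>"
  and b: "\<And>x. b x \<le> ennreal C * (\<integral>\<^sup>+p. ennreal (w p x ^ s) * \<beta> p x \<partial>count_space I)"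
 shows "(\<integral>\<^sup>+x. enn_powr (b x) r \<partial>M) \<le> ennreal (C powr r * (2 powr r * D powr (r - 1)) * C powr r) * (\<integral>\<^sup>+p. enn_powr (N p) r \<partial>count_space I)"
proof -
 have r0: "0 < r" using r by simp
 let ?Z = "%p x. ennreal (w p x ^ (2 * s)) * \<beta> p x"
 have tm: "(\<integral>\<^sup>+x. ennreal (1 / w p x ^ s) * enn_powr (?Z p x) r \<partial>M) \<le> ennreal (C powr r) * enn_powr (N p) r" if p: "p \<in> I" for p
 proof -
  have "(\<integral>\<^sup>+x. ennreal (1 / w p x ^ s) * enn_powr (?Z p x) r \<partial>M) \<le> (\<integral>\<^sup>+x. enn_powr (?Z p x) r \<partial>M)"
  proof (rule nn_integral_mono)
   fix x
   have "ennreal (1 / w p x ^ s) \<le> ennreal 1" using one_le_power[OF w1[of p x], of s] by (intro ennreal_leI) (simp add: divide_le_eq)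
   then show "ennreal (1 / w p x ^ s) * enn_powr (?Z p x) r \<le> enn_powr (?Z p x) r"
    using mult_right_mono[of "ennreal (1 / w p x ^ s)" 1 "enn_powr (?Z p x) r"] by simp
  qed
  also have "\<dots> \<le> enn_powr (ennreal C * N p) r"
  proof (cases "r = 1")
   case True
   then show ?thesis using L2[OF p] by simp
  next
   case False
   then have r1: "0 < r - 1" using r by simp
   have "(\<integral>\<^sup>+x. enn_powr (?Z p x) r \<partial>M) \<le> (\<integral>\<^sup>+x. enn_powr (ennreal C * N p) (r - 1) * ?Z p x \<partial>M)"
   proof (rule nn_integral_mono)
    fix x
    have "enn_powr (?Z p x) r = enn_powr (?Z p x) (r - 1) * ?Z p x"
     using enn_powr_add[OF r1 zero_less_one, of "?Z p x"] by simp
    also have "\<dots> \<le> enn_powr (ennreal C * N p) (r - 1) * ?Z p x"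
     using r1 by (intro mult_right_mono enn_powr_mono sup p) auto
    finally show "enn_powr (?Z p x) r \<le> enn_powr (ennreal C * N p) (r - 1) * ?Z p x" .
   qed
   also have "\<dots> = enn_powr (ennreal C * N p) (r - 1) * (\<integral>\<^sup>+x. ?Z p x \<partial>M)" by (rule nn_integral_cmult) measurable
   also have "\<dots> \<le> enn_powr (ennreal C * N p) (r - 1) * (ennreal C * N p)" by (intro mult_left_mono L2 p) auto
   also have "\<dots> = enn_powr (ennreal C * N p) r" using enn_powr_add[OF r1 zero_less_one, of "ennreal C * N p"] by simp
   finally show ?thesis .
  qed
  also have "\<dots> = ennreal (C powr r) * enn_powr (N p) r" using C by (simp add: enn_powr_mult[OF r0])
  finally show ?thesis .
 qed
 have "(\<integral>\<^sup>+x. enn_powr (b x) r \<partial>M) \<le> (\<integral>\<^sup>+x. ennreal (C powr r * (2 powr r * D powr (r - 1))) * (\<integral>\<^sup>+p. ennreal (1 / w p x ^ s) * enn_powr (?Z p x) r \<partial>count_space I) \<partial>M)"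
 proof (rule nn_integral_mono)
  fix x
  define \<mu> where "\<mu> = density (count_space I) (%p. ennreal (1 / w p x ^ s))"
  have e: "ennreal (w p x ^ s) * \<beta> p x = ennreal (1 / w p x ^ s) * ?Z p x" for p
  proof -
   have u: "0 < w p x ^ s" using w1[of p x] by simp
   have "ennreal (1 / w p x ^ s) * ennreal (w p x ^ (2 * s)) = ennreal (1 / w p x ^ s * w p x ^ (2 * s))"
    using u w1[of p x] by (intro ennreal_mult[symmetric]) auto
   also have "1 / w p x ^ s * w p x ^ (2 * s) = w p x ^ s"
    using u by (simp add: mult_2 power_add)
   finally show ?thesis by (simp add: mult.assoc[symmetric])
  qed
  have i1: "(\<integral>\<^sup>+p. ennreal (w p x ^ s) * \<beta> p x \<partial>count_space I) = (\<integral>\<^sup>+p. ?Z p x \<partial>\<mu>)"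
   unfolding \<mu>_def e by (subst nn_integral_density) auto
  have i2: "(\<integral>\<^sup>+p. enn_powr (?Z p x) r \<partial>\<mu>) = (\<integral>\<^sup>+p. ennreal (1 / w p x ^ s) * enn_powr (?Z p x) r \<partial>count_space I)"
   unfolding \<mu>_def by (subst nn_integral_density) auto
  have "emeasure \<mu> (space \<mu>) = (\<integral>\<^sup>+p. ennreal (1 / w p x ^ s) \<partial>count_space I)"
   unfolding \<mu>_def by (subst emeasure_density) (auto intro!: nn_integral_cong)
  then have mu: "emeasure \<mu> (space \<mu>) \<le> ennreal D" using S by simp
  have "enn_powr (b x) r \<le> enn_powr (ennreal C * (\<integral>\<^sup>+p. ?Z p x \<partial>\<mu>)) r"
   unfolding i1[symmetric] using r0 by (intro enn_powr_mono b) auto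
  also have "\<dots> = ennreal (C powr r) * enn_powr (\<integral>\<^sup>+p. ?Z p x \<partial>\<mu>) r"
   using C by (simp add: enn_powr_mult[OF r0])
  also have "\<dots> \<le> ennreal (C powr r) * (ennreal (2 powr r * D powr (r - 1)) * (\<integral>\<^sup>+p. enn_powr (?Z p x) r \<partial>\<mu>))"
   by (intro mult_left_mono enn_powr_jensen r D mu) (auto simp: \<mu>_def)
  finally show "enn_powr (b x) r \<le> ennreal (C powr r * (2 powr r * D powr (r - 1))) * (\<integral>\<^sup>+p. ennreal (1 / w p x ^ s) * enn_powr (?Z p x) r \<partial>count_space I)"
   unfolding i2 by (subst ennreal_mult) (auto simp: mult.assoc)
 qed
 also have "\<dots> = ennreal (C powr r * (2 powr r * D powr (r - 1))) * (\<integral>\<^sup>+x. (\<integral>\<^sup>+p. ennreal (1 / w p x ^ s) * enn_powr (?Z p x) r \<partial>count_space I) \<partial>M)"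
  using I by (intro nn_integral_cmult borel_measurable_nn_integral_count_space) measurable
 also have "(\<integral>\<^sup>+x. (\<integral>\<^sup>+p. ennreal (1 / w p x ^ s) * enn_powr (?Z p x) r \<partial>count_space I) \<partial>M) = (\<integral>\<^sup>+p. (\<integral>\<^sup>+x. ennreal (1 / w p x ^ s) * enn_powr (?Z p x) r \<partial>M) \<partial>count_space I)"
  by (rule nn_integral_count_space_nn_integral[OF I]) measurable
 also have "\<dots> \<le> (\<integral>\<^sup>+p. ennreal (C powr r) * enn_powr (N p) r \<partial>count_space I)"
  by (intro nn_integral_mono tm) simp
 also have "\<dots> = ennreal (C powr r) * (\<integral>\<^sup>+p. enn_powr (N p) r \<partial>count_space I)"
  by (rule nn_integral_cmult) simp
 finally show ?thesis by (subst ennreal_mult) (auto simp: mult.assoc mult_left_mono)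
qed

section \<open>Integrable weights and unit cubes\<close>

lemma nn_integral_lborel_prod_vec:
 fixes f :: "'n::finite => real => ennreal"
 assumes [measurable]: "\<And>i. f i \<in> borel_measurable borel"
 shows "(\<integral>\<^sup>+x. (\<Prod>i\<in>UNIV. f i (x $ i)) \<partial>lborel) = (\<Prod>i\<in>UNIV. \<integral>\<^sup>+s. f i s \<partial>lborel)"
proof -
 define ix where "ix b = (THE i. b = axis i (1::real))" for b :: "real^'n"
 have ix: "ix (axis i 1) = i" for i unfolding ix_def by (rule the_equality) (auto simp: axis_eq_axis)
 have "(\<integral>\<^sup>+x. (\<Prod>b\<in>Basis. f (ix b) (x \<bullet> b)) \<partial>lborel) = (\<Prod>b\<in>Basis. \<integral>\<^sup>+s. f (ix b) s \<partial>lborel)"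
  by (rule nn_integral_lborel_prod) auto
 then show ?thesis by (simp add: prod_Basis_vec ix inner_axis)
qed

definition cauchy_mass :: ennreal where
 "cauchy_mass = (\<integral>\<^sup>+t. ennreal (1 / (1 + t\<^sup>2)) \<partial>lborel)"

lemma cauchy_mass_finite: "cauchy_mass < \<top>"
proof -
 let ?f = "%t::real. 1 / (1 + t\<^sup>2)"
 have pos: "(1::real) + t\<^sup>2 ~= 0" for t :: real using zero_le_power2[of t] by linarith
 have half: "(\<integral>\<^sup>+t. ennreal (?f t) * indicator {0..} t \<partial>lborel) = ennreal (pi / 2 - arctan 0)"
 proof (rule nn_integral_FTC_atLeast)
  show "((%x. arctan x) \<longlongrightarrow> pi / 2) at_top" by (rule tendsto_arctan_at_top)
  show "DERIV arctan x :> ?f x" for x by (auto intro!: derivative_eq_intros simp: inverse_eq_divide pos)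
 qed auto
 have neg: "(\<integral>\<^sup>+t. ennreal (?f t) * indicator {..0} t \<partial>lborel) = (\<integral>\<^sup>+t. ennreal (?f t) * indicator {0..} t \<partial>lborel)"
  by (subst lborel_nn_integral_reflect[of _ 0, symmetric]) (auto intro!: nn_integral_cong simp: indicator_def)
 have "cauchy_mass \<le> (\<integral>\<^sup>+t. ennreal (?f t) * indicator {0..} t + ennreal (?f t) * indicator {..0} t \<partial>lborel)"
  unfolding cauchy_mass_def by (intro nn_integral_mono) (auto simp: indicator_def)
 also have "\<dots> = (\<integral>\<^sup>+t. ennreal (?f t) * indicator {0..} t \<partial>lborel) + (\<integral>\<^sup>+t. ennreal (?f t) * indicator {..0} t \<partial>lborel)"
  by (rule nn_integral_add) auto
 also have "\<dots> < \<top>" unfolding neg half by simp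
 finally show ?thesis .
qed

lemma cauchy_shift_scale:
 assumes "R > 0"
 shows "(\<integral>\<^sup>+t. ennreal (1 / (1 + ((t - c) / R)\<^sup>2)) \<partial>lborel) = ennreal R * cauchy_mass"
 unfolding cauchy_mass_def
 by (subst nn_integral_real_affine[where c = R and t = c]) (use assms in auto)

text \<open>\<open>wgt\<close> dominates each of the n coordinate factors, so its n-th power
  dominates their product, which is a tensor product and can be integrated.\<close>

lemma wgt_power_ge_prod:
 fixes c :: "real^'n"
 assumes "R > 0"
 shows "1 / wgt c R \<xi> ^ CARD('n) \<le> (\<Prod>i\<in>UNIV. 1 / (1 + ((\<xi> $ i - c $ i) / R)\<^sup>2))"
proof -
 have pos: "0 < 1 + ((\<xi> $ i - c $ i) / R)\<^sup>2" for i using zero_le_power2[of "(\<xi> $ i - c $ i) / R"] by linarith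
 have "1 + ((\<xi> $ i - c $ i) / R)\<^sup>2 \<le> wgt c R \<xi>" for i
 proof -
  have "\<bar>(\<xi> - c) $ i\<bar>\<^sup>2 \<le> (norm (\<xi> - c))\<^sup>2" by (intro power_mono component_le_norm_cart) auto
  then show ?thesis using assms by (simp add: wgt_def power_divide divide_right_mono)
 qed
 then have "(\<Prod>i\<in>UNIV. 1 + ((\<xi> $ i - c $ i) / R)\<^sup>2) \<le> (\<Prod>i\<in>(UNIV::'n set). wgt c R \<xi>)"
  using pos by (intro prod_mono) (auto intro: less_imp_le)
 then have "1 / wgt c R \<xi> ^ CARD('n) \<le> 1 / (\<Prod>i\<in>UNIV. 1 + ((\<xi> $ i - c $ i) / R)\<^sup>2)"
  using pos wgt_ge_1[of c R \<xi>] by (intro divide_left_mono) (auto intro!: mult_pos_pos prod_pos)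
 then show ?thesis by (simp add: prod_dividef)
qed

text \<open>The bound is a constant times the volume R^n of the box; it becomes the effective volume
  in \<open>assembly_small_exponent\<close>.\<close>

lemma wgt_integral:
 fixes c :: "real^'n"
 assumes R: "R > 0"
 shows "(\<integral>\<^sup>+\<xi>. ennreal (1 / wgt c R \<xi> ^ CARD('n)) \<partial>lborel) \<le> (ennreal R * cauchy_mass) ^ CARD('n)"
proof -
 have "(\<integral>\<^sup>+\<xi>. ennreal (1 / wgt c R \<xi> ^ CARD('n)) \<partial>lborel) \<le> (\<integral>\<^sup>+\<xi>. (\<Prod>i\<in>UNIV. ennreal (1 / (1 + ((\<xi> $ i - c $ i) / R)\<^sup>2))) \<partial>lborel)"
  by (intro nn_integral_mono) (use wgt_power_ge_prod[OF R] in \<open>auto simp: prod_ennreal intro!: ennreal_leI\<close>)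
 also have "\<dots> = (\<Prod>i\<in>UNIV. \<integral>\<^sup>+t. ennreal (1 / (1 + ((t - c $ i) / R)\<^sup>2)) \<partial>lborel)"
  by (rule nn_integral_lborel_prod_vec[of "%i t. ennreal (1 / (1 + ((t - c $ i) / R)\<^sup>2))"]) measurable
 also have "\<dots> = (ennreal R * cauchy_mass) ^ CARD('n)" by (simp add: cauchy_shift_scale[OF R])
 finally show ?thesis .
qed

definition fl :: "real^'n => int^'n" where
 "fl z = (\<chi> i. \<lfloor>z $ i\<rfloor>)"

definition iv :: "int^'n => real^'n" where
 "iv k = (\<chi> i. real_of_int (k $ i))"

lemma fl_iv [simp]: "fl (iv k) = k"
 by (simp add: fl_def iv_def vec_eq_iff)

lemma cube_measurable [measurable]: "{z. fl z = k} \<in> sets borel"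
proof -
 have "{z. fl z = k} = (\<Inter>i\<in>UNIV. {z. real_of_int (k $ i) \<le> z $ i} \<inter> {z. z $ i < real_of_int (k $ i) + 1})"
  by (auto simp: fl_def vec_eq_iff floor_eq_iff)
 also have "\<dots> \<in> sets borel" by (intro sets.finite_INT) auto
 finally show ?thesis .
qed

lemma pred_cube [measurable]: "Measurable.pred borel (%z. fl z = k)"
 using cube_measurable[of k] by (simp add: pred_def)

lemma emeasure_cube: "emeasure lborel {z::real^'n. fl z = k} = 1"
proof -
 have sub: "box (iv k) (iv k + 1) \<subseteq> {z. fl z = k}" "{z. fl z = k} \<subseteq> cbox (iv k) (iv k + 1)"
  by (auto simp: fl_def iv_def vec_eq_iff floor_eq_iff mem_box_cart less_imp_le)
 have B: "iv k \<bullet> b \<le> (iv k + 1) \<bullet> b" if "b \<in> Basis" for b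
  using that by (auto simp: Basis_vec_def inner_axis)
 have P: "(\<Prod>b\<in>Basis. (iv k + 1 - iv k) \<bullet> b) = 1" by (simp add: prod_Basis_vec inner_axis)
 have "emeasure lborel (box (iv k) (iv k + 1)) = 1"
  by (subst emeasure_lborel_box[OF B], assumption, subst P) simp
 moreover have "emeasure lborel (cbox (iv k) (iv k + 1)) = 1"
  by (subst emeasure_lborel_cbox[OF B], assumption, subst P) simp
 ultimately have "emeasure lborel (box (iv k) (iv k + 1)) = 1" "emeasure lborel (cbox (iv k) (iv k + 1)) = 1" by auto
 then show ?thesis using emeasure_mono[OF sub(1), of lborel] emeasure_mono[OF sub(2), of lborel] by auto
qed

lemma nn_integral_single_index:
 "(\<integral>\<^sup>+k. (if g = k then f k else 0) \<partial>count_space UNIV) = (f g :: ennreal)"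
proof -
 have "(\<integral>\<^sup>+k. (if g = k then f k else 0) \<partial>count_space UNIV) = (\<Sum>k\<in>{g}. if g = k then f k else 0)"
  by (rule nn_integral_count_space') auto
 then show ?thesis by simp
qed

lemma nn_integral_cubes:
 fixes g :: "real^'n => ennreal"
 assumes [measurable]: "g \<in> borel_measurable borel"
 shows "(\<integral>\<^sup>+z. g z \<partial>lborel) = (\<integral>\<^sup>+k. (\<integral>\<^sup>+z. (if fl z = k then g z else 0) \<partial>lborel) \<partial>count_space UNIV)"
proof -
 have "(\<integral>\<^sup>+z. g z \<partial>lborel) = (\<integral>\<^sup>+z. (\<integral>\<^sup>+k. (if fl z = k then g z else 0) \<partial>count_space UNIV) \<partial>lborel)"
  by (simp add: nn_integral_single_index[of _ "%_. g _"])
 also have "\<dots> = (\<integral>\<^sup>+k. (\<integral>\<^sup>+z. (if fl z = k then g z else 0) \<partial>lborel) \<partial>count_space UNIV)"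
  by (rule nn_integral_count_space_nn_integral) auto
 finally show ?thesis .
qed

text \<open>Each term is compared with an integral over the unit cube of its lattice point: moving a
  coordinate by at most 1 changes 1 + u^2 by at most the factor 3. The integrals add up to a product
  of n Cauchy integrals.\<close>

lemma lattice_sum_le:
 fixes y :: "real^'n"
 shows "(\<integral>\<^sup>+l. ennreal (\<Prod>i\<in>UNIV. 1 / (1 + (y $ i - real_of_int (l $ i))\<^sup>2)) \<partial>count_space UNIV) \<le> (3 * cauchy_mass) ^ CARD('n)"
proof -
 let ?g = "%t::real. 1 / (1 + t\<^sup>2)"
 have pos: "0 < 1 + t\<^sup>2" for t :: real using zero_le_power2[of t] by linarith
 have g1: "?g (a - real_of_int m) \<le> 3 * ?g (a - t)" if "\<lfloor>t\<rfloor> = m" for a t m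
 proof -
  define u where "u = a - real_of_int m"
  define v where "v = real_of_int m - t"
  have v: "\<bar>v\<bar> \<le> 1" using that unfolding v_def by linarith
  have "(u + v)\<^sup>2 \<le> 2 * u\<^sup>2 + 2 * v\<^sup>2" using sum_squares_bound[of u v] by (simp add: power2_sum)
  moreover have "v\<^sup>2 \<le> 1" using v by (simp add: abs_square_le_1)
  ultimately have "1 + (u + v)\<^sup>2 \<le> 3 * (1 + u\<^sup>2)" using zero_le_power2[of u] by (simp only: distrib_left)
  then have "1 / (1 + u\<^sup>2) \<le> 3 / (1 + (u + v)\<^sup>2)" using pos[of u] pos[of "u + v"] by (simp add: field_simps)
  then show ?thesis by (simp add: u_def v_def)
 qed
 have g3: "(\<integral>\<^sup>+t. ennreal (3 * ?g (a - t)) \<partial>lborel) = 3 * cauchy_mass" for a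
 proof -
  have "(\<integral>\<^sup>+t. ennreal (3 * ?g (a - t)) \<partial>lborel) = (\<integral>\<^sup>+t. ennreal (3 * ?g t) \<partial>lborel)"
   by (rule lborel_nn_integral_reflect[of "%t. ennreal (3 * ?g t)"]) measurable
  also have "\<dots> = (\<integral>\<^sup>+t. 3 * ennreal (?g t) \<partial>lborel)"
   by (intro nn_integral_cong) (subst ennreal_mult, auto)
  finally show ?thesis unfolding cauchy_mass_def by (simp add: nn_integral_cmult)
 qed
 have "(\<integral>\<^sup>+l. ennreal (\<Prod>i\<in>UNIV. ?g (y $ i - real_of_int (l $ i))) \<partial>count_space UNIV) \<le>
   (\<integral>\<^sup>+l. (\<integral>\<^sup>+t. (if fl t = l then \<Prod>i\<in>UNIV. ennreal (3 * ?g (y $ i - t $ i)) else 0) \<partial>lborel) \<partial>count_space UNIV)"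
 proof (rule nn_integral_mono)
  fix l :: "int^'n"
  have "ennreal (\<Prod>i\<in>UNIV. ?g (y $ i - real_of_int (l $ i))) = (\<integral>\<^sup>+t. ennreal (\<Prod>i\<in>UNIV. ?g (y $ i - real_of_int (l $ i))) * indicator {t. fl t = l} t \<partial>lborel)"
   by (subst nn_integral_cmult_indicator) (auto simp: emeasure_cube)
  also have "\<dots> \<le> (\<integral>\<^sup>+t. (if fl t = l then \<Prod>i\<in>UNIV. ennreal (3 * ?g (y $ i - t $ i)) else 0) \<partial>lborel)"
  proof (rule nn_integral_mono)
   fix t :: "real^'n"
   have "(\<Prod>i\<in>UNIV. ?g (y $ i - real_of_int (l $ i))) \<le> (\<Prod>i\<in>UNIV. 3 * ?g (y $ i - t $ i))" if "fl t = l"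
    using that by (intro prod_mono conjI g1) (auto simp: fl_def)
   then show "ennreal (\<Prod>i\<in>UNIV. ?g (y $ i - real_of_int (l $ i))) * indicator {t. fl t = l} t \<le> (if fl t = l then \<Prod>i\<in>UNIV. ennreal (3 * ?g (y $ i - t $ i)) else 0)"
    by (auto simp: prod_ennreal intro!: ennreal_leI)
  qed
  finally show "ennreal (\<Prod>i\<in>UNIV. ?g (y $ i - real_of_int (l $ i))) \<le> (\<integral>\<^sup>+t. (if fl t = l then \<Prod>i\<in>UNIV. ennreal (3 * ?g (y $ i - t $ i)) else 0) \<partial>lborel)" .
 qed
 also have "\<dots> = (\<integral>\<^sup>+t. (\<Prod>i\<in>UNIV. ennreal (3 * ?g (y $ i - t $ i))) \<partial>lborel)"
  by (rule nn_integral_cubes[symmetric]) measurable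
 also have "\<dots> = (\<Prod>i\<in>UNIV. \<integral>\<^sup>+t. ennreal (3 * ?g (y $ i - t)) \<partial>lborel)"
  by (rule nn_integral_lborel_prod_vec[of "%i t. ennreal (3 * ?g (y $ i - t))"]) measurable
 also have "\<dots> = (3 * cauchy_mass) ^ CARD('n)" unfolding g3 by simp
 finally show ?thesis .
qed

section \<open>The frequency pieces: dyadic levels and grid boxes\<close>

text \<open>A lattice substitute for 1 + |\<xi>| on the unit cube with corner k;
  \<open>mag_norm\<close> compares the two.\<close>

definition mag :: "int^'n => real" where
 "mag k = 1 + (\<Sum>i\<in>UNIV. \<bar>real_of_int (k $ i)\<bar>)"

definition lev :: "int^'n => nat" where
 "lev k = nat \<lfloor>log 2 (mag k)\<rfloor>"

text \<open>Within a factor 2 of 2^(j \<delta>), and an integer so that grid boxes are unions of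
  unit cubes.\<close>

definition rad :: "real => nat => nat" where
 "rad \<delta> j = 2 ^ nat \<lfloor>real j * \<delta>\<rfloor>"

text \<open>A piece is the part of a grid box of side \<open>rad\<close> inside one dyadic shell.
  Its label consists of the level and the grid position; \<open>idx\<close> maps a unit cube to the
  label of its piece.\<close>

definition idx :: "real => int^'n => nat \<times> (int^'n)" where
 "idx \<delta> k = (lev k, \<chi> i. k $ i div int (rad \<delta> (lev k)))"

definition ctr :: "real => nat \<times> (int^'n) => real^'n" where
 "ctr \<delta> p = (\<chi> i. real (rad \<delta> (fst p)) * real_of_int (snd p $ i))"

lemma mag_ge_1: "1 \<le> mag k"
 by (simp add: mag_def sum_nonneg)

lemma lev_bounds: "2 ^ lev k \<le> mag k" "mag k < 2 * 2 ^ lev k"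
proof -
 have l0: "0 \<le> log 2 (mag k)" using mag_ge_1[of k] by simp
 have m: "mag k > 0" using mag_ge_1[of k] by linarith
 have "real (lev k) \<le> log 2 (mag k)" unfolding lev_def using l0 by simp
 then have "2 powr real (lev k) \<le> mag k" using m by (simp add: le_log_iff)
 then show "2 ^ lev k \<le> mag k" by (simp add: powr_realpow)
 have "log 2 (mag k) < real (lev k) + 1" unfolding lev_def using l0 by linarith
 then have "mag k < 2 powr (real (lev k) + 1)" using m by (simp add: log_less_iff)
 then show "mag k < 2 * 2 ^ lev k" by (simp add: powr_add powr_realpow)
qed

lemma rad_ge_1: "1 \<le> rad \<delta> j"
 by (simp add: rad_def)

lemma rad_bounds:
 assumes "0 \<le> \<delta>"
 shows "real (rad \<delta> j) \<le> 2 powr (real j * \<delta>)" "2 powr (real j * \<delta>) \<le> 2 * real (rad \<delta> j)"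
proof -
 have 0: "0 \<le> real j * \<delta>" using assms by simp
 have e: "real (rad \<delta> j) = 2 powr real (nat \<lfloor>real j * \<delta>\<rfloor>)" by (simp add: rad_def powr_realpow)
 show "real (rad \<delta> j) \<le> 2 powr (real j * \<delta>)" unfolding e using 0 by (intro powr_mono) auto
 have "2 * real (rad \<delta> j) = 2 powr (real (nat \<lfloor>real j * \<delta>\<rfloor>) + 1)" unfolding e by (simp add: powr_add)
 moreover have "real j * \<delta> \<le> real (nat \<lfloor>real j * \<delta>\<rfloor>) + 1" using 0 by linarith
 ultimately show "2 powr (real j * \<delta>) \<le> 2 * real (rad \<delta> j)" by (simp add: powr_mono)
qed

lemma mag_norm:
 fixes z :: "real^'n"
 shows "mag (fl z) \<le> (real CARD('n) + 1) * (1 + norm z)" "1 + norm z \<le> (real CARD('n) + 1) * mag (fl z)"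
proof -
 let ?n = "real CARD('n)"
 have a: "\<bar>real_of_int \<lfloor>z $ i\<rfloor>\<bar> \<le> 1 + norm z" for i
  using component_le_norm_cart[of z i] by linarith
 have "(\<Sum>i\<in>UNIV. \<bar>real_of_int (fl z $ i)\<bar>) \<le> (\<Sum>i\<in>(UNIV::'n set). 1 + norm z)"
  using a by (intro sum_mono) (simp add: fl_def)
 then show "mag (fl z) \<le> (?n + 1) * (1 + norm z)"
 proof -
  assume h: "(\<Sum>i\<in>UNIV. \<bar>real_of_int (fl z $ i)\<bar>) \<le> (\<Sum>i\<in>(UNIV::'n set). 1 + norm z)"
  have "(\<Sum>i\<in>(UNIV::'n set). 1 + norm z) = ?n * (1 + norm z)" by simp
  moreover have "(?n + 1) * (1 + norm z) = ?n * (1 + norm z) + (1 + norm z)" by (simp only: distrib_right mult_1_left)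
  ultimately show ?thesis unfolding mag_def using h norm_ge_zero[of z] by linarith
 qed
 have "norm z \<le> (\<Sum>i\<in>UNIV. \<bar>z $ i\<bar>)" by (rule norm_le_l1_cart)
 also have "\<dots> \<le> (\<Sum>i\<in>UNIV. \<bar>real_of_int (fl z $ i)\<bar> + 1)"
  by (intro sum_mono) (simp add: fl_def, linarith)
 finally have "1 + norm z \<le> mag (fl z) + ?n" by (simp add: mag_def sum.distrib)
 also have "\<dots> \<le> (?n + 1) * mag (fl z)" using mag_ge_1[of "fl z"] by (simp add: algebra_simps mult_le_cancel_left1)
 finally show "1 + norm z \<le> (?n + 1) * mag (fl z)" .
qed

lemma in_piece_vbox:
 assumes "idx \<delta> (fl z) = p"
 shows "z \<in> vbox (ctr \<delta> p) (real (rad \<delta> (fst p)))"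
proof -
 let ?R = "rad \<delta> (lev (fl z))"
 have R: "0 < int ?R" using rad_ge_1[of \<delta> "lev (fl z)"] by simp
 have "real ?R * real_of_int (\<lfloor>z $ i\<rfloor> div int ?R) \<le> z $ i \<and> z $ i \<le> real ?R * real_of_int (\<lfloor>z $ i\<rfloor> div int ?R) + real ?R" for i
 proof -
  let ?f = "\<lfloor>z $ i\<rfloor>"
  have "int ?R * (?f div int ?R) + ?f mod int ?R = ?f" by simp
  \<comment> \<open>The remainder is at most R - 1, so the whole unit cube above the floor stays
    below the upper face of the box.\<close>
  moreover have "0 \<le> ?f mod int ?R" "?f mod int ?R \<le> int ?R - 1" using R by (auto simp: pos_mod_bound zle_diff1_eq)
  ultimately have "int ?R * (?f div int ?R) \<le> ?f" "?f + 1 \<le> int ?R * (?f div int ?R) + int ?R" by linarith+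
  then have "real_of_int (int ?R * (?f div int ?R)) \<le> real_of_int ?f" "real_of_int (?f + 1) \<le> real_of_int (int ?R * (?f div int ?R) + int ?R)"
   by (simp_all only: of_int_le_iff)
  then show ?thesis by simp linarith
 qed
 then show ?thesis using assms by (auto simp: vbox_def ctr_def idx_def fl_def)
qed

text \<open>The side of the box is at most 2^(j \<delta>). Where this is small against 2^j, the
  variation of |z| over the box is harmless; elsewhere \<delta> < 1 forces 2^j below a fixed
  constant.\<close>

lemma box_comparable:
 assumes \<delta>: "0 \<le> \<delta>" "\<delta> < 1"
 shows "\<exists>\<kappa>\<ge>1. \<forall>k::int^'n. \<forall>z\<in>vbox (ctr \<delta> (idx \<delta> k)) (real (rad \<delta> (lev k))). 1 + norm z \<le> \<kappa> * 2 ^ lev k \<and> 2 ^ lev k \<le> \<kappa> * (1 + norm z)"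
proof -
 let ?n = "real CARD('n)"
 define Q where "Q = 2 * ?n * (?n + 1)"
 have n1: "1 \<le> ?n" using zero_less_card_finite[where 'a='n] by linarith
 have Q: "Q > 0" unfolding Q_def using n1 by simp
 \<comment> \<open>The middle summand serves the upper bound and, where Q R \<le> 2^j, the lower
   bound; the last one covers the low levels with Q R > 2^j, and the first gives \<kappa> \<ge>
   1.\<close>
 define \<kappa> where "\<kappa> = 1 + 3 * (?n + 1) + Q powr (1 / (1 - \<delta>))"
 have k1: "1 \<le> \<kappa>" unfolding \<kappa>_def by simp
 show ?thesis
 proof (intro exI[of _ \<kappa>] conjI k1 allI ballI)
  fix k :: "int^'n" and z assume z: "z \<in> vbox (ctr \<delta> (idx \<delta> k)) (real (rad \<delta> (lev k)))"
  let ?R = "real (rad \<delta> (lev k))" and ?X = "2 ^ lev k :: real"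
  have X1: "1 \<le> ?X" by simp
  define z0 where "z0 = iv k"
  have z0: "z0 \<in> vbox (ctr \<delta> (idx \<delta> k)) ?R"
   using in_piece_vbox[of \<delta> z0 "idx \<delta> k"] by (simp add: z0_def idx_def)
  have "norm (z - z0) \<le> (\<Sum>i\<in>UNIV. \<bar>(z - z0) $ i\<bar>)" by (rule norm_le_l1_cart)
  also have "\<dots> \<le> (\<Sum>i\<in>(UNIV::'n set). ?R)"
  proof (rule sum_mono)
   fix i
   have "ctr \<delta> (idx \<delta> k) $ i \<le> z $ i" "z $ i \<le> ctr \<delta> (idx \<delta> k) $ i + ?R" "ctr \<delta> (idx \<delta> k) $ i \<le> z0 $ i" "z0 $ i \<le> ctr \<delta> (idx \<delta> k) $ i + ?R"
    using z z0 by (auto simp: vbox_def)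
   then show "\<bar>(z - z0) $ i\<bar> \<le> ?R" by simp
  qed
  finally have d: "norm (z - z0) \<le> ?n * ?R" by simp
  have mg: "mag (fl z0) = mag k" by (simp add: z0_def)
  have Rd: "?R \<le> 2 powr (real (lev k) * \<delta>)" by (rule rad_bounds[OF \<delta>(1)])
  also have "\<dots> \<le> 2 powr real (lev k)" using \<delta> by (intro powr_mono) (auto intro: mult_left_le)
  finally have RX: "?R \<le> ?X" by (simp add: powr_realpow)
  have "norm z \<le> norm z0 + norm (z - z0)" by (metis add.commute diff_add_cancel norm_triangle_ineq)
  then have "1 + norm z \<le> (1 + norm z0) + ?n * ?R" using d by linarith
  also have "\<dots> \<le> (?n + 1) * (2 * ?X) + ?n * ?X"
   using mag_norm(2)[of z0] lev_bounds(2)[of k] n1 RX unfolding mg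
   by (intro add_mono mult_left_mono) (auto intro: order_trans[OF _ mult_left_mono])
  also have "\<dots> \<le> 3 * (?n + 1) * ?X" by (simp add: algebra_simps)
  also have "\<dots> \<le> \<kappa> * ?X" unfolding \<kappa>_def by (intro mult_right_mono) auto
  finally show "1 + norm z \<le> \<kappa> * ?X" .
  have "norm z0 \<le> norm z + norm (z - z0)" by (metis add.commute diff_add_cancel norm_minus_commute norm_triangle_ineq)
  then have "1 + norm z0 \<le> (1 + norm z) + ?n * ?R" using d by linarith
  then have "(?n + 1) * (1 + norm z0) \<le> (?n + 1) * ((1 + norm z) + ?n * ?R)" using n1 by (intro mult_left_mono) auto
  moreover have "?X \<le> (?n + 1) * (1 + norm z0)" using mag_norm(1)[of z0] lev_bounds(1)[of k] unfolding mg by linarith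
  ultimately have low: "?X \<le> (?n + 1) * (1 + norm z) + (?n * (?n + 1)) * ?R" by (simp add: algebra_simps)
  have Q2: "Q * ?R = 2 * ((?n * (?n + 1)) * ?R)" unfolding Q_def by simp
  show "?X \<le> \<kappa> * (1 + norm z)"
  proof (cases "Q * ?R \<le> ?X")
   case True
   then have "?X \<le> 2 * (?n + 1) * (1 + norm z)" using low unfolding Q2 by (simp only: mult.assoc)
   also have "\<dots> \<le> \<kappa> * (1 + norm z)" unfolding \<kappa>_def by (intro mult_right_mono) auto
   finally show ?thesis .
  next
   case False
   then have "2 powr real (lev k) < Q * ?R" by (simp add: powr_realpow)
   also have "\<dots> \<le> Q * 2 powr (real (lev k) * \<delta>)" using Rd Q by (intro mult_left_mono) auto
   finally have "2 powr (real (lev k) * (1 - \<delta>)) < Q"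
    by (simp add: powr_diff right_diff_distrib divide_less_eq)
   then have "(2 powr (real (lev k) * (1 - \<delta>))) powr (1 / (1 - \<delta>)) < Q powr (1 / (1 - \<delta>))"
    using \<delta> by (intro powr_less_mono2) auto
   then have "?X < Q powr (1 / (1 - \<delta>))" using \<delta> by (simp add: powr_powr powr_realpow)
   also have "\<dots> \<le> \<kappa> * 1" unfolding \<kappa>_def using n1 by simp
   also have "\<dots> \<le> \<kappa> * (1 + norm z)" using k1 by (intro mult_left_mono) auto
   finally show ?thesis by simp
  qed
 qed
qed

text \<open>Any two admissible exponents differ by at most the binary logarithm of A^2.\<close>

lemma card_near_le:
 fixes A t :: real
 assumes A: "1 \<le> A" and t: "0 < t"
 shows "finite {j::nat. t \<le> A * 2 ^ j \<and> 2 ^ j \<le> A * t}" (is "finite ?S")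
  and "real (card {j::nat. t \<le> A * 2 ^ j \<and> 2 ^ j \<le> A * t}) \<le> log 2 (A * A) + 1"
proof -
 have bd: "real j' \<le> real j + log 2 (A * A)" if "j \<in> ?S" "j' \<in> ?S" for j j'
 proof -
  have "2 ^ j' \<le> A * (A * 2 ^ j)" using that A by (auto intro: order_trans[OF _ mult_left_mono])
  then have "2 powr real j' \<le> (A * A) * 2 powr real j" by (simp add: powr_realpow mult.assoc)
  then have "log 2 (2 powr real j') \<le> log 2 ((A * A) * 2 powr real j)" using A by (subst log_le_cancel_iff) auto
  then show ?thesis using A by (simp add: log_mult)
 qed
 show fin: "finite ?S"
 proof (cases "?S = {}")
  case False
  then obtain j where j: "j \<in> ?S" by blast
  have "?S \<subseteq> {..nat \<lceil>real j + log 2 (A * A)\<rceil>}"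
  proof
   fix j' assume "j' \<in> ?S"
   from bd[OF j this] show "j' \<in> {..nat \<lceil>real j + log 2 (A * A)\<rceil>}" by (simp, linarith)
  qed
  then show ?thesis by (rule finite_subset) simp
 next
  case True then show ?thesis by (simp only: finite.emptyI)
 qed
 have A2: "0 \<le> log 2 (A * A)" using A mult_mono[OF A A] by simp
 show "real (card ?S) \<le> log 2 (A * A) + 1"
 proof (cases "?S = {}")
  case False
  define a where "a = Min ?S"
  have a: "a \<in> ?S" "\<And>j. j \<in> ?S ==> a \<le> j" using Min_in[OF fin False] Min_le[OF fin] unfolding a_def by blast+
  have "?S \<subseteq> {a..a + nat \<lfloor>log 2 (A * A)\<rfloor>}"
  proof
   fix j assume j: "j \<in> ?S"
   from bd[OF a(1) j] a(2)[OF j] show "j \<in> {a..a + nat \<lfloor>log 2 (A * A)\<rfloor>}" by (simp, linarith)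
  qed
  then have "card ?S \<le> card {a..a + nat \<lfloor>log 2 (A * A)\<rfloor>}" by (intro card_mono) auto
  also have "\<dots> = nat \<lfloor>log 2 (A * A)\<rfloor> + 1" by simp
  finally show ?thesis using A2 by linarith
 next
  case True
  show ?thesis unfolding True using A2 by simp
 qed
qed

text \<open>If 1 + |\<xi>| and 2^j are not comparable, the distance from \<xi> to the corner is at
  least of order 2^j. Divided by the side, at most 2^(j \<delta>), and squared, it grows like 2^(2
  (1 - \<delta>) j).\<close>

lemma far_box:
 assumes \<delta>: "0 \<le> \<delta>" "\<delta> < 1"
 shows "\<exists>A\<ge>1. \<exists>a>0. \<forall>(k::int^'n) \<xi>. (1 + norm \<xi> \<le> A * 2 ^ lev k \<and> 2 ^ lev k \<le> A * (1 + norm \<xi>)) \<or>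
   a * (2 powr (2 * (1 - \<delta>))) ^ lev k \<le> wgt (ctr \<delta> (idx \<delta> k)) (real (rad \<delta> (lev k))) \<xi>"
proof -
 obtain \<kappa> where \<kappa>: "\<kappa> \<ge> 1" and comp: "\<And>(k::int^'n) z. z \<in> vbox (ctr \<delta> (idx \<delta> k)) (real (rad \<delta> (lev k))) ==> 1 + norm z \<le> \<kappa> * 2 ^ lev k \<and> 2 ^ lev k \<le> \<kappa> * (1 + norm z)"
  using box_comparable[OF \<delta>, where 'n='n] by blast
 \<comment> \<open>Twice the comparability constant of the box, so that \<xi> and the corner are
   separated by a fixed proportion of 2^j.\<close>
 define A where "A = 2 * \<kappa>"
 define a where "a = 1 / (2 * \<kappa>)\<^sup>2"
 have a: "a > 0" unfolding a_def using \<kappa> by simp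
 have A: "A \<ge> 1" unfolding A_def using \<kappa> by simp
 show ?thesis
 proof (rule exI[of _ A], rule conjI[OF A], rule exI[of _ a], rule conjI[OF a], intro allI)
  fix k :: "int^'n" and \<xi> :: "real^'n"
  let ?c = "ctr \<delta> (idx \<delta> k)" and ?R = "real (rad \<delta> (lev k))" and ?X = "2 ^ lev k :: real"
  have R: "?R \<ge> 1" using rad_ge_1[of \<delta> "lev k"] by simp
  have "?c \<in> vbox ?c ?R" using R by (simp add: vbox_def)
  from comp[OF this] have c: "1 + norm ?c \<le> \<kappa> * ?X" "?X \<le> \<kappa> * (1 + norm ?c)" by auto
  have X: "?X \<ge> 1" by simp
  show "(1 + norm \<xi> \<le> A * ?X \<and> ?X \<le> A * (1 + norm \<xi>)) \<or> a * (2 powr (2 * (1 - \<delta>))) ^ lev k \<le> wgt ?c ?R \<xi>"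
  proof (cases "1 + norm \<xi> \<le> A * ?X \<and> ?X \<le> A * (1 + norm \<xi>)")
   case False
   have d: "?X / (2 * \<kappa>) \<le> norm (\<xi> - ?c)"
   proof (cases "1 + norm \<xi> \<le> A * ?X")
    case True
    with False have "A * (1 + norm \<xi>) < ?X" by simp
    then have 1: "1 + norm \<xi> < ?X / (2 * \<kappa>)" unfolding A_def using \<kappa> by (simp add: pos_less_divide_eq mult.commute)
    have 2: "?X / \<kappa> \<le> 1 + norm ?c" using c(2) \<kappa> by (simp add: pos_divide_le_eq mult.commute)
    have 3: "?X / \<kappa> = ?X / (2 * \<kappa>) + ?X / (2 * \<kappa>)" using \<kappa> by (simp add: field_simps)
    have "norm ?c - norm \<xi> \<le> norm (\<xi> - ?c)" by (metis norm_minus_commute norm_triangle_ineq2)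
    then show ?thesis using 1 2 3 by linarith
   next
    case F: False
    then have 1: "2 * (\<kappa> * ?X) < 1 + norm \<xi>" unfolding A_def by simp
    have "?X * 1 \<le> ?X * (\<kappa> * (2 * \<kappa>))" using X mult_mono[of 1 \<kappa> 1 "2 * \<kappa>"] \<kappa> by (intro mult_left_mono) auto
    then have 2: "?X / (2 * \<kappa>) \<le> \<kappa> * ?X" using \<kappa> by (simp add: pos_divide_le_eq mult_ac)
    have "norm \<xi> - norm ?c \<le> norm (\<xi> - ?c)" by (rule norm_triangle_ineq2)
    then show ?thesis using 1 2 c(1) by linarith
   qed
   have "(?X / (2 * \<kappa>))\<^sup>2 / ?R\<^sup>2 \<le> (norm (\<xi> - ?c))\<^sup>2 / ?R\<^sup>2"
    using d \<kappa> by (intro divide_right_mono power_mono) auto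
   then have "(?X / (2 * \<kappa>))\<^sup>2 / ?R\<^sup>2 \<le> wgt ?c ?R \<xi>" unfolding wgt_def by linarith
   moreover have "a * (2 powr (2 * (1 - \<delta>))) ^ lev k \<le> (?X / (2 * \<kappa>))\<^sup>2 / ?R\<^sup>2"
   proof -
    have Rp: "?R\<^sup>2 \<le> (2 powr (real (lev k) * \<delta>))\<^sup>2" using rad_bounds(1)[OF \<delta>(1), of "lev k"] R by (intro power_mono) auto
    have R2: "0 < ?R\<^sup>2" using R by simp
    have e1: "(2 powr (2 * (1 - \<delta>))) ^ lev k = 2 powr (2 * (1 - \<delta>) * real (lev k))"
     by (simp add: powr_realpow[symmetric] powr_powr)
    have e2: "?X\<^sup>2 = 2 powr (2 * real (lev k))" by (simp add: powr_realpow[symmetric] powr_powr mult.commute)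
    have e3: "(2 powr (real (lev k) * \<delta>))\<^sup>2 = 2 powr (2 * real (lev k) * \<delta>)" by (simp add: power2_eq_square powr_add[symmetric] mult_ac)
    have "(2 powr (2 * (1 - \<delta>))) ^ lev k * ?R\<^sup>2 \<le> (2 powr (2 * (1 - \<delta>))) ^ lev k * (2 powr (real (lev k) * \<delta>))\<^sup>2"
     by (intro mult_left_mono Rp) simp
    also have "\<dots> = ?X\<^sup>2" unfolding e1 e2 e3 powr_add[symmetric] by (simp add: algebra_simps)
    finally have "(2 powr (2 * (1 - \<delta>))) ^ lev k \<le> ?X\<^sup>2 / ?R\<^sup>2" using R2 by (simp add: pos_le_divide_eq)
    then have "a * (2 powr (2 * (1 - \<delta>))) ^ lev k \<le> a * (?X\<^sup>2 / ?R\<^sup>2)" using a by (intro mult_left_mono) auto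
    then show ?thesis unfolding a_def by (simp add: power_divide)
   qed
   ultimately show ?thesis by linarith
  qed simp
 qed
qed

text \<open>One of the n + 1 powers of the weight controls the levels: boundedly many are near the
  size of \<xi>, the others form a geometric series. The remaining n powers are summed over the grid
  positions of a level by \<open>lattice_sum_le\<close>.\<close>

lemma counting:
 assumes \<delta>: "0 \<le> \<delta>" "\<delta> < 1"
 shows "\<exists>D>0. \<forall>\<xi>::real^'n. (\<integral>\<^sup>+p. ennreal (1 / wgt (ctr \<delta> p) (real (rad \<delta> (fst p))) \<xi> ^ (CARD('n) + 1)) \<partial>count_space (range (idx \<delta>))) \<le> ennreal D"
proof -
 obtain A a where A: "A \<ge> 1" and a: "a > 0" and far: "\<And>(k::int^'n) \<xi>. (1 + norm \<xi> \<le> A * 2 ^ lev k \<and> 2 ^ lev k \<le> A * (1 + norm \<xi>)) \<or>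
   a * (2 powr (2 * (1 - \<delta>))) ^ lev k \<le> wgt (ctr \<delta> (idx \<delta> k)) (real (rad \<delta> (lev k))) \<xi>"
  using far_box[OF \<delta>, where 'n='n] by blast
 define x where "x = 1 / (2 powr (2 * (1 - \<delta>)))"
 have x: "0 < x" "x < 1" unfolding x_def using \<delta> by (auto simp: divide_less_eq)
 define near where "near \<xi> j \<longleftrightarrow> 1 + norm \<xi> \<le> A * 2 ^ j \<and> 2 ^ j \<le> A * (1 + norm \<xi>)" for \<xi> :: "real^'n" and j :: nat
 \<comment> \<open>A majorant of one factor 1 / \<open>wgt\<close> that depends on the level alone:
   1 on near levels, geometrically small elsewhere.\<close>
 define h where "h \<xi> j = indicator {j. near \<xi> j} j + 1 / a * x ^ j" for \<xi> :: "real^'n" and j :: nat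
 have h0: "0 \<le> h \<xi> j" for \<xi> j using a x by (simp add: h_def)
 let ?y = "%\<xi> j. \<chi> i. \<xi> $ i / real (rad \<delta> j)"
 let ?P = "%\<xi> j (l::int^'n). \<Prod>i\<in>UNIV. 1 / (1 + (?y \<xi> j $ i - real_of_int (l $ i))\<^sup>2)"
 have pos: "0 < 1 + t\<^sup>2" for t :: real using zero_le_power2[of t] by linarith
 have P0: "0 \<le> ?P \<xi> j l" for \<xi> j l using pos by (intro prod_nonneg) (auto intro: less_imp_le)
 have pt: "1 / wgt (ctr \<delta> p) (real (rad \<delta> (fst p))) \<xi> ^ (CARD('n) + 1) \<le> h \<xi> (fst p) * ?P \<xi> (fst p) (snd p)"
  if "p \<in> range (idx \<delta>)" for p \<xi>
 proof -
  obtain k where k: "p = idx \<delta> k" using \<open>p \<in> range (idx \<delta>)\<close> by blast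
  have fp: "fst p = lev k" by (simp add: k idx_def)
  let ?w = "wgt (ctr \<delta> p) (real (rad \<delta> (fst p))) \<xi>"
  have R: "0 < real (rad \<delta> (fst p))" using rad_ge_1[of \<delta> "fst p"] by simp
  have w1: "1 \<le> ?w" by (rule wgt_ge_1)
  have e: "(\<xi> $ i - ctr \<delta> p $ i) / real (rad \<delta> (fst p)) = ?y \<xi> (fst p) $ i - real_of_int (snd p $ i)" for i
   using R by (simp add: ctr_def diff_divide_distrib)
  have a1: "1 / ?w ^ CARD('n) \<le> ?P \<xi> (fst p) (snd p)"
   using wgt_power_ge_prod[OF R, of "ctr \<delta> p" \<xi>] unfolding e .
  have a2: "1 / ?w \<le> h \<xi> (fst p)"
  proof (cases "near \<xi> (fst p)")
   case True
   have "1 / ?w \<le> 1" using w1 by (simp add: divide_le_eq)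
   also have "1 \<le> h \<xi> (fst p)" using True a x by (simp add: h_def)
   finally show ?thesis .
  next
   case False
   then have "a * (2 powr (2 * (1 - \<delta>))) ^ lev k \<le> ?w"
    using far[of \<xi> k] unfolding near_def fp k[symmetric] by blast
   then have "1 / ?w \<le> 1 / (a * (2 powr (2 * (1 - \<delta>))) ^ lev k)"
    using a w1 by (intro divide_left_mono) (auto intro!: mult_pos_pos)
   also have "\<dots> = 1 / a * x ^ fst p" unfolding x_def fp by (simp add: power_one_over divide_inverse power_inverse)
   also have "\<dots> \<le> h \<xi> (fst p)" by (simp add: h_def)
   finally show ?thesis .
  qed
  have "1 / ?w ^ (CARD('n) + 1) = 1 / ?w * (1 / ?w ^ CARD('n))" by simp
  also have "\<dots> \<le> h \<xi> (fst p) * ?P \<xi> (fst p) (snd p)"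
   using a1 a2 w1 h0 by (intro mult_mono) auto
  finally show ?thesis .
 qed
 let ?Q = "(3 * cauchy_mass) ^ CARD('n)"
 have Qfin: "?Q < \<top>" using cauchy_mass_finite by (simp add: ennreal_mult_less_top power_less_top_ennreal)
 have hsum: "(\<integral>\<^sup>+j. ennreal (h \<xi> j) \<partial>count_space UNIV) \<le> ennreal (log 2 (A * A) + 1 + 1 / a * (1 / (1 - x)))" for \<xi>
 proof -
  have fin: "finite {j. near \<xi> j}" and cd: "real (card {j. near \<xi> j}) \<le> log 2 (A * A) + 1"
   unfolding near_def using card_near_le[OF A, of "1 + norm \<xi>"] by (auto simp: add_pos_nonneg)
  have "(\<integral>\<^sup>+j. ennreal (h \<xi> j) \<partial>count_space UNIV) = (\<integral>\<^sup>+j. indicator {j. near \<xi> j} j + ennreal (1 / a * x ^ j) \<partial>count_space UNIV)"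
   unfolding h_def using a x by (intro nn_integral_cong) (auto simp: ennreal_plus indicator_def)
  also have "\<dots> = (\<integral>\<^sup>+j. indicator {j. near \<xi> j} j \<partial>count_space UNIV) + (\<integral>\<^sup>+j. ennreal (1 / a * x ^ j) \<partial>count_space UNIV)"
   by (rule nn_integral_add) auto
  also have "(\<integral>\<^sup>+j. indicator {j. near \<xi> j} j \<partial>count_space UNIV) = ennreal (real (card {j. near \<xi> j}))"
   using fin by (simp add: ennreal_of_nat_eq_real_of_nat)
  also have "(\<integral>\<^sup>+j. ennreal (1 / a * x ^ j) \<partial>count_space UNIV) = (\<Sum>j. ennreal (1 / a * x ^ j))"
   by (rule nn_integral_count_space_nat)
  also have "\<dots> = ennreal (1 / a * (1 / (1 - x)))"
   using a x by (intro suminf_ennreal_eq sums_mult geometric_sums) auto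
  also have "ennreal (real (card {j. near \<xi> j})) + ennreal (1 / a * (1 / (1 - x))) = ennreal (real (card {j. near \<xi> j}) + 1 / a * (1 / (1 - x)))"
   using a x by (intro ennreal_plus[symmetric]) auto
  also have "\<dots> \<le> ennreal (log 2 (A * A) + 1 + 1 / a * (1 / (1 - x)))"
   using cd by (intro ennreal_leI) auto
  finally show ?thesis .
 qed
 let ?B = "ennreal (log 2 (A * A) + 1 + 1 / a * (1 / (1 - x))) * ?Q"
 have Bfin: "?B < \<top>" using Qfin by (simp add: ennreal_mult_less_top)
 then obtain B where B: "0 \<le> B" "?B = ennreal B" by (auto simp: less_top_ennreal)
 have main: "(\<integral>\<^sup>+p. ennreal (1 / wgt (ctr \<delta> p) (real (rad \<delta> (fst p))) \<xi> ^ (CARD('n) + 1)) \<partial>count_space (range (idx \<delta>))) \<le> ?B" for \<xi> :: "real^'n"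
 proof -
  have "(\<integral>\<^sup>+p. ennreal (1 / wgt (ctr \<delta> p) (real (rad \<delta> (fst p))) \<xi> ^ (CARD('n) + 1)) \<partial>count_space (range (idx \<delta>)))
   \<le> (\<integral>\<^sup>+p. ennreal (h \<xi> (fst p) * ?P \<xi> (fst p) (snd p)) \<partial>count_space (range (idx \<delta>)))"
   by (intro nn_integral_mono ennreal_leI pt) simp
  also have "\<dots> \<le> (\<integral>\<^sup>+p. ennreal (h \<xi> (fst p) * ?P \<xi> (fst p) (snd p)) \<partial>count_space UNIV)"
   by (subst nn_integral_count_space_indicator) (auto intro!: nn_integral_mono simp: indicator_def)
  also have "\<dots> = (\<integral>\<^sup>+j. \<integral>\<^sup>+l. ennreal (h \<xi> j * ?P \<xi> j l) \<partial>count_space UNIV \<partial>count_space UNIV)"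
   by (subst nn_integral_fst_count_space[symmetric]) simp
  also have "\<dots> = (\<integral>\<^sup>+j. ennreal (h \<xi> j) * (\<integral>\<^sup>+l. ennreal (?P \<xi> j l) \<partial>count_space UNIV) \<partial>count_space UNIV)"
  proof (rule nn_integral_cong)
   fix j
   have "(\<integral>\<^sup>+l. ennreal (h \<xi> j * ?P \<xi> j l) \<partial>count_space UNIV) = (\<integral>\<^sup>+l. ennreal (h \<xi> j) * ennreal (?P \<xi> j l) \<partial>count_space UNIV)"
    by (intro nn_integral_cong ennreal_mult h0 P0)
   then show "(\<integral>\<^sup>+l. ennreal (h \<xi> j * ?P \<xi> j l) \<partial>count_space UNIV) = ennreal (h \<xi> j) * (\<integral>\<^sup>+l. ennreal (?P \<xi> j l) \<partial>count_space UNIV)"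
    by (simp only: nn_integral_cmult borel_measurable_count_space)
  qed
  also have "\<dots> \<le> (\<integral>\<^sup>+j. ennreal (h \<xi> j) * ?Q \<partial>count_space UNIV)"
   by (intro nn_integral_mono mult_left_mono lattice_sum_le) simp
  also have "\<dots> = (\<integral>\<^sup>+j. ennreal (h \<xi> j) \<partial>count_space UNIV) * ?Q"
   by (rule nn_integral_multc) simp
  also have "\<dots> \<le> ?B" by (intro mult_right_mono hsum) simp
  finally show ?thesis .
 qed
 show ?thesis
 proof (intro exI[of _ "B + 1"] conjI allI)
  show "B + 1 > 0" using B by simp
  show "(\<integral>\<^sup>+p. ennreal (1 / wgt (ctr \<delta> p) (real (rad \<delta> (fst p))) \<xi> ^ (CARD('n) + 1)) \<partial>count_space (range (idx \<delta>))) \<le> ennreal (B + 1)" for \<xi> :: "real^'n"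
   by (rule order_trans[OF main[of \<xi>, unfolded B(2)]]) (intro ennreal_leI, simp)
 qed
qed

section \<open>Directional derivatives, Schwartz functions and their Fourier transforms\<close>

text \<open>The chain rule that leads from \<open>frechet_derivative\<close>, on which
  \<open>dderiv\<close> rests, to one-variable derivatives along a curve, the form in which
  derivatives enter the estimates.\<close>

lemma dderiv_has_vector_derivative:
 assumes d: "g differentiable (at (h s))" and h: "(h has_vector_derivative v) (at s)"
 shows "((%s. g (h s)) has_vector_derivative dderiv v g (h s)) (at s)"
proof -
 have "(g has_derivative frechet_derivative g (at (h s))) (at (h s))"
  using d by (simp add: frechet_derivative_works)
 then have "(g has_derivative frechet_derivative g (at (h s))) (at (h s) within range h)"
  by (rule has_derivative_at_withinI)
 from diff_chain_at[OF h[unfolded has_vector_derivative_def] \<open>(g has_derivative frechet_derivative g (at (h s))) (at (h s))\<close>]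
 have "((%s. g (h s)) has_derivative (%x. frechet_derivative g (at (h s)) (x *\<^sub>R v))) (at s)"
  by (simp add: o_def)
 moreover have "linear (frechet_derivative g (at (h s)))" using d by (rule linear_frechet_derivative)
 ultimately show ?thesis unfolding has_vector_derivative_def dderiv_def by (simp add: linear_cmul)
qed

lemma upd_has_vector_derivative: "((%s. upd z i s) has_vector_derivative axis i 1) (at s)"
proof -
 define a where "a = upd z i 0"
 have e: "upd z i = (%s. a + s *\<^sub>R axis i 1)"
  by (rule ext) (simp add: a_def vec_eq_iff axis_def)
 have "((%s. a + s *\<^sub>R axis i 1) has_vector_derivative (0 + 1 *\<^sub>R axis i 1)) (at s)"
  unfolding has_vector_derivative_def by (auto intro!: derivative_eq_intros)
 then show ?thesis unfolding e by simp
qed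

lemma smooth_fun_continuous:
 assumes "smooth_fun g"
 shows "continuous_on UNIV (iter_dderiv vs g)"
 using assms unfolding smooth_fun_def
 by (intro differentiable_imp_continuous_on) (auto simp: differentiable_on_def intro: differentiable_at_withinI)

abbreviation partials :: "'n list => (real^'n => complex) => real^'n => complex" where
 "partials is f \<equiv> iter_dderiv (map (%i. axis i 1) is) f"

lemma wgt_0_1_integrable: "integrable lborel (%x::real^'n. 1 / wgt 0 1 x ^ CARD('n))"
proof (rule integrableI_bounded)
 have w: "0 < wgt (0::real^'n) 1 x" for x using wgt_ge_1[of 0 1 x] by linarith
 have "(\<integral>\<^sup>+x. ennreal (norm (1 / wgt (0::real^'n) 1 x ^ CARD('n))) \<partial>lborel) = (\<integral>\<^sup>+x. ennreal (1 / wgt (0::real^'n) 1 x ^ CARD('n)) \<partial>lborel)"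
  using w by (intro nn_integral_cong) (simp add: less_imp_le)
 also have "\<dots> \<le> (ennreal 1 * cauchy_mass) ^ CARD('n)" by (rule wgt_integral) simp
 also have "\<dots> < \<infinity>" using cauchy_mass_finite by (simp add: power_less_top_ennreal)
 finally show "(\<integral>\<^sup>+x. ennreal (norm (1 / wgt (0::real^'n) 1 x ^ CARD('n))) \<partial>lborel) < \<infinity>" .
qed measurable

lemma wgt_0_1_le: "wgt 0 1 x ^ k \<le> (1 + norm x) ^ (2 * k)"
proof -
 have "wgt 0 1 x \<le> (1 + norm x)\<^sup>2" by (simp add: wgt_def power2_sum)
 then show ?thesis unfolding power_mult using wgt_ge_1[of 0 1 x] by (intro power_mono) auto
qed

context
 fixes f :: "real^'n => complex"
 assumes f: "schwartz f"
begin

lemma schwartz_smooth: "smooth_fun f"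
 using f by (simp add: schwartz_def)

lemma schwartz_partials_measurable [measurable]: "partials is f \<in> borel_measurable borel"
 by (intro borel_measurable_continuous_onI smooth_fun_continuous schwartz_smooth)

lemma schwartz_partials_integrable: "integrable lborel (partials is f)"
proof -
 obtain C where C: "\<And>x. (1 + norm x) ^ (2 * CARD('n)) * norm (partials is f x) \<le> C"
  using f unfolding schwartz_def by blast
 show ?thesis
 proof (rule Bochner_Integration.integrable_bound)
  show "integrable lborel (%x::real^'n. C * (1 / wgt 0 1 x ^ CARD('n)))"
   by (intro integrable_mult_right wgt_0_1_integrable)
  have "norm (partials is f x) \<le> C * (1 / wgt 0 1 x ^ CARD('n))" for x
  proof -
   have w: "0 < wgt 0 1 x ^ CARD('n)" using wgt_ge_1[of 0 1 x] by simp
   have "wgt 0 1 x ^ CARD('n) * norm (partials is f x) \<le> (1 + norm x) ^ (2 * CARD('n)) * norm (partials is f x)"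
    by (intro mult_right_mono wgt_0_1_le) simp
   also have "\<dots> \<le> C" by (rule C)
   finally show ?thesis using w by (simp add: pos_le_divide_eq mult.commute)
  qed
  then show "AE x in lborel. norm (partials is f x) \<le> norm (C * (1 / wgt 0 1 x ^ CARD('n)))"
   by (intro AE_I2) (metis abs_ge_self order_trans real_norm_def)
 qed measurable
qed

text \<open>Integration by parts through \<open>integral_partial_eq_0\<close>; the partial
  derivatives of a Schwartz function are integrable and continuous.\<close>

lemma fourier_partial:
 "\<i> * complex_of_real (\<xi> $ i) * fourier (partials is f) \<xi> = fourier (partials (i # is) f) \<xi>"
proof -
 let ?G = "%t. cis (- (\<xi> \<bullet> t)) * partials is f t"
 let ?G' = "%t. - (\<i> * complex_of_real (\<xi> $ i)) * ?G t + cis (- (\<xi> \<bullet> t)) * partials (i # is) f t"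
 have ints: "integrable lborel (%t. cis (- (\<xi> \<bullet> t)) * partials js f t)" for js
  by (intro integrable_cis_mult schwartz_partials_integrable) measurable
 have conts: "continuous_on UNIV (partials js f)" for js
  by (rule smooth_fun_continuous[OF schwartz_smooth])
 have cs: "continuous_on UNIV (%t. cis (- (\<xi> \<bullet> t)))" by (intro continuous_intros)
 have "(\<integral>t. ?G' t \<partial>lborel) = 0"
 proof (rule integral_partial_eq_0[of ?G _ i])
  show "integrable lborel ?G" by (rule ints)
  show "integrable lborel ?G'" by (intro Bochner_Integration.integrable_add integrable_mult_right ints)
  show "continuous_on UNIV ?G'" by (intro continuous_on_add continuous_on_mult continuous_on_const conts cs)
  fix t s
  have d2: "((%s. cis (- (\<xi> \<bullet> upd t i s))) has_vector_derivative (- (\<i> * complex_of_real (\<xi> $ i))) * cis (- (\<xi> \<bullet> upd t i s))) (at s)"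
  proof -
   define a where "a = upd t i 0 \<bullet> (- \<xi>)"
   have e: "- (\<xi> \<bullet> upd t i s) = a + s * (- \<xi> $ i)" for s
    unfolding a_def using inner_upd[of t i s "- \<xi>"] by (simp add: inner_commute)
   have k: "- (\<i> * complex_of_real (\<xi> $ i)) = \<i> * complex_of_real (- \<xi> $ i)" by simp
   show ?thesis unfolding e k by (rule has_vector_derivative_cis_affine)
  qed
  have d1: "((%s. partials is f (upd t i s)) has_vector_derivative partials (i # is) f (upd t i s)) (at s)"
   using dderiv_has_vector_derivative[OF _ upd_has_vector_derivative, of "partials is f" t i s] schwartz_smooth
   by (simp add: smooth_fun_def)
  have "((%s. ?G (upd t i s)) has_vector_derivative 
    cis (- (\<xi> \<bullet> upd t i s)) * partials (i # is) f (upd t i s) + ((- (\<i> * complex_of_real (\<xi> $ i))) * cis (- (\<xi> \<bullet> upd t i s))) * partials is f (upd t i s)) (at s)"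
   by (rule has_vector_derivative_mult[OF d2 d1])
  then show "((%s. ?G (upd t i s)) has_vector_derivative ?G' (upd t i s)) (at s)"
   by (rule has_vector_derivative_eq_rhs) (simp only: mult.assoc add.commute)
 qed
 also have "(\<integral>t. ?G' t \<partial>lborel) = - (\<i> * complex_of_real (\<xi> $ i)) * fourier (partials is f) \<xi> + fourier (partials (i # is) f) \<xi>"
  unfolding fourier_def by (simp only: Bochner_Integration.integral_add integrable_mult_right ints integral_mult_right_zero)
 finally show ?thesis by (simp add: algebra_simps)
qed

lemma fourier_power:
 "(\<i> * complex_of_real (\<xi> $ i)) ^ M * fourier f \<xi> = fourier (partials (replicate M i) f) \<xi>"
proof (induction M)
 case (Suc M)
 have "(\<i> * complex_of_real (\<xi> $ i)) ^ Suc M * fourier f \<xi> = \<i> * complex_of_real (\<xi> $ i) * ((\<i> * complex_of_real (\<xi> $ i)) ^ M * fourier f \<xi>)"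
  by (simp only: power_Suc mult.assoc)
 also have "\<dots> = fourier (partials (i # replicate M i) f) \<xi>"
  unfolding Suc.IH by (rule fourier_partial)
 finally show ?case by (simp only: replicate_Suc)
qed simp

lemma norm_fourier_le: "norm (fourier (partials is f) \<xi>) \<le> (\<integral>x. norm (partials is f x) \<partial>lborel)"
 unfolding fourier_def by (rule order_trans[OF integral_norm_bound]) (simp add: norm_mult)

text \<open>Powers of 1 + |\<xi>| are reduced to pure powers of single coordinates, and each of
  these corresponds to an iterated derivative of f, whose transform is bounded by its L^1
  norm.\<close>

lemma fourier_decay: "\<exists>C\<ge>0. \<forall>\<xi>. (1 + norm \<xi>) ^ M * norm (fourier f \<xi>) \<le> C"
proof -
 define I where "I is = (\<integral>x. norm (partials is f x) \<partial>lborel)" for "is"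
 have I0: "0 \<le> I is" for "is" unfolding I_def by simp
 define C where "C = 2 ^ M * real CARD('n) ^ M * (I [] + (\<Sum>i\<in>UNIV. I (replicate M i)))"
 have n1: "1 \<le> real CARD('n) ^ M" using zero_less_card_finite[where 'a='n] by (intro one_le_power) linarith
 show ?thesis
 proof (intro exI[of _ C] conjI allI)
  show "0 \<le> C" unfolding C_def using I0 by (intro mult_nonneg_nonneg add_nonneg_nonneg sum_nonneg) auto
  fix \<xi> :: "real^'n"
  have comp: "\<bar>\<xi> $ i\<bar> ^ M * norm (fourier f \<xi>) \<le> I (replicate M i)" for i
  proof -
   have "\<bar>\<xi> $ i\<bar> ^ M * norm (fourier f \<xi>) = norm ((\<i> * complex_of_real (\<xi> $ i)) ^ M * fourier f \<xi>)"
    by (simp add: norm_mult norm_power)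
   also have "\<dots> \<le> I (replicate M i)" unfolding fourier_power I_def by (rule norm_fourier_le)
   finally show ?thesis .
  qed
  have c0: "norm (fourier f \<xi>) \<le> I []" using norm_fourier_le[of "[]" \<xi>] by (simp add: I_def)
  have "(1 + norm \<xi>) ^ M \<le> 2 ^ M * (1 ^ M + norm \<xi> ^ M)" by (rule power_add_le) auto
  also have "norm \<xi> ^ M \<le> (\<Sum>i\<in>UNIV. \<bar>\<xi> $ i\<bar>) ^ M" by (intro power_mono norm_le_l1_cart) auto
  also have "\<dots> \<le> real CARD('n) ^ M * (\<Sum>i\<in>UNIV. \<bar>\<xi> $ i\<bar> ^ M)" by (rule power_sum_le) auto
  also have "(1::real) ^ M + real CARD('n) ^ M * (\<Sum>i\<in>UNIV. \<bar>\<xi> $ i\<bar> ^ M) \<le> real CARD('n) ^ M * (1 + (\<Sum>i\<in>UNIV. \<bar>\<xi> $ i\<bar> ^ M))"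
   unfolding distrib_left power_one mult_1_right by (intro add_mono n1) simp
  finally have "(1 + norm \<xi>) ^ M \<le> 2 ^ M * (real CARD('n) ^ M * (1 + (\<Sum>i\<in>UNIV. \<bar>\<xi> $ i\<bar> ^ M)))"
   by simp
  then have "(1 + norm \<xi>) ^ M * norm (fourier f \<xi>) \<le> 2 ^ M * (real CARD('n) ^ M * (1 + (\<Sum>i\<in>UNIV. \<bar>\<xi> $ i\<bar> ^ M))) * norm (fourier f \<xi>)"
   by (rule mult_right_mono) simp
  also have "\<dots> = 2 ^ M * real CARD('n) ^ M * (norm (fourier f \<xi>) + (\<Sum>i\<in>UNIV. \<bar>\<xi> $ i\<bar> ^ M * norm (fourier f \<xi>)))"
   unfolding sum_distrib_right[symmetric, where r = "norm (fourier f \<xi>)"] by (simp only: mult.assoc distrib_right mult_1_left)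
  also have "\<dots> \<le> C" unfolding C_def by (intro mult_left_mono add_mono c0 sum_mono comp) auto
  finally show "(1 + norm \<xi>) ^ M * norm (fourier f \<xi>) \<le> C" .
 qed
qed

lemma fourier_measurable [measurable]: "fourier f \<in> borel_measurable borel"
proof -
 have [measurable]: "f \<in> borel_measurable borel" using schwartz_partials_measurable[of "[]"] by simp
 show ?thesis unfolding fourier_def[abs_def] by measurable
qed

lemma stft_gauss_eq_wav: "stft gauss_window g x \<xi> = wav (%t. exp (- (norm t)\<^sup>2)) g x \<xi>" for g :: "real^'n => complex"
 unfolding stft_def wav_def gauss_window_def
 by (intro Bochner_Integration.integral_cong refl) (simp add: cis_cnj)

text \<open>For fixed \<xi> the Fourier transform in x of the short-time Fourier transform is the
  translate by \<xi> of f hat times the Gaussian \<open>heat 1\<close>. Bessel bounds its L^2 norm,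
  and the Gaussian is bounded below at distances occurring within one unit cube.\<close>

lemma local_fourier_le_stft:
 assumes k: "fl \<xi> = k"
 shows "(\<integral>\<^sup>+z. (if fl z = k then ennreal ((norm (fourier f z))\<^sup>2) else 0) \<partial>lborel) \<le>
  ennreal ((2 * pi) ^ CARD('n) / (sqrt pi ^ CARD('n) * exp (- (real CARD('n))\<^sup>2 / 4))\<^sup>2) * (\<integral>\<^sup>+x. ennreal ((norm (stft gauss_window f x \<xi>))\<^sup>2) \<partial>lborel)"
proof -
 let ?g = "%t::real^'n. exp (- (norm t)\<^sup>2)"
 have [measurable]: "f \<in> borel_measurable borel" using schwartz_partials_measurable[of "[]"] by simp
 have fi: "integrable lborel f" using schwartz_partials_integrable[of "[]"] by simp
 have gi: "integrable lborel (%x. complex_of_real (?g x))"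
  using integrable_of_real[OF integrable_gauss_real[of 1, where 'a="real^'n"]] by simp
 let ?W = "%\<eta> x t. cis (- (\<eta> \<bullet> x)) * (complex_of_real (?g (t - x)) * cis (- (\<xi> \<bullet> t)) * f t)"
 have gx: "integrable lborel (%x. complex_of_real (?g (t - x)))" for t
  using lborel_integrable_shift[OF gi, of "- t"] by (simp add: norm_minus_commute)
 have gxi: "(\<integral>x. ?g (t - x) \<partial>lborel) = (\<integral>x. ?g x \<partial>lborel)" for t
  using lborel_integral_shift[of ?g "- t"] by (simp add: norm_minus_commute)
 have pint: "integrable (lborel \<Otimes>\<^sub>M lborel) (%(t, x). ?W \<eta> x t)" for \<eta>
 proof (rule lborel_pair.Fubini_integrable)
  show "(%(t, x). ?W \<eta> x t) \<in> borel_measurable (lborel \<Otimes>\<^sub>M lborel)" by measurable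
  have "(\<integral>x. norm (case (t, x) of (t, x) => ?W \<eta> x t) \<partial>lborel) = norm (f t) * (\<integral>x. ?g x \<partial>lborel)" for t
   unfolding gxi[of t, symmetric] by (simp add: norm_mult mult.commute)
  then show "integrable lborel (%t. \<integral>x. norm (case (t, x) of (t, x) => ?W \<eta> x t) \<partial>lborel)"
   using fi by simp
  show "AE t in lborel. integrable lborel (%x. case (t, x) of (t, x) => ?W \<eta> x t)"
   using gx by (intro AE_I2) (simp, intro integrable_cis_mult integrable_mult_left, auto)
 qed
 have wi: "integrable lborel (%x. wav ?g f x \<xi>)"
  using lborel_pair.integrable_snd[OF pint[of 0]] unfolding wav_def by simp
 have ft: "(\<integral>x. cis (- (\<eta> \<bullet> x)) * wav ?g f x \<xi> \<partial>lborel) = complex_of_real (heat 1 \<eta>) * fourier f (\<xi> + \<eta>)" for \<eta>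
 proof -
  have "(\<integral>x. cis (- (\<eta> \<bullet> x)) * wav ?g f x \<xi> \<partial>lborel) = (\<integral>x. (\<integral>t. ?W \<eta> x t \<partial>lborel) \<partial>lborel)"
   unfolding wav_def by simp
  also have "\<dots> = (\<integral>t. (\<integral>x. ?W \<eta> x t \<partial>lborel) \<partial>lborel)"
   by (rule lborel_pair.Fubini_integral) (rule pint)
  also have "\<dots> = (\<integral>t. complex_of_real (heat 1 \<eta>) * (cis (- ((\<xi> + \<eta>) \<bullet> t)) * f t) \<partial>lborel)"
  proof (intro Bochner_Integration.integral_cong refl)
   fix t
   let ?h = "%y. complex_of_real (exp (- 1 * (norm y)\<^sup>2)) * cis (y \<bullet> \<eta>)"
   have [measurable]: "(%x. cis (- (\<eta> \<bullet> x)) * complex_of_real (?g (t - x))) \<in> borel_measurable borel" by measurable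
   have "(\<integral>x. ?W \<eta> x t \<partial>lborel) = (cis (- (\<xi> \<bullet> t)) * f t) * (\<integral>x. cis (- (\<eta> \<bullet> x)) * complex_of_real (?g (t - x)) \<partial>lborel)"
    by (subst integral_mult_right_zero[symmetric]) (intro Bochner_Integration.integral_cong refl, simp only: mult_ac)
   also have "(\<integral>x. cis (- (\<eta> \<bullet> x)) * complex_of_real (?g (t - x)) \<partial>lborel) = (\<integral>x. cis (- (\<eta> \<bullet> (x + t))) * complex_of_real (?g (t - (x + t))) \<partial>lborel)"
    by (rule lborel_integral_shift[symmetric]) measurable
   also have "\<dots> = (\<integral>x. cis (- (\<eta> \<bullet> t)) * (complex_of_real (exp (- 1 * (norm x)\<^sup>2)) * cis (x \<bullet> (- \<eta>))) \<partial>lborel)"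
    by (intro Bochner_Integration.integral_cong refl) (simp add: inner_add_right inner_commute cis_mult mult_ac)
   also have "\<dots> = cis (- (\<eta> \<bullet> t)) * complex_of_real (heat 1 \<eta>)"
    using gauss_cis_eq_heat[of 1 "- \<eta>"] by (subst integral_mult_right_zero) (simp add: heat_def)
   finally show "(\<integral>x. ?W \<eta> x t \<partial>lborel) = complex_of_real (heat 1 \<eta>) * (cis (- ((\<xi> + \<eta>) \<bullet> t)) * f t)"
   proof -
    assume h: "(\<integral>x. ?W \<eta> x t \<partial>lborel) = cis (- (\<xi> \<bullet> t)) * f t * (cis (- (\<eta> \<bullet> t)) * complex_of_real (heat 1 \<eta>))"
    have "cis (- ((\<xi> + \<eta>) \<bullet> t)) = cis (- (\<xi> \<bullet> t)) * cis (- (\<eta> \<bullet> t))" by (simp add: cis_mult inner_add_left)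
    then show ?thesis unfolding h by (simp only: mult_ac)
   qed
  qed
  also have "\<dots> = complex_of_real (heat 1 \<eta>) * fourier f (\<xi> + \<eta>)" unfolding fourier_def by (rule integral_mult_right_zero)
  finally show ?thesis .
 qed
 let ?m = "sqrt pi ^ CARD('n) * exp (- (real CARD('n))\<^sup>2 / 4)"
 have m: "?m > 0" by simp
 let ?N = "\<integral>\<^sup>+x. ennreal ((norm (stft gauss_window f x \<xi>))\<^sup>2) \<partial>lborel"
 have bes: "(\<integral>\<^sup>+\<eta>. ennreal ((norm (complex_of_real (heat 1 \<eta>) * fourier f (\<xi> + \<eta>)))\<^sup>2) \<partial>lborel) \<le> ennreal ((2 * pi) ^ CARD('n)) * ?N"
  using bessel_fourier_minus[OF wi] unfolding ft stft_gauss_eq_wav by simp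
 have "(\<integral>\<^sup>+z. (if fl z = k then ennreal ((norm (fourier f z))\<^sup>2) else 0) \<partial>lborel) =
   (\<integral>\<^sup>+\<eta>. (if fl (\<eta> + \<xi>) = k then ennreal ((norm (fourier f (\<eta> + \<xi>)))\<^sup>2) else 0) \<partial>lborel)"
  by (rule lborel_nn_integral_shift[symmetric]) measurable
 also have "\<dots> \<le> (\<integral>\<^sup>+\<eta>. ennreal (1 / ?m\<^sup>2) * ennreal ((norm (complex_of_real (heat 1 \<eta>) * fourier f (\<xi> + \<eta>)))\<^sup>2) \<partial>lborel)"
 proof (rule nn_integral_mono)
  fix \<eta> :: "real^'n"
  show "(if fl (\<eta> + \<xi>) = k then ennreal ((norm (fourier f (\<eta> + \<xi>)))\<^sup>2) else 0) \<le> ennreal (1 / ?m\<^sup>2) * ennreal ((norm (complex_of_real (heat 1 \<eta>) * fourier f (\<xi> + \<eta>)))\<^sup>2)"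
  proof (cases "fl (\<eta> + \<xi>) = k")
   case True
   \<comment> \<open>Two points of one unit cube differ by at most 1 in each coordinate, hence by at
     most n in norm; this is the n in the lower bound \<open>?m\<close> of the Gaussian.\<close>
   have "\<bar>\<eta> $ i\<bar> \<le> 1" for i
   proof -
    have "\<lfloor>\<eta> $ i + \<xi> $ i\<rfloor> = \<lfloor>\<xi> $ i\<rfloor>" using True k by (auto simp: fl_def vec_eq_iff)
    then show ?thesis by linarith
   qed
   then have "norm \<eta> \<le> (\<Sum>i\<in>(UNIV::'n set). 1)" by (intro order_trans[OF norm_le_l1_cart] sum_mono)
   then have "norm \<eta> \<le> real CARD('n)" by simp
   then have "(norm \<eta>)\<^sup>2 \<le> (real CARD('n))\<^sup>2" by (intro power_mono) auto
   then have h: "?m \<le> heat 1 \<eta>" unfolding heat_def by (auto intro!: mult_left_mono)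
   have "?m\<^sup>2 * (norm (fourier f (\<eta> + \<xi>)))\<^sup>2 \<le> (norm (complex_of_real (heat 1 \<eta>) * fourier f (\<xi> + \<eta>)))\<^sup>2"
    using power_mono[OF h, of 2] m by (simp add: norm_mult power_mult_distrib add.commute mult_right_mono)
   then have "(norm (fourier f (\<eta> + \<xi>)))\<^sup>2 \<le> 1 / ?m\<^sup>2 * (norm (complex_of_real (heat 1 \<eta>) * fourier f (\<xi> + \<eta>)))\<^sup>2"
    using m by (simp add: pos_le_divide_eq mult.commute)
   then show ?thesis using True by (subst ennreal_mult[symmetric]) (auto intro: ennreal_leI)
  qed simp
 qed
 also have "\<dots> = ennreal (1 / ?m\<^sup>2) * (\<integral>\<^sup>+\<eta>. ennreal ((norm (complex_of_real (heat 1 \<eta>) * fourier f (\<xi> + \<eta>)))\<^sup>2) \<partial>lborel)"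
  by (rule nn_integral_cmult) measurable
 also have "\<dots> \<le> ennreal (1 / ?m\<^sup>2) * (ennreal ((2 * pi) ^ CARD('n)) * ?N)" by (intro mult_left_mono bes) simp
 also have "\<dots> = ennreal ((2 * pi) ^ CARD('n) / ?m\<^sup>2) * ?N"
  by (subst mult.assoc[symmetric], subst ennreal_mult[symmetric]) auto
 finally show ?thesis .
qed

end

section \<open>Decomposing the operator into pieces\<close>

context symbol_boxes
begin

text \<open>The exchange of \<open>wav_osc\<close> for amplitudes of unbounded support, such as the
  full Fourier transform before it is cut: an integrable majorant of symbol times amplitude replaces
  the bounded support.\<close>

lemma
 assumes [measurable]: "H \<in> borel_measurable borel"
  and D: "integrable lborel D" "\<And>t z. norm (A [] bs t z * H z) \<le> D z"
 shows wav_osc_dominated: "wav (pwin i q) (osc bs H) x \<xi> = (\<integral>z. H z * Jint i q bs x \<xi> z \<partial>lborel)"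
  and wav_osc_dominated_integrable: "integrable lborel (%z. H z * Jint i q bs x \<xi> z)"
proof -
 let ?\<Phi> = "%t z. complex_of_real (pwin i q (t - x)) * cis (- (\<xi> \<bullet> t)) * (cis (t \<bullet> z) * A [] bs t z * H z)"
 have D0: "0 \<le> D z" for z using D(2)[of 0 z] norm_ge_zero order_trans by blast
 have pint: "integrable (lborel \<Otimes>\<^sub>M lborel) (%(t, z). ?\<Phi> t z)"
 proof (rule Bochner_Integration.integrable_bound)
  show "integrable (lborel \<Otimes>\<^sub>M lborel) (%(t, z). complex_of_real (pwin i q (t - x)) * complex_of_real (D z))"
   using D(1) by (intro integrable_tensor_lborel pwin_shift_integrable) auto
  show "(%(t, z). ?\<Phi> t z) \<in> borel_measurable (lborel \<Otimes>\<^sub>M lborel)" by measurable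
  have "norm (?\<Phi> t z) \<le> norm (complex_of_real (pwin i q (t - x)) * complex_of_real (D z))" for t z
  proof -
   have "norm (?\<Phi> t z) = \<bar>pwin i q (t - x)\<bar> * norm (A [] bs t z * H z)" by (simp add: norm_mult mult.assoc)
   also have "\<dots> \<le> \<bar>pwin i q (t - x)\<bar> * D z" by (intro mult_left_mono D) auto
   finally show ?thesis using D0[of z] by (simp add: norm_mult)
  qed
  then show "AE p in lborel \<Otimes>\<^sub>M lborel. norm (case p of (t, z) => ?\<Phi> t z) \<le> norm (case p of (t, z) => complex_of_real (pwin i q (t - x)) * complex_of_real (D z))"
   by (intro AE_I2) auto
 qed
 have inner: "(\<integral>t. ?\<Phi> t z \<partial>lborel) = H z * Jint i q bs x \<xi> z" for z
 proof -
  have e: "?\<Phi> t z = H z * (complex_of_real (pwin i q (t - x)) * cis (t \<bullet> (z - \<xi>)) * A [] bs t z)" for t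
  proof -
   have "cis (t \<bullet> (z - \<xi>)) = cis (- (\<xi> \<bullet> t)) * cis (t \<bullet> z)" by (simp add: cis_mult inner_diff_right inner_commute)
   then show ?thesis by (simp only: mult_ac)
  qed
  show ?thesis unfolding e Jint_def by (rule integral_mult_right_zero)
 qed
 have "wav (pwin i q) (osc bs H) x \<xi> = (\<integral>t. (\<integral>z. ?\<Phi> t z \<partial>lborel) \<partial>lborel)"
  unfolding wav_def osc_def by simp
 also have "\<dots> = (\<integral>z. (\<integral>t. ?\<Phi> t z \<partial>lborel) \<partial>lborel)"
  by (rule lborel_pair.Fubini_integral[symmetric]) (rule pint)
 also have "\<dots> = (\<integral>z. H z * Jint i q bs x \<xi> z \<partial>lborel)" unfolding inner ..
 finally show "wav (pwin i q) (osc bs H) x \<xi> = (\<integral>z. H z * Jint i q bs x \<xi> z \<partial>lborel)" .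
 show "integrable lborel (%z. H z * Jint i q bs x \<xi> z)"
  using lborel_pair.integrable_snd[OF pint] unfolding inner by simp
qed

end

lemma ennreal_norm_suminf_le: "ennreal (norm (suminf f)) \<le> (\<Sum>i. ennreal (norm (f i :: complex)))"
proof (cases "(\<Sum>i. ennreal (norm (f i))) = \<top>")
 case False
 then have s: "summable (%i. norm (f i))" by (intro summable_suminf_not_top) auto
 have "ennreal (norm (suminf f)) \<le> ennreal (\<Sum>i. norm (f i))" by (intro ennreal_leI summable_norm s)
 also have "\<dots> = (\<Sum>i. ennreal (norm (f i)))" by (rule suminf_ennreal2[symmetric]) (use s in auto)
 finally show ?thesis .
qed simp

text \<open>Countable additivity of the set integral followed by the triangle inequality;
  \<open>to_nat\<close> turns the labels into indices of a sequence of disjoint sets.\<close>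

lemma norm_integral_partition:
 fixes \<Psi> :: "real^'n => complex" and \<pi> :: "real^'n => 'p::countable"
 assumes int: "integrable lborel \<Psi>" and pm: "\<And>p. {z. \<pi> z = p} \<in> sets borel"
 shows "ennreal (norm (\<integral>z. \<Psi> z \<partial>lborel)) \<le> (\<integral>\<^sup>+p. ennreal (norm (\<integral>z. (if \<pi> z = p then \<Psi> z else 0) \<partial>lborel)) \<partial>count_space UNIV)"
proof -
 define A where "A i = {z. to_nat (\<pi> z) = i}" for i
 have A: "A i \<in> sets lborel" for i
 proof -
  have "A i = (\<Union>p\<in>{p. to_nat p = i}. {z. \<pi> z = p})" by (auto simp: A_def)
  then show ?thesis using pm by (auto intro!: sets.countable_UN'')
 qed
 have U: "(\<Union>i. A i) = UNIV" by (auto simp: A_def)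
 have "(\<integral>z. \<Psi> z \<partial>lborel) = (LINT z:(\<Union>i. A i)|lborel. \<Psi> z)" unfolding U by (simp add: set_lebesgue_integral_def)
 also have "\<dots> = (\<Sum>i. LINT z:A i|lborel. \<Psi> z)"
 proof (rule lebesgue_integral_countable_add)
  show "A i \<in> sets lborel" for i by (rule A)
  show "A i \<inter> A j = {}" if "i ~= j" for i j using that by (auto simp: A_def)
  show "set_integrable lborel (\<Union>i. A i) \<Psi>" unfolding U using int by (simp add: set_integrable_def)
 qed
 finally have "ennreal (norm (\<integral>z. \<Psi> z \<partial>lborel)) \<le> (\<Sum>i. ennreal (norm (LINT z:A i|lborel. \<Psi> z)))"
  by (simp add: ennreal_norm_suminf_le)
 also have "\<dots> = (\<integral>\<^sup>+i. ennreal (norm (LINT z:A i|lborel. \<Psi> z)) \<partial>count_space UNIV)"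
  by (rule nn_integral_count_space_nat[symmetric])
 also have "\<dots> = (\<integral>\<^sup>+i. ennreal (norm (LINT z:A i|lborel. \<Psi> z)) \<partial>count_space (range (to_nat :: 'p => nat)))"
 proof (rule nn_integral_count_space_eq)
  fix i assume "i \<in> UNIV - range (to_nat :: 'p => nat)"
  then have "A i = {}" by (auto simp: A_def)
  then show "ennreal (norm (LINT z:A i|lborel. \<Psi> z)) = 0" by (simp add: set_lebesgue_integral_def)
 qed simp
 also have "\<dots> = (\<integral>\<^sup>+p. ennreal (norm (LINT z:A (to_nat p)|lborel. \<Psi> z)) \<partial>count_space (UNIV :: 'p set))"
  by (rule nn_integral_bij_count_space[symmetric]) (auto simp: bij_betw_def)
 also have "\<dots> = (\<integral>\<^sup>+p. ennreal (norm (\<integral>z. (if \<pi> z = p then \<Psi> z else 0) \<partial>lborel)) \<partial>count_space UNIV)"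
 proof (rule nn_integral_cong)
  fix p :: 'p
  have "(LINT z:A (to_nat p)|lborel. \<Psi> z) = (\<integral>z. (if \<pi> z = p then \<Psi> z else 0) \<partial>lborel)"
   unfolding set_lebesgue_integral_def by (intro Bochner_Integration.integral_cong) (auto simp: A_def indicator_def)
  then show "ennreal (norm (LINT z:A (to_nat p)|lborel. \<Psi> z)) = ennreal (norm (\<integral>z. (if \<pi> z = p then \<Psi> z else 0) \<partial>lborel))" by simp
 qed
 finally show ?thesis .
qed

text \<open>Each sign of the exponent uses one of the two comparisons.\<close>

lemma powr_comparable:
 fixes X Y :: real
 assumes "0 < X" "0 < Y" "1 \<le> \<kappa>" "X \<le> \<kappa> * Y" "Y \<le> \<kappa> * X"
 shows "X powr e \<le> \<kappa> powr \<bar>e\<bar> * Y powr e"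
proof (cases "0 \<le> e")
 case True
 then have "X powr e \<le> (\<kappa> * Y) powr e" using assms by (intro powr_mono2) auto
 then show ?thesis using True assms by (simp add: powr_mult)
next
 case False
 have "Y / \<kappa> \<le> X" using assms by (simp add: pos_divide_le_eq mult.commute)
 then have "X powr e \<le> (Y / \<kappa>) powr e" using assms False by (intro powr_mono2') auto
 also have "\<dots> = \<kappa> powr \<bar>e\<bar> * Y powr e" using assms False by (simp add: powr_divide powr_minus_divide)
 finally show ?thesis .
qed

definition sderiv :: "(real^'n => real^'n => complex) => 'n list => 'n list => real^'n => real^'n => complex" where
 "sderiv \<sigma> as bs x z = iter_dderiv (map (%i. (0, axis i 1)) as @ map (%j. (axis j 1, 0)) bs) (%(x, \<xi>). \<sigma> x \<xi>) (x, z)"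

text \<open>The boxes that carry a piece; the third entry 2^(j m) is the size of a symbol of order m
  at level j.\<close>

definition freq_boxes :: "real => real => ((real^'n) \<times> real \<times> real) set" where
 "freq_boxes \<delta> m = (%p. (ctr \<delta> p, real (rad \<delta> (fst p)), 2 powr (real (fst p) * m))) ` range (idx \<delta>)"

text \<open>As \<delta> \<le> \<rho>, the frequency gain may be weakened from \<rho> to \<delta>. On
  a box of level j, 1 + |z| is comparable to 2^j and R to 2^(j \<delta>), so powers of 1 + |z|
  become L times powers of R.\<close>

lemma symbol_boxes_symbol_class:
 fixes \<sigma> :: "real^'n => real^'n => complex"
 assumes \<sigma>: "\<sigma> \<in> symbol_class m \<rho> \<delta>" and \<delta>: "0 \<le> \<delta>" "\<delta> \<le> \<rho>" "\<delta> < 1"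
 shows "symbol_boxes (sderiv \<sigma>) (freq_boxes \<delta> m)"
proof
 have sm: "smooth_fun (%(x, \<xi>). \<sigma> x \<xi>)" using \<sigma> by (simp add: symbol_class_def)
 show "continuous_on UNIV (%(x, z). sderiv \<sigma> as bs x z)" for as bs
  using smooth_fun_continuous[OF sm] unfolding sderiv_def by (simp add: split_beta')
 have df: "iter_dderiv vs (%(x, \<xi>). \<sigma> x \<xi>) differentiable at w" for vs w using sm unfolding smooth_fun_def by blast
 show "((%s. sderiv \<sigma> as bs x (upd z i s)) has_vector_derivative sderiv \<sigma> (i # as) bs x (upd z i s)) (at s)" for as bs i x z s
 proof -
  have "((%s. (x, upd z i s)) has_vector_derivative (0, axis i 1)) (at s)"
   by (intro has_vector_derivative_Pair has_vector_derivative_const upd_has_vector_derivative)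
  from dderiv_has_vector_derivative[OF df this] show ?thesis unfolding sderiv_def by simp
 qed
 show "((%s. sderiv \<sigma> [] bs (upd x i s) z) has_vector_derivative sderiv \<sigma> [] (i # bs) (upd x i s) z) (at s)" for bs i x z s
 proof -
  have "((%s. (upd x i s, z)) has_vector_derivative (axis i 1, 0)) (at s)"
   by (intro has_vector_derivative_Pair has_vector_derivative_const upd_has_vector_derivative)
  from dderiv_has_vector_derivative[OF df this] show ?thesis unfolding sderiv_def by simp
 qed
 show "R \<ge> 1 \<and> L \<ge> 0" if "(c, R, L) \<in> freq_boxes \<delta> m" for c :: "real^'n" and R L
  using that rad_ge_1 by (auto simp: freq_boxes_def)
 obtain \<kappa> where \<kappa>: "\<kappa> \<ge> 1" and comp: "\<And>(k::int^'n) z. z \<in> vbox (ctr \<delta> (idx \<delta> k)) (real (rad \<delta> (lev k))) ==> 1 + norm z \<le> \<kappa> * 2 ^ lev k \<and> 2 ^ lev k \<le> \<kappa> * (1 + norm z)"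
  using box_comparable[OF \<delta>(1,3), where 'n='n] by blast
 show "\<exists>K\<ge>0. \<forall>c R L. (c, R, L) \<in> freq_boxes \<delta> m --> (\<forall>x. \<forall>z\<in>vbox c R. norm (sderiv \<sigma> as bs x z) \<le> K * L * R ^ length bs * (1 / R) ^ length as)" for as bs :: "'n list"
 proof -
  let ?a = "real (length as)" and ?b = "real (length bs)"
  obtain C0 where C0: "\<And>x \<xi>. norm (sderiv \<sigma> as bs x \<xi>) \<le> C0 * (1 + norm \<xi>) powr (m - \<rho> * ?a + \<delta> * ?b)"
   using \<sigma> unfolding symbol_class_def sderiv_def by blast
  define C where "C = \<bar>C0\<bar>"
  have C: "norm (sderiv \<sigma> as bs x \<xi>) \<le> C * (1 + norm \<xi>) powr (m - \<rho> * ?a + \<delta> * ?b)" "0 \<le> C" for x \<xi>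
   unfolding C_def by (rule order_trans[OF C0 mult_right_mono]) auto
  define e where "e = m - \<delta> * ?a + \<delta> * ?b"
  let ?K = "C * (\<kappa> powr \<bar>e\<bar> * 2 ^ length bs)"
  show ?thesis
  proof (intro exI[of _ ?K] conjI allI impI ballI)
   show "0 \<le> ?K" using C(2) by simp
   fix c :: "real^'n" and R L and x z :: "real^'n" assume "(c, R, L) \<in> freq_boxes \<delta> m" and z: "z \<in> vbox c R"
   then obtain k where k: "c = ctr \<delta> (idx \<delta> k)" "R = real (rad \<delta> (lev k))" "L = 2 powr (real (lev k) * m)"
    by (auto simp: freq_boxes_def idx_def)
   let ?X = "1 + norm z" and ?j = "real (lev k)"
   have X: "1 \<le> ?X" by simp
   have R: "1 \<le> R" unfolding k using rad_ge_1 by simp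
   have "norm (sderiv \<sigma> as bs x z) \<le> C * ?X powr (m - \<rho> * ?a + \<delta> * ?b)" by (rule C)
   also have "\<dots> \<le> C * ?X powr e"
    using \<delta> X by (intro mult_left_mono C powr_mono) (auto simp: e_def mult_right_mono)
   also have "?X powr e \<le> \<kappa> powr \<bar>e\<bar> * (2 ^ lev k :: real) powr e"
    using comp[of z k] z \<kappa> X unfolding k by (intro powr_comparable) (auto intro: add_pos_nonneg)
   also have "(2 ^ lev k :: real) powr e = 2 powr (?j * e)" by (simp add: powr_realpow[symmetric] powr_powr)
   also have "\<dots> = L * (2 powr (?j * \<delta>)) powr ?b * (1 / (2 powr (?j * \<delta>)) powr ?a)"
    unfolding k powr_powr powr_minus_divide[symmetric] powr_add[symmetric] by (simp add: e_def algebra_simps)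
   \<comment> \<open>\<open>rad\<close> rounds 2^(j \<delta>) down: every space derivative loses a
     factor 2, the frequency derivatives lose nothing.\<close>
   also have "\<dots> \<le> L * (2 * R) powr ?b * (1 / R powr ?a)"
   proof -
    have h1: "(2 powr (?j * \<delta>)) powr ?b \<le> (2 * R) powr ?b"
     using rad_bounds[OF \<delta>(1), of "lev k"] unfolding k by (intro powr_mono2) auto
    have "R powr ?a \<le> (2 powr (?j * \<delta>)) powr ?a"
     using rad_bounds[OF \<delta>(1), of "lev k"] unfolding k by (intro powr_mono2) auto
    then have h2: "1 / (2 powr (?j * \<delta>)) powr ?a \<le> 1 / R powr ?a" using R by (intro divide_left_mono) auto
    have L0: "0 \<le> L" unfolding k by simp
    show ?thesis by (intro mult_mono order_refl mult_left_mono h1 h2 mult_nonneg_nonneg L0) auto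
   qed
   also have "\<dots> = 2 ^ length bs * L * R ^ length bs * (1 / R) ^ length as"
    using R by (simp add: powr_realpow power_mult_distrib power_one_over)
   finally have "norm (sderiv \<sigma> as bs x z) \<le> C * (\<kappa> powr \<bar>e\<bar> * (2 ^ length bs * L * R ^ length bs * (1 / R) ^ length as))"
    using C(2) by (simp add: mult_left_mono)
   then show "norm (sderiv \<sigma> as bs x z) \<le> ?K * L * R ^ length bs * (1 / R) ^ length as" by (simp only: mult.assoc)
  qed
 qed
qed

lemma fl_measurable [measurable]: "fl \<in> measurable borel (count_space UNIV)"
proof (subst measurable_count_space_eq2_countable, intro conjI ballI)
 show "fl -` {k} \<inter> space borel \<in> sets borel" for k :: "int^'n"
 proof -
  have "fl -` {k} = {z. fl z = k}" by auto
  then show ?thesis by simp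
 qed
qed auto

lemma pred_idx_fl [measurable]: "Measurable.pred borel (%z. idx \<delta> (fl z) = p)"
 using measurable_compose[OF fl_measurable, of "%k. idx \<delta> k = p" "count_space UNIV"] by simp

lemma emeasure_piece_le:
 "emeasure lborel {z::real^'n. idx \<delta> (fl z) = p} \<le> ennreal (real (rad \<delta> (fst p)) ^ CARD('n))"
proof -
 let ?R = "real (rad \<delta> (fst p))"
 have R: "0 \<le> ?R" by simp
 have B: "ctr \<delta> p \<bullet> b \<le> (ctr \<delta> p + (\<chi> i. ?R)) \<bullet> b" if "b \<in> Basis" for b :: "real^'n"
  using that by (auto simp: Basis_vec_def inner_axis)
 have "emeasure lborel {z::real^'n. idx \<delta> (fl z) = p} \<le> emeasure lborel (vbox (ctr \<delta> p) ?R)"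
  using in_piece_vbox by (intro emeasure_mono) auto
 also have "\<dots> = ennreal (\<Prod>b\<in>Basis. (ctr \<delta> p + (\<chi> i. ?R) - ctr \<delta> p) \<bullet> b)"
  unfolding vbox_cbox by (rule emeasure_lborel_cbox[OF B])
 also have "(\<Prod>b\<in>Basis. (ctr \<delta> p + (\<chi> i. ?R) - ctr \<delta> p) \<bullet> b) = ?R ^ CARD('n)"
  by (simp add: prod_Basis_vec inner_axis)
 finally show ?thesis .
qed

text \<open>The hypothesis holds at every point of a cube, and cubes have measure 1, so averaging it
  over the cube costs nothing.\<close>

lemma cube_transfer:
 fixes G :: "real^'n => ennreal"
 assumes [measurable]: "G \<in> borel_measurable borel"
  and le: "\<And>\<xi>. \<Psi> (fl \<xi>) \<le> c * G \<xi>"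
 shows "(\<integral>\<^sup>+k. (if idx \<delta> k = p then \<Psi> k else 0) \<partial>count_space UNIV) \<le> c * (\<integral>\<^sup>+\<xi>. (if idx \<delta> (fl \<xi>) = p then G \<xi> else 0) \<partial>lborel)"
proof -
 have "(if idx \<delta> k = p then \<Psi> k else 0) \<le> c * (\<integral>\<^sup>+\<xi>. (if fl \<xi> = k then (if idx \<delta> (fl \<xi>) = p then G \<xi> else 0) else 0) \<partial>lborel)" for k
 proof (cases "idx \<delta> k = p")
  case True
  have "\<Psi> k = (\<integral>\<^sup>+\<xi>. \<Psi> k * indicator {\<xi>::real^'n. fl \<xi> = k} \<xi> \<partial>lborel)"
   by (subst nn_integral_cmult_indicator) (auto simp: emeasure_cube)
  also have "\<dots> \<le> (\<integral>\<^sup>+\<xi>. c * (if fl \<xi> = k then (if idx \<delta> (fl \<xi>) = p then G \<xi> else 0) else 0) \<partial>lborel)"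
   using le True by (intro nn_integral_mono) (auto simp: indicator_def)
  also have "\<dots> = c * (\<integral>\<^sup>+\<xi>. (if fl \<xi> = k then (if idx \<delta> (fl \<xi>) = p then G \<xi> else 0) else 0) \<partial>lborel)"
   by (rule nn_integral_cmult) measurable
  finally show ?thesis using True by simp
 qed simp
 then have "(\<integral>\<^sup>+k. (if idx \<delta> k = p then \<Psi> k else 0) \<partial>count_space UNIV) \<le> (\<integral>\<^sup>+k. c * (\<integral>\<^sup>+\<xi>. (if fl \<xi> = k then (if idx \<delta> (fl \<xi>) = p then G \<xi> else 0) else 0) \<partial>lborel) \<partial>count_space UNIV)"
  by (intro nn_integral_mono)
 also have "\<dots> = c * (\<integral>\<^sup>+k. (\<integral>\<^sup>+\<xi>. (if fl \<xi> = k then (if idx \<delta> (fl \<xi>) = p then G \<xi> else 0) else 0) \<partial>lborel) \<partial>count_space UNIV)"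
  by (rule nn_integral_cmult) simp
 also have "(\<integral>\<^sup>+k. (\<integral>\<^sup>+\<xi>. (if fl \<xi> = k then (if idx \<delta> (fl \<xi>) = p then G \<xi> else 0) else 0) \<partial>lborel) \<partial>count_space UNIV) = (\<integral>\<^sup>+\<xi>. (if idx \<delta> (fl \<xi>) = p then G \<xi> else 0) \<partial>lborel)"
  by (rule nn_integral_cubes[symmetric]) measurable
 finally show ?thesis .
qed

lemma sum_pieces_le:
 fixes G :: "real^'n => ennreal"
 assumes [measurable]: "G \<in> borel_measurable borel"
 shows "(\<integral>\<^sup>+p. (\<integral>\<^sup>+\<xi>. (if idx \<delta> (fl \<xi>) = p then G \<xi> else 0) \<partial>lborel) \<partial>count_space (range (idx \<delta>))) \<le> (\<integral>\<^sup>+\<xi>. G \<xi> \<partial>lborel)"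
proof -
 have "(\<integral>\<^sup>+p. (\<integral>\<^sup>+\<xi>. (if idx \<delta> (fl \<xi>) = p then G \<xi> else 0) \<partial>lborel) \<partial>count_space (range (idx \<delta>))) \<le>
  (\<integral>\<^sup>+p. (\<integral>\<^sup>+\<xi>. (if idx \<delta> (fl \<xi>) = p then G \<xi> else 0) \<partial>lborel) \<partial>count_space UNIV)"
  by (subst nn_integral_count_space_indicator) (auto intro!: nn_integral_mono simp: indicator_def)
 also have "\<dots> = (\<integral>\<^sup>+\<xi>. (\<integral>\<^sup>+p. (if idx \<delta> (fl \<xi>) = p then G \<xi> else 0) \<partial>count_space UNIV) \<partial>lborel)"
  by (rule nn_integral_count_space_nn_integral[symmetric]) auto
 also have "\<dots> = (\<integral>\<^sup>+\<xi>. G \<xi> \<partial>lborel)" by (simp add: nn_integral_single_index[of _ "%_. G _"])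
 finally show ?thesis .
qed

lemma enn_powr_if: "enn_powr (if P then x else 0) r = (if P then enn_powr x r else 0)"
 by simp

text \<open>Subadditivity of the r-th power over the unit cubes of the piece; the number of cubes
  does not enter.\<close>

lemma piece_small_exponent:
 fixes F :: "real^'n => complex" and a :: "real^'n => ennreal"
 assumes r: "0 < r" "r \<le> 1" and [measurable]: "F \<in> borel_measurable borel" "a \<in> borel_measurable borel" and c: "0 \<le> c"
  and le: "\<And>\<xi>. (\<integral>\<^sup>+z. (if fl z = fl \<xi> then ennreal ((norm (F z))\<^sup>2) else 0) \<partial>lborel) \<le> ennreal c * a \<xi>"
 shows "enn_powr (\<integral>\<^sup>+z. (if idx \<delta> (fl z) = p then ennreal ((norm (F z))\<^sup>2) else 0) \<partial>lborel) r \<le> ennreal (c powr r) * (\<integral>\<^sup>+\<xi>. (if idx \<delta> (fl \<xi>) = p then enn_powr (a \<xi>) r else 0) \<partial>lborel)"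
proof -
 let ?\<Phi> = "%k. \<integral>\<^sup>+z. (if fl z = k then ennreal ((norm (F z))\<^sup>2) else 0) \<partial>lborel"
 have "(\<integral>\<^sup>+z. (if idx \<delta> (fl z) = p then ennreal ((norm (F z))\<^sup>2) else 0) \<partial>lborel) = (\<integral>\<^sup>+k. (\<integral>\<^sup>+z. (if fl z = k then (if idx \<delta> (fl z) = p then ennreal ((norm (F z))\<^sup>2) else 0) else 0) \<partial>lborel) \<partial>count_space UNIV)"
  by (rule nn_integral_cubes) measurable
 also have "\<dots> = (\<integral>\<^sup>+k. (if idx \<delta> k = p then ?\<Phi> k else 0) \<partial>count_space UNIV)"
  by (intro nn_integral_cong) (auto intro!: nn_integral_cong simp: nn_integral_0_iff_AE)
 finally have "enn_powr (\<integral>\<^sup>+z. (if idx \<delta> (fl z) = p then ennreal ((norm (F z))\<^sup>2) else 0) \<partial>lborel) r \<le> (\<integral>\<^sup>+k. (if idx \<delta> k = p then enn_powr (?\<Phi> k) r else 0) \<partial>count_space UNIV)"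
  using enn_powr_nn_integral_le[OF r, where X = "%k. if idx \<delta> k = p then ?\<Phi> k else 0" and I = UNIV] by (simp add: enn_powr_if)
 also have "\<dots> \<le> ennreal (c powr r) * (\<integral>\<^sup>+\<xi>. (if idx \<delta> (fl \<xi>) = p then enn_powr (a \<xi>) r else 0) \<partial>lborel)"
 proof (rule cube_transfer)
  fix \<xi>
  have "enn_powr (?\<Phi> (fl \<xi>)) r \<le> enn_powr (ennreal c * a \<xi>) r" using r by (intro enn_powr_mono le) auto
  then show "enn_powr (?\<Phi> (fl \<xi>)) r \<le> ennreal (c powr r) * enn_powr (a \<xi>) r" using c by (simp add: enn_powr_mult[OF r(1)])
 qed measurable
 finally show ?thesis .
qed

text \<open>Jensen over the piece costs its volume to the power r - 1. This is where the number of
  unit cubes enters when q > 2.\<close>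

lemma piece_large_exponent:
 fixes F :: "real^'n => complex" and a :: "real^'n => ennreal"
 assumes r: "1 \<le> r" and [measurable]: "F \<in> borel_measurable borel" "a \<in> borel_measurable borel" and c: "0 \<le> c"
  and le: "\<And>\<xi>. (\<integral>\<^sup>+z. (if fl z = fl \<xi> then ennreal ((norm (F z))\<^sup>2) else 0) \<partial>lborel) \<le> ennreal c * a \<xi>"
 shows "enn_powr (\<integral>\<^sup>+z. (if idx \<delta> (fl z) = p then ennreal ((norm (F z))\<^sup>2) else 0) \<partial>lborel) r \<le>
  ennreal (c powr r * (2 powr r * (real (rad \<delta> (fst p)) ^ CARD('n)) powr (r - 1))) * (\<integral>\<^sup>+\<xi>. (if idx \<delta> (fl \<xi>) = p then enn_powr (a \<xi>) r else 0) \<partial>lborel)"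
proof -
 have r0: "0 < r" using r by simp
 let ?\<Phi> = "%k. \<integral>\<^sup>+z. (if fl z = k then ennreal ((norm (F z))\<^sup>2) else 0) \<partial>lborel"
 have "(\<integral>\<^sup>+z. (if idx \<delta> (fl z) = p then ennreal ((norm (F z))\<^sup>2) else 0) \<partial>lborel) = (\<integral>\<^sup>+k. (\<integral>\<^sup>+z. (if fl z = k then (if idx \<delta> (fl z) = p then ennreal ((norm (F z))\<^sup>2) else 0) else 0) \<partial>lborel) \<partial>count_space UNIV)"
  by (rule nn_integral_cubes) measurable
 also have "\<dots> = (\<integral>\<^sup>+k. (if idx \<delta> k = p then ?\<Phi> k else 0) \<partial>count_space UNIV)"
  by (intro nn_integral_cong) (auto intro!: nn_integral_cong simp: nn_integral_0_iff_AE)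
 also have "\<dots> \<le> ennreal c * (\<integral>\<^sup>+\<xi>. (if idx \<delta> (fl \<xi>) = p then a \<xi> else 0) \<partial>lborel)"
  by (rule cube_transfer) (use le in auto)
 finally have "enn_powr (\<integral>\<^sup>+z. (if idx \<delta> (fl z) = p then ennreal ((norm (F z))\<^sup>2) else 0) \<partial>lborel) r \<le> enn_powr (ennreal c * (\<integral>\<^sup>+\<xi>. (if idx \<delta> (fl \<xi>) = p then a \<xi> else 0) \<partial>lborel)) r"
  using r0 by (intro enn_powr_mono) auto
 also have "\<dots> = ennreal (c powr r) * enn_powr (\<integral>\<^sup>+\<xi>. (if idx \<delta> (fl \<xi>) = p then a \<xi> else 0) \<partial>lborel) r"
  using c by (simp add: enn_powr_mult[OF r0])
 also have "enn_powr (\<integral>\<^sup>+\<xi>. (if idx \<delta> (fl \<xi>) = p then a \<xi> else 0) \<partial>lborel) r \<le> 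
   ennreal (2 powr r * (real (rad \<delta> (fst p)) ^ CARD('n)) powr (r - 1)) * (\<integral>\<^sup>+\<xi>. (if idx \<delta> (fl \<xi>) = p then enn_powr (a \<xi>) r else 0) \<partial>lborel)"
 proof -
  let ?S = "{z::real^'n. idx \<delta> (fl z) = p}"
  define M where "M = density lborel (%z::real^'n. indicator ?S z :: ennreal)"
  have Sm [measurable]: "?S \<in> sets borel" by measurable
  have i1: "(\<integral>\<^sup>+\<xi>. (if idx \<delta> (fl \<xi>) = p then a \<xi> else 0) \<partial>lborel) = (\<integral>\<^sup>+\<xi>. a \<xi> \<partial>M)"
   unfolding M_def by (subst nn_integral_density) (auto intro!: nn_integral_cong simp: indicator_def)
  have i2: "(\<integral>\<^sup>+\<xi>. (if idx \<delta> (fl \<xi>) = p then enn_powr (a \<xi>) r else 0) \<partial>lborel) = (\<integral>\<^sup>+\<xi>. enn_powr (a \<xi>) r \<partial>M)"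
   unfolding M_def by (subst nn_integral_density) (auto intro!: nn_integral_cong simp: indicator_def)
  have "emeasure M (space M) = emeasure lborel ?S"
   unfolding M_def by (subst emeasure_density) (auto simp: nn_integral_indicator)
  then have "emeasure M (space M) \<le> ennreal (real (rad \<delta> (fst p)) ^ CARD('n))" using emeasure_piece_le[of \<delta> p] by simp
  moreover have "0 < real (rad \<delta> (fst p)) ^ CARD('n)" using rad_ge_1[of \<delta> "fst p"] by simp
  ultimately show ?thesis unfolding i1 i2 by (intro enn_powr_jensen r) (auto simp: M_def)
 qed
 finally show ?thesis using c by (simp add: ennreal_mult mult.assoc mult_left_mono)
qed

text \<open>The arithmetic of the threshold: the volume R^n to the power e, used with e = |1 - r|,
  against the symbol size 2^(j m) to the power 2 r = q. The hypothesis on m says that the resulting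
  exponent of 2^j is not positive.\<close>

lemma scale_factor_le:
 assumes \<delta>: "0 \<le> \<delta>" and r: "0 \<le> e" and m: "2 * m * r + e * \<delta> * real n \<le> 0"
 shows "(real (rad \<delta> j) ^ n) powr e * ((2 powr (real j * m))\<^sup>2) powr r \<le> 1"
proof -
 have R: "0 < real (rad \<delta> j)" using rad_ge_1[of \<delta> j] by simp
 have "(real (rad \<delta> j) ^ n) powr e = real (rad \<delta> j) powr (real n * e)"
  using R by (simp add: powr_powr flip: powr_realpow)
 also have "\<dots> \<le> (2 powr (real j * \<delta>)) powr (real n * e)"
  using rad_bounds(1)[OF \<delta>, of j] r by (intro powr_mono2) auto
 finally have 1: "(real (rad \<delta> j) ^ n) powr e \<le> 2 powr (real j * \<delta> * (real n * e))" by (simp add: powr_powr)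
 have 2: "((2 powr (real j * m))\<^sup>2) powr r = 2 powr (real j * m * 2 * r)"
  by (simp add: power2_eq_square powr_powr powr_mult powr_add[symmetric] mult_ac)
 have "(real (rad \<delta> j) ^ n) powr e * ((2 powr (real j * m))\<^sup>2) powr r \<le> 2 powr (real j * \<delta> * (real n * e)) * 2 powr (real j * m * 2 * r)"
  unfolding 2 by (intro mult_right_mono 1) simp
 also have "\<dots> = 2 powr (real j * (2 * m * r + e * \<delta> * real n))"
  by (simp add: powr_add[symmetric] algebra_simps)
 also have "\<dots> \<le> 2 powr 0" using m by (intro powr_mono) (auto intro: mult_nonneg_nonpos)
 finally show ?thesis by simp
qed

definition amp_piece :: "real => (real^'n => complex) => nat \<times> (int^'n) => real^'n => complex" where
 "amp_piece \<delta> F p z = (if idx \<delta> (fl z) = p then F z else 0)"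

lemma amp_piece_measurable [measurable]:
 assumes [measurable]: "F \<in> borel_measurable borel"
 shows "amp_piece \<delta> F p \<in> borel_measurable borel"
 unfolding amp_piece_def[abs_def] by measurable

lemma amp_piece_ok:
 assumes "F \<in> borel_measurable borel" "\<And>z. norm (F z) \<le> B"
 shows "ok_amp (ctr \<delta> p) (real (rad \<delta> (fst p))) (amp_piece \<delta> F p)"
proof -
 have B0: "0 \<le> B" using assms(2)[of 0] norm_ge_zero order_trans by blast
 have "norm (amp_piece \<delta> F p z) \<le> B" for z using assms(2)[of z] B0 by (simp add: amp_piece_def)
 moreover have "amp_piece \<delta> F p z = 0" if "z \<notin> vbox (ctr \<delta> p) (real (rad \<delta> (fst p)))" for z
  using that in_piece_vbox[of \<delta> z p] by (auto simp: amp_piece_def)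
 ultimately show ?thesis using assms(1) by (auto simp: ok_amp_def)
qed

lemma amp_piece_norm:
 "(\<integral>\<^sup>+z. ennreal ((norm (amp_piece \<delta> F p z))\<^sup>2) \<partial>lborel) = (\<integral>\<^sup>+z. (if idx \<delta> (fl z) = p then ennreal ((norm (F z))\<^sup>2) else 0) \<partial>lborel)"
 by (intro nn_integral_cong) (simp add: amp_piece_def)

lemma amp_piece_finite:
 assumes [measurable]: "F \<in> borel_measurable borel" and B: "\<And>z. norm (F z) \<le> B"
 shows "(\<integral>\<^sup>+z. ennreal ((norm (amp_piece \<delta> F p z))\<^sup>2) \<partial>lborel) < \<top>"
proof -
 have "(\<integral>\<^sup>+z. ennreal ((norm (amp_piece \<delta> F p z))\<^sup>2) \<partial>lborel) \<le> (\<integral>\<^sup>+z. ennreal (B\<^sup>2) * indicator {z. idx \<delta> (fl z) = p} z \<partial>lborel)"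
  using B by (intro nn_integral_mono) (auto simp: amp_piece_def indicator_def intro!: ennreal_leI power_mono)
 also have "\<dots> = ennreal (B\<^sup>2) * emeasure lborel {z. idx \<delta> (fl z) = p}"
  by (rule nn_integral_cmult_indicator) measurable
 also have "\<dots> < \<top>"
  using emeasure_piece_le[of \<delta> p] by (auto simp: ennreal_mult_less_top intro: le_less_trans)
 finally show ?thesis .
qed


lemma psido_eq_osc:
 fixes \<sigma> :: "real^'n => real^'n => complex"
 assumes "symbol_boxes (sderiv \<sigma>) G"
 shows "psido \<sigma> f = (%t. complex_of_real ((2 * pi) powr (- real CARD('n))) * symbol_boxes.osc (sderiv \<sigma>) [] (fourier f) t)"
 unfolding psido_def symbol_boxes.osc_def[OF assms] sderiv_def by simp

lemma stft_scale:
 "stft gauss_window (%t. c * u t) x \<xi> = c * stft gauss_window u x \<xi>"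
proof -
 have "stft gauss_window (%t. c * u t) x \<xi> = (\<integral>t. c * (u t * cnj (cis (\<xi> \<bullet> t) * gauss_window (t - x))) \<partial>lborel)"
  unfolding stft_def by (simp only: mult.assoc)
 then show ?thesis unfolding stft_def by simp
qed

text \<open>The z-integral is split over the pieces, and Cauchy-Schwarz is applied with the weights
  w^(-s) and w^s: the first sum is the counting bound D, the second keeps the weighted squares that
  \<open>box_estimate\<close> controls.\<close>

lemma psido_stft_pieces:
 fixes \<sigma> :: "real^'n => real^'n => complex"
 assumes \<sigma>: "\<sigma> \<in> symbol_class m \<rho> \<delta>" and \<delta>: "0 \<le> \<delta>" "\<delta> \<le> \<rho>" "\<delta> < 1"
  and f: "schwartz f"
  and D: "(\<integral>\<^sup>+p. ennreal (1 / wgt (ctr \<delta> p) (real (rad \<delta> (fst p))) \<xi> ^ s) \<partial>count_space (range (idx \<delta>))) \<le> ennreal D"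
 shows "(\<integral>\<^sup>+x. ennreal ((norm (stft gauss_window (psido \<sigma> f) x \<xi>))\<^sup>2) \<partial>lborel) \<le>
  ennreal (((2 * pi) powr (- real CARD('n)))\<^sup>2) * (ennreal D * (\<integral>\<^sup>+p. ennreal (wgt (ctr \<delta> p) (real (rad \<delta> (fst p))) \<xi> ^ s) *
   (\<integral>\<^sup>+x. ennreal ((norm (wav (%t. exp (- (norm t)\<^sup>2)) (symbol_boxes.osc (sderiv \<sigma>) [] (amp_piece \<delta> (fourier f) p)) x \<xi>))\<^sup>2) \<partial>lborel)
   \<partial>count_space (range (idx \<delta>))))"
proof -
 interpret symbol_boxes "sderiv \<sigma>" "freq_boxes \<delta> m" by (rule symbol_boxes_symbol_class[OF \<sigma> \<delta>])
 let ?F = "fourier f" and ?g = "%t::real^'n. exp (- (norm t)\<^sup>2)" and ?I = "range (idx \<delta>) :: (nat \<times> (int^'n)) set"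
 have [measurable]: "?F \<in> borel_measurable borel" by (rule fourier_measurable[OF f])
 have pw: "?g = pwin i 1" for i :: 'n by (simp add: pwin_def fun_eq_iff)
 have [measurable]: "?g \<in> borel_measurable borel" by measurable
 obtain B where B: "\<And>z. norm (?F z) \<le> B" using fourier_decay[OF f, of 0] by auto
 \<comment> \<open>The polynomial growth of the symbol is beaten by the rapid decay of f hat,
   leaving a multiple of the integrable function \<open>1 / wgt 0 1 z ^ n\<close>.\<close>
 have Dint: "\<exists>D. integrable lborel D \<and> (\<forall>t z. norm (sderiv \<sigma> [] [] t z * ?F z) \<le> D z)"
 proof -
  obtain C0 where "\<forall>x \<xi>. norm (sderiv \<sigma> [] [] x \<xi>) \<le> C0 * (1 + norm \<xi>) powr (m - \<rho> * real (length ([]::'n list)) + \<delta> * real (length ([]::'n list)))"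
   using \<sigma> unfolding symbol_class_def sderiv_def by blast
  then have C0: "norm (sderiv \<sigma> [] [] x \<xi>) \<le> C0 * (1 + norm \<xi>) powr m" for x \<xi> by simp
  \<comment> \<open>A natural exponent not below m, as \<open>fourier_decay\<close> speaks of
    natural powers; for m \<le> 0 it is 0.\<close>
  define K where "K = nat \<lceil>m\<rceil>"
  obtain C1 where C1: "C1 \<ge> 0" "\<And>\<xi>. (1 + norm \<xi>) ^ (K + 2 * CARD('n)) * norm (?F \<xi>) \<le> C1"
   using fourier_decay[OF f, of "K + 2 * CARD('n)"] by blast
  have "norm (sderiv \<sigma> [] [] t z * ?F z) \<le> \<bar>C0\<bar> * C1 * (1 / wgt 0 1 z ^ CARD('n))" for t z
  proof -
   have X: "1 \<le> 1 + norm z" by simp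
   have w: "0 < wgt 0 1 z ^ CARD('n)" using wgt_ge_1[of 0 1 z] by simp
   have "norm (sderiv \<sigma> [] [] t z) \<le> \<bar>C0\<bar> * (1 + norm z) powr m"
    by (rule order_trans[OF C0 mult_right_mono]) auto
   also have "\<dots> \<le> \<bar>C0\<bar> * (1 + norm z) powr real K"
    using X unfolding K_def by (intro mult_left_mono powr_mono) (auto, linarith)
   also have "(1 + norm z) powr real K = (1 + norm z) ^ K" by (rule powr_realpow) (auto intro: add_pos_nonneg)
   finally have "norm (sderiv \<sigma> [] [] t z * ?F z) \<le> \<bar>C0\<bar> * (1 + norm z) ^ K * norm (?F z)"
    unfolding norm_mult by (rule mult_right_mono) simp
   moreover have "(1 + norm z) ^ K * norm (?F z) \<le> C1 * (1 / wgt 0 1 z ^ CARD('n))"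
   proof -
    have "wgt 0 1 z ^ CARD('n) * ((1 + norm z) ^ K * norm (?F z)) \<le> (1 + norm z) ^ (2 * CARD('n)) * ((1 + norm z) ^ K * norm (?F z))"
     by (intro mult_right_mono wgt_0_1_le) auto
    also have "\<dots> \<le> C1" using C1(2)[of z] by (simp add: power_add mult_ac)
    finally show ?thesis using w by (simp add: pos_le_divide_eq mult.commute)
   qed
   then have "\<bar>C0\<bar> * ((1 + norm z) ^ K * norm (?F z)) \<le> \<bar>C0\<bar> * (C1 * (1 / wgt 0 1 z ^ CARD('n)))"
    by (rule mult_left_mono) simp
   ultimately show ?thesis unfolding mult.assoc by (rule order_trans)
  qed
  moreover have "integrable lborel (%z::real^'n. \<bar>C0\<bar> * C1 * (1 / wgt 0 1 z ^ CARD('n)))"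
   by (intro integrable_mult_right wgt_0_1_integrable)
  ultimately show ?thesis by blast
 qed
 then obtain D' where D': "integrable lborel D'" "\<And>t z. norm (sderiv \<sigma> [] [] t z * ?F z) \<le> D' z" by blast
 let ?W = "%p x. wav ?g (osc [] (amp_piece \<delta> ?F p)) x \<xi>"
 let ?w = "%p. wgt (ctr \<delta> p) (real (rad \<delta> (fst p))) \<xi>"
 have w1: "1 \<le> ?w p" for p by (rule wgt_ge_1)
 have pw_le: "ennreal (norm (wav ?g (osc [] ?F) x \<xi>)) \<le> (\<integral>\<^sup>+p. ennreal (norm (?W p x)) \<partial>count_space ?I)" for x
 proof -
  fix i0 :: 'n
  have J: "wav ?g (osc [] ?F) x \<xi> = (\<integral>z. ?F z * Jint undefined 1 [] x \<xi> z \<partial>lborel)"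
   unfolding pw[of undefined] by (rule wav_osc_dominated[OF _ D']) measurable
  have Ji: "integrable lborel (%z. ?F z * Jint undefined 1 [] x \<xi> z)"
   by (rule wav_osc_dominated_integrable[OF _ D']) measurable
  have Wp: "?W p x = (\<integral>z. (if idx \<delta> (fl z) = p then ?F z * Jint undefined 1 [] x \<xi> z else 0) \<partial>lborel)" for p
  proof -
   have "norm (sderiv \<sigma> [] [] t z * amp_piece \<delta> ?F p z) \<le> D' z" for t z
    using D'(2)[of t z] order_trans[OF norm_ge_zero D'(2)[of t z]] by (simp add: amp_piece_def)
   then have "?W p x = (\<integral>z. amp_piece \<delta> ?F p z * Jint undefined 1 [] x \<xi> z \<partial>lborel)"
    unfolding pw[of undefined] by (intro wav_osc_dominated[OF _ D'(1)]) measurable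
   also have "\<dots> = (\<integral>z. (if idx \<delta> (fl z) = p then ?F z * Jint undefined 1 [] x \<xi> z else 0) \<partial>lborel)"
    by (intro Bochner_Integration.integral_cong) (auto simp: amp_piece_def)
   finally show ?thesis .
  qed
  have "ennreal (norm (wav ?g (osc [] ?F) x \<xi>)) \<le> (\<integral>\<^sup>+p. ennreal (norm (?W p x)) \<partial>count_space UNIV)"
   unfolding J Wp by (rule norm_integral_partition[OF Ji]) (use pred_idx_fl[of \<delta>] in \<open>simp add: pred_def\<close>)
  also have "\<dots> = (\<integral>\<^sup>+p. ennreal (norm (?W p x)) \<partial>count_space ?I)"
  proof (rule nn_integral_count_space_eq)
   fix p :: "nat \<times> (int^'n)" assume "p \<in> UNIV - ?I"
   then have "idx \<delta> (fl z) ~= p" for z :: "real^'n" by auto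
   then show "ennreal (norm (?W p x)) = 0" unfolding Wp by simp
  qed simp
  finally show ?thesis .
 qed
 have gen: "sqrt (1 / v) * (sqrt v * t) = t" if "0 < v" for v t :: real using that by (simp add: real_sqrt_divide)
 have cs: "ennreal ((norm (wav ?g (osc [] ?F) x \<xi>))\<^sup>2) \<le> ennreal D * (\<integral>\<^sup>+p. ennreal (?w p ^ s) * ennreal ((norm (?W p x))\<^sup>2) \<partial>count_space ?I)" for x
 proof -
  have "ennreal ((norm (wav ?g (osc [] ?F) x \<xi>))\<^sup>2) = (ennreal (norm (wav ?g (osc [] ?F) x \<xi>)))\<^sup>2" by (simp add: ennreal_power)
  also have "\<dots> \<le> (\<integral>\<^sup>+p. ennreal (norm (?W p x)) \<partial>count_space ?I)\<^sup>2"
   by (intro power_mono pw_le) simp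
  also have "(\<integral>\<^sup>+p. ennreal (norm (?W p x)) \<partial>count_space ?I) = (\<integral>\<^sup>+p. ennreal (sqrt (1 / ?w p ^ s)) * ennreal (sqrt (?w p ^ s) * norm (?W p x)) \<partial>count_space ?I)"
  proof (rule nn_integral_cong)
   fix p
   have u: "0 < ?w p ^ s" using w1[of p] by simp
   have "sqrt (1 / ?w p ^ s) * (sqrt (?w p ^ s) * norm (?W p x)) = norm (?W p x)"
    by (rule gen[OF u])
   then show "ennreal (norm (?W p x)) = ennreal (sqrt (1 / ?w p ^ s)) * ennreal (sqrt (?w p ^ s) * norm (?W p x))"
    using u by (subst ennreal_mult[symmetric]) auto
  qed
  also have "\<dots>\<^sup>2 \<le> (\<integral>\<^sup>+p. (ennreal (sqrt (1 / ?w p ^ s)))\<^sup>2 \<partial>count_space ?I) * (\<integral>\<^sup>+p. (ennreal (sqrt (?w p ^ s) * norm (?W p x)))\<^sup>2 \<partial>count_space ?I)"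
   by (rule Cauchy_Schwarz_nn_integral) auto
  also have "(\<integral>\<^sup>+p. (ennreal (sqrt (1 / ?w p ^ s)))\<^sup>2 \<partial>count_space ?I) = (\<integral>\<^sup>+p. ennreal (1 / ?w p ^ s) \<partial>count_space ?I)"
  proof (rule nn_integral_cong)
   fix p
   have "0 < ?w p ^ s" using w1[of p] by simp
   then show "(ennreal (sqrt (1 / ?w p ^ s)))\<^sup>2 = ennreal (1 / ?w p ^ s)" by (subst ennreal_power) auto
  qed
  also have "(\<integral>\<^sup>+p. (ennreal (sqrt (?w p ^ s) * norm (?W p x)))\<^sup>2 \<partial>count_space ?I) = (\<integral>\<^sup>+p. ennreal (?w p ^ s) * ennreal ((norm (?W p x))\<^sup>2) \<partial>count_space ?I)"
  proof (rule nn_integral_cong)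
   fix p
   have u: "0 < ?w p ^ s" using w1[of p] by simp
   then have "(sqrt (?w p ^ s) * norm (?W p x))\<^sup>2 = ?w p ^ s * (norm (?W p x))\<^sup>2" by (simp add: power_mult_distrib)
   then show "(ennreal (sqrt (?w p ^ s) * norm (?W p x)))\<^sup>2 = ennreal (?w p ^ s) * ennreal ((norm (?W p x))\<^sup>2)"
    using u by (subst ennreal_power) (auto simp: ennreal_mult[symmetric])
  qed
  finally show ?thesis using D by (meson mult_right_mono order_trans zero_le)
 qed
 have Wm: "(%x. ?W p x) \<in> borel_measurable borel" for p by measurable
 have "(\<integral>\<^sup>+x. ennreal ((norm (wav ?g (osc [] ?F) x \<xi>))\<^sup>2) \<partial>lborel) \<le> (\<integral>\<^sup>+x. ennreal D * (\<integral>\<^sup>+p. ennreal (?w p ^ s) * ennreal ((norm (?W p x))\<^sup>2) \<partial>count_space ?I) \<partial>lborel)"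
  by (intro nn_integral_mono cs)
 also have "\<dots> = ennreal D * (\<integral>\<^sup>+x. (\<integral>\<^sup>+p. ennreal (?w p ^ s) * ennreal ((norm (?W p x))\<^sup>2) \<partial>count_space ?I) \<partial>lborel)"
  by (intro nn_integral_cmult borel_measurable_nn_integral_count_space) (auto intro!: borel_measurable_times measurable_compose[OF Wm])
 also have "(\<integral>\<^sup>+x. (\<integral>\<^sup>+p. ennreal (?w p ^ s) * ennreal ((norm (?W p x))\<^sup>2) \<partial>count_space ?I) \<partial>lborel) = (\<integral>\<^sup>+p. (\<integral>\<^sup>+x. ennreal (?w p ^ s) * ennreal ((norm (?W p x))\<^sup>2) \<partial>lborel) \<partial>count_space ?I)"
  by (intro nn_integral_count_space_nn_integral) (auto intro!: borel_measurable_times measurable_compose[OF Wm])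
 also have "\<dots> = (\<integral>\<^sup>+p. ennreal (?w p ^ s) * (\<integral>\<^sup>+x. ennreal ((norm (?W p x))\<^sup>2) \<partial>lborel) \<partial>count_space ?I)"
  by (intro nn_integral_cong nn_integral_cmult) (auto intro!: measurable_compose[OF Wm])
 finally have main: "(\<integral>\<^sup>+x. ennreal ((norm (wav ?g (osc [] ?F) x \<xi>))\<^sup>2) \<partial>lborel) \<le> ennreal D * (\<integral>\<^sup>+p. ennreal (?w p ^ s) * (\<integral>\<^sup>+x. ennreal ((norm (?W p x))\<^sup>2) \<partial>lborel) \<partial>count_space ?I)" .
 let ?c = "(2 * pi) powr (- real CARD('n))"
 have "(\<integral>\<^sup>+x. ennreal ((norm (stft gauss_window (psido \<sigma> f) x \<xi>))\<^sup>2) \<partial>lborel) = (\<integral>\<^sup>+x. ennreal (?c\<^sup>2) * ennreal ((norm (wav ?g (osc [] ?F) x \<xi>))\<^sup>2) \<partial>lborel)"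
 proof (rule nn_integral_cong)
  fix x
  have "stft gauss_window (psido \<sigma> f) x \<xi> = complex_of_real ?c * wav ?g (osc [] ?F) x \<xi>"
   unfolding psido_eq_osc[OF symbol_boxes_axioms] stft_scale stft_gauss_eq_wav[OF f] ..
  then have "(norm (stft gauss_window (psido \<sigma> f) x \<xi>))\<^sup>2 = ?c\<^sup>2 * (norm (wav ?g (osc [] ?F) x \<xi>))\<^sup>2"
   by (simp only: norm_mult norm_of_real power_mult_distrib power2_abs)
  then show "ennreal ((norm (stft gauss_window (psido \<sigma> f) x \<xi>))\<^sup>2) = ennreal (?c\<^sup>2) * ennreal ((norm (wav ?g (osc [] ?F) x \<xi>))\<^sup>2)"
   by (simp only: ennreal_mult zero_le_power2)
 qed
 also have "\<dots> = ennreal (?c\<^sup>2) * (\<integral>\<^sup>+x. ennreal ((norm (wav ?g (osc [] ?F) x \<xi>))\<^sup>2) \<partial>lborel)"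
  by (rule nn_integral_cmult) measurable
 also have "\<dots> \<le> ennreal (?c\<^sup>2) * (ennreal D * (\<integral>\<^sup>+p. ennreal (?w p ^ s) * (\<integral>\<^sup>+x. ennreal ((norm (?W p x))\<^sup>2) \<partial>lborel) \<partial>count_space ?I))"
  by (intro mult_left_mono main) simp
 finally show ?thesis .
qed

section \<open>Boundedness below the threshold\<close>

lemma stft_gauss_norm_measurable:
 fixes g :: "real^'n => complex"
 assumes [measurable]: "g \<in> borel_measurable borel"
 shows "(%\<xi>. \<integral>\<^sup>+x. ennreal ((norm (stft gauss_window g x \<xi>))\<^sup>2) \<partial>lborel) \<in> borel_measurable borel"
proof -
 have "stft gauss_window g x \<xi> = wav (%t. exp (- (norm t)\<^sup>2)) g x \<xi>" for x \<xi>
  unfolding stft_def wav_def gauss_window_def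
  by (intro Bochner_Integration.integral_cong refl) (simp add: cis_cnj)
 then show ?thesis by (simp only:) measurable
qed

text \<open>The volume factor V^|1 - r|, r = q/2, is paid once. For q < 2 it arises in the output,
  where the mass of a box spreads over its neighbourhood; for q > 2 in the input, where the L^2 mass
  of a box is compared with that of its unit cubes. The symbol size compensates it through
  \<open>scale_factor_le\<close>.\<close>

theorem psido_bounded_M2q:
 fixes \<sigma> :: "real^'n => real^'n => complex"
 assumes q: "1 < q" and \<delta>: "0 \<le> \<delta>" "\<delta> \<le> \<rho>" "\<delta> < 1"
  and m: "m \<le> - \<bar>1 / q - 1 / 2\<bar> * \<delta> * real CARD('n)"
  and \<sigma>: "\<sigma> \<in> symbol_class m \<rho> \<delta>"
 shows "bounded_on_M2q q (psido \<sigma>)"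
proof -
 interpret symbol_boxes "sderiv \<sigma>" "freq_boxes \<delta> m" by (rule symbol_boxes_symbol_class[OF \<sigma> \<delta>])
 let ?g = "%t::real^'n. exp (- (norm t)\<^sup>2)" and ?I = "range (idx \<delta>) :: (nat \<times> (int^'n)) set"
 define r where "r = q / 2"
 \<comment> \<open>The exponent of \<open>counting\<close>. The decomposition loses w^s; the
   assembly asks for decay w^(3 s) when r \<le> 1 and w^(2 s) when r > 1, whence the two box
   estimates.\<close>
 define s where "s = CARD('n) + 1"
 have r12: "1 / 2 \<le> r" and r0: "0 < r" using q by (auto simp: r_def)
 obtain C1 where C1: "C1 \<ge> 0" and est1: "\<And>c R L H \<nu>. (c, R, L) \<in> freq_boxes \<delta> m ==> ok_amp c R H ==> \<nu> \<in> slice_measures ==>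
   (\<integral>\<^sup>+\<xi>. ennreal (wgt c R \<xi> ^ (3 * s)) * (\<integral>\<^sup>+x. ennreal ((norm (wav ?g (osc [] H) x \<xi>))\<^sup>2) \<partial>lborel) \<partial>\<nu>) \<le>
   ennreal (C1 * L\<^sup>2) * (\<integral>\<^sup>+z. ennreal ((norm (H z))\<^sup>2) \<partial>lborel)"
  using box_estimate[of "3 * s"] by blast
 obtain C2 where C2: "C2 \<ge> 0" and est2: "\<And>c R L H \<nu>. (c, R, L) \<in> freq_boxes \<delta> m ==> ok_amp c R H ==> \<nu> \<in> slice_measures ==>
   (\<integral>\<^sup>+\<xi>. ennreal (wgt c R \<xi> ^ (2 * s)) * (\<integral>\<^sup>+x. ennreal ((norm (wav ?g (osc [] H) x \<xi>))\<^sup>2) \<partial>lborel) \<partial>\<nu>) \<le>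
   ennreal (C2 * L\<^sup>2) * (\<integral>\<^sup>+z. ennreal ((norm (H z))\<^sup>2) \<partial>lborel)"
  using box_estimate[of "2 * s"] by blast
 obtain D where D: "D > 0" and cnt: "\<And>\<xi>::real^'n. (\<integral>\<^sup>+p. ennreal (1 / wgt (ctr \<delta> p) (real (rad \<delta> (fst p))) \<xi> ^ s) \<partial>count_space ?I) \<le> ennreal D"
  using counting[OF \<delta>(1,3), where 'n='n] unfolding s_def by blast
 obtain cm where cm: "cm \<ge> 0" "cauchy_mass = ennreal cm" using cauchy_mass_finite by (auto simp: less_top_ennreal)
 let ?cn = "((2 * pi) powr (- real CARD('n)))\<^sup>2"
 \<comment> \<open>One constant for the hypotheses of both assembly lemmas; the last summand makes
   it positive.\<close>
 define C where "C = C1 + C2 + cm ^ CARD('n) + ?cn * D + 1"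
 have cnD: "0 \<le> ?cn * D" using D by simp
 have C: "C > 0" "C1 \<le> C" "C2 \<le> C" "cm ^ CARD('n) \<le> C" "?cn * D \<le> C"
  using C1 C2 cm(1) cnD zero_le_power[OF cm(1), of "CARD('n)"] unfolding C_def by linarith+
 let ?K2 = "(2 * pi) ^ CARD('n) / (sqrt pi ^ CARD('n) * exp (- (real CARD('n))\<^sup>2 / 4))\<^sup>2"
 have K2: "0 \<le> ?K2" by simp
 define T where "T = (if r \<le> 1 then C powr r * (2 * C) * ?K2 powr r
   else C powr r * (2 powr r * D powr (r - 1)) * C powr r * (?K2 powr r * 2 powr r))"
 have T0: "0 \<le> T" using C unfolding T_def by simp
 have main: "(\<integral>\<^sup>+\<xi>. enn_powr (\<integral>\<^sup>+x. ennreal ((norm (stft gauss_window (psido \<sigma> f) x \<xi>))\<^sup>2) \<partial>lborel) r \<partial>lborel) \<le>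
   ennreal T * (\<integral>\<^sup>+\<xi>. enn_powr (\<integral>\<^sup>+x. ennreal ((norm (stft gauss_window f x \<xi>))\<^sup>2) \<partial>lborel) r \<partial>lborel)"
  if f: "schwartz f" for f
 proof -
  let ?F = "fourier f"
  have Fm [measurable]: "?F \<in> borel_measurable borel" by (rule fourier_measurable[OF f])
  have fm: "f \<in> borel_measurable borel" using schwartz_partials_measurable[OF f, of "[]"] by simp
  obtain B where B: "\<And>z. norm (?F z) \<le> B" using fourier_decay[OF f, of 0] by auto
  define a where "a \<xi> = (\<integral>\<^sup>+x. ennreal ((norm (stft gauss_window f x \<xi>))\<^sup>2) \<partial>lborel)" for \<xi>
  define b where "b \<xi> = (\<integral>\<^sup>+x. ennreal ((norm (stft gauss_window (psido \<sigma> f) x \<xi>))\<^sup>2) \<partial>lborel)" for \<xi>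
  have am [measurable]: "a \<in> borel_measurable borel" unfolding a_def[abs_def] by (rule stft_gauss_norm_measurable[OF fm])
  define w where "w p = wgt (ctr \<delta> p) (real (rad \<delta> (fst p)))" for p :: "nat \<times> (int^'n)"
  define \<beta> where "\<beta> p \<xi> = (\<integral>\<^sup>+x. ennreal ((norm (wav ?g (osc [] (amp_piece \<delta> ?F p)) x \<xi>))\<^sup>2) \<partial>lborel)" for p :: "nat \<times> (int^'n)" and \<xi>
  define L where "L p = 2 powr (real (fst p) * m)" for p :: "nat \<times> (int^'n)"
  define N0 where "N0 p = (\<integral>\<^sup>+z. (if idx \<delta> (fl z) = p then ennreal ((norm (?F z))\<^sup>2) else 0) \<partial>lborel)" for p :: "nat \<times> (int^'n)"
  define N where "N p = ennreal ((L p)\<^sup>2) * N0 p" for p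
  define V where "V p = real (rad \<delta> (fst p)) ^ CARD('n)" for p :: "nat \<times> (int^'n)"
  have Rpos: "0 < real (rad \<delta> (fst p))" for p :: "nat \<times> (int^'n)" using rad_ge_1[of \<delta> "fst p"] by simp
  have V0: "V p > 0" for p unfolding V_def using Rpos[of p] by simp
  have w1: "1 \<le> w p \<xi>" for p \<xi> unfolding w_def by (rule wgt_ge_1)
  have wm [measurable]: "w p \<in> borel_measurable lborel" for p unfolding w_def by simp
  have \<beta>m [measurable]: "\<beta> p \<in> borel_measurable lborel" for p unfolding \<beta>_def by measurable
  have box: "(ctr \<delta> p, real (rad \<delta> (fst p)), L p) \<in> freq_boxes \<delta> m" if "p \<in> ?I" for p
   using that unfolding freq_boxes_def L_def by blast
  have ok: "ok_amp (ctr \<delta> p) (real (rad \<delta> (fst p))) (amp_piece \<delta> ?F p)" for p by (rule amp_piece_ok[OF Fm B])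
  have NE: "ennreal (E * (L p)\<^sup>2) * (\<integral>\<^sup>+z. ennreal ((norm (amp_piece \<delta> ?F p z))\<^sup>2) \<partial>lborel) \<le> ennreal C * N p" if "0 \<le> E" "E \<le> C" for E p
  proof -
   have "ennreal (E * (L p)\<^sup>2) * N0 p = ennreal E * N p"
    using that(1) unfolding N_def by (simp add: ennreal_mult mult.assoc)
   also have "\<dots> \<le> ennreal C * N p" using that by (intro mult_right_mono ennreal_leI) auto
   finally show ?thesis unfolding amp_piece_norm N0_def .
  qed
  have L2_3: "(\<integral>\<^sup>+\<xi>. ennreal (w p \<xi> ^ (3 * s)) * \<beta> p \<xi> \<partial>lborel) \<le> ennreal C * N p" if "p \<in> ?I" for p
   unfolding w_def \<beta>_def
   by (rule order_trans[OF est1[OF box[OF that] ok] NE[OF C1 C(2)]]) (simp add: slice_measures_def)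
  have L2_2: "(\<integral>\<^sup>+\<xi>. ennreal (w p \<xi> ^ (2 * s)) * \<beta> p \<xi> \<partial>lborel) \<le> ennreal C * N p" if "p \<in> ?I" for p
   unfolding w_def \<beta>_def
   by (rule order_trans[OF est2[OF box[OF that] ok] NE[OF C2 C(3)]]) (simp add: slice_measures_def)
  \<comment> \<open>The point mass at \<xi>, taken as the slice measure, turns the integrated box
    estimate into a bound at a single frequency.\<close>
  have sup: "ennreal (w p \<xi> ^ (2 * s)) * \<beta> p \<xi> \<le> ennreal C * N p" if "p \<in> ?I" for p \<xi>
  proof -
   have "(\<integral>\<^sup>+\<xi>'. ennreal (w p \<xi>' ^ (2 * s)) * \<beta> p \<xi>' \<partial>return borel \<xi>) \<le> ennreal C * N p"
    unfolding w_def \<beta>_def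
    by (rule order_trans[OF est2[OF box[OF that] ok] NE[OF C2 C(3)]]) (simp add: slice_measures_def)
   moreover have "(\<integral>\<^sup>+\<xi>'. ennreal (w p \<xi>' ^ (2 * s)) * \<beta> p \<xi>' \<partial>return borel \<xi>) = ennreal (w p \<xi> ^ (2 * s)) * \<beta> p \<xi>"
    using wm[of p] \<beta>m[of p] by (intro nn_integral_return) auto
   ultimately show ?thesis by simp
  qed
  have Nfin: "N p < \<top>" for p
   using amp_piece_finite[OF Fm B, of \<delta> p] unfolding N_def N0_def amp_piece_norm by (simp add: ennreal_mult_less_top)
  have bb: "b \<xi> \<le> ennreal C * (\<integral>\<^sup>+p. ennreal (w p \<xi> ^ s) * \<beta> p \<xi> \<partial>count_space ?I)" for \<xi>
  proof -
   have "b \<xi> \<le> ennreal ?cn * (ennreal D * (\<integral>\<^sup>+p. ennreal (w p \<xi> ^ s) * \<beta> p \<xi> \<partial>count_space ?I))"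
    unfolding b_def w_def \<beta>_def by (rule psido_stft_pieces[OF \<sigma> \<delta> f cnt])
   also have "\<dots> = ennreal (?cn * D) * (\<integral>\<^sup>+p. ennreal (w p \<xi> ^ s) * \<beta> p \<xi> \<partial>count_space ?I)"
    using D by (simp add: ennreal_mult mult.assoc)
   also have "\<dots> \<le> ennreal C * (\<integral>\<^sup>+p. ennreal (w p \<xi> ^ s) * \<beta> p \<xi> \<partial>count_space ?I)"
    by (intro mult_right_mono ennreal_leI C) simp
   finally show ?thesis .
  qed
  have loc: "(\<integral>\<^sup>+z. (if fl z = fl \<xi> then ennreal ((norm (?F z))\<^sup>2) else 0) \<partial>lborel) \<le> ennreal ?K2 * a \<xi>" for \<xi>
   unfolding a_def by (rule local_fourier_le_stft[OF f refl])
  have Npow: "enn_powr (N p) r = ennreal (((L p)\<^sup>2) powr r) * enn_powr (N0 p) r" for p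
   unfolding N_def by (simp add: enn_powr_mult[OF r0])
  have cI: "countable ?I" by simp
  have "(\<integral>\<^sup>+\<xi>. enn_powr (b \<xi>) r \<partial>lborel) \<le> ennreal T * (\<integral>\<^sup>+\<xi>. enn_powr (a \<xi>) r \<partial>lborel)"
  proof (cases "r \<le> 1")
   case True
   \<comment> \<open>For q \<le> 2 the absolute value is 1/q - 1/2; multiplication by q = 2 r turns
     the threshold into the hypothesis of \<open>scale_factor_le\<close> with e = 1 - r.\<close>
   have me: "2 * m * r + (1 - r) * \<delta> * real CARD('n) \<le> 0"
   proof -
    have "1 / q \<ge> 1 / 2" using True q by (simp add: r_def field_simps)
    then have "m \<le> - (1 / q - 1 / 2) * \<delta> * real CARD('n)" using m by simp
    then have "m * q \<le> (- (1 / q - 1 / 2) * \<delta> * real CARD('n)) * q" using q by (intro mult_right_mono) auto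
    also have "\<dots> = - (1 - r) * \<delta> * real CARD('n)" using q by (simp add: r_def field_simps)
    finally show ?thesis by (simp add: r_def algebra_simps)
   qed
   have "(\<integral>\<^sup>+\<xi>. enn_powr (b \<xi>) r \<partial>lborel) \<le> ennreal (C powr r * (2 * C)) * (\<integral>\<^sup>+p. ennreal (V p powr (1 - r)) * enn_powr (N p) r \<partial>count_space ?I)"
   proof (rule assembly_small_exponent[where w = w and \<beta> = \<beta> and s = s])
    show "\<beta> p \<xi> \<le> ennreal C * N p" if "p \<in> ?I" for p \<xi>
    proof -
     have "1 * \<beta> p \<xi> \<le> ennreal (w p \<xi> ^ (2 * s)) * \<beta> p \<xi>"
      using one_le_power[OF w1[of p \<xi>], of "2 * s"] by (intro mult_right_mono) auto
     then show ?thesis using sup[OF that, of \<xi>] by simp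
    qed
    show "(\<integral>\<^sup>+\<xi>. ennreal (1 / w p \<xi> ^ s) \<partial>lborel) \<le> ennreal (C * V p)" if "p \<in> ?I" for p
    proof -
     have "(\<integral>\<^sup>+\<xi>. ennreal (1 / w p \<xi> ^ s) \<partial>lborel) \<le> (\<integral>\<^sup>+\<xi>. ennreal (1 / w p \<xi> ^ CARD('n)) \<partial>lborel)"
     proof (intro nn_integral_mono ennreal_leI)
      fix \<xi>
      have "w p \<xi> ^ CARD('n) \<le> w p \<xi> ^ s" unfolding s_def by (intro power_increasing w1) simp
      then show "1 / w p \<xi> ^ s \<le> 1 / w p \<xi> ^ CARD('n)" using w1[of p \<xi>] by (intro divide_left_mono) auto
     qed
     also have "\<dots> \<le> (ennreal (real (rad \<delta> (fst p))) * cauchy_mass) ^ CARD('n)"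
      unfolding w_def by (rule wgt_integral[OF Rpos])
     also have "\<dots> = ennreal (V p * cm ^ CARD('n))"
      using cm Rpos[of p] unfolding V_def cm(2) by (simp add: ennreal_mult[symmetric] ennreal_power power_mult_distrib)
     also have "\<dots> \<le> ennreal (C * V p)" using C(4) V0[of p] by (intro ennreal_leI) (simp add: mult.commute)
     finally show ?thesis .
    qed
   qed (use r12 True C wm \<beta>m w1 L2_3 V0 Nfin bb cI in \<open>auto simp: less_imp_le\<close>)
   also have "(\<integral>\<^sup>+p. ennreal (V p powr (1 - r)) * enn_powr (N p) r \<partial>count_space ?I) \<le>
    (\<integral>\<^sup>+p. ennreal (?K2 powr r) * (\<integral>\<^sup>+\<xi>. (if idx \<delta> (fl \<xi>) = p then enn_powr (a \<xi>) r else 0) \<partial>lborel) \<partial>count_space ?I)"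
   proof (rule nn_integral_mono)
    fix p
    have sc: "V p powr (1 - r) * ((L p)\<^sup>2) powr r \<le> 1"
     unfolding V_def L_def by (rule scale_factor_le[OF \<delta>(1) _ me]) (use True in simp)
    have "ennreal (V p powr (1 - r)) * enn_powr (N p) r = ennreal (V p powr (1 - r) * ((L p)\<^sup>2) powr r) * enn_powr (N0 p) r"
     unfolding Npow by (simp add: ennreal_mult mult.assoc)
    also have "\<dots> \<le> ennreal 1 * enn_powr (N0 p) r" by (intro mult_right_mono ennreal_leI sc) simp
    also have "\<dots> = enn_powr (N0 p) r" by simp
    also have "\<dots> \<le> ennreal (?K2 powr r) * (\<integral>\<^sup>+\<xi>. (if idx \<delta> (fl \<xi>) = p then enn_powr (a \<xi>) r else 0) \<partial>lborel)"
     unfolding N0_def by (rule piece_small_exponent[OF r0 True Fm am K2 loc])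
    finally show "ennreal (V p powr (1 - r)) * enn_powr (N p) r \<le> ennreal (?K2 powr r) * (\<integral>\<^sup>+\<xi>. (if idx \<delta> (fl \<xi>) = p then enn_powr (a \<xi>) r else 0) \<partial>lborel)" .
   qed
   also have "\<dots> = ennreal (?K2 powr r) * (\<integral>\<^sup>+p. (\<integral>\<^sup>+\<xi>. (if idx \<delta> (fl \<xi>) = p then enn_powr (a \<xi>) r else 0) \<partial>lborel) \<partial>count_space ?I)"
    by (rule nn_integral_cmult) simp
   also have "\<dots> \<le> ennreal (?K2 powr r) * (\<integral>\<^sup>+\<xi>. enn_powr (a \<xi>) r \<partial>lborel)"
    by (intro mult_left_mono sum_pieces_le) auto
   finally have "(\<integral>\<^sup>+\<xi>. enn_powr (b \<xi>) r \<partial>lborel) \<le> ennreal (C powr r * (2 * C)) * (ennreal (?K2 powr r) * (\<integral>\<^sup>+\<xi>. enn_powr (a \<xi>) r \<partial>lborel))"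
    by (simp add: mult_left_mono)
   also have "\<dots> = ennreal T * (\<integral>\<^sup>+\<xi>. enn_powr (a \<xi>) r \<partial>lborel)"
   proof -
    have "T = (C powr r * (2 * C)) * ?K2 powr r" using True by (simp add: T_def)
    then have "ennreal T = ennreal (C powr r * (2 * C)) * ennreal (?K2 powr r)"
     using C(1) by (simp only: ennreal_mult powr_ge_zero mult_nonneg_nonneg zero_le_numeral less_imp_le)
    then show ?thesis by (simp only: mult.assoc)
   qed
   finally show ?thesis .
  next
   case False
   then have r1: "1 \<le> r" by simp
   \<comment> \<open>The same computation for q > 2, where the absolute value is 1/2 - 1/q and e = r
     - 1.\<close>
   have me: "2 * m * r + (r - 1) * \<delta> * real CARD('n) \<le> 0"
   proof -
    have "1 / q \<le> 1 / 2" using False q by (simp add: r_def field_simps)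
    then have "m \<le> - (1 / 2 - 1 / q) * \<delta> * real CARD('n)" using m by simp
    then have "m * q \<le> (- (1 / 2 - 1 / q) * \<delta> * real CARD('n)) * q" using q by (intro mult_right_mono) auto
    also have "\<dots> = - (r - 1) * \<delta> * real CARD('n)" using q by (simp add: r_def field_simps)
    finally show ?thesis by (simp add: r_def algebra_simps)
   qed
   let ?E = "C powr r * (2 powr r * D powr (r - 1)) * C powr r"
   have "(\<integral>\<^sup>+\<xi>. enn_powr (b \<xi>) r \<partial>lborel) \<le> ennreal ?E * (\<integral>\<^sup>+p. enn_powr (N p) r \<partial>count_space ?I)"
    by (rule assembly_large_exponent[where w = w and \<beta> = \<beta> and s = s])
      (use r1 C(1) D wm \<beta>m w1 cnt L2_2 sup Nfin bb cI in \<open>auto simp: w_def\<close>)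
   also have "(\<integral>\<^sup>+p. enn_powr (N p) r \<partial>count_space ?I) \<le>
    (\<integral>\<^sup>+p. ennreal (?K2 powr r * 2 powr r) * (\<integral>\<^sup>+\<xi>. (if idx \<delta> (fl \<xi>) = p then enn_powr (a \<xi>) r else 0) \<partial>lborel) \<partial>count_space ?I)"
   proof (rule nn_integral_mono)
    fix p
    let ?A = "\<integral>\<^sup>+\<xi>. (if idx \<delta> (fl \<xi>) = p then enn_powr (a \<xi>) r else 0) \<partial>lborel"
    have sc: "V p powr (r - 1) * ((L p)\<^sup>2) powr r \<le> 1"
     unfolding V_def L_def by (rule scale_factor_le[OF \<delta>(1) _ me]) (use r1 in simp)
    have "enn_powr (N p) r \<le> ennreal (((L p)\<^sup>2) powr r) * (ennreal (?K2 powr r * (2 powr r * V p powr (r - 1))) * ?A)"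
     unfolding Npow N0_def V_def by (intro mult_left_mono piece_large_exponent[OF r1 Fm am K2 loc]) simp
    also have "\<dots> = ennreal ((?K2 powr r * 2 powr r) * (V p powr (r - 1) * ((L p)\<^sup>2) powr r)) * ?A"
     by (subst mult.assoc[symmetric], subst ennreal_mult[symmetric]) (auto simp: mult_ac)
    also have "\<dots> \<le> ennreal ((?K2 powr r * 2 powr r) * 1) * ?A"
     by (intro mult_right_mono ennreal_leI mult_left_mono sc) auto
    finally show "enn_powr (N p) r \<le> ennreal (?K2 powr r * 2 powr r) * ?A" by (simp only: mult_1_right)
   qed
   also have "\<dots> = ennreal (?K2 powr r * 2 powr r) * (\<integral>\<^sup>+p. (\<integral>\<^sup>+\<xi>. (if idx \<delta> (fl \<xi>) = p then enn_powr (a \<xi>) r else 0) \<partial>lborel) \<partial>count_space ?I)"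
    by (rule nn_integral_cmult) simp
   also have "\<dots> \<le> ennreal (?K2 powr r * 2 powr r) * (\<integral>\<^sup>+\<xi>. enn_powr (a \<xi>) r \<partial>lborel)"
    by (intro mult_left_mono sum_pieces_le) auto
   finally have "(\<integral>\<^sup>+\<xi>. enn_powr (b \<xi>) r \<partial>lborel) \<le> ennreal ?E * (ennreal (?K2 powr r * 2 powr r) * (\<integral>\<^sup>+\<xi>. enn_powr (a \<xi>) r \<partial>lborel))"
    by (simp add: mult_left_mono)
   also have "\<dots> = ennreal T * (\<integral>\<^sup>+\<xi>. enn_powr (a \<xi>) r \<partial>lborel)"
   proof -
    have "T = ?E * (?K2 powr r * 2 powr r)" using False by (simp add: T_def)
    then have "ennreal T = ennreal ?E * ennreal (?K2 powr r * 2 powr r)"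
     by (simp only: ennreal_mult powr_ge_zero mult_nonneg_nonneg)
    then show ?thesis by (simp only: mult.assoc)
   qed
   finally show ?thesis .
  qed
  then show ?thesis unfolding a_def b_def .
 qed
 show ?thesis
  unfolding bounded_on_M2q_def
 proof (intro exI[of _ "T powr (1 / q) + 1"] conjI allI impI)
  show "0 < T powr (1 / q) + 1" by (simp add: add_nonneg_pos)
  fix f :: "real^'n => complex" assume f: "schwartz f"
  have q0: "0 < 1 / q" using q by simp
  have "mod_norm_2q q (psido \<sigma> f) \<le> enn_powr (ennreal T * (\<integral>\<^sup>+\<xi>. enn_powr (\<integral>\<^sup>+x. ennreal ((norm (stft gauss_window f x \<xi>))\<^sup>2) \<partial>lborel) r \<partial>lborel)) (1 / q)"
   unfolding mod_norm_2q_def r_def[symmetric] using q0 by (intro enn_powr_mono main f) auto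
  also have "\<dots> = ennreal (T powr (1 / q)) * mod_norm_2q q f"
   unfolding mod_norm_2q_def r_def[symmetric] enn_powr_mult[OF q0] using T0 by simp
  also have "\<dots> \<le> ennreal (T powr (1 / q) + 1) * mod_norm_2q q f"
   by (intro mult_right_mono ennreal_leI) auto
  finally show "mod_norm_2q q (psido \<sigma> f) \<le> ennreal (T powr (1 / q) + 1) * mod_norm_2q q f" .
 qed
qed

section \<open>A calculus of smooth functions\<close>

text \<open>A smooth function is carried together with the tower of its derivatives,
  \<open>U k\<close> being the k-th derivative of \<open>U 0\<close>. Explicit towers keep the
  iterated derivatives of the test symbol computable.\<close>

definition smooth1 :: "(nat => real => complex) => bool" where
 "smooth1 U \<longleftrightarrow> (\<forall>k t. (U k has_vector_derivative U (Suc k) t) (at t))"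

lemma smooth1D: "smooth1 U ==> (U k has_vector_derivative U (Suc k) t) (at t)"
 by (simp add: smooth1_def)

text \<open>Sums and products of functions from towers composed with linear forms are stable under
  directional derivatives, so differentiability to all orders follows by rule induction.\<close>

inductive elem :: "('a::real_normed_vector => complex) => bool" where
 comp: "smooth1 U ==> bounded_linear l ==> elem (%x. U k (l x))"
| const: "elem (%_. c)"
| add: "elem f ==> elem g ==> elem (%x. f x + g x)"
| mult: "elem f ==> elem g ==> elem (%x. f x * g x)"

lemma dderiv_eqI: "(g has_derivative g') (at x) ==> dderiv v g x = g' v"
 unfolding dderiv_def by (simp add: frechet_derivative_at[symmetric])

lemma elem_deriv: "elem g ==> (\<forall>x. g differentiable (at x)) \<and> elem (dderiv v g)"
proof (induction rule: elem.induct)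
 case (comp U l k)
 have d: "((%x. U k (l x)) has_derivative (%h. l h *\<^sub>R U (Suc k) (l x))) (at x)" for x
 proof -
  have "(l has_derivative l) (at x)" using comp(2) by (rule bounded_linear_imp_has_derivative)
  moreover have "(U k has_derivative (%h. h *\<^sub>R U (Suc k) (l x))) (at (l x))"
   using smooth1D[OF comp(1)] unfolding has_vector_derivative_def .
  ultimately show ?thesis using diff_chain_at by (fastforce simp: o_def)
 qed
 have "dderiv v (%x. U k (l x)) = (%x. complex_of_real (l v) * U (Suc k) (l x))"
  by (rule ext) (simp add: dderiv_eqI[OF d] scaleR_conv_of_real)
 moreover have "elem (%x. complex_of_real (l v) * U (Suc k) (l x))"
  by (intro elem.mult elem.const elem.comp comp)
 ultimately show ?case using d unfolding differentiable_def by auto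
next
 case (const c)
 have d: "((%x::'a. c) has_derivative (%h. 0)) (at x)" for x by simp
 have "dderiv v (%x::'a. c) = (%x. 0)" by (rule ext) (simp add: dderiv_eqI[OF d])
 then show ?case using elem.const[of 0] by simp
next
 case (add f g)
 have d: "((%x. f x + g x) has_derivative (%h. frechet_derivative f (at x) h + frechet_derivative g (at x) h)) (at x)" for x
  using add.IH by (intro has_derivative_add) (auto simp: frechet_derivative_works[symmetric])
 have "dderiv v (%x. f x + g x) = (%x. dderiv v f x + dderiv v g x)"
  by (rule ext) (simp add: dderiv_eqI[OF d], simp add: dderiv_def)
 then show ?case using add.IH elem.add d unfolding differentiable_def by auto
next
 case (mult f g)
 have d: "((%x. f x * g x) has_derivative (%h. f x * frechet_derivative g (at x) h + frechet_derivative f (at x) h * g x)) (at x)" for x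
  using mult.IH by (intro has_derivative_mult) (auto simp: frechet_derivative_works[symmetric])
 have "dderiv v (%x. f x * g x) = (%x. f x * dderiv v g x + dderiv v f x * g x)"
  by (rule ext) (simp add: dderiv_eqI[OF d], simp add: dderiv_def)
 moreover have "elem (%x. f x * dderiv v g x + dderiv v f x * g x)"
  using mult by (intro elem.add elem.mult) auto
 ultimately show ?case using d unfolding differentiable_def by auto
qed

lemma elem_iter: "elem g ==> elem (iter_dderiv vs g)"
 by (induction vs) (auto simp: elem_deriv)

lemma elem_smooth: "elem g ==> smooth_fun g"
 unfolding smooth_fun_def using elem_iter elem_deriv by blast

lemma elem_prod: "finite S ==> (\<And>i. i \<in> S ==> elem (f i)) ==> elem (%x. \<Prod>i\<in>S. f i x)"
 by (induction S rule: finite_induct) (auto intro: elem.intros)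

lemma elem_sum: "finite S ==> (\<And>i. i \<in> S ==> elem (f i)) ==> elem (%x. \<Sum>i\<in>S. f i x)"
 by (induction S rule: finite_induct) (auto intro: elem.intros)

text \<open>Allows a locally finite sum to be differentiated as a finite one, and derivatives to
  vanish off the support.\<close>

lemma iter_dderiv_local:
 assumes "open S" "\<And>y. y \<in> S ==> g y = h y" "y \<in> S"
 shows "iter_dderiv vs g y = iter_dderiv vs h y"
 using assms(3)
proof (induction vs arbitrary: y)
 case Nil
 then show ?case using assms(2) by simp
next
 case (Cons v vs)
 have "(iter_dderiv vs g has_derivative D) (at y) \<longleftrightarrow> (iter_dderiv vs h has_derivative D) (at y)" for D
  using Cons assms(1) by (auto elim!: has_derivative_transform_within_open)
 then show ?case by (simp add: dderiv_def frechet_derivative_def)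
qed

lemma smooth_fun_local:
 assumes "\<And>x. \<exists>S h. open S \<and> x \<in> S \<and> smooth_fun h \<and> (\<forall>y\<in>S. g y = h y)"
 shows "smooth_fun g"
 unfolding smooth_fun_def
proof (intro allI)
 fix vs x
 obtain S h where S: "open S" "x \<in> S" "smooth_fun h" "\<And>y. y \<in> S ==> g y = h y" using assms by metis
 have "iter_dderiv vs h differentiable at x" using S(3) by (simp add: smooth_fun_def)
 then obtain D where "(iter_dderiv vs h has_derivative D) (at x)" by (auto simp: differentiable_def)
 then have "(iter_dderiv vs g has_derivative D) (at x)"
  by (rule has_derivative_transform_within_open[OF _ S(1,2)]) (simp add: iter_dderiv_local[OF S(1,4)])
 then show "iter_dderiv vs g differentiable at x" by (auto simp: differentiable_def)
qed

definition derivs :: "(real => complex) => nat => real => complex" where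
 "derivs g k = iter_dderiv (replicate k 1) g"

lemma derivs_0 [simp]: "derivs g 0 = g"
 by (simp add: derivs_def)

lemma smooth1_derivs: "smooth_fun g ==> smooth1 (derivs g)"
 unfolding smooth1_def derivs_def
proof (intro allI)
 fix k t assume g: "smooth_fun g"
 have "((%s. iter_dderiv (replicate k 1) g s) has_vector_derivative dderiv 1 (iter_dderiv (replicate k 1) g) t) (at t)"
  using g by (intro dderiv_has_vector_derivative[where h = "%s. s"]) (auto simp: smooth_fun_def has_vector_derivative_def)
 then show "(iter_dderiv (replicate k 1) g has_vector_derivative iter_dderiv (replicate (Suc k) 1) g t) (at t)" by simp
qed

lemma derivs_vanish:
 assumes "open S" "\<And>t. t \<in> S ==> g t = 0" "t \<in> S"
 shows "derivs g k t = 0"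
proof -
 have z: "iter_dderiv vs (%_. 0) = (%_. (0::complex))" for vs :: "real list"
  by (induction vs) (auto simp: dderiv_def)
 show ?thesis using iter_dderiv_local[OF assms(1), of g "%_. 0" t] assms z by (simp add: derivs_def)
qed

lemma tensor_has_vector_derivative:
 assumes U: "\<And>i. smooth1 (U i)"
 shows "((%s. \<Prod>i\<in>UNIV. U i (\<beta> i) (upd x j s $ i)) has_vector_derivative
   (\<Prod>i\<in>UNIV. U i ((\<beta>(j := Suc (\<beta> j))) i) (upd x j s $ i))) (at s)"
proof -
 let ?c = "\<Prod>i\<in>UNIV - {j}. U i (\<beta> i) (x $ i)"
 have e: "(\<Prod>i\<in>UNIV. U i (\<beta>' i) (upd x j s $ i)) = U j (\<beta>' j) s * (\<Prod>i\<in>UNIV - {j}. U i (\<beta>' i) (x $ i))" for s \<beta>'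
  by (subst prod.remove[of _ j]) (auto intro!: prod.cong)
 have c: "(\<Prod>i\<in>UNIV - {j}. U i ((\<beta>(j := Suc (\<beta> j))) i) (x $ i)) = ?c"
  by (intro prod.cong) auto
 show ?thesis unfolding e c using has_vector_derivative_mult_left[OF smooth1D[OF U]] by simp
qed

text \<open>A partial derivative acts on the factor of its own coordinate only, so the list matters
  just through its multiplicities.\<close>

lemma iter_dderiv_tensor:
 fixes U :: "'n::finite => nat => real => complex"
 assumes U: "\<And>i. smooth1 (U i)"
 shows "partials is (%x::real^'n. \<Prod>i\<in>UNIV. U i 0 (x $ i)) = (%x. \<Prod>i\<in>UNIV. U i (count_list is i) (x $ i))"
proof (induction "is")
 case (Cons j js)
 show ?case
 proof (rule ext)
  fix x :: "real^'n"
  let ?g = "%x::real^'n. \<Prod>i\<in>UNIV. U i (count_list js i) (x $ i)"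
  have el: "elem ?g"
   by (intro elem_prod elem.comp U bounded_linear_vec_nth) auto
  have ux: "upd x j (x $ j) = x" by (simp add: vec_eq_iff)
  have "((%s. ?g (upd x j s)) has_vector_derivative dderiv (axis j 1) ?g (upd x j (x $ j))) (at (x $ j))"
   using elem_deriv[OF el] by (intro dderiv_has_vector_derivative upd_has_vector_derivative) auto
  moreover have "((%s. ?g (upd x j s)) has_vector_derivative
    (\<Prod>i\<in>UNIV. U i (((count_list js)(j := Suc (count_list js j))) i) (upd x j (x $ j) $ i))) (at (x $ j))"
   by (rule tensor_has_vector_derivative[OF U])
  ultimately have "dderiv (axis j 1) ?g (upd x j (x $ j)) = (\<Prod>i\<in>UNIV. U i (((count_list js)(j := Suc (count_list js j))) i) (upd x j (x $ j) $ i))"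
   by (rule vector_derivative_unique_at)
  then have "dderiv (axis j 1) ?g x = (\<Prod>i\<in>UNIV. U i (((count_list js)(j := Suc (count_list js j))) i) (x $ i))"
   unfolding ux .
  also have "(count_list js)(j := Suc (count_list js j)) = count_list (j # js)"
   by (auto simp: fun_eq_iff)
  finally show "partials (j # js) (%x::real^'n. \<Prod>i\<in>UNIV. U i 0 (x $ i)) x = (\<Prod>i\<in>UNIV. U i (count_list (j # js) i) (x $ i))"
   using Cons.IH by simp
 qed
qed simp

text \<open>The counterpart for sums of products of an x-tensor and a \<xi>-tensor, with the
  derivatives in the order that \<open>symbol_class\<close> prescribes. Indexing \<open>T\<close> by
  the multiplicities in both variables keeps the inductions inside one family.\<close>

lemma iter_dderiv_tensor_sum:
 fixes U W :: "nat => 'n::finite => nat => real => complex" and c :: "nat => complex" and K :: nat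
 assumes U: "\<And>k i. smooth1 (U k i)" and W: "\<And>k i. smooth1 (W k i)"
 defines "T \<equiv> %\<alpha> \<beta> (p :: (real^'n) \<times> (real^'n)). \<Sum>k<K. c k * (\<Prod>i\<in>UNIV. U k i (\<beta> i) (fst p $ i)) * (\<Prod>i\<in>UNIV. W k i (\<alpha> i) (snd p $ i))"
 shows "iter_dderiv (map (%i. (0, axis i 1)) as @ map (%j. (axis j 1, 0)) bs) (T (%_. 0) (%_. 0)) = T (count_list as) (count_list bs)"
  and "elem (T \<alpha> \<beta>)"
proof -
 have el: "elem (T \<alpha> \<beta>)" for \<alpha> \<beta>
 proof -
  have b1: "bounded_linear (%p :: (real^'n) \<times> (real^'n). fst p $ i)" for i
   by (intro bounded_linear_compose[OF bounded_linear_vec_nth bounded_linear_fst])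
  have b2: "bounded_linear (%p :: (real^'n) \<times> (real^'n). snd p $ i)" for i
   by (intro bounded_linear_compose[OF bounded_linear_vec_nth bounded_linear_snd])
  show ?thesis unfolding T_def
   by (intro elem_sum elem.mult elem.const elem_prod elem.comp[OF U b1] elem.comp[OF W b2]) auto
 qed
 then show "elem (T \<alpha> \<beta>)" .
 have up: "(count_list js)(j := Suc (count_list js j)) = count_list (j # js)" for j :: 'n and js
  by (auto simp: fun_eq_iff)
 have d1: "dderiv (axis j 1, 0) (T \<alpha> \<beta>) (x, z) = T \<alpha> (\<beta>(j := Suc (\<beta> j))) (x, z)" for \<alpha> \<beta> j x z
 proof -
  have ux: "upd x j (x $ j) = x" by (simp add: vec_eq_iff)
  have "((%s. (upd x j s, z)) has_vector_derivative (axis j 1, 0)) (at (x $ j))"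
   by (intro has_vector_derivative_Pair has_vector_derivative_const upd_has_vector_derivative)
  then have "((%s. T \<alpha> \<beta> (upd x j s, z)) has_vector_derivative dderiv (axis j 1, 0) (T \<alpha> \<beta>) (upd x j (x $ j), z)) (at (x $ j))"
   using elem_deriv[OF el] by (intro dderiv_has_vector_derivative) auto
  moreover have "((%s. T \<alpha> \<beta> (upd x j s, z)) has_vector_derivative T \<alpha> (\<beta>(j := Suc (\<beta> j))) (upd x j (x $ j), z)) (at (x $ j))"
   unfolding T_def fst_conv snd_conv
   by (intro has_vector_derivative_sum has_vector_derivative_mult_left has_vector_derivative_mult_right tensor_has_vector_derivative U)
  ultimately show ?thesis using vector_derivative_unique_at unfolding ux by blast
 qed
 have d2: "dderiv (0, axis j 1) (T \<alpha> \<beta>) (x, z) = T (\<alpha>(j := Suc (\<alpha> j))) \<beta> (x, z)" for \<alpha> \<beta> j x z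
 proof -
  have ux: "upd z j (z $ j) = z" by (simp add: vec_eq_iff)
  have "((%s. (x, upd z j s)) has_vector_derivative (0, axis j 1)) (at (z $ j))"
   by (intro has_vector_derivative_Pair has_vector_derivative_const upd_has_vector_derivative)
  then have "((%s. T \<alpha> \<beta> (x, upd z j s)) has_vector_derivative dderiv (0, axis j 1) (T \<alpha> \<beta>) (x, upd z j (z $ j))) (at (z $ j))"
   using elem_deriv[OF el] by (intro dderiv_has_vector_derivative) auto
  moreover have "((%s. T \<alpha> \<beta> (x, upd z j s)) has_vector_derivative T (\<alpha>(j := Suc (\<alpha> j))) \<beta> (x, upd z j (z $ j))) (at (z $ j))"
   unfolding T_def fst_conv snd_conv
   by (intro has_vector_derivative_sum has_vector_derivative_mult_right tensor_has_vector_derivative W)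
  ultimately show ?thesis using vector_derivative_unique_at unfolding ux by blast
 qed
 have b: "iter_dderiv (map (%j. (axis j 1, 0)) bs) (T (%_. 0) (%_. 0)) = T (%_. 0) (count_list bs)"
 proof (induction bs)
  case Nil
  have "count_list [] = (%_::'n. 0)" by (simp add: fun_eq_iff)
  then show ?case by simp
 next
  case (Cons j bs)
  then show ?case by (simp only: list.map iter_dderiv.simps) (auto simp: fun_eq_iff d1 up simp del: count_list.simps)
 qed
 show "iter_dderiv (map (%i. (0, axis i 1)) as @ map (%j. (axis j 1, 0)) bs) (T (%_. 0) (%_. 0)) = T (count_list as) (count_list bs)"
 proof (induction as)
  case Nil
  have "count_list [] = (%_::'n. 0)" by (simp add: fun_eq_iff)
  then show ?case using b by simp
 next
  case (Cons j as)
  then show ?case by (simp only: list.map append_Cons iter_dderiv.simps) (auto simp: fun_eq_iff d2 up simp del: count_list.simps)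
 qed
qed

lemma sum_count_list: "(\<Sum>i\<in>UNIV. count_list xs (i::'n::finite)) = length xs"
 by (rule sum_count_set) auto

section \<open>A smooth bump\<close>

text \<open>The polynomials P_k for which the k-th derivative of exp (- 1/t), t > 0, is P_k(1/t) exp
  (- 1/t). With s = 1/t, differentiation in t gives P_(k+1)(s) = s^2 (P_k(s) - P_k'(s)).\<close>

fun bump_poly :: "nat => real poly" where
 "bump_poly 0 = 1"
| "bump_poly (Suc k) = [:0, 0, 1:] * (bump_poly k - pderiv (bump_poly k))"

lemma poly_exp_minus_tendsto: "((%s::real. poly p s * exp (- s)) \<longlongrightarrow> 0) at_top"
proof -
 have "((%s::real. \<Sum>i\<le>degree p. coeff p i * (s ^ i / exp s)) \<longlongrightarrow> (\<Sum>i\<le>degree p. coeff p i * 0)) at_top"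
  by (intro tendsto_sum tendsto_mult tendsto_const tendsto_power_div_exp_0)
 moreover have "(\<Sum>i\<le>degree p. coeff p i * (s ^ i / exp s)) = poly p s * exp (- s)" for s
  by (simp add: poly_altdef sum_distrib_right exp_minus divide_inverse mult.assoc)
 ultimately show ?thesis by simp
qed

definition flatr :: "nat => real => real" where
 "flatr k t = (if t > 0 then poly (bump_poly k) (1 / t) * exp (- (1 / t)) else 0)"

text \<open>The point t = 0 is the delicate one: from the right the difference quotient is a
  polynomial in 1/h times exp (- 1/h), from the left it vanishes.\<close>

lemma flatr_deriv: "(flatr k has_field_derivative flatr (Suc k) t) (at t)"
proof (cases "t = 0")
 case True
 have "((%h. (flatr k (0 + h) - flatr k 0) / h) \<longlongrightarrow> 0) (at_right 0)"
 proof -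
  have "((%h::real. poly ([:0, 1:] * bump_poly k) (inverse h) * exp (- inverse h)) \<longlongrightarrow> 0) (at_right 0)"
   by (rule filterlim_compose[OF poly_exp_minus_tendsto filterlim_inverse_at_top_right])
  then show ?thesis
   by (rule Lim_transform_eventually) (auto simp: eventually_at_filter flatr_def field_simps)
 qed
 moreover have "((%h. (flatr k (0 + h) - flatr k 0) / h) \<longlongrightarrow> 0) (at_left 0)"
  by (rule tendsto_eventually) (auto simp: eventually_at_filter flatr_def)
 ultimately have "((%h. (flatr k (0 + h) - flatr k 0) / h) \<longlongrightarrow> 0) (at 0)"
  by (rule filterlim_split_at[rotated])
 moreover have "flatr (Suc k) 0 = 0" by (simp add: flatr_def)
 ultimately show ?thesis unfolding True by (simp only: DERIV_def)
next
 case False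
 show ?thesis
 proof (cases "t > 0")
  case True
  have "((%t. poly (bump_poly k) (1 / t) * exp (- (1 / t))) has_field_derivative flatr (Suc k) t) (at t)"
   using True by (auto intro!: derivative_eq_intros DERIV_chain2[OF poly_DERIV] simp: flatr_def field_simps power2_eq_square)
  then show ?thesis
   by (rule has_field_derivative_transform_within_open[of _ _ _ "{0<..}"]) (use True in \<open>auto simp: flatr_def\<close>)
 next
  case F: False
  have "((%t. 0) has_field_derivative flatr (Suc k) t) (at t)" using F by (simp add: flatr_def)
  then show ?thesis
   by (rule has_field_derivative_transform_within_open[of _ _ _ "{..<0}"]) (use F False in \<open>auto simp: flatr_def\<close>)
 qed
qed

lemma smooth1_flat: "smooth1 (%k t. complex_of_real (flatr k t))"
 unfolding smooth1_def
 using flatr_deriv by (auto intro!: has_vector_derivative_of_real simp: has_real_derivative_iff_has_vector_derivative)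

text \<open>The support |t| \<le> 1/4 keeps unit translates apart; on |t| \<le> 1/8 both factors are
  at least exp (- 8).\<close>

definition bump :: "real => complex" where
 "bump t = complex_of_real (flatr 0 (t + 1/4) * flatr 0 (1/4 - t))"

text \<open>The dilated tower has k-th member a^k U k (a t + b), from which the factor a^k is
  divided out; for a = 0 the function is constant.\<close>

lemma elem_id_affine:
 assumes "smooth1 U" shows "elem (%t::real. U k (a * t + b))"
proof -
 have "smooth1 (%k s. complex_of_real (a ^ k) * U k (a * s + b))"
  unfolding smooth1_def
 proof (intro allI)
  fix k t
  have "((%s. a * s + b) has_vector_derivative a) (at t)"
   by (auto intro!: derivative_eq_intros simp: has_real_derivative_iff_has_vector_derivative[symmetric])
  from vector_diff_chain_at[OF this smooth1D[OF assms, of k]]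
  have "((%s. U k (a * s + b)) has_vector_derivative a *\<^sub>R U (Suc k) (a * t + b)) (at t)" by (simp add: o_def)
  from has_vector_derivative_mult_right[OF this, of "complex_of_real (a ^ k)"]
  show "((%s. complex_of_real (a ^ k) * U k (a * s + b)) has_vector_derivative complex_of_real (a ^ Suc k) * U (Suc k) (a * t + b)) (at t)"
   by (simp add: scaleR_conv_of_real mult_ac)
 qed
 note s = this
 show ?thesis
 proof (cases "a = 0")
  case True
  then show ?thesis by (simp add: elem.const)
 next
  case False
  have "elem (%t::real. complex_of_real (1 / a ^ k) * (complex_of_real (a ^ k) * U k (a * t + b)))"
   by (intro elem.mult elem.const elem.comp[OF s, where l = "%t. t"]) (rule bounded_linear_ident)
  then show ?thesis using False by (simp add: mult.assoc[symmetric] of_real_mult[symmetric] del: of_real_mult)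
 qed
qed

lemma elem_bump: "elem bump"
proof -
 have "elem (%t::real. complex_of_real (flatr 0 (1 * t + 1/4)) * complex_of_real (flatr 0 ((-1) * t + 1/4)))"
  by (intro elem.mult elem_id_affine[OF smooth1_flat])
 moreover have "(%t::real. complex_of_real (flatr 0 (1 * t + 1/4)) * complex_of_real (flatr 0 ((-1) * t + 1/4))) = bump"
  by (simp add: fun_eq_iff bump_def algebra_simps)
 ultimately show ?thesis by simp
qed

lemma bump_real: "bump t = complex_of_real (Re (bump t))" "0 \<le> Re (bump t)"
 by (auto simp: bump_def flatr_def)

lemma bump_vanish: "1/4 \<le> \<bar>t\<bar> ==> bump t = 0"
 by (auto simp: bump_def flatr_def)

lemma bump_ge: "\<bar>t\<bar> \<le> 1/8 ==> exp (- 16) \<le> Re (bump t)"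
proof -
 assume t: "\<bar>t\<bar> \<le> 1/8"
 have 1: "exp (- 8) \<le> flatr 0 u" if "1/8 \<le> u" for u
 proof -
  have "1 / u \<le> 8" using that by (simp add: divide_le_eq)
  then show ?thesis using that by (simp add: flatr_def)
 qed
 have "exp (- 8) * exp (- 8) \<le> flatr 0 (t + 1/4) * flatr 0 (1/4 - t)"
  using t by (intro mult_mono 1) (auto simp: flatr_def)
 then show ?thesis by (simp add: bump_def exp_add[symmetric])
qed

section \<open>Rudin-Shapiro polynomials and their derivatives\<close>

text \<open>The Rudin-Shapiro signs, to be read for indices below 2^k: the components belong to P_k
  and Q_k with P_(k+1) = P_k + e^(i 2^k x) Q_k and Q_(k+1) = P_k - e^(i 2^k x) Q_k.\<close>

fun rs :: "nat => (nat => real) \<times> (nat => real)" where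
 "rs 0 = (%_. 1, %_. 1)"
| "rs (Suc k) = (%l. if l < 2 ^ k then fst (rs k) l else snd (rs k) (l - 2 ^ k),
         %l. if l < 2 ^ k then fst (rs k) l else - snd (rs k) (l - 2 ^ k))"

lemma rs_abs: "\<bar>fst (rs k) l\<bar> = 1" "\<bar>snd (rs k) l\<bar> = 1"
 by (induction k arbitrary: l) auto

text \<open>The m-th derivative of a trigonometric polynomial, written out so that m indexes a tower
  in the sense of \<open>smooth1\<close>.\<close>

definition tpoly :: "(nat => real) => nat => nat => real => complex" where
 "tpoly c N m x = (\<Sum>l<N. complex_of_real (c l) * (\<i> * of_nat l) ^ m * cis (real l * x))"

lemma smooth1_tpoly: "smooth1 (tpoly c N)"
 unfolding smooth1_def
proof (intro allI)
 fix m t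
 have "((%x. cis (real l * x)) has_vector_derivative \<i> * of_nat l * cis (real l * t)) (at t)" for l
  using has_vector_derivative_cis_affine[of 0 "real l" t] by (simp add: mult.commute)
 then have "((%x. \<Sum>l<N. complex_of_real (c l) * (\<i> * of_nat l) ^ m * cis (real l * x)) has_vector_derivative
   (\<Sum>l<N. complex_of_real (c l) * (\<i> * of_nat l) ^ m * (\<i> * of_nat l * cis (real l * t)))) (at t)"
  by (intro has_vector_derivative_sum has_vector_derivative_mult_right)
 then show "(tpoly c N m has_vector_derivative tpoly c N (Suc m) t) (at t)"
  unfolding tpoly_def by (simp add: mult.assoc mult.left_commute)
qed

lemma sum_split_double: "(\<Sum>l<2 * N. f l) = (\<Sum>l<N. f l) + (\<Sum>l<N. f (l + N))" for f :: "nat => complex"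
proof -
 have "(\<Sum>l<2 * N. f l) = (\<Sum>l<N. f l) + (\<Sum>l=N..<N + N. f l)"
  using sum.atLeastLessThan_concat[of 0 N "2 * N" f] by (simp add: lessThan_atLeast0 mult_2)
 also have "(\<Sum>l=N..<N + N. f l) = (\<Sum>l<N. f (l + N))"
  using sum.shift_bounds_nat_ivl[of f 0 N N] by (simp add: lessThan_atLeast0)
 finally show ?thesis .
qed

text \<open>Leibniz' rule for e^(i N' x) times a polynomial, in the guise of the binomial theorem
  for (l + N')^m.\<close>

lemma tpoly_shift:
 "(\<Sum>l<N. complex_of_real (c l) * (\<i> * of_nat (l + N')) ^ m * cis (real (l + N') * x)) =
  cis (real N' * x) * (\<Sum>j\<le>m. of_nat (m choose j) * (\<i> * of_nat N') ^ (m - j) * tpoly c N j x)"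
proof -
 have "complex_of_real (c l) * (\<i> * of_nat (l + N')) ^ m * cis (real (l + N') * x) =
  (\<Sum>j\<le>m. cis (real N' * x) * (of_nat (m choose j) * (\<i> * of_nat N') ^ (m - j) * (complex_of_real (c l) * (\<i> * of_nat l) ^ j * cis (real l * x))))" for l
 proof -
  have "\<i> * of_nat (l + N') = \<i> * of_nat l + \<i> * of_nat N'" by (simp add: distrib_left)
  then have b: "(\<i> * of_nat (l + N')) ^ m = (\<Sum>j\<le>m. of_nat (m choose j) * (\<i> * of_nat l) ^ j * (\<i> * of_nat N') ^ (m - j))"
   by (simp only: binomial_ring)
  have c: "cis (real (l + N') * x) = cis (real N' * x) * cis (real l * x)" by (simp add: cis_mult distrib_right add.commute)
  show ?thesis unfolding b c sum_distrib_left sum_distrib_right by (intro sum.cong refl) (simp only: mult_ac)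
 qed
 then have "(\<Sum>l<N. complex_of_real (c l) * (\<i> * of_nat (l + N')) ^ m * cis (real (l + N') * x)) =
  (\<Sum>l<N. \<Sum>j\<le>m. cis (real N' * x) * (of_nat (m choose j) * (\<i> * of_nat N') ^ (m - j) * (complex_of_real (c l) * (\<i> * of_nat l) ^ j * cis (real l * x))))"
  by simp
 also have "\<dots> = (\<Sum>j\<le>m. \<Sum>l<N. cis (real N' * x) * (of_nat (m choose j) * (\<i> * of_nat N') ^ (m - j) * (complex_of_real (c l) * (\<i> * of_nat l) ^ j * cis (real l * x))))"
  by (rule sum.swap)
 also have "\<dots> = cis (real N' * x) * (\<Sum>j\<le>m. of_nat (m choose j) * (\<i> * of_nat N') ^ (m - j) * tpoly c N j x)"
  unfolding tpoly_def by (simp only: sum_distrib_left)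
 finally show ?thesis .
qed

lemma rs_recursion:
 fixes m k x
 defines "S \<equiv> \<Sum>j\<le>m. of_nat (m choose j) * (\<i> * of_nat (2 ^ k)) ^ (m - j) * tpoly (snd (rs k)) (2 ^ k) j x"
 shows "tpoly (fst (rs (Suc k))) (2 ^ Suc k) m x = tpoly (fst (rs k)) (2 ^ k) m x + cis (real (2 ^ k) * x) * S"
  and "tpoly (snd (rs (Suc k))) (2 ^ Suc k) m x = tpoly (fst (rs k)) (2 ^ k) m x - cis (real (2 ^ k) * x) * S"
proof -
 have sh: "cis (real (2 ^ k) * x) * S = (\<Sum>l<2 ^ k. complex_of_real (snd (rs k) l) * (\<i> * of_nat (l + 2 ^ k)) ^ m * cis (real (l + 2 ^ k) * x))"
  unfolding S_def by (rule tpoly_shift[symmetric])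
 show "tpoly (fst (rs (Suc k))) (2 ^ Suc k) m x = tpoly (fst (rs k)) (2 ^ k) m x + cis (real (2 ^ k) * x) * S"
  unfolding sh unfolding tpoly_def power_Suc sum_split_double
  by (intro arg_cong2[of _ _ _ _ "(+)"] sum.cong refl) auto
 have "tpoly (snd (rs (Suc k))) (2 ^ Suc k) m x = tpoly (fst (rs k)) (2 ^ k) m x + (\<Sum>l<2 ^ k. - (complex_of_real (snd (rs k) l) * (\<i> * of_nat (l + 2 ^ k)) ^ m * cis (real (l + 2 ^ k) * x)))"
  unfolding tpoly_def power_Suc sum_split_double
  by (intro arg_cong2[of _ _ _ _ "(+)"] sum.cong refl) auto
 then show "tpoly (snd (rs (Suc k))) (2 ^ Suc k) m x = tpoly (fst (rs k)) (2 ^ k) m x - cis (real (2 ^ k) * x) * S"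
  unfolding sh by (simp only: sum_negf diff_conv_add_uminus)
qed

text \<open>The parallelogram law doubles |P|^2 + |Q|^2 at each step. Each polynomial is thus at
  most sqrt 2 times the square root of its number of terms.\<close>

lemma rs_flat: "(norm (tpoly (fst (rs k)) (2 ^ k) 0 x))\<^sup>2 + (norm (tpoly (snd (rs k)) (2 ^ k) 0 x))\<^sup>2 = 2 * 2 ^ k"
proof (induction k)
 case 0
 then show ?case by (simp add: tpoly_def)
next
 case (Suc k)
 let ?P = "tpoly (fst (rs k)) (2 ^ k) 0 x" and ?Q = "cis (real (2 ^ k) * x) * tpoly (snd (rs k)) (2 ^ k) 0 x"
 have e: "tpoly (fst (rs (Suc k))) (2 ^ Suc k) 0 x = ?P + ?Q" "tpoly (snd (rs (Suc k))) (2 ^ Suc k) 0 x = ?P - ?Q"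
  unfolding rs_recursion by simp_all
 have "(norm (?P + ?Q))\<^sup>2 + (norm (?P - ?Q))\<^sup>2 = 2 * ((norm ?P)\<^sup>2 + (norm ?Q)\<^sup>2)"
  by (simp add: cmod_power2 power2_sum power2_diff)
 also have "norm ?Q = norm (tpoly (snd (rs k)) (2 ^ k) 0 x)" by (simp add: norm_mult)
 finally show ?case unfolding e using Suc.IH by simp
qed

text \<open>A Bernstein inequality for these polynomials, by induction on the order m and, for fixed
  m, on k through the recursion. Lower orders contribute terms of the right scaling; order m enters
  with coefficient 1 and is absorbed because the scaling (2^k)^m sqrt (2^k) grows fast enough from k
  to k + 1.\<close>

lemma rs_bound: "\<exists>C\<ge>0. \<forall>k x. norm (tpoly (fst (rs k)) (2 ^ k) m x) \<le> C * (2 ^ k) ^ m * sqrt (2 ^ k) \<and> norm (tpoly (snd (rs k)) (2 ^ k) m x) \<le> C * (2 ^ k) ^ m * sqrt (2 ^ k)"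
proof (induction m rule: less_induct)
 case (less m)
 show ?case
 proof (cases "m = 0")
  case True
  have "norm (tpoly (fst (rs k)) (2 ^ k) 0 x) \<le> sqrt 2 * sqrt (2 ^ k) \<and> norm (tpoly (snd (rs k)) (2 ^ k) 0 x) \<le> sqrt 2 * sqrt (2 ^ k)" for k x
  proof -
   have "(norm (tpoly (fst (rs k)) (2 ^ k) 0 x))\<^sup>2 \<le> 2 * 2 ^ k" "(norm (tpoly (snd (rs k)) (2 ^ k) 0 x))\<^sup>2 \<le> 2 * 2 ^ k"
    using rs_flat[of k x] zero_le_power2[of "norm (tpoly (fst (rs k)) (2 ^ k) 0 x)"] zero_le_power2[of "norm (tpoly (snd (rs k)) (2 ^ k) 0 x)"]
    by linarith+
   then show ?thesis by (auto simp: real_sqrt_mult[symmetric] intro: real_le_rsqrt)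
  qed
  then show ?thesis unfolding True by (intro exI[of _ "sqrt 2"]) auto
 next
  case False
  have "\<forall>j. \<exists>C\<ge>0. j < m --> (\<forall>k x. norm (tpoly (snd (rs k)) (2 ^ k) j x) \<le> C * (2 ^ k) ^ j * sqrt (2 ^ k))"
   using less.IH by (metis order_refl)
  then obtain c where c0: "\<And>j. c j \<ge> 0" and c: "\<And>j k x. j < m ==> norm (tpoly (snd (rs k)) (2 ^ k) j x) \<le> c j * (2 ^ k) ^ j * sqrt (2 ^ k)"
   by metis
  \<comment> \<open>2 S is the constant that closes the inner induction: a step gives 2 S from P, 2
    S from the order-m part of Q and S from the lower orders, and 5 S \<le> 2 S 2^m sqrt 2 as m
    \<ge> 1 and sqrt 2 \<ge> 5/4.\<close>
  define S where "S = (\<Sum>j<m. real (m choose j) * c j)"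
  have S0: "0 \<le> S" unfolding S_def using c0 by (intro sum_nonneg) auto
  let ?C = "2 * S"
  have "norm (tpoly (fst (rs k)) (2 ^ k) m x) \<le> ?C * (2 ^ k) ^ m * sqrt (2 ^ k) \<and> norm (tpoly (snd (rs k)) (2 ^ k) m x) \<le> ?C * (2 ^ k) ^ m * sqrt (2 ^ k)" for k x
  proof (induction k)
   case 0
   \<comment> \<open>For k = 0 the polynomial is constant, and m \<ge> 1.\<close>
   show ?case using False S0 by (simp add: tpoly_def power_0_left)
  next
   case (Suc k)
   let ?N = "2 ^ k :: real"
   let ?b = "?N ^ m * sqrt ?N"
   let ?S = "\<Sum>j\<le>m. of_nat (m choose j) * (\<i> * of_nat (2 ^ k)) ^ (m - j) * tpoly (snd (rs k)) (2 ^ k) j x"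
   have b0: "0 \<le> ?b" by simp
   have "norm ?S \<le> (\<Sum>j\<le>m. real (m choose j) * ?N ^ (m - j) * norm (tpoly (snd (rs k)) (2 ^ k) j x))"
    by (rule order_trans[OF norm_sum]) (simp add: norm_mult norm_power)
   also have "\<dots> = (\<Sum>j<m. real (m choose j) * ?N ^ (m - j) * norm (tpoly (snd (rs k)) (2 ^ k) j x)) + norm (tpoly (snd (rs k)) (2 ^ k) m x)"
    by (simp add: lessThan_Suc_atMost[symmetric])
   also have "\<dots> \<le> (\<Sum>j<m. real (m choose j) * c j * ?b) + ?C * ?b"
   proof (intro add_mono sum_mono)
    fix j assume "j \<in> {..<m}"
    then have j: "j < m" by simp
    have "real (m choose j) * ?N ^ (m - j) * norm (tpoly (snd (rs k)) (2 ^ k) j x) \<le> real (m choose j) * ?N ^ (m - j) * (c j * ?N ^ j * sqrt ?N)"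
     by (intro mult_left_mono c j) simp
    also have "\<dots> = real (m choose j) * c j * ((?N ^ (m - j) * ?N ^ j) * sqrt ?N)" by (simp only: mult_ac)
    also have "?N ^ (m - j) * ?N ^ j = ?N ^ m" using j by (simp only: power_add[symmetric]) simp
    finally show "real (m choose j) * ?N ^ (m - j) * norm (tpoly (snd (rs k)) (2 ^ k) j x) \<le> real (m choose j) * c j * ?b" .
   next
    show "norm (tpoly (snd (rs k)) (2 ^ k) m x) \<le> ?C * ?b" using Suc.IH by (simp add: mult.assoc)
   qed
   also have "\<dots> = 3 * S * ?b" unfolding S_def sum_distrib_right[symmetric] by (simp add: algebra_simps)
   finally have nS: "norm ?S \<le> 3 * S * ?b" .
   have nP: "norm (tpoly (fst (rs k)) (2 ^ k) m x) \<le> 2 * S * ?b" using Suc.IH by (simp add: mult.assoc)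
   have tot: "5 * S * ?b \<le> ?C * (2 ^ Suc k) ^ m * sqrt (2 ^ Suc k)"
   proof -
    have "(2::real) ^ 1 \<le> 2 ^ m" using False by (intro power_increasing) auto
    moreover have "(5/4::real) \<le> sqrt 2" by (rule real_le_rsqrt) (simp add: power2_eq_square)
    ultimately have "(2::real) ^ 1 * (5/4) \<le> 2 ^ m * sqrt 2" by (intro mult_mono) auto
    then have "5 / 2 \<le> 2 ^ m * sqrt (2::real)" by simp
    then have "2 * S * (5 / 2) * ?b \<le> 2 * S * (2 ^ m * sqrt 2) * ?b" using S0 b0 by (intro mult_right_mono mult_left_mono) auto
    then have "5 * S * ?b \<le> 2 * S * (2 ^ m * sqrt 2) * ?b" by simp
    also have "\<dots> = ?C * (2 ^ Suc k) ^ m * sqrt (2 ^ Suc k)"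
     by (simp add: power_mult_distrib real_sqrt_mult mult_ac)
    finally show ?thesis .
   qed
   have "norm (tpoly (fst (rs (Suc k))) (2 ^ Suc k) m x) \<le> norm (tpoly (fst (rs k)) (2 ^ k) m x) + norm ?S"
    unfolding rs_recursion by (rule order_trans[OF norm_triangle_ineq]) (simp add: norm_mult)
   moreover have "norm (tpoly (snd (rs (Suc k))) (2 ^ Suc k) m x) \<le> norm (tpoly (fst (rs k)) (2 ^ k) m x) + norm ?S"
    unfolding rs_recursion by (rule order_trans[OF norm_triangle_ineq4]) (simp add: norm_mult)
   moreover have "2 * S * ?b + 3 * S * ?b = 5 * S * ?b" by (simp only: distrib_right[symmetric]) simp
   ultimately show ?case using nS nP tot by linarith
  qed
  then show ?thesis using S0 by (intro exI[of _ ?C]) auto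
 qed
qed

lemma bump_smooth1: "smooth1 (derivs bump)"
 by (intro smooth1_derivs elem_smooth elem_bump)

lemma derivs_bump_vanish: "1/4 < \<bar>t\<bar> ==> derivs bump k t = 0"
proof (rule derivs_vanish[of "{t. 1/4 < \<bar>t\<bar>}"])
 show "open {t::real. 1/4 < \<bar>t\<bar>}" by (intro open_Collect_less continuous_intros)
qed (auto intro: bump_vanish)

lemma smooth1_continuous: "smooth1 U ==> continuous_on S (U k)"
 by (intro continuous_at_imp_continuous_on ballI has_vector_derivative_continuous) (rule smooth1D)

lemma derivs_bump_bounded: "\<exists>B\<ge>0. \<forall>t. norm (derivs bump k t) \<le> B"
proof -
 have "compact (derivs bump k ` {-(1/4)..1/4})"
  by (intro compact_continuous_image smooth1_continuous bump_smooth1) auto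
 then have "bounded (derivs bump k ` {-(1/4)..1/4})" by (rule compact_imp_bounded)
 then obtain B where "\<forall>y\<in>derivs bump k ` {-(1/4)..1/4}. norm y \<le> B" unfolding bounded_iff by (elim exE)
 then have B: "norm (derivs bump k t) \<le> B" if "t \<in> {-(1/4)..1/4}" for t using that by simp
 have "norm (derivs bump k t) \<le> max B 0" for t
 proof (cases "1/4 < \<bar>t\<bar>")
  case True
  then show ?thesis by (simp add: derivs_bump_vanish)
 next
  case False
  then have "t \<in> {-(1/4)..1/4}" by (simp add: abs_le_iff not_less) linarith
  from B[OF this] show ?thesis by simp
 qed
 then show ?thesis by (intro exI[of _ "max B 0"]) simp
qed

section \<open>The test symbol\<close>

definition lam :: "nat => real" where "lam k = 4 ^ k"

text \<open>Chosen so that 2 ^ \<open>rexp\<close>, the number of exponentials in block k, is the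
  largest power of 2 not above (4^k)^\<delta>.\<close>

definition rexp :: "real => nat => nat" where "rexp \<delta> k = nat \<lfloor>2 * real k * \<delta>\<rfloor>"

lemma lam_ge_1: "1 \<le> lam k" by (simp add: lam_def)

lemma lam_powr: "lam k powr e = 2 powr (2 * real k * e)"
proof -
 have "lam k = 2 ^ (2 * k)" by (simp add: lam_def power_mult)
 also have "\<dots> = 2 powr real (2 * k)" by (rule powr_realpow[symmetric]) simp
 finally have "lam k = 2 powr (2 * real k)" by simp
 then show ?thesis by (simp add: powr_powr)
qed

lemma rexp_bounds:
 assumes "0 \<le> \<delta>"
 shows "2 ^ rexp \<delta> k \<le> lam k powr \<delta>" "lam k powr \<delta> \<le> 2 * 2 ^ rexp \<delta> k"
proof -
 have 0: "0 \<le> 2 * real k * \<delta>" using assms by simp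
 have e: "(2::real) ^ rexp \<delta> k = 2 powr real (nat \<lfloor>2 * real k * \<delta>\<rfloor>)" by (simp add: rexp_def powr_realpow)
 show "2 ^ rexp \<delta> k \<le> lam k powr \<delta>" unfolding e lam_powr using 0 by (intro powr_mono) auto
 have "2 * 2 ^ rexp \<delta> k = (2::real) powr (real (nat \<lfloor>2 * real k * \<delta>\<rfloor>) + 1)" unfolding e by (simp add: powr_add)
 moreover have "2 * real k * \<delta> \<le> real (nat \<lfloor>2 * real k * \<delta>\<rfloor>) + 1" using 0 by linarith
 ultimately show "lam k powr \<delta> \<le> 2 * 2 ^ rexp \<delta> k" unfolding lam_powr by (simp add: powr_mono)
qed

text \<open>Coefficients of modulus 2^(-r/2): by flatness the polynomial is then bounded
  independently of r, while the squares of the coefficients add up to 1.\<close>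

definition rsc :: "nat => nat => real" where
 "rsc r l = fst (rs r) l / sqrt (2 ^ r)"

definition fosc :: "real => nat => nat => real => complex" where
 "fosc \<delta> k = tpoly (rsc (rexp \<delta> k)) (2 ^ rexp \<delta> k)"

text \<open>The j-th derivative of the cut-off to the block around \<open>lam k\<close>, of width
  proportional to \<open>lam k\<close>.\<close>

definition fcut :: "nat => nat => real => complex" where
 "fcut k j t = complex_of_real ((1 / lam k) ^ j) * derivs bump j (t / lam k - 1)"

lemma smooth1_fosc: "smooth1 (fosc \<delta> k)"
 unfolding fosc_def by (rule smooth1_tpoly)

lemma smooth1_fcut: "smooth1 (fcut k)"
 unfolding smooth1_def
proof (intro allI)
 fix j t
 have "((%s. s / lam k - 1) has_vector_derivative (1 / lam k)) (at t)"
  using lam_ge_1[of k] by (auto intro!: derivative_eq_intros simp: has_real_derivative_iff_has_vector_derivative[symmetric])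
 from vector_diff_chain_at[OF this smooth1D[OF bump_smooth1, of j]]
 have "((%s. derivs bump j (s / lam k - 1)) has_vector_derivative (1 / lam k) *\<^sub>R derivs bump (Suc j) (t / lam k - 1)) (at t)" by (simp add: o_def)
 from has_vector_derivative_mult_right[OF this, of "complex_of_real ((1 / lam k) ^ j)"]
 show "(fcut k j has_vector_derivative fcut k (Suc j) t) (at t)"
  unfolding fcut_def by (simp add: scaleR_conv_of_real mult_ac)
qed

lemma fosc_bound: "\<exists>C\<ge>0. \<forall>k x. norm (fosc \<delta> k m x) \<le> C * (2 ^ rexp \<delta> k) ^ m"
proof -
 obtain C where C: "C \<ge> 0" "\<And>r x. norm (tpoly (fst (rs r)) (2 ^ r) m x) \<le> C * (2 ^ r) ^ m * sqrt (2 ^ r)"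
  using rs_bound[of m] by blast
 have "norm (fosc \<delta> k m x) \<le> C * (2 ^ rexp \<delta> k) ^ m" for k x
 proof -
  let ?r = "rexp \<delta> k"
  have "fosc \<delta> k m x = tpoly (fst (rs ?r)) (2 ^ ?r) m x / complex_of_real (sqrt (2 ^ ?r))"
   unfolding fosc_def tpoly_def rsc_def by (simp add: sum_divide_distrib)
  then have "norm (fosc \<delta> k m x) = norm (tpoly (fst (rs ?r)) (2 ^ ?r) m x) / sqrt (2 ^ ?r)"
   by (simp add: norm_divide del: of_real_sqrt)
  also have "\<dots> \<le> C * (2 ^ ?r) ^ m * sqrt (2 ^ ?r) / sqrt (2 ^ ?r)" by (intro divide_right_mono C) simp
  also have "\<dots> = C * (2 ^ ?r) ^ m" by simp
  finally show ?thesis .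
 qed
 with C(1) show ?thesis by blast
qed

lemma fcut_bound: "\<exists>C\<ge>0. \<forall>k t. norm (fcut k j t) \<le> C * (1 / lam k) ^ j"
proof -
 obtain B where B: "B \<ge> 0" "\<And>t. norm (derivs bump j t) \<le> B" using derivs_bump_bounded[of j] by blast
 have "norm (fcut k j t) \<le> B * (1 / lam k) ^ j" for k t
  using mult_right_mono[OF B(2)[of "t / lam k - 1"], of "(1 / lam k) ^ j"] lam_ge_1[of k]
  by (simp add: fcut_def norm_mult norm_power norm_divide mult.commute power_divide)
 with B(1) show ?thesis by blast
qed

lemma fcut_supp: "fcut k j t ~= 0 ==> 3/4 * lam k \<le> t \<and> t \<le> 5/4 * lam k"
proof -
 assume "fcut k j t ~= 0"
 then have "\<bar>t / lam k - 1\<bar> \<le> 1/4" using derivs_bump_vanish[of "t / lam k - 1" j] unfolding fcut_def by (auto simp: not_less[symmetric])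
 then have "3/4 \<le> t / lam k" "t / lam k \<le> 5/4" by linarith+
 then show ?thesis using lam_ge_1[of k] by (simp add: pos_le_divide_eq pos_divide_le_eq)
qed

text \<open>Consecutive centres differ by the factor 4, more than the ratio 5/3 between the two ends
  of a block.\<close>

lemma fcut_disjoint: "fcut k j t ~= 0 ==> fcut k' j' t ~= 0 ==> k = k'"
proof (rule ccontr)
 assume h: "fcut k j t ~= 0" "fcut k' j' t ~= 0" "k ~= k'"
 have *: False if "a < b" "3/4 * lam b \<le> t" "t \<le> 5/4 * lam a" for a b
 proof -
  have "(4::real) ^ Suc a \<le> 4 ^ b" using that(1) by (intro power_increasing) auto
  then have "4 * lam a \<le> lam b" by (simp add: lam_def)
  then show False using that lam_ge_1[of a] by linarith
 qed
 from h(3) show False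
  by (rule linorder_neqE_nat) (use fcut_supp[OF h(1)] fcut_supp[OF h(2)] * in blast)+
qed

definition tsym :: "real => real => nat => real^'n => real^'n => complex" where
 "tsym m \<delta> k x z = complex_of_real (lam k powr m) * (\<Prod>i\<in>UNIV. fosc \<delta> k 0 (x $ i)) * (\<Prod>i\<in>UNIV. fcut k 0 (z $ i))"

text \<open>The series over all k, cut at a bound depending on z: block k lives where |z| \<ge> 3/4
  4^k > k, so every omitted term vanishes.\<close>

definition csym :: "real => real => real^'n => real^'n => complex" where
 "csym m \<delta> x z = (\<Sum>k<nat \<lceil>1 + norm z\<rceil>. tsym m \<delta> k x z)"

lemma less_lam: "real k < 3/4 * lam k"
proof (induction k)
 case (Suc k)
 have "lam (Suc k) = 4 * lam k" by (simp add: lam_def)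
 then show ?case using Suc.IH lam_ge_1[of k] unfolding of_nat_Suc by linarith
qed (simp add: lam_def)

lemma tsym_vanish:
 assumes "norm z \<le> real k"
 shows "tsym m \<delta> k x (z::real^'n) = 0"
proof -
 have "fcut k 0 (z $ undefined) = 0"
 proof (rule ccontr)
  assume "fcut k 0 (z $ undefined) ~= 0"
  from fcut_supp[OF this] have "3/4 * lam k \<le> z $ undefined" by simp
  then show False using component_le_norm_cart[of z undefined] assms less_lam[of k] by linarith
 qed
 then have "(\<Prod>i\<in>UNIV. fcut k 0 (z $ i)) = 0" by (auto intro!: prod_zero)
 then show ?thesis by (simp add: tsym_def)
qed

lemma csym_eq:
 assumes "norm z < real M"
 shows "csym m \<delta> x z = (\<Sum>k<Suc M. tsym m \<delta> k x z)"
proof -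
 have "nat \<lceil>1 + norm z\<rceil> \<le> Suc M" using assms by (simp add: nat_le_iff ceiling_le_iff)
 moreover have "tsym m \<delta> k x z = 0" if "k \<in> {..<Suc M} - {..<nat \<lceil>1 + norm z\<rceil>}" for k
 proof (rule tsym_vanish)
  have "nat \<lceil>1 + norm z\<rceil> \<le> k" using that by auto
  then have "1 + norm z \<le> real k" by (simp add: nat_le_iff ceiling_le_iff)
  then show "norm z \<le> real k" by linarith
 qed
 ultimately show ?thesis unfolding csym_def by (intro sum.mono_neutral_left) auto
qed

text \<open>At each \<xi> at most one block is nonzero, and there 1 + |\<xi>| is comparable to
  \<open>lam k\<close>. A space derivative costs 2 ^ \<open>rexp\<close>, at most lam^\<delta>, by
  \<open>fosc_bound\<close>; a frequency derivative gains 1 / lam, which is the behaviour for \<rho>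
  = 1 and implies that for every \<rho> \<le> 1.\<close>

lemma csym_symbol_class:
 assumes \<delta>: "0 \<le> \<delta>" "\<rho> \<le> 1"
 shows "(csym m \<delta> :: real^'n => real^'n => complex) \<in> symbol_class m \<rho> \<delta>"
proof -
 define T where "T K \<alpha> \<beta> p = (\<Sum>k<K. complex_of_real (lam k powr m) * (\<Prod>i\<in>UNIV. fosc \<delta> k (\<beta> i) (fst p $ i)) * (\<Prod>i\<in>UNIV. fcut k (\<alpha> i) (snd p $ i)))"
  for K and \<alpha> \<beta> :: "'n => nat" and p :: "(real^'n) \<times> (real^'n)"
 have el: "elem (T K \<alpha> \<beta>)" for K \<alpha> \<beta>
  using iter_dderiv_tensor_sum(2)[where U = "%k i. fosc \<delta> k" and W = "%k i. fcut k" and K = K and c = "%k. complex_of_real (lam k powr m)" and \<alpha> = \<alpha> and \<beta> = \<beta>, OF smooth1_fosc smooth1_fcut]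
  unfolding T_def .
 have iterT: "iter_dderiv (map (%i. (0, axis i 1)) as @ map (%j. (axis j 1, 0)) bs) (T K (%_. 0) (%_. 0)) = T K (count_list as) (count_list bs)" for K as bs
  using iter_dderiv_tensor_sum(1)[where U = "%k i. fosc \<delta> k" and W = "%k i. fcut k" and K = K and c = "%k. complex_of_real (lam k powr m)" and as = as and bs = bs, OF smooth1_fosc smooth1_fcut]
  unfolding T_def .
 let ?\<sigma> = "%(x::real^'n, z::real^'n). csym m \<delta> x z"
 \<comment> \<open>On such an open set the symbol equals the fixed finite sum
   \<open>T (Suc M)\<close>, so smoothness and derivatives can be computed there.\<close>
 define B where "B M = {p :: (real^'n) \<times> (real^'n). norm (snd p) < real M}" for M
 have oB: "open (B M)" for M unfolding B_def by (intro open_Collect_less continuous_intros)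
 have eqB: "?\<sigma> p = T (Suc M) (%_. 0) (%_. 0) p" if "p \<in> B M" for M p
  using that csym_eq[of "snd p" M m \<delta> "fst p"] by (simp add: B_def T_def tsym_def split_beta')
 have inB: "\<exists>M. p \<in> B M" for p :: "(real^'n) \<times> (real^'n)"
  unfolding B_def using reals_Archimedean2[of "norm (snd p)"] by auto
 have sm: "smooth_fun ?\<sigma>"
 proof (rule smooth_fun_local)
  fix p :: "(real^'n) \<times> (real^'n)"
  obtain M where M: "p \<in> B M" using inB by blast
  show "\<exists>S h. open S \<and> p \<in> S \<and> smooth_fun h \<and> (\<forall>y\<in>S. ?\<sigma> y = h y)"
   by (intro exI[of _ "B M"] exI[of _ "T (Suc M) (%_. 0) (%_. 0)"] conjI ballI oB M elem_smooth el eqB)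
 qed
 have "\<exists>C. \<forall>x \<xi>. norm (iter_dderiv (map (%i. (0, axis i 1)) as @ map (%j. (axis j 1, 0)) bs) ?\<sigma> (x, \<xi>))
    \<le> C * (1 + norm \<xi>) powr (m - \<rho> * real (length as) + \<delta> * real (length bs))" for as bs :: "'n list"
 proof -
  have "\<forall>i. \<exists>C\<ge>0. \<forall>k x. norm (fosc \<delta> k (count_list bs i) x) \<le> C * (2 ^ rexp \<delta> k) ^ count_list bs i" using fosc_bound by blast
  then obtain C1 where C1: "\<And>i. C1 i \<ge> 0" "\<And>i k x. norm (fosc \<delta> k (count_list bs i) x) \<le> C1 i * (2 ^ rexp \<delta> k) ^ count_list bs i" by metis
  have "\<forall>i. \<exists>C\<ge>0. \<forall>k t. norm (fcut k (count_list as i) t) \<le> C * (1 / lam k) ^ count_list as i" using fcut_bound by blast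
  then obtain C2 where C2: "\<And>i. C2 i \<ge> 0" "\<And>i k t. norm (fcut k (count_list as i) t) \<le> C2 i * (1 / lam k) ^ count_list as i" by metis
  define C where "C = (\<Prod>i\<in>UNIV. C1 i) * (\<Prod>i\<in>UNIV. C2 i)"
  have C0: "0 \<le> C" unfolding C_def using C1(1) C2(1) by (intro mult_nonneg_nonneg prod_nonneg) auto
  \<comment> \<open>The exponent of the class with \<rho> = 1; the passage to the given \<rho> comes
    last.\<close>
  define e where "e = m - real (length as) + \<delta> * real (length bs)"
  define \<kappa> where "\<kappa> = 2 * (real CARD('n) + 1) + 2"
  have \<kappa>: "1 \<le> \<kappa>" unfolding \<kappa>_def by simp
  let ?t = "%k x z. complex_of_real (lam k powr m) * (\<Prod>i\<in>UNIV. fosc \<delta> k (count_list bs i) (x $ i)) * (\<Prod>i\<in>UNIV. fcut k (count_list as i) (z $ i))"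
  have single: "norm (?t k x z) \<le> C * \<kappa> powr \<bar>e\<bar> * (1 + norm z) powr e" for k and x z :: "real^'n"
  proof (cases "?t k x z = 0")
   case True
   have "0 \<le> C * \<kappa> powr \<bar>e\<bar> * (1 + norm z) powr e" using C0 by simp
   then show ?thesis unfolding True by simp
  next
   case False
   have lp: "0 < lam k" using lam_ge_1[of k] by simp
   have nz: "fcut k (count_list as i) (z $ i) ~= 0" for i
    using False by (auto simp: prod_zero_iff)
   have zi: "3/4 * lam k \<le> z $ i" "z $ i \<le> 5/4 * lam k" for i using fcut_supp[OF nz[of i]] by auto
   have lo: "lam k \<le> \<kappa> * (1 + norm z)"
   proof -
    have "3/4 * lam k \<le> norm z" using zi(1)[of undefined] component_le_norm_cart[of z undefined] by linarith
    moreover have "a \<le> 2 * (1 + b)" if "3/4 * a \<le> b" "0 \<le> b" for a b :: real using that by argo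
    ultimately have "lam k \<le> 2 * (1 + norm z)" using norm_ge_zero by blast
    also have "\<dots> \<le> \<kappa> * (1 + norm z)" by (intro mult_right_mono) (auto simp: \<kappa>_def)
    finally show ?thesis .
   qed
   have hi: "1 + norm z \<le> \<kappa> * lam k"
   proof -
    have "norm z \<le> (\<Sum>i\<in>UNIV. \<bar>z $ i\<bar>)" by (rule norm_le_l1_cart)
    also have "\<dots> \<le> (\<Sum>i\<in>(UNIV::'n set). 5/4 * lam k)"
    proof (rule sum_mono)
     fix i show "\<bar>z $ i\<bar> \<le> 5/4 * lam k" using zi[of i] lp by linarith
    qed
    finally have "norm z \<le> real CARD('n) * (5/4 * lam k)" by simp
    moreover have "real CARD('n) * (5/4 * lam k) \<le> 2 * (real CARD('n) * lam k)" using lp by simp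
    ultimately have "1 + norm z \<le> 2 * (real CARD('n) * lam k) + lam k" using lam_ge_1[of k] by linarith
    also have "\<dots> \<le> \<kappa> * lam k" using lp unfolding \<kappa>_def by (simp add: algebra_simps)
    finally show ?thesis .
   qed
   have "norm (?t k x z) = lam k powr m * (\<Prod>i\<in>UNIV. norm (fosc \<delta> k (count_list bs i) (x $ i))) * (\<Prod>i\<in>UNIV. norm (fcut k (count_list as i) (z $ i)))"
    by (simp add: norm_mult prod_norm)
   also have "\<dots> \<le> lam k powr m * (\<Prod>i\<in>UNIV. C1 i * (2 ^ rexp \<delta> k) ^ count_list bs i) * (\<Prod>i\<in>UNIV. C2 i * (1 / lam k) ^ count_list as i)"
    using C1 C2 lp by (intro mult_mono mult_left_mono prod_mono conjI) (auto intro!: prod_nonneg mult_nonneg_nonneg)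
   also have "\<dots> = C * (lam k powr m * (2 ^ rexp \<delta> k) ^ length bs * (1 / lam k) ^ length as)"
    unfolding C_def prod.distrib power_sum[symmetric] sum_count_list by simp
   also have "\<dots> \<le> C * (lam k powr m * (lam k powr \<delta>) ^ length bs * (1 / lam k) ^ length as)"
    using rexp_bounds(1)[OF \<delta>(1), of k] C0 lp by (intro mult_left_mono mult_right_mono power_mono) auto
   also have "lam k powr m * (lam k powr \<delta>) ^ length bs * (1 / lam k) ^ length as = lam k powr e"
   proof -
    have 1: "(lam k powr \<delta>) ^ length bs = lam k powr (\<delta> * real (length bs))"
     using lp by (subst powr_realpow[symmetric]) (auto simp: powr_powr)
    have 2: "(1 / lam k) ^ length as = lam k powr (- real (length as))"
     using lp by (simp add: powr_minus powr_realpow power_one_over divide_inverse power_inverse)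
    show ?thesis unfolding 1 2 powr_add[symmetric] e_def by (simp add: algebra_simps)
   qed
   also have "lam k powr e \<le> \<kappa> powr \<bar>e\<bar> * (1 + norm z) powr e"
    using lp \<kappa> lo hi by (intro powr_comparable) (auto intro: add_pos_nonneg)
   finally show ?thesis using C0 by (simp add: mult_left_mono mult.assoc)
  qed
  show ?thesis
  proof (intro exI[of _ "C * \<kappa> powr \<bar>e\<bar>"] allI)
   fix x z :: "real^'n"
   obtain M where M: "(x, z) \<in> B M" using inB by blast
   have "iter_dderiv (map (%i. (0, axis i 1)) as @ map (%j. (axis j 1, 0)) bs) ?\<sigma> (x, z) = T (Suc M) (count_list as) (count_list bs) (x, z)"
    unfolding iterT[symmetric] by (rule iter_dderiv_local[OF oB eqB M])
   also have "\<dots> = (\<Sum>k<Suc M. ?t k x z)" by (simp add: T_def)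
   also have "norm \<dots> \<le> C * \<kappa> powr \<bar>e\<bar> * (1 + norm z) powr e"
   proof (cases "\<exists>k<Suc M. ?t k x z ~= 0")
    case True
    then obtain k where k: "k < Suc M" "?t k x z ~= 0" by blast
    have "?t k' x z = 0" if "k' ~= k" for k'
    proof (rule ccontr)
     assume "?t k' x z ~= 0"
     then have "fcut k' (count_list as undefined) (z $ undefined) ~= 0" by (auto simp: prod_zero_iff)
     moreover have "fcut k (count_list as undefined) (z $ undefined) ~= 0" using k(2) by (auto simp: prod_zero_iff)
     ultimately show False using fcut_disjoint that by blast
    qed
    then have "(\<Sum>k<Suc M. ?t k x z) = (\<Sum>k\<in>{k}. ?t k x z)"
     using k(1) by (intro sum.mono_neutral_right) auto
    then show ?thesis using single[of k x z] by simp
   next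
    case False
    then have "(\<Sum>k<Suc M. ?t k x z) = 0" by (intro sum.neutral) auto
    then show ?thesis using C0 by simp
   qed
   also have "\<dots> \<le> C * \<kappa> powr \<bar>e\<bar> * (1 + norm z) powr (m - \<rho> * real (length as) + \<delta> * real (length bs))"
    using mult_right_mono[OF \<delta>(2), of "real (length as)"] C0 by (intro mult_left_mono powr_mono) (auto simp: e_def)
   finally show "norm (iter_dderiv (map (%i. (0, axis i 1)) as @ map (%j. (axis j 1, 0)) bs) ?\<sigma> (x, z))
    \<le> C * \<kappa> powr \<bar>e\<bar> * (1 + norm z) powr (m - \<rho> * real (length as) + \<delta> * real (length bs))" .
  qed
 qed
 then show ?thesis unfolding symbol_class_def using sm by auto
qed

section \<open>Test functions: tensor products with compactly supported Fourier transform\<close>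

lemma
 fixes f :: "'n::finite => real => complex"
 assumes f: "\<And>i. integrable lborel (f i)"
 shows integrable_lborel_prod_vec: "integrable lborel (%x. \<Prod>i\<in>UNIV. f i (x $ i))"
  and integral_lborel_prod_vec: "(\<integral>x. (\<Prod>i\<in>UNIV. f i (x $ i)) \<partial>lborel) = (\<Prod>i\<in>UNIV. \<integral>s. f i s \<partial>lborel)"
proof -
 define ix where "ix b = (THE i. b = axis i (1::real))" for b :: "real^'n"
 have ix: "ix (axis i 1) = i" for i unfolding ix_def by (rule the_equality) (auto simp: axis_eq_axis)
 have "(\<integral>x. (\<Prod>b\<in>Basis. f (ix b) (x \<bullet> b)) \<partial>lborel) = (\<Prod>b\<in>Basis. \<integral>s. f (ix b) s \<partial>lborel)"
  by (rule integral_lborel_prod) (rule f)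
 then show "(\<integral>x. (\<Prod>i\<in>UNIV. f i (x $ i)) \<partial>lborel) = (\<Prod>i\<in>UNIV. \<integral>s. f i s \<partial>lborel)"
  by (simp add: prod_Basis_vec ix inner_axis)
 have "integrable lborel (%x. \<Prod>b\<in>Basis. f (ix b) (x \<bullet> b))"
  by (rule integrable_lborel_prod) (rule f)
 then show "integrable lborel (%x. \<Prod>i\<in>UNIV. f i (x $ i))"
  by (simp add: prod_Basis_vec ix inner_axis)
qed

definition ett :: "(real => complex) => real => complex" where
 "ett b x = (\<integral>t. cis (x \<bullet> t) * b t \<partial>lborel)"

text \<open>Smooth functions of compact support, with smoothness certified by
  \<open>elem\<close>.\<close>

definition ccs :: "(real => complex) => bool" where
 "ccs b \<longleftrightarrow> elem b \<and> (\<exists>M. \<forall>t. M < \<bar>t\<bar> --> b t = 0)"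

text \<open>The tower is t, 1, 0, 0, ...; it supplies the factor i t that differentiating
  \<open>ett\<close> produces.\<close>

lemma elem_of_real: "elem (%t::real. complex_of_real t)"
proof -
 define U :: "nat => real => complex" where "U k t = (if k = 0 then complex_of_real t else if k = 1 then 1 else 0)" for k t
 have "smooth1 U"
  unfolding smooth1_def
 proof (intro allI)
  fix k t
  have U0: "U 0 = complex_of_real" and U1: "U (Suc 0) = (%_. 1)" and Un: "U (Suc (Suc n)) = (%_. 0)" for n
   by (auto simp: U_def fun_eq_iff)
  have d0: "(complex_of_real has_vector_derivative 1) (at t)"
   using has_vector_derivative_of_real[of "%x. x" 1 "at t"] by (simp add: has_vector_derivative_def)
  show "(U k has_vector_derivative U (Suc k) t) (at t)"
  proof (cases k)
   case 0
   then show ?thesis using d0 by (simp add: U0 U1)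
  next
   case (Suc n)
   then show ?thesis by (cases n) (simp_all add: U1 Un)
  qed
 qed
 from elem.comp[OF this bounded_linear_ident, of 0] show ?thesis by (simp add: U_def)
qed

lemma elem_power: "elem f ==> elem (%x. f x ^ k)"
 by (induction k) (auto intro: elem.intros)

lemma elem_continuous_real: "elem (b :: real => complex) ==> continuous_on S b"
 using smooth_fun_continuous[OF elem_smooth, of b "[]"] by (auto intro: continuous_on_subset)

lemma ccs_mult: "elem a ==> ccs b ==> ccs (%t. a t * b t)"
 unfolding ccs_def by (auto intro: elem.mult)

lemma ccs_add: "ccs a ==> ccs b ==> ccs (%t. a t + b t)"
 unfolding ccs_def
proof (elim conjE exE, intro conjI elem.add)
 fix M N assume "\<forall>t. M < \<bar>t\<bar> --> a t = 0" "\<forall>t. N < \<bar>t\<bar> --> b t = 0"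
 then show "\<exists>M. \<forall>t. M < \<bar>t\<bar> --> a t + b t = 0" by (intro exI[of _ "max M N"]) auto
qed

lemma ccs_0: "ccs (%_. 0)"
 unfolding ccs_def by (auto intro: elem.const)

lemma ccs_sum: "finite S ==> (\<And>i. i \<in> S ==> ccs (f i)) ==> ccs (%t. \<Sum>i\<in>S. f i t)"
 by (induction S rule: finite_induct) (auto intro: ccs_0 ccs_add)

lemma ccs_derivs:
 assumes "ccs b" shows "ccs (derivs b k)"
proof -
 from assms obtain M where b: "elem b" and M: "\<And>t. M < \<bar>t\<bar> ==> b t = 0" by (auto simp: ccs_def)
 have "derivs b k t = 0" if "M < \<bar>t\<bar>" for t
 proof (rule derivs_vanish[of "{t. M < \<bar>t\<bar>}"])
  show "open {t::real. M < \<bar>t\<bar>}" by (intro open_Collect_less continuous_intros)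
 qed (use M that in auto)
 moreover have "elem (derivs b k)" unfolding derivs_def by (rule elem_iter[OF b])
 ultimately show ?thesis unfolding ccs_def by blast
qed

lemma ccs_facts:
 assumes "ccs b"
 shows "continuous_on UNIV b" "integrable lborel b" "\<exists>B. \<forall>t. norm (b t) \<le> B"
proof -
 from assms obtain M0 where b: "elem b" and M0: "\<And>t. M0 < \<bar>t\<bar> ==> b t = 0" by (auto simp: ccs_def)
 define M where "M = max M0 0"
 have M: "b t = 0" if "t \<notin> {-M..M}" for t
  by (rule M0) (use that in \<open>auto simp: M_def abs_if max_def split: if_splits\<close>)
 show c: "continuous_on UNIV b" by (rule elem_continuous_real[OF b])
 have "compact (b ` {-M..M})" by (intro compact_continuous_image elem_continuous_real b) auto
 then have "bounded (b ` {-M..M})" by (rule compact_imp_bounded)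
 then obtain B where "\<forall>y\<in>b ` {-M..M}. norm y \<le> B" unfolding bounded_iff by (elim exE)
 then have B: "norm (b t) \<le> B" if "t \<in> {-M..M}" for t using that by simp
 have B': "norm (b t) \<le> max B 0" for t
 proof (cases "t \<in> {-M..M}")
  case True
  from B[OF this] show ?thesis by simp
 qed (simp add: M)
 then show "\<exists>B. \<forall>t. norm (b t) \<le> B" by blast
 show "integrable lborel b"
  by (rule integrable_bounded_support[of _ _ "{-M..M}" "max B 0"])
    (use B' M c in \<open>auto simp: emeasure_lborel_Icc_eq intro: borel_measurable_continuous_onI\<close>)
qed

text \<open>Differentiation under the integral sign, over a compact interval that contains the
  support.\<close>

lemma ett_smooth:
 assumes "ccs b"
 shows "(ett b has_vector_derivative ett (%t. \<i> * complex_of_real t * b t) x) (at x)"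
proof -
 from assms obtain M0 where b: "elem b" and M0: "\<And>t. M0 < \<bar>t\<bar> ==> b t = 0" by (auto simp: ccs_def)
 define M where "M = max M0 0"
 have M: "b t = 0" if "t \<notin> {-M..M}" for t
  by (rule M0) (use that in \<open>auto simp: M_def abs_if max_def split: if_splits\<close>)
 have c: "continuous_on S b" for S by (rule elem_continuous_real[OF b])
 have eq: "ett a x = integral (cbox (-M) M) (%t. cis (x * t) * a t)" if a: "ccs a" "\<And>t. t \<notin> {-M..M} ==> a t = 0" for a x
 proof -
  have int: "integrable lborel (%t. cis (x \<bullet> t) * a t)"
   by (intro integrable_cis_mult ccs_facts(2)[OF a(1)]) measurable
  have "ett a x = integral UNIV (%t. cis (x \<bullet> t) * a t)" unfolding ett_def by (rule integral_lborel[OF int, symmetric])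
  also have "\<dots> = integral UNIV (%t. if t \<in> cbox (-M) M then cis (x * t) * a t else 0)"
   using a(2) by (intro arg_cong[of _ _ "integral UNIV"]) (auto simp: fun_eq_iff)
  also have "\<dots> = integral (cbox (-M) M) (%t. cis (x * t) * a t)" by (rule integral_restrict_UNIV)
  finally show ?thesis .
 qed
 let ?a = "%t. \<i> * complex_of_real t * b t"
 have ca: "ccs ?a" using ccs_mult[OF elem.mult[OF elem.const elem_of_real] assms] by simp
 have "((%x. integral (cbox (-M) M) (%t. cis (x * t) * b t)) has_vector_derivative integral (cbox (-M) M) (%t. cis (x * t) * ?a t)) (at x within UNIV)"
 proof (rule leibniz_rule_vector_derivative)
  show "((%x. cis (x * t) * b t) has_vector_derivative cis (x * t) * ?a t) (at x within UNIV)" for x t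
  proof -
   have "((%x. cis (0 + x * t)) has_vector_derivative \<i> * complex_of_real t * cis (0 + x * t)) (at x)"
    by (rule has_vector_derivative_cis_affine)
   from has_vector_derivative_mult_left[OF this, of "b t"] show ?thesis by (simp add: mult_ac)
  qed
  show "(%t. cis (x * t) * b t) integrable_on cbox (-M) M" for x
   by (intro integrable_continuous continuous_intros c)
  have "continuous_on (UNIV \<times> cbox (-M) M) (%p. b (snd p))"
   by (rule continuous_on_compose2[OF c[of UNIV]]) (auto intro!: continuous_intros)
  then show "continuous_on (UNIV \<times> cbox (-M) M) (%(x, t). cis (x * t) * ?a t)"
   unfolding split_beta' by (intro continuous_intros)
 qed auto
 moreover have "ett b = (%x. integral (cbox (-M) M) (%t. cis (x * t) * b t))" using eq[OF assms M] by blast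
 moreover have "ett ?a x = integral (cbox (-M) M) (%t. cis (x * t) * ?a t)" by (rule eq[OF ca]) (simp add: M)
 ultimately show ?thesis by simp
qed

lemma ett_by_parts:
 assumes "ccs b"
 shows "\<i> * complex_of_real x * ett b x = - ett (derivs b 1) x"
proof -
 from assms obtain M0 where b: "elem b" and M0: "\<And>t. M0 < \<bar>t\<bar> ==> b t = 0" by (auto simp: ccs_def)
 \<comment> \<open>The added 1 puts the end points strictly outside the support, so that the
   boundary terms vanish.\<close>
 define M where "M = max M0 0 + 1"
 have M: "b t = 0" if "t \<le> - M \<or> M \<le> t" for t
  by (rule M0) (use that in \<open>auto simp: M_def abs_if max_def split: if_splits\<close>)
 have dM: "derivs b 1 t = 0" if "t \<notin> {-M..M}" for t
 proof (rule derivs_vanish[of "{t. M0 < \<bar>t\<bar>}"])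
  show "open {t::real. M0 < \<bar>t\<bar>}" by (intro open_Collect_less continuous_intros)
  show "t \<in> {t. M0 < \<bar>t\<bar>}" using that by (auto simp: M_def abs_if max_def split: if_splits)
 qed (auto intro: M0)
 have c: "continuous_on S b" "continuous_on S (derivs b 1)" for S
  using elem_continuous_real[OF b] ccs_derivs[OF assms, of 1] elem_continuous_real by (auto simp: ccs_def)
 let ?f = "%t. cis (x \<bullet> t) * derivs b 1 t + \<i> * complex_of_real x * (cis (x \<bullet> t) * b t)"
 have d: "((%t. cis (x \<bullet> t) * b t) has_vector_derivative ?f t) (at t)" for t
 proof -
  have "((%t. cis (0 + t * x)) has_vector_derivative \<i> * complex_of_real x * cis (0 + t * x)) (at t)"
   by (rule has_vector_derivative_cis_affine)
  moreover have "(b has_vector_derivative derivs b 1 t) (at t)"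
   using smooth1D[OF smooth1_derivs[OF elem_smooth[OF b]], of 0 t] by simp
  ultimately have "((%t. cis (0 + t * x) * b t) has_vector_derivative
    (cis (0 + t * x) * derivs b 1 t + \<i> * complex_of_real x * cis (0 + t * x) * b t)) (at t)"
   by (rule has_vector_derivative_mult)
  moreover have "x \<bullet> t = 0 + t * x" for t by simp
  ultimately show ?thesis by (simp only: mult.assoc)
 qed
 have "(\<integral>t. indicator {-M..M} t *\<^sub>R ?f t \<partial>lborel) = cis (x \<bullet> M) * b M - cis (x \<bullet> (-M)) * b (-M)"
 proof (rule integral_FTC_atLeastAtMost)
  show "- M \<le> M" by (simp add: M_def)
  show "((%t. cis (x \<bullet> t) * b t) has_vector_derivative ?f t) (at t within {-M..M})" for t
   by (rule has_vector_derivative_at_within[OF d])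
  show "continuous_on {-M..M} ?f" by (intro continuous_intros c)
 qed
 also have "\<dots> = 0" using M[of M] M[of "-M"] by simp
 also have "(\<integral>t. indicator {-M..M} t *\<^sub>R ?f t \<partial>lborel) = (\<integral>t. ?f t \<partial>lborel)"
 proof (intro Bochner_Integration.integral_cong refl)
  fix t show "indicator {-M..M} t *\<^sub>R ?f t = ?f t"
  proof (cases "t \<in> {-M..M}")
   case True
   then show ?thesis by (simp only: indicator_simps scaleR_one)
  next
   case False
   then have "b t = 0" by (intro M) auto
   then show ?thesis unfolding dM[OF False] by (simp only: mult_zero_right add_0 scaleR_zero_right)
  qed
 qed
 also have "\<dots> = ett (derivs b 1) x + \<i> * complex_of_real x * ett b x"
 proof -
  have "integrable lborel (%t. cis (x \<bullet> t) * derivs b 1 t)"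
   by (intro integrable_cis_mult ccs_facts(2)[OF ccs_derivs[OF assms]]) measurable
  moreover have "integrable lborel (%t. \<i> * complex_of_real x * (cis (x \<bullet> t) * b t))"
   by (intro integrable_mult_right integrable_cis_mult ccs_facts(2)[OF assms]) measurable
  ultimately show ?thesis unfolding ett_def by (simp only: Bochner_Integration.integral_add integral_mult_right_zero)
 qed
 finally show ?thesis by (simp add: eq_neg_iff_add_eq_0 add.commute)
qed

lemma norm_ett_le: "norm (ett b x) \<le> (\<integral>t. norm (b t) \<partial>lborel)"
 unfolding ett_def by (rule order_trans[OF integral_norm_bound]) (simp add: norm_mult)

lemma ett_decay:
 assumes "ccs b" shows "\<exists>C\<ge>0. \<forall>x. (1 + \<bar>x\<bar>) ^ N * norm (ett b x) \<le> C"
 using assms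
proof (induction N arbitrary: b)
 case 0
 then show ?case using norm_ett_le[of b] by (intro exI[of _ "\<integral>t. norm (b t) \<partial>lborel"]) auto
next
 case (Suc N)
 obtain C1 where C1: "C1 \<ge> 0" "\<And>x. (1 + \<bar>x\<bar>) ^ N * norm (ett b x) \<le> C1" using Suc by blast
 obtain C2 where C2: "C2 \<ge> 0" "\<And>x. (1 + \<bar>x\<bar>) ^ N * norm (ett (derivs b 1) x) \<le> C2" using Suc.IH[OF ccs_derivs[OF Suc.prems]] by blast
 have "(1 + \<bar>x\<bar>) ^ Suc N * norm (ett b x) \<le> C1 + C2" for x
 proof -
  have "\<bar>x\<bar> * norm (ett b x) = norm (\<i> * complex_of_real x * ett b x)" by (simp add: norm_mult)
  also have "\<dots> = norm (ett (derivs b 1) x)" unfolding ett_by_parts[OF Suc.prems] by simp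
  finally have e: "\<bar>x\<bar> * norm (ett b x) = norm (ett (derivs b 1) x)" .
  have "(1 + \<bar>x\<bar>) ^ Suc N * norm (ett b x) = (1 + \<bar>x\<bar>) ^ N * norm (ett b x) + (1 + \<bar>x\<bar>) ^ N * (\<bar>x\<bar> * norm (ett b x))"
   by (simp add: algebra_simps)
  then show ?thesis unfolding e using C1(2)[of x] C2(2)[of x] by linarith
 qed
 then show ?case using C1 C2 by (intro exI[of _ "C1 + C2"]) auto
qed

lemma ett_integrable:
 assumes "ccs b" shows "integrable lborel (ett b)"
proof -
 obtain C where C: "C \<ge> 0" "\<And>x. (1 + \<bar>x\<bar>) ^ 2 * norm (ett b x) \<le> C" using ett_decay[OF assms, of 2] by blast
 have c: "integrable lborel (%t::real. 1 / (1 + t\<^sup>2))"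
  using cauchy_mass_finite unfolding cauchy_mass_def by (intro integrableI_bounded) (auto simp: abs_of_nonneg)
 have m: "ett b \<in> borel_measurable borel"
  using ett_smooth[OF assms] by (intro borel_measurable_continuous_onI continuous_at_imp_continuous_on ballI) (rule has_vector_derivative_continuous)
 show ?thesis
 proof (rule Bochner_Integration.integrable_bound)
  show "integrable lborel (%t::real. C * (1 / (1 + t\<^sup>2)))" by (intro integrable_mult_right c)
  have "norm (ett b x) \<le> norm (C * (1 / (1 + x\<^sup>2)))" for x
  proof -
   have p: "0 < 1 + x\<^sup>2" using zero_le_power2[of x] by linarith
   have "(1 + x\<^sup>2) * norm (ett b x) \<le> (1 + \<bar>x\<bar>)\<^sup>2 * norm (ett b x)" by (intro mult_right_mono) (auto simp: power2_sum)
   also have "\<dots> \<le> C" by (rule C)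
   finally have "norm (ett b x) \<le> C / (1 + x\<^sup>2)" using p by (simp add: pos_le_divide_eq mult.commute)
   then show ?thesis using p C(1) by simp
  qed
  then show "AE x in lborel. norm (ett b x) \<le> norm (C * (1 / (1 + x\<^sup>2)))" by simp
 qed (use m in simp)
qed

definition tens :: "(real => complex) => real^'n => complex" where
 "tens v x = (\<Prod>i\<in>UNIV. v (x $ i))"

text \<open>Distributes a polynomial weight over the coordinates, so that decay of the
  one-dimensional factors yields Schwartz decay of their tensor product.\<close>

lemma one_plus_norm_le_prod: "1 + norm (x :: real^'n) \<le> (\<Prod>i\<in>UNIV. 1 + \<bar>x $ i\<bar>)"
proof -
 have "1 + (\<Sum>i\<in>S. a i) \<le> (\<Prod>i\<in>S. 1 + a i)" if "finite S" "\<And>i. 0 \<le> a i" for S and a :: "'n => real"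
  using that(1)
 proof (induction S rule: finite_induct)
  case (insert i S)
  have s: "0 \<le> sum a S" using that(2) by (intro sum_nonneg) auto
  have "1 + sum a (insert i S) = 1 + sum a S + a i" using insert by simp
  also have "\<dots> \<le> (1 + a i) * (1 + sum a S)" using mult_nonneg_nonneg[OF that(2)[of i] s] by (simp add: algebra_simps)
  also have "\<dots> \<le> (1 + a i) * (\<Prod>i\<in>S. 1 + a i)" using insert.IH that(2)[of i] by (intro mult_left_mono) auto
  finally show ?case using insert by simp
 qed simp
 from this[of UNIV "%i. \<bar>x $ i\<bar>"] norm_le_l1_cart[of x] show ?thesis by simp
qed

text \<open>The derivatives of a factor are transforms again, of (i t)^j b, so
  \<open>ett_decay\<close> covers all of them.\<close>

lemma schwartz_tens_ett:
 assumes b: "ccs b"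
 shows "schwartz (tens (%x. c * ett b x) :: real^'n => complex)"
proof -
 define U where "U j x = c * ett (%t. (\<i> * complex_of_real t) ^ j * b t) x" for j x
 have cj: "ccs (%t. (\<i> * complex_of_real t) ^ j * b t)" for j
  by (intro ccs_mult elem_power elem.mult elem.const elem_of_real b)
 have U: "smooth1 U"
  unfolding smooth1_def
 proof (intro allI)
  fix j t
  have "(%t. \<i> * complex_of_real t * ((\<i> * complex_of_real t) ^ j * b t)) = (%t. (\<i> * complex_of_real t) ^ Suc j * b t)"
   by (simp add: fun_eq_iff mult.assoc)
  then show "(U j has_vector_derivative U (Suc j) t) (at t)"
   using has_vector_derivative_mult_right[OF ett_smooth[OF cj[of j], of t], of c] unfolding U_def by simp
 qed
 have U0: "tens (%x. c * ett b x) = (%x::real^'n. \<Prod>i\<in>UNIV. U 0 (x $ i))"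
  by (simp add: tens_def U_def fun_eq_iff)
 have el: "elem (%x::real^'n. \<Prod>i\<in>UNIV. U 0 (x $ i))"
  by (intro elem_prod elem.comp[OF U] bounded_linear_vec_nth) auto
 have "\<exists>C. \<forall>x. (1 + norm x) ^ k * norm (partials is (%x::real^'n. \<Prod>i\<in>UNIV. U 0 (x $ i)) x) \<le> C" for k and "is" :: "'n list"
 proof -
  have "\<forall>j. \<exists>C. C \<ge> 0 \<and> (\<forall>x. (1 + \<bar>x\<bar>) ^ k * norm (U j x) \<le> C)"
  proof
   fix j
   obtain C where C: "C \<ge> 0" "\<And>x. (1 + \<bar>x\<bar>) ^ k * norm (ett (%t. (\<i> * complex_of_real t) ^ j * b t) x) \<le> C"
    using ett_decay[OF cj[of j], of k] by blast
   have "(1 + \<bar>x\<bar>) ^ k * norm (U j x) \<le> norm c * C" for x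
    using mult_left_mono[OF C(2)[of x], of "norm c"] by (simp add: U_def norm_mult mult_ac)
   then show "\<exists>C. C \<ge> 0 \<and> (\<forall>x. (1 + \<bar>x\<bar>) ^ k * norm (U j x) \<le> C)" using C(1) by (intro exI[of _ "norm c * C"]) auto
  qed
  then obtain C where C: "\<And>j. C j \<ge> 0" "\<And>j x. (1 + \<bar>x\<bar>) ^ k * norm (U j x) \<le> C j" by metis
  have "(1 + norm x) ^ k * norm (partials is (%x::real^'n. \<Prod>i\<in>UNIV. U 0 (x $ i)) x) \<le> (\<Prod>i\<in>UNIV. C (count_list is i))" for x :: "real^'n"
  proof -
   have "(1 + norm x) ^ k \<le> (\<Prod>i\<in>UNIV. (1 + \<bar>x $ i\<bar>) ^ k)"
    unfolding prod_power_distrib[symmetric] by (intro power_mono one_plus_norm_le_prod) simp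
   then have "(1 + norm x) ^ k * norm (\<Prod>i\<in>UNIV. U (count_list is i) (x $ i)) \<le> (\<Prod>i\<in>UNIV. (1 + \<bar>x $ i\<bar>) ^ k) * norm (\<Prod>i\<in>UNIV. U (count_list is i) (x $ i))"
    by (rule mult_right_mono) simp
   also have "\<dots> = (\<Prod>i\<in>UNIV. (1 + \<bar>x $ i\<bar>) ^ k * norm (U (count_list is i) (x $ i)))"
    by (simp add: prod.distrib prod_norm)
   also have "\<dots> \<le> (\<Prod>i\<in>UNIV. C (count_list is i))" by (intro prod_mono conjI C) auto
   finally show ?thesis using iter_dderiv_tensor[of "%_. U" "is", OF U] by simp
  qed
  then show ?thesis by blast
 qed
 then show ?thesis unfolding schwartz_def U0 using elem_smooth[OF el] by blast
qed

lemma fourier_tens: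
 fixes v :: "real => complex"
 assumes "integrable lborel v"
 shows "fourier (tens v) (\<xi>::real^'n) = (\<Prod>i\<in>UNIV. \<integral>t. cis (- (\<xi> $ i \<bullet> t)) * v t \<partial>lborel)"
proof -
 have "cis (- (\<xi> \<bullet> x)) * tens v x = (\<Prod>i\<in>UNIV. cis (- (\<xi> $ i \<bullet> (x $ i))) * v (x $ i))" for x :: "real^'n"
  by (simp add: tens_def prod.distrib prod_cis inner_vec_def sum_negf)
 then show ?thesis unfolding fourier_def
  by (simp only:) (rule integral_lborel_prod_vec, intro integrable_cis_mult assms, measurable)
qed

text \<open>\<open>fourier_inversion\<close> in each coordinate; the factor 1 / (2 pi) is the
  normalisation of the inverse transform on the line.\<close>

lemma fourier_tens_ett:
 assumes b: "ccs b"
 shows "fourier (tens (%x. complex_of_real (1 / (2 * pi)) * ett b x)) (\<xi>::real^'n) = tens b \<xi>"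
proof -
 obtain B where B: "\<And>t. norm (b t) \<le> B" using ccs_facts(3)[OF b] by blast
 have *: "(\<integral>t. cis (- (y \<bullet> t)) * (complex_of_real (1 / (2 * pi)) * ett b t) \<partial>lborel) = b y" for y
 proof -
  have "(\<integral>t. cis (- (y \<bullet> t)) * (complex_of_real (1 / (2 * pi)) * ett b t) \<partial>lborel) = (\<integral>t. complex_of_real (1 / (2 * pi)) * (cis (- (y \<bullet> t)) * ett b t) \<partial>lborel)"
   by (simp only: mult.left_commute)
  also have "\<dots> = complex_of_real (1 / (2 * pi)) * (\<integral>t. cis (- (y \<bullet> t)) * ett b t \<partial>lborel)" by (rule integral_mult_right_zero)
  also have "(\<integral>t. cis (- (y \<bullet> t)) * ett b t \<partial>lborel) = (2 * pi) ^ DIM(real) * b y"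
   using fourier_inversion[OF ccs_facts(2)[OF b] ccs_facts(1)[OF b] B, of y] ett_integrable[OF b] unfolding ett_def by simp
  finally show ?thesis by simp
 qed
 show ?thesis unfolding fourier_tens[OF integrable_mult_right[OF ett_integrable[OF b]]] * by (simp add: tens_def)
qed

section \<open>Modulation norms of tensor products\<close>

definition itt :: "(real => complex) => real => complex" where
 "itt Q = (%x. complex_of_real (1 / (2 * pi)) * ett Q x)"

lemma itt_integrable: "ccs Q ==> integrable lborel (itt Q)"
 unfolding itt_def by (intro integrable_mult_right ett_integrable)

text \<open>The one-dimensional factor of the Gaussian short-time Fourier transform of a tensor
  product.\<close>

definition gab :: "(real => complex) => real => real => complex" where
 "gab v x \<xi> = (\<integral>t. cis (- (\<xi> * t)) * (complex_of_real (exp (- (t - x)\<^sup>2)) * v t) \<partial>lborel)"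

lemma stft_tens:
 assumes v: "integrable lborel v"
 shows "stft gauss_window (tens v) x (\<xi>::real^'n) = (\<Prod>i\<in>UNIV. gab v (x $ i) (\<xi> $ i))"
proof -
 have i: "integrable lborel (%t. cis (- (\<xi> $ i * t)) * (complex_of_real (exp (- (t - x $ i)\<^sup>2)) * v t))" for i
 proof (intro integrable_cis_mult)
  show "integrable lborel (%t. complex_of_real (exp (- (t - x $ i)\<^sup>2)) * v t)"
   by (rule Bochner_Integration.integrable_bound[OF v]) (use v in \<open>auto simp: norm_mult mult_left_le_one_le\<close>)
 qed measurable
 have eq: "tens v t * cnj (cis (\<xi> \<bullet> t) * gauss_window (t - x))
   = (\<Prod>i\<in>UNIV. cis (- (\<xi> $ i * t $ i)) * (complex_of_real (exp (- (t $ i - x $ i)\<^sup>2)) * v (t $ i)))" for t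
 proof -
  have "- (norm (t - x))\<^sup>2 = (\<Sum>i\<in>UNIV. - (t $ i - x $ i)\<^sup>2)"
   unfolding power2_norm_eq_inner by (simp add: inner_vec_def power2_eq_square sum_negf)
  then have "gauss_window (t - x) = (\<Prod>i\<in>UNIV. complex_of_real (exp (- (t $ i - x $ i)\<^sup>2)))"
   unfolding gauss_window_def by (simp only: exp_sum[OF finite] of_real_prod)
  then show ?thesis
   by (simp add: tens_def prod.distrib prod_cis inner_vec_def sum_negf cis_cnj del: of_real_exp)
 qed
 show ?thesis unfolding stft_def eq gab_def by (rule integral_lborel_prod_vec) (rule i)
qed

lemma gab_measurable [measurable]:
 assumes [measurable]: "v \<in> borel_measurable borel"
 shows "(%x. gab v x \<xi>) \<in> borel_measurable borel"
 unfolding gab_def by measurable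

lemma heat_real_le: "heat 1 (z::real) \<le> 2"
proof -
 have "heat 1 z \<le> sqrt pi * 1" unfolding heat_def by (intro mult_mono) auto
 also have "sqrt pi \<le> sqrt 4" using pi_less_4 by (intro real_sqrt_le_mono) simp
 finally show ?thesis by simp
qed

lemma heat_real_ge: "\<bar>z\<bar> \<le> 1/4 ==> exp (- 1) \<le> heat 1 (z::real)"
proof -
 assume "\<bar>z\<bar> \<le> 1/4"
 then have "z\<^sup>2 \<le> 1\<^sup>2" by (intro power2_le_iff_abs_le[THEN iffD2]) auto
 then have "1 * exp (- 1) \<le> sqrt pi * exp (- z\<^sup>2 / 4)" using pi_gt3 by (intro mult_mono) auto
 then show ?thesis by (simp add: heat_def)
qed

text \<open>Fubini and the Gaussian Fourier transform move the window to the frequency side, where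
  it becomes the factor \<open>heat 1 (\<theta> - \<xi>)\<close>.\<close>

lemma gab_itt:
 assumes "ccs Q"
 shows "gab (itt Q) x \<xi> = complex_of_real (1 / (2 * pi)) * (cis (- (x * \<xi>)) *
  (\<integral>\<theta>. cis (x \<bullet> \<theta>) * (Q \<theta> * complex_of_real (heat 1 (\<theta> - \<xi>))) \<partial>lborel))"
proof -
 have Q: "integrable lborel Q" by (rule ccs_facts(2)[OF assms])
 then have [measurable]: "Q \<in> borel_measurable borel" by auto
 let ?g = "%t. complex_of_real (exp (- (t - x)\<^sup>2))"
 have "integrable lborel (%t::real. complex_of_real (exp (- 1 * (norm t)\<^sup>2)))"
  using integrable_gauss_real[of 1, where 'a = real] by (intro integrable_of_real) auto
 from lborel_integrable_real_affine[OF this, of 1 "- x"] have gi: "integrable lborel ?g" by simp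
 let ?K = "%t \<theta>. ?g t * Q \<theta> * cis (t * (\<theta> - \<xi>))"
 have K: "integrable (lborel \<Otimes>\<^sub>M lborel) (%(t,\<theta>). ?K t \<theta>)"
 proof (rule Bochner_Integration.integrable_bound)
  show "integrable (lborel \<Otimes>\<^sub>M lborel) (%(t,\<theta>). ?g t * Q \<theta>)"
   by (intro integrable_tensor_lborel gi Q)
  show "(%(t,\<theta>). ?K t \<theta>) \<in> borel_measurable (lborel \<Otimes>\<^sub>M lborel)" by measurable
 qed (auto simp: norm_mult)
 have "cis (- (\<xi> * t)) * (?g t * itt Q t) = complex_of_real (1 / (2 * pi)) * (\<integral>\<theta>. ?K t \<theta> \<partial>lborel)" for t
 proof -
  have "cis (t * (\<theta> - \<xi>)) = cis (- (\<xi> * t)) * cis (t * \<theta>)" for \<theta>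
   by (simp add: cis_mult algebra_simps)
  then have "(\<integral>\<theta>. ?K t \<theta> \<partial>lborel) = (\<integral>\<theta>. (cis (- (\<xi> * t)) * ?g t) * (cis (t \<bullet> \<theta>) * Q \<theta>) \<partial>lborel)"
   by (intro Bochner_Integration.integral_cong refl) (simp only: inner_real_def mult_ac)
  also have "\<dots> = (cis (- (\<xi> * t)) * ?g t) * ett Q t" unfolding ett_def by (rule integral_mult_right_zero)
  finally show ?thesis unfolding itt_def by (simp only: mult_ac)
 qed
 then have "gab (itt Q) x \<xi> = complex_of_real (1 / (2 * pi)) * (\<integral>t. (\<integral>\<theta>. ?K t \<theta> \<partial>lborel) \<partial>lborel)"
  unfolding gab_def by (simp only: integral_mult_right_zero)
 also have "(\<integral>t. (\<integral>\<theta>. ?K t \<theta> \<partial>lborel) \<partial>lborel) = (\<integral>\<theta>. (\<integral>t. ?K t \<theta> \<partial>lborel) \<partial>lborel)"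
  by (rule lborel_pair.Fubini_integral[symmetric]) (rule K)
 also have "\<dots> = (\<integral>\<theta>. cis (- (x * \<xi>)) * (cis (x \<bullet> \<theta>) * (Q \<theta> * complex_of_real (heat 1 (\<theta> - \<xi>)))) \<partial>lborel)"
 proof (intro Bochner_Integration.integral_cong refl)
  fix \<theta>
  have c: "cis ((t + x) * (\<theta> - \<xi>)) = cis (t \<bullet> (\<theta> - \<xi>)) * (cis (- (x * \<xi>)) * cis (x \<bullet> \<theta>))" for t
   by (simp add: cis_mult algebra_simps)
  have "(\<integral>t. ?K t \<theta> \<partial>lborel) = (\<integral>t. ?K (t + x) \<theta> \<partial>lborel)"
   by (rule lborel_integral_shift[symmetric]) measurable
  also have "\<dots> = (\<integral>t. (Q \<theta> * (cis (- (x * \<xi>)) * cis (x \<bullet> \<theta>))) * (complex_of_real (exp (- 1 * (norm t)\<^sup>2)) * cis (t \<bullet> (\<theta> - \<xi>))) \<partial>lborel)"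
   unfolding c by (intro Bochner_Integration.integral_cong refl) (simp del: of_real_exp)
  also have "\<dots> = (Q \<theta> * (cis (- (x * \<xi>)) * cis (x \<bullet> \<theta>))) * complex_of_real (heat 1 (\<theta> - \<xi>))"
   by (simp only: integral_mult_right_zero gauss_cis_eq_heat[OF zero_less_one])
  finally show "(\<integral>t. ?K t \<theta> \<partial>lborel) = cis (- (x * \<xi>)) * (cis (x \<bullet> \<theta>) * (Q \<theta> * complex_of_real (heat 1 (\<theta> - \<xi>))))"
   by (simp only: mult_ac)
 qed
 finally show ?thesis by (simp only: integral_mult_right_zero)
qed

text \<open>The mass of \<open>Q\<close> near \<xi>; it is 2 pi times the squared L^2 norm in x of
  the short-time Fourier transform of \<open>itt Q\<close> at frequency \<xi>.\<close>

definition slice :: "(real => complex) => real => ennreal" where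
 "slice Q \<xi> = (\<integral>\<^sup>+\<theta>. ennreal ((norm (Q \<theta>))\<^sup>2 * (heat 1 (\<theta> - \<xi>))\<^sup>2) \<partial>lborel)"

lemma slice_measurable [measurable]:
 assumes [measurable]: "Q \<in> borel_measurable borel"
 shows "slice Q \<in> borel_measurable borel"
 unfolding slice_def[abs_def] by measurable

text \<open>Exact Plancherel from \<open>bessel_fourier\<close> and \<open>plancherel_lower\<close>.
  Equality matters, as the norm of the input is needed from above and that of the output from
  below.\<close>

lemma gab_itt_norm:
 assumes "ccs Q"
 shows "(\<integral>\<^sup>+x. ennreal ((norm (gab (itt Q) x \<xi>))\<^sup>2) \<partial>lborel) = ennreal (1 / (2 * pi)) * slice Q \<xi>"
proof -
 obtain B where B: "\<And>t. norm (Q t) \<le> B" using ccs_facts(3)[OF assms] by blast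
 have Q: "integrable lborel Q" "continuous_on UNIV Q" by (rule ccs_facts[OF assms])+
 then have [measurable]: "Q \<in> borel_measurable borel" by auto
 let ?H = "%\<theta>. Q \<theta> * complex_of_real (heat 1 (\<theta> - \<xi>))"
 have h: "norm (?H \<theta>) \<le> 2 * norm (Q \<theta>)" for \<theta>
  using mult_left_mono[OF heat_real_le[of "\<theta> - \<xi>"], of "norm (Q \<theta>)"] heat_nonneg[of 1 "\<theta> - \<xi>"]
  by (simp add: norm_mult)
 have H: "integrable lborel ?H"
 proof (rule Bochner_Integration.integrable_bound)
  show "integrable lborel (%\<theta>. 2 * Q \<theta>)" using Q by simp
  show "AE \<theta> in lborel. norm (?H \<theta>) \<le> norm (2 * Q \<theta>)" using h by (simp add: norm_mult)
 qed measurable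
 have c: "continuous_on UNIV ?H" unfolding heat_def using Q(2) by (intro continuous_intros) auto
 have b: "norm (?H \<theta>) \<le> 2 * B" for \<theta> using h[of \<theta>] B[of \<theta>] by linarith
 have "(\<integral>\<^sup>+x. ennreal ((norm (\<integral>\<theta>. cis (x \<bullet> \<theta>) * ?H \<theta> \<partial>lborel))\<^sup>2) \<partial>lborel)
   = ennreal ((2 * pi) ^ DIM(real)) * (\<integral>\<^sup>+\<theta>. ennreal ((norm (?H \<theta>))\<^sup>2) \<partial>lborel)"
  by (intro antisym bessel_fourier[OF H] plancherel_lower[OF H c b])
 also have "(\<integral>\<^sup>+\<theta>. ennreal ((norm (?H \<theta>))\<^sup>2) \<partial>lborel) = slice Q \<xi>"
  unfolding slice_def by (intro nn_integral_cong) (simp add: norm_mult power_mult_distrib)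
 finally have e: "(\<integral>\<^sup>+x. ennreal ((norm (\<integral>\<theta>. cis (x \<bullet> \<theta>) * ?H \<theta> \<partial>lborel))\<^sup>2) \<partial>lborel) = ennreal (2 * pi) * slice Q \<xi>" by simp
 have "(norm (gab (itt Q) x \<xi>))\<^sup>2 = (1 / (2 * pi))\<^sup>2 * (norm (\<integral>\<theta>. cis (x \<bullet> \<theta>) * ?H \<theta> \<partial>lborel))\<^sup>2" for x
 proof -
  have "norm (complex_of_real (1 / (2 * pi))) = 1 / (2 * pi)" unfolding norm_of_real by simp
  then show ?thesis unfolding gab_itt[OF assms] norm_mult by (simp only: norm_cis mult_1 power_mult_distrib)
 qed
 then have "(\<integral>\<^sup>+x. ennreal ((norm (gab (itt Q) x \<xi>))\<^sup>2) \<partial>lborel)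
   = ennreal ((1 / (2 * pi))\<^sup>2) * (\<integral>\<^sup>+x. ennreal ((norm (\<integral>\<theta>. cis (x \<bullet> \<theta>) * ?H \<theta> \<partial>lborel))\<^sup>2) \<partial>lborel)"
  by (simp only: ennreal_mult'[OF zero_le_power2]) (rule nn_integral_cmult, measurable)
 also have "\<dots> = ennreal ((1 / (2 * pi))\<^sup>2 * (2 * pi)) * slice Q \<xi>"
  unfolding e ennreal_mult'[OF zero_le_power2] mult.assoc ..
 also have "(1 / (2 * pi))\<^sup>2 * (2 * pi) = 1 / (2 * pi)" by (simp add: power2_eq_square)
 finally show ?thesis .
qed

text \<open>With r = q/2 this is, up to a constant, the q-th power of the one-dimensional M^{2,q}
  norm.\<close>

definition slice_norm :: "real => (real => complex) => ennreal" where
 "slice_norm r Q = (\<integral>\<^sup>+\<xi>. enn_powr (slice Q \<xi>) r \<partial>lborel)"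

lemma enn_powr_prod: "finite S ==> 0 < r ==> enn_powr (\<Prod>i\<in>S. a i) r = (\<Prod>i\<in>S. enn_powr (a i) r)"
proof (induction S rule: finite_induct)
 case empty
 have "enn_powr (ennreal 1) r = ennreal 1" by (subst enn_powr_ennreal) auto
 then show ?case by simp
qed (simp add: enn_powr_mult)

text \<open>All integrals factorise over the coordinates, so the norm is governed by an n-th power
  and the necessity reduces to estimates on the line.\<close>

lemma mod_norm_tens:
 assumes Q: "ccs Q" and c: "0 \<le> c" and q: "1 < q"
 shows "mod_norm_2q q (%x::real^'n. complex_of_real c * tens (itt Q) x)
  = enn_powr (ennreal ((c\<^sup>2 * (1 / (2 * pi)) ^ CARD('n)) powr (q / 2)) * slice_norm (q / 2) Q ^ CARD('n)) (1 / q)"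
proof -
 let ?r = "q / 2"
 let ?\<kappa> = "c\<^sup>2 * (1 / (2 * pi)) ^ CARD('n)"
 have [measurable]: "Q \<in> borel_measurable borel" "itt Q \<in> borel_measurable borel"
  using ccs_facts(2)[OF Q] itt_integrable[OF Q] by auto
 have r: "0 < ?r" using q by simp
 have "(\<integral>\<^sup>+x. ennreal ((cmod (stft gauss_window (%x. complex_of_real c * tens (itt Q) x) x \<xi>))\<^sup>2) \<partial>lborel)
   = ennreal ?\<kappa> * (\<Prod>i\<in>UNIV. slice Q (\<xi> $ i))" for \<xi> :: "real^'n"
 proof -
  have "ennreal ((cmod (stft gauss_window (%x. complex_of_real c * tens (itt Q) x) x \<xi>))\<^sup>2)
    = ennreal (c\<^sup>2) * (\<Prod>i\<in>UNIV. ennreal ((norm (gab (itt Q) (x $ i) (\<xi> $ i)))\<^sup>2))" for x :: "real^'n"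
  proof -
   have "stft gauss_window (%x. complex_of_real c * tens (itt Q) x) x \<xi> = complex_of_real c * stft gauss_window (tens (itt Q)) x \<xi>"
    unfolding stft_def mult.assoc by (rule integral_mult_right_zero)
   then have "(cmod (stft gauss_window (%x. complex_of_real c * tens (itt Q) x) x \<xi>))\<^sup>2
     = c\<^sup>2 * (\<Prod>i\<in>UNIV. (norm (gab (itt Q) (x $ i) (\<xi> $ i)))\<^sup>2)"
    unfolding stft_tens[OF itt_integrable[OF Q]] by (simp add: norm_mult power_mult_distrib prod_norm[symmetric] prod_power_distrib)
   then show ?thesis by (simp add: ennreal_mult' prod_ennreal)
  qed
  then have "(\<integral>\<^sup>+x. ennreal ((cmod (stft gauss_window (%x. complex_of_real c * tens (itt Q) x) x \<xi>))\<^sup>2) \<partial>lborel)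
    = ennreal (c\<^sup>2) * (\<integral>\<^sup>+x. (\<Prod>i\<in>UNIV. ennreal ((norm (gab (itt Q) (x $ i) (\<xi> $ i)))\<^sup>2)) \<partial>(lborel :: (real^'n) measure))"
   by (simp only:) (rule nn_integral_cmult, measurable)
  also have "(\<integral>\<^sup>+x. (\<Prod>i\<in>UNIV. ennreal ((norm (gab (itt Q) (x $ i) (\<xi> $ i)))\<^sup>2)) \<partial>(lborel :: (real^'n) measure))
    = (\<Prod>i\<in>UNIV. ennreal (1 / (2 * pi)) * slice Q (\<xi> $ i))"
   by (subst nn_integral_lborel_prod_vec) (measurable, simp only: gab_itt_norm[OF Q])
  also have "\<dots> = ennreal ((1 / (2 * pi)) ^ CARD('n)) * (\<Prod>i\<in>UNIV. slice Q (\<xi> $ i))"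
   by (simp only: prod.distrib prod_constant ennreal_power[OF divide_nonneg_nonneg[OF zero_le_one mult_nonneg_nonneg[OF zero_le_numeral pi_ge_zero]]])
  finally show ?thesis by (simp add: ennreal_mult' mult.assoc)
 qed
 then have "(\<integral>\<^sup>+\<xi>. enn_powr (\<integral>\<^sup>+x. ennreal ((cmod (stft gauss_window (%x. complex_of_real c * tens (itt Q) x) x \<xi>))\<^sup>2) \<partial>lborel) ?r \<partial>(lborel :: (real^'n) measure))
   = (\<integral>\<^sup>+\<xi>. ennreal (?\<kappa> powr ?r) * (\<Prod>i\<in>UNIV. enn_powr (slice Q (\<xi> $ i)) ?r) \<partial>(lborel :: (real^'n) measure))"
  using r by (simp add: enn_powr_mult enn_powr_prod)
 also have "\<dots> = ennreal (?\<kappa> powr ?r) * (\<integral>\<^sup>+\<xi>. (\<Prod>i\<in>UNIV. enn_powr (slice Q (\<xi> $ i)) ?r) \<partial>(lborel :: (real^'n) measure))"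
  by (rule nn_integral_cmult) measurable
 also have "(\<integral>\<^sup>+\<xi>. (\<Prod>i\<in>UNIV. enn_powr (slice Q (\<xi> $ i)) ?r) \<partial>(lborel :: (real^'n) measure)) = slice_norm ?r Q ^ CARD('n)"
  by (subst nn_integral_lborel_prod_vec) (measurable, simp add: slice_norm_def)
 finally show ?thesis unfolding mod_norm_2q_def by simp
qed

section \<open>Norm bounds on the line\<close>

text \<open>On N disjoint intervals of length 1/4 the slices are at least c / N, which contributes N
  (c / N)^r.\<close>

lemma slice_norm_lower:
 assumes e0: "0 < e0" and r: "0 < r"
 shows "\<exists>c>0. \<forall>N Q s. 0 < N --> (\<forall>l<N. \<forall>\<theta>. \<bar>\<theta> - (s + real l)\<bar> \<le> 1/8 --> e0 / real N \<le> (norm (Q \<theta>))\<^sup>2)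
  --> ennreal (c * real N powr (1 - r)) \<le> slice_norm r Q"
proof -
 define c1 where "c1 = e0 * (exp (- 1))\<^sup>2 / 4"
 have c1: "0 < c1" using e0 by (simp add: c1_def)
 have "ennreal (c1 powr r / 4 * real N powr (1 - r)) \<le> slice_norm r Q"
  if N: "0 < N" and Q: "\<And>l \<theta>. l < N ==> \<bar>\<theta> - (s + real l)\<bar> \<le> 1/8 ==> e0 / real N \<le> (norm (Q \<theta>))\<^sup>2" for N Q s
 proof -
  define I where "I l = {s + real l - 1/8..s + real l + 1/8}" for l
  have IQ: "\<theta> \<in> I l \<longleftrightarrow> \<bar>\<theta> - (s + real l)\<bar> \<le> 1/8" for \<theta> l unfolding I_def abs_diff_le_iff by simp
  have Im [measurable]: "I l \<in> sets borel" and Ie: "emeasure lborel (I l) = ennreal (1/4)" for l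
   unfolding I_def by (auto simp: emeasure_lborel_Icc_eq)
  have lo: "ennreal (c1 / real N) \<le> slice Q \<xi>" if "l < N" "\<xi> \<in> I l" for l \<xi>
  proof -
   have "ennreal (c1 / real N) = ennreal (e0 / real N * (exp (- 1))\<^sup>2) * emeasure lborel (I l)"
    unfolding Ie using e0 by (subst ennreal_mult'[symmetric]) (auto simp: c1_def)
   also have "\<dots> = (\<integral>\<^sup>+\<theta>. ennreal (e0 / real N * (exp (- 1))\<^sup>2) * indicator (I l) \<theta> \<partial>lborel)"
    by (rule nn_integral_cmult_indicator[symmetric]) simp
   also have "\<dots> \<le> slice Q \<xi>"
    unfolding slice_def
   proof (intro nn_integral_mono)
    fix \<theta>
    show "ennreal (e0 / real N * (exp (- 1))\<^sup>2) * indicator (I l) \<theta> \<le> ennreal ((norm (Q \<theta>))\<^sup>2 * (heat 1 (\<theta> - \<xi>))\<^sup>2)"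
    proof (cases "\<theta> \<in> I l")
     case True
     have "\<bar>\<theta> - \<xi>\<bar> \<le> 1/4" using True that(2) unfolding IQ by linarith
     then have "(exp (- 1))\<^sup>2 \<le> (heat 1 (\<theta> - \<xi>))\<^sup>2" by (intro power_mono heat_real_ge) auto
     moreover have "e0 / real N \<le> (norm (Q \<theta>))\<^sup>2" using Q[OF that(1)] True unfolding IQ by blast
     ultimately have "e0 / real N * (exp (- 1))\<^sup>2 \<le> (norm (Q \<theta>))\<^sup>2 * (heat 1 (\<theta> - \<xi>))\<^sup>2"
      by (intro mult_mono) auto
     then show ?thesis using True by (simp add: ennreal_leI)
    qed simp
   qed
   finally show ?thesis .
  qed
  let ?a = "ennreal ((c1 / real N) powr r)"
  have disj: "l = l'" if "\<xi> \<in> I l" "\<xi> \<in> I l'" for \<xi> l l'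
  proof (rule ccontr)
   assume "l ~= l'"
   then have "1 \<le> \<bar>real l - real l'\<bar>" by linarith
   then show False using that unfolding IQ by linarith
  qed
  have pw: "(\<Sum>l<N. ?a * indicator (I l) \<xi>) \<le> enn_powr (slice Q \<xi>) r" for \<xi>
  proof (cases "\<exists>l<N. \<xi> \<in> I l")
   case True
   then obtain l where l: "l < N" "\<xi> \<in> I l" by blast
   have "(\<Sum>l<N. ?a * indicator (I l) \<xi>) = (\<Sum>l\<in>{l}. ?a * indicator (I l) \<xi>)"
    using l disj by (intro sum.mono_neutral_right) (auto simp: indicator_def)
   also have "\<dots> = enn_powr (ennreal (c1 / real N)) r" using l c1 by simp
   also have "\<dots> \<le> enn_powr (slice Q \<xi>) r" using lo[OF l] r by (intro enn_powr_mono) auto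
   finally show ?thesis .
  next
   case False
   then have z: "(\<Sum>l<N. ?a * indicator (I l) \<xi>) = 0" by (intro sum.neutral) auto
   show ?thesis unfolding z by simp
  qed
  have "(\<integral>\<^sup>+\<xi>. (\<Sum>l<N. ?a * indicator (I l) \<xi>) \<partial>lborel) = (\<Sum>l<N. \<integral>\<^sup>+\<xi>. ?a * indicator (I l) \<xi> \<partial>lborel)"
   by (rule nn_integral_sum) measurable
  also have "\<dots> = (\<Sum>l<N. ?a * ennreal (1/4))" by (intro sum.cong refl, subst nn_integral_cmult_indicator) (auto simp: Ie)
  also have "\<dots> = ennreal (real N * ((c1 / real N) powr r * (1/4)))"
   by (simp only: sum_constant card_lessThan ennreal_of_nat_eq_real_of_nat ennreal_mult'[OF of_nat_0_le_iff] ennreal_mult'[OF powr_ge_zero])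
  also have "real N * ((c1 / real N) powr r * (1/4)) = c1 powr r / 4 * real N powr (1 - r)"
   using N c1 by (simp add: powr_divide powr_diff mult_ac)
  finally have "ennreal (c1 powr r / 4 * real N powr (1 - r)) = (\<integral>\<^sup>+\<xi>. (\<Sum>l<N. ?a * indicator (I l) \<xi>) \<partial>lborel)" by simp
  also have "\<dots> \<le> slice_norm r Q" unfolding slice_norm_def by (intro nn_integral_mono pw)
  finally show ?thesis .
 qed
 moreover have "0 < c1 powr r / 4" using c1 by simp
 ultimately show ?thesis by blast
qed

text \<open>The mass sits in one interval, so the slices decay like a Gaussian around s and every
  power of them is integrable.\<close>

lemma slice_norm_upper_single:
 assumes K: "0 < K" and r: "0 < r"
 shows "\<exists>C>0. \<forall>Q s. (\<forall>\<theta>. (norm (Q \<theta>))\<^sup>2 \<le> K * indicator {s - 1/4..s + 1/4} \<theta>) --> slice_norm r Q \<le> ennreal C"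
proof -
 define C where "C = (4 * K) powr r / sqrt (pi * r) * (2 * pi)"
 have h: "exp (- (r * z\<^sup>2 / 4)) = 1 / sqrt (pi * r) * heat (1 / r) z" for z :: real using r by (simp add: heat_def mult.commute)
 have "slice_norm r Q \<le> ennreal C" if Q: "\<And>\<theta>. (norm (Q \<theta>))\<^sup>2 \<le> K * indicator {s - 1/4..s + 1/4} \<theta>" for Q s
 proof -
  let ?I = "{s - 1/4..s + 1/4}"
  have A: "slice Q \<xi> \<le> ennreal (4 * K * exp (- (\<xi> - s)\<^sup>2 / 4))" for \<xi>
  proof -
   have "slice Q \<xi> \<le> (\<integral>\<^sup>+\<theta>. ennreal (8 * K * exp (- (\<xi> - s)\<^sup>2 / 4)) * indicator ?I \<theta> \<partial>lborel)"
    unfolding slice_def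
   proof (intro nn_integral_mono)
    fix \<theta>
    show "ennreal ((norm (Q \<theta>))\<^sup>2 * (heat 1 (\<theta> - \<xi>))\<^sup>2) \<le> ennreal (8 * K * exp (- (\<xi> - s)\<^sup>2 / 4)) * indicator ?I \<theta>"
    proof (cases "\<theta> \<in> ?I")
     case True
     then have t: "\<bar>\<theta> - s\<bar> \<le> 1/4" unfolding abs_diff_le_iff by simp
     then have "(\<theta> - s)\<^sup>2 \<le> (1/4)\<^sup>2" by (intro power2_le_iff_abs_le[THEN iffD2]) auto
     moreover have "(\<xi> - s)\<^sup>2 \<le> 2 * (\<theta> - \<xi>)\<^sup>2 + 2 * (\<theta> - s)\<^sup>2"
      using zero_le_power2[of "\<theta> - \<xi> + (\<theta> - s)"] by (simp add: power2_eq_square algebra_simps)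
     ultimately have le: "- (\<theta> - \<xi>)\<^sup>2 / 2 \<le> 1/2 + - (\<xi> - s)\<^sup>2 / 4" by (simp add: power2_eq_square)
     have "(heat 1 (\<theta> - \<xi>))\<^sup>2 = pi * exp (- (\<theta> - \<xi>)\<^sup>2 / 2)"
      by (simp add: heat_def power_mult_distrib power2_eq_square[of "exp _"] mult_exp_exp)
     also have "\<dots> \<le> 4 * exp (1/2 + - (\<xi> - s)\<^sup>2 / 4)" using le pi_less_4 by (intro mult_mono) auto
     also have "\<dots> = 4 * exp (1/2) * exp (- (\<xi> - s)\<^sup>2 / 4)" by (simp only: exp_add mult.assoc)
     also have "exp (1/2) \<le> (2::real)"
     proof (rule power2_le_imp_le)
      have "(exp (1/2))\<^sup>2 = exp (1::real)" by (simp add: power2_eq_square mult_exp_exp)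
      then show "(exp (1/2))\<^sup>2 \<le> (2::real)\<^sup>2" using exp_le by simp
     qed simp
     finally have "(heat 1 (\<theta> - \<xi>))\<^sup>2 \<le> 8 * exp (- (\<xi> - s)\<^sup>2 / 4)" by simp
     with Q[of \<theta>] True have "(norm (Q \<theta>))\<^sup>2 * (heat 1 (\<theta> - \<xi>))\<^sup>2 \<le> K * (8 * exp (- (\<xi> - s)\<^sup>2 / 4))"
      using K by (intro mult_mono) auto
     then show ?thesis using True by (simp add: ennreal_leI mult_ac)
    next
     case False
     then show ?thesis using Q[of \<theta>] by simp
    qed
   qed
   also have "\<dots> = ennreal (8 * K * exp (- (\<xi> - s)\<^sup>2 / 4)) * emeasure lborel ?I" by (rule nn_integral_cmult_indicator) simp
   also have "\<dots> = ennreal (4 * K * exp (- (\<xi> - s)\<^sup>2 / 4))"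
   proof -
    have e: "emeasure lborel ?I = ennreal (1/2)" by (simp add: emeasure_lborel_Icc_eq)
    show ?thesis unfolding e using K by (subst ennreal_mult'[symmetric]) auto
   qed
   finally show ?thesis .
  qed
  have "enn_powr (slice Q \<xi>) r \<le> ennreal ((4 * K) powr r / sqrt (pi * r)) * ennreal (heat (1 / r) (\<xi> - s))" for \<xi>
  proof -
   have "enn_powr (slice Q \<xi>) r \<le> enn_powr (ennreal (4 * K * exp (- (\<xi> - s)\<^sup>2 / 4))) r"
    using A r by (intro enn_powr_mono) auto
   also have "\<dots> = ennreal ((4 * K) powr r * exp (- (r * (\<xi> - s)\<^sup>2 / 4)))"
    using K by (simp add: powr_mult exp_powr_real)
   also have "\<dots> = ennreal ((4 * K) powr r / sqrt (pi * r)) * ennreal (heat (1 / r) (\<xi> - s))"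
    unfolding h using heat_nonneg[of "1 / r" "\<xi> - s"] r by (subst ennreal_mult'[symmetric]) auto
   finally show ?thesis .
  qed
  then have "slice_norm r Q \<le> (\<integral>\<^sup>+\<xi>. ennreal ((4 * K) powr r / sqrt (pi * r)) * ennreal (heat (1 / r) (\<xi> - s)) \<partial>lborel)"
   unfolding slice_norm_def by (intro nn_integral_mono)
  also have "\<dots> = ennreal ((4 * K) powr r / sqrt (pi * r)) * ennreal ((2 * pi) ^ DIM(real))"
   using r by (subst nn_integral_cmult) (measurable, simp only: nn_integral_heat divide_pos_pos zero_less_one)
  also have "\<dots> = ennreal C" using r by (subst ennreal_mult'[symmetric]) (auto simp: C_def)
  finally show ?thesis .
 qed
 moreover have "0 < C" using K r by (simp add: C_def)
 ultimately show ?thesis by blast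
qed

lemma enn_powr_le_mult:
 assumes "a \<le> ennreal M" "0 \<le> M" "1 \<le> r"
 shows "enn_powr a r \<le> ennreal (M powr (r - 1)) * a"
proof -
 obtain x where x: "a = ennreal x" "0 \<le> x" using assms(1) by (cases a) (auto simp: top_unique)
 have "x powr r = x powr (r - 1) * x" using x(2) assms(3) powr_add[of x "r - 1" 1] by (cases "x = 0") auto
 also have "\<dots> \<le> M powr (r - 1) * x" using x assms by (intro mult_right_mono powr_mono2) auto
 finally have "x powr r \<le> M powr (r - 1) * x" .
 then show ?thesis using x by (simp add: ennreal_mult'[symmetric] ennreal_leI)
qed

text \<open>The slices are at most of order 1 / N and their integral is bounded; for r \<ge> 1
  interpolation between the two gives (1 / N)^(r - 1).\<close>

lemma slice_norm_upper:
 assumes K: "0 < K" and r: "1 \<le> r"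
 shows "\<exists>C>0. \<forall>N Q E. 0 < N --> Q \<in> borel_measurable borel --> E \<in> sets borel --> emeasure lborel E \<le> ennreal (real N)
  --> (\<forall>\<theta>. (norm (Q \<theta>))\<^sup>2 \<le> K / real N * indicator E \<theta>) --> slice_norm r Q \<le> ennreal (C * real N powr (1 - r))"
proof -
 define M where "M = 4 * pi * K"
 have M: "0 < M" using K by (simp add: M_def)
 have "slice_norm r Q \<le> ennreal (M powr r * real N powr (1 - r))"
  if N: "0 < N" and [measurable]: "Q \<in> borel_measurable borel" "E \<in> sets borel" and E: "emeasure lborel E \<le> ennreal (real N)"
   and Q: "\<And>\<theta>. (norm (Q \<theta>))\<^sup>2 \<le> K / real N * indicator E \<theta>" for N Q and E :: "real set"
 proof -
  have pw: "ennreal ((norm (Q \<theta>))\<^sup>2 * (heat 1 (\<theta> - \<xi>))\<^sup>2) \<le> ennreal (2 * K / real N) * (indicator E \<theta> * ennreal (heat 1 (\<theta> - \<xi>)))" for \<theta> \<xi>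
  proof (cases "\<theta> \<in> E")
   case True
   have h0: "0 \<le> heat 1 (\<theta> - \<xi>)" by (intro heat_nonneg) simp
   have "(heat 1 (\<theta> - \<xi>))\<^sup>2 \<le> 2 * heat 1 (\<theta> - \<xi>)"
    using mult_right_mono[OF heat_real_le h0] by (simp add: power2_eq_square)
   with Q[of \<theta>] True have "(norm (Q \<theta>))\<^sup>2 * (heat 1 (\<theta> - \<xi>))\<^sup>2 \<le> K / real N * (2 * heat 1 (\<theta> - \<xi>))"
    using K by (intro mult_mono) auto
   then show ?thesis using True K h0 by (simp add: ennreal_mult'[symmetric] ennreal_leI mult_ac)
  qed (use Q[of \<theta>] in simp)
  have A: "slice Q \<xi> \<le> ennreal (M / real N)" for \<xi>
  proof -
   have "slice Q \<xi> \<le> (\<integral>\<^sup>+\<theta>. ennreal (2 * K / real N) * ennreal (heat 1 (\<theta> - \<xi>)) \<partial>lborel)"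
    unfolding slice_def
    by (intro nn_integral_mono order_trans[OF pw] mult_left_mono) (auto simp: indicator_def)
   also have "\<dots> = ennreal (2 * K / real N) * ennreal ((2 * pi) ^ DIM(real))"
    by (subst nn_integral_cmult) (measurable, simp only: nn_integral_heat zero_less_one)
   also have "\<dots> = ennreal (M / real N)" using K by (subst ennreal_mult'[symmetric]) (auto simp: M_def field_simps)
   finally show ?thesis .
  qed
  have h1: "(\<integral>\<^sup>+\<xi>. ennreal (heat 1 (\<theta> - \<xi>)) \<partial>lborel) = ennreal (2 * pi)" for \<theta> :: real
   unfolding heat_minus[of 1 \<theta>] using nn_integral_heat[of 1 \<theta>] by simp
  have "(\<integral>\<^sup>+\<xi>. slice Q \<xi> \<partial>lborel) \<le> (\<integral>\<^sup>+\<xi>. \<integral>\<^sup>+\<theta>. ennreal (2 * K / real N) * (indicator E \<theta> * ennreal (heat 1 (\<theta> - \<xi>))) \<partial>lborel \<partial>lborel)"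
   unfolding slice_def by (intro nn_integral_mono pw)
  also have "\<dots> = (\<integral>\<^sup>+\<theta>. \<integral>\<^sup>+\<xi>. ennreal (2 * K / real N) * (indicator E \<theta> * ennreal (heat 1 (\<theta> - \<xi>))) \<partial>lborel \<partial>lborel)"
   by (rule lborel_pair.Fubini') measurable
  also have "\<dots> = ennreal (2 * K / real N) * (ennreal (2 * pi) * emeasure lborel E)"
   by (simp add: nn_integral_cmult h1 nn_integral_multc mult.commute)
  also have "\<dots> \<le> ennreal (2 * K / real N) * (ennreal (2 * pi) * ennreal (real N))" by (intro mult_left_mono E) auto
  also have "\<dots> = ennreal M"
   using K N by (simp add: ennreal_mult'[symmetric] M_def)
  finally have I: "(\<integral>\<^sup>+\<xi>. slice Q \<xi> \<partial>lborel) \<le> ennreal M" .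
  have "slice_norm r Q \<le> (\<integral>\<^sup>+\<xi>. ennreal ((M / real N) powr (r - 1)) * slice Q \<xi> \<partial>lborel)"
   unfolding slice_norm_def using M r by (intro nn_integral_mono enn_powr_le_mult A) auto
  also have "\<dots> = ennreal ((M / real N) powr (r - 1)) * (\<integral>\<^sup>+\<xi>. slice Q \<xi> \<partial>lborel)" by (rule nn_integral_cmult) measurable
  also have "\<dots> \<le> ennreal ((M / real N) powr (r - 1)) * ennreal M" by (intro mult_left_mono I) auto
  also have "\<dots> = ennreal (M powr r * real N powr (1 - r))"
   using M N by (subst ennreal_mult'[symmetric]) (auto simp: powr_divide powr_diff field_simps)
  finally show ?thesis .
 qed
 moreover have "0 < M powr r" using M by simp
 ultimately show ?thesis by blast
qed

section \<open>The action of the symbol and the test functions for both ranges of q\<close>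

lemma ccs_shift:
 assumes "ccs b" shows "ccs (%t. b (t - a))"
proof -
 from assms obtain M where b: "elem b" and M: "\<And>t. M < \<bar>t\<bar> ==> b t = 0" by (auto simp: ccs_def)
 have U: "smooth1 (%j t. derivs b j (t - a))"
  unfolding smooth1_def
 proof (intro allI)
  fix k t
  have "((%t. t - a) has_vector_derivative 1) (at t)" by (auto intro!: derivative_eq_intros)
  from vector_diff_chain_at[OF this smooth1D[OF smooth1_derivs[OF elem_smooth[OF b]], of k]]
  show "((%t. derivs b k (t - a)) has_vector_derivative derivs b (Suc k) (t - a)) (at t)" by (simp add: o_def)
 qed
 have "elem (%t. b (t - a))" using elem.comp[OF U bounded_linear_ident, of 0] by simp
 moreover have "b (t - a) = 0" if "M + \<bar>a\<bar> < \<bar>t\<bar>" for t by (rule M) (use that in linarith)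
 ultimately show ?thesis unfolding ccs_def by blast
qed

lemma ccs_bump: "ccs bump"
 unfolding ccs_def using elem_bump bump_vanish by (intro conjI exI[of _ "1/4"]) auto

lemma elem_fcut: "elem (fcut k 0)"
 using elem.comp[OF smooth1_fcut bounded_linear_ident] by simp

lemma fcut_0: "fcut k 0 t = bump (t / lam k - 1)"
 by (simp add: fcut_def)

lemma fcut_ge: "\<bar>t / lam k - 1\<bar> \<le> 1/8 ==> exp (- 16) \<le> Re (fcut k 0 t)"
 unfolding fcut_0 by (rule bump_ge)

text \<open>Multiplication by the k-th polynomial, seen on the Fourier side: translates by the
  frequencies l of the cut-off input, with coefficients \<open>rsc\<close>.\<close>

definition spread :: "real => nat => (real => complex) => real => complex" where
 "spread \<delta> k b \<theta> = (\<Sum>l<2 ^ rexp \<delta> k. complex_of_real (rsc (rexp \<delta> k) l) * (fcut k 0 (\<theta> - real l) * b (\<theta> - real l)))"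

lemma ccs_spread:
 assumes "ccs b" shows "ccs (spread \<delta> k b)"
proof -
 have B: "ccs (%t. fcut k 0 t * b t)" by (rule ccs_mult[OF elem_fcut assms])
 show ?thesis unfolding spread_def[abs_def] by (intro ccs_sum ccs_mult elem.const ccs_shift[OF B]) auto
qed

lemma fosc_mult_itt:
 assumes "ccs b"
 shows "fosc \<delta> k 0 s * itt (%t. fcut k 0 t * b t) s = itt (spread \<delta> k b) s"
proof -
 let ?B = "%t. fcut k 0 t * b t"
 have B: "ccs ?B" by (rule ccs_mult[OF elem_fcut assms])
 then have [measurable]: "?B \<in> borel_measurable borel" using ccs_facts(2)[OF B] by auto
 have sh: "cis (real l * s) * ett ?B s = (\<integral>t. cis (s \<bullet> t) * ?B (t - real l) \<partial>lborel)" for l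
 proof -
  have "(\<integral>t. cis (s \<bullet> t) * ?B (t - real l) \<partial>lborel) = (\<integral>t. cis (s \<bullet> (t + real l)) * ?B (t + real l - real l) \<partial>lborel)"
   by (rule lborel_integral_shift[symmetric]) measurable
  also have "\<dots> = (\<integral>t. cis (real l * s) * (cis (s \<bullet> t) * ?B t) \<partial>lborel)"
   by (intro Bochner_Integration.integral_cong refl) (simp add: distrib_left cis_mult[symmetric] mult_ac)
  also have "\<dots> = cis (real l * s) * ett ?B s" unfolding ett_def by (rule integral_mult_right_zero)
  finally show ?thesis ..
 qed
 have "ett (spread \<delta> k b) s = (\<integral>t. (\<Sum>l<2 ^ rexp \<delta> k. complex_of_real (rsc (rexp \<delta> k) l) * (cis (s \<bullet> t) * ?B (t - real l))) \<partial>lborel)"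
  unfolding ett_def spread_def by (intro Bochner_Integration.integral_cong refl) (simp only: sum_distrib_left mult_ac)
 also have "\<dots> = (\<Sum>l<2 ^ rexp \<delta> k. complex_of_real (rsc (rexp \<delta> k) l) * (\<integral>t. cis (s \<bullet> t) * ?B (t - real l) \<partial>lborel))"
 proof -
  have int: "integrable lborel (%t. complex_of_real (rsc (rexp \<delta> k) l) * (cis (s \<bullet> t) * ?B (t - real l)))" for l
   by (intro integrable_mult_right integrable_cis_mult ccs_facts(2)[OF ccs_shift[OF B]]) measurable
  show ?thesis unfolding Bochner_Integration.integral_sum[OF int] by (simp only: integral_mult_right_zero)
 qed
 also have "\<dots> = fosc \<delta> k 0 s * ett ?B s"
  unfolding sh[symmetric] fosc_def tpoly_def by (simp only: power_0 mult_1_right sum_distrib_right mult.assoc)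
 finally show ?thesis unfolding itt_def by (simp only: mult_ac)
qed

text \<open>Frequencies near \<open>lam k\<close> in every coordinate meet block k only, and that
  block is a tensor product in x and in \<xi>; the image is therefore a tensor product
  again.\<close>

lemma psido_csym_tens:
 assumes b: "ccs b" and supp: "\<And>t. b t ~= 0 ==> \<bar>t / lam k - 1\<bar> \<le> 1/8"
 shows "psido (csym m \<delta>) (tens (itt b)) = (%x::real^'n. complex_of_real (lam k powr m) * tens (itt (spread \<delta> k b)) x)"
proof
 fix x :: "real^'n"
 let ?B = "%t. fcut k 0 t * b t"
 have B: "ccs ?B" by (rule ccs_mult[OF elem_fcut b])
 have f: "fourier (tens (itt b)) \<xi> = tens b \<xi>" for \<xi> :: "real^'n"
  using fourier_tens_ett[OF b, of \<xi>] by (simp only: itt_def)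
 have sing: "csym m \<delta> x \<xi> * tens b \<xi> = tsym m \<delta> k x \<xi> * tens b \<xi>" for \<xi> :: "real^'n"
 proof (cases "tens b \<xi> = 0")
  case False
  then have "b (\<xi> $ undefined) ~= 0" by (auto simp: tens_def)
  from fcut_ge[OF supp[OF this]] have F: "fcut k 0 (\<xi> $ undefined) ~= 0" by (auto simp: not_le)
  obtain M0 where "norm \<xi> < real M0" using reals_Archimedean2 by blast
  then have M: "norm \<xi> < real (max M0 k)" by simp
  have "csym m \<delta> x \<xi> = (\<Sum>j<Suc (max M0 k). tsym m \<delta> j x \<xi>)" by (rule csym_eq[OF M])
  also have "\<dots> = (\<Sum>j\<in>{k}. tsym m \<delta> j x \<xi>)"
  proof (intro sum.mono_neutral_right ballI)
   fix j assume "j \<in> {..<Suc (max M0 k)} - {k}"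
   then have "fcut j 0 (\<xi> $ undefined) = 0" using fcut_disjoint[OF F, of j 0] by auto
   then have "(\<Prod>i\<in>UNIV. fcut j 0 (\<xi> $ i)) = 0" by (auto intro!: prod_zero)
   then show "tsym m \<delta> j x \<xi> = 0" by (simp add: tsym_def)
  qed auto
  finally show ?thesis by simp
 qed simp
 let ?c = "complex_of_real (lam k powr m) * (\<Prod>i\<in>UNIV. fosc \<delta> k 0 (x $ i))"
 have "cis (x \<bullet> \<xi>) * csym m \<delta> x \<xi> * fourier (tens (itt b)) \<xi> = ?c * (\<Prod>i\<in>UNIV. cis (x $ i \<bullet> (\<xi> $ i)) * ?B (\<xi> $ i))" for \<xi>
  unfolding f mult.assoc sing by (simp add: tsym_def tens_def prod.distrib prod_cis inner_vec_def mult_ac)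
 then have "psido (csym m \<delta>) (tens (itt b)) x = complex_of_real ((2 * pi) powr - real CARD('n)) * (?c * (\<integral>\<xi>. (\<Prod>i\<in>UNIV. cis (x $ i \<bullet> (\<xi> $ i)) * ?B (\<xi> $ i)) \<partial>lborel))"
  unfolding psido_def by (simp only: integral_mult_right_zero)
 also have "(\<integral>\<xi>. (\<Prod>i\<in>UNIV. cis (x $ i \<bullet> (\<xi> $ i)) * ?B (\<xi> $ i)) \<partial>(lborel :: (real^'n) measure)) = (\<Prod>i\<in>UNIV. ett ?B (x $ i))"
  unfolding ett_def by (rule integral_lborel_prod_vec) (intro integrable_cis_mult ccs_facts(2)[OF B], measurable)
 also have "complex_of_real ((2 * pi) powr - real CARD('n)) = (\<Prod>i\<in>(UNIV::'n set). complex_of_real (1 / (2 * pi)))"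
  by (simp add: powr_minus powr_realpow power_divide inverse_eq_divide)
 also have "\<dots> * (?c * (\<Prod>i\<in>UNIV. ett ?B (x $ i))) = complex_of_real (lam k powr m) * (\<Prod>i\<in>UNIV. fosc \<delta> k 0 (x $ i) * itt ?B (x $ i))"
  unfolding itt_def by (simp only: prod.distrib mult_ac)
 finally show "psido (csym m \<delta>) (tens (itt b)) x = complex_of_real (lam k powr m) * tens (itt (spread \<delta> k b)) x"
  unfolding fosc_mult_itt[OF b] tens_def .
qed

lemma rsc_sq: "rsc r l * rsc r l = 1 / 2 ^ r"
proof -
 have f: "fst (rs r) l * fst (rs r) l = 1" using abs_mult_self_eq[of "fst (rs r) l"] by (simp add: rs_abs)
 show ?thesis unfolding rsc_def times_divide_times_eq f real_sqrt_mult_self by simp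
qed

lemma real_ge_norm_sq: "c \<le> Re z ==> 0 \<le> c ==> c\<^sup>2 \<le> (norm z)\<^sup>2"
 by (intro power_mono order_trans[OF _ complex_Re_le_cmod])

lemma bump_norm_bound: "\<exists>K>0. \<forall>t. (norm (bump t))\<^sup>2 \<le> K * indicator {- (1/4)..1/4} t"
proof -
 obtain B where B: "0 \<le> B" "\<And>t. norm (derivs bump 0 t) \<le> B" using derivs_bump_bounded[of 0] by blast
 have "(norm (bump t))\<^sup>2 \<le> (B\<^sup>2 + 1) * indicator {- (1/4)..1/4} t" for t
 proof (cases "t \<in> {- (1/4)..1/4}")
  case True
  have "(norm (bump t))\<^sup>2 \<le> B\<^sup>2" using B(2)[of t] by (intro power_mono) auto
  then show ?thesis using True by simp
 next
  case False
  then have "1/4 \<le> \<bar>t\<bar>" by (auto simp: abs_if)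
  then show ?thesis by (simp add: bump_vanish)
 qed
 moreover have "0 < B\<^sup>2 + 1" using zero_le_power2[of B] by linarith
 ultimately show ?thesis by blast
qed

text \<open>Translates by up to 2 ^ \<open>rexp\<close> then stay where the cut-off of block k is
  bounded below. It holds for large k because \<delta> < 1.\<close>

definition small_scale :: "real => nat => bool" where
 "small_scale \<delta> k \<longleftrightarrow> 2 ^ rexp \<delta> k + 1 \<le> lam k / 8"

lemma near_lam:
 assumes "small_scale \<delta> k" "\<bar>t - lam k\<bar> \<le> 2 ^ rexp \<delta> k + 1"
 shows "\<bar>t / lam k - 1\<bar> \<le> 1/8"
proof -
 have l: "0 < lam k" using lam_ge_1[of k] by linarith
 have "t / lam k - 1 = (t - lam k) / lam k" using l by (simp add: diff_divide_distrib)
 then have "\<bar>t / lam k - 1\<bar> = \<bar>t - lam k\<bar> / lam k" using l by (simp only: abs_divide abs_of_pos)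
 also have "\<dots> \<le> (lam k / 8) / lam k" using assms l unfolding small_scale_def by (intro divide_right_mono) auto
 finally show ?thesis using l by simp
qed

text \<open>With N = 2 ^ \<open>rexp\<close>, an input that gains N^|1 - r| under
  \<open>spread\<close>, up to a constant K that is to be independent of k. Only the ratio of the
  norms counts, so the scale y of the input is left free.\<close>

definition probe :: "real => real => real => nat => bool" where
 "probe r \<delta> K k \<longleftrightarrow> (\<exists>b y. ccs b \<and> 0 < y \<and> (\<forall>t. b t ~= 0 --> \<bar>t / lam k - 1\<bar> \<le> 1/8) \<and>
  slice_norm r b \<le> ennreal (K * y) \<and> ennreal (y * (2 ^ rexp \<delta> k) powr \<bar>1 - r\<bar> / K) \<le> slice_norm r (spread \<delta> k b))"

text \<open>A single bump at \<open>lam k\<close> has norm of order 1. Its image consists of N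
  disjoint bumps of squared height about 1 / N, and N slices of that size give N^(1 - r).\<close>

lemma probe_low:
 assumes r: "0 < r" "r \<le> 1"
 shows "\<exists>K>0. \<forall>k. small_scale \<delta> k --> probe r \<delta> K k"
proof -
 obtain K0 where K0: "K0 > 0" "\<And>t. (norm (bump t))\<^sup>2 \<le> K0 * indicator {- (1/4)..1/4} t" using bump_norm_bound by blast
 obtain C where C: "C > 0" "\<forall>Q s. (\<forall>\<theta>. (norm (Q \<theta>))\<^sup>2 \<le> K0 * indicator {s - 1/4..s + 1/4} \<theta>) --> slice_norm r Q \<le> ennreal C"
  using slice_norm_upper_single[OF K0(1) r(1)] by (elim exE conjE)
 have e0: "(0::real) < (exp (- 16) * exp (- 16))\<^sup>2" by simp
 obtain c where c: "c > 0" "\<forall>N Q s. 0 < N --> (\<forall>l<N. \<forall>\<theta>. \<bar>\<theta> - (s + real l)\<bar> \<le> 1/8 --> (exp (- 16) * exp (- 16))\<^sup>2 / real N \<le> (norm (Q \<theta>))\<^sup>2)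
  --> ennreal (c * real N powr (1 - r)) \<le> slice_norm r Q"
  using slice_norm_lower[OF e0 r(1)] by (elim exE conjE)
 define K where "K = max C (1 / c)"
 have K: "C \<le> K" "1 / c \<le> K" "0 < K" using C(1) by (auto simp: K_def)
 have "probe r \<delta> K k" if k: "small_scale \<delta> k" for k
  unfolding probe_def
 proof (intro exI conjI allI impI)
  let ?b = "%t. bump (t - lam k)"
  let ?N = "2 ^ rexp \<delta> k :: nat"
  show "ccs ?b" by (rule ccs_shift[OF ccs_bump])
  show "\<bar>t / lam k - 1\<bar> \<le> 1/8" if "?b t ~= 0" for t
  proof (rule near_lam[OF k])
   have "\<bar>t - lam k\<bar> < 1/4" using that bump_vanish[of "t - lam k"] by (auto simp: not_less[symmetric])
   moreover have "(0::real) \<le> 2 ^ rexp \<delta> k" by simp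
   ultimately show "\<bar>t - lam k\<bar> \<le> 2 ^ rexp \<delta> k + 1" by linarith
  qed
  have "slice_norm r ?b \<le> ennreal C"
  proof (rule C(2)[rule_format])
   fix \<theta>
   have "indicator {- (1/4)..1/4} (\<theta> - lam k) = (indicator {lam k - 1/4..lam k + 1/4} \<theta> :: real)" by (auto simp: indicator_def)
   then show "(norm (?b \<theta>))\<^sup>2 \<le> K0 * indicator {lam k - 1/4..lam k + 1/4} \<theta>" using K0(2)[of "\<theta> - lam k"] by simp
  qed
  then show "slice_norm r ?b \<le> ennreal (K * 1)" using K by (auto intro: order_trans ennreal_leI)
  have "ennreal (1 * (2 ^ rexp \<delta> k) powr \<bar>1 - r\<bar> / K) \<le> ennreal (c * real ?N powr (1 - r))"
  proof (intro ennreal_leI)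
   have "1 / K \<le> c" using K c(1) by (simp add: field_simps)
   then have "1 / K * (2 ^ rexp \<delta> k) powr (1 - r) \<le> c * (2 ^ rexp \<delta> k) powr (1 - r)" by (intro mult_right_mono) auto
   then show "1 * (2 ^ rexp \<delta> k) powr \<bar>1 - r\<bar> / K \<le> c * real ?N powr (1 - r)" using r by simp
  qed
  also have "\<dots> \<le> slice_norm r (spread \<delta> k ?b)"
  proof (rule c(2)[rule_format, where N = ?N and s = "lam k"])
   fix l \<theta> assume l: "l < ?N" and t: "\<bar>\<theta> - (lam k + real l)\<bar> \<le> 1/8"
   have "bump (\<theta> - real j - lam k) = 0" if "j ~= l" for j
   proof (rule bump_vanish)
    have "1 \<le> \<bar>real l - real j\<bar>" using that by linarith
    then show "1/4 \<le> \<bar>\<theta> - real j - lam k\<bar>" using t by linarith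
   qed
   then have "spread \<delta> k ?b \<theta> = (\<Sum>l\<in>{l}. complex_of_real (rsc (rexp \<delta> k) l) * (fcut k 0 (\<theta> - real l) * ?b (\<theta> - real l)))"
    unfolding spread_def using l by (intro sum.mono_neutral_right) auto
   then have "(norm (spread \<delta> k ?b \<theta>))\<^sup>2 = (rsc (rexp \<delta> k) l)\<^sup>2 * ((norm (fcut k 0 (\<theta> - real l)))\<^sup>2 * (norm (bump (\<theta> - real l - lam k)))\<^sup>2)"
    by (simp add: norm_mult power_mult_distrib)
   also have "(rsc (rexp \<delta> k) l)\<^sup>2 = 1 / real ?N" by (simp add: power2_eq_square rsc_sq)
   finally have e: "(norm (spread \<delta> k ?b \<theta>))\<^sup>2 = 1 / real ?N * ((norm (fcut k 0 (\<theta> - real l)))\<^sup>2 * (norm (bump (\<theta> - real l - lam k)))\<^sup>2)" .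
   have "\<bar>\<theta> - real l - lam k\<bar> \<le> 2 ^ rexp \<delta> k + 1"
    using t zero_le_power[of "2::real" "rexp \<delta> k"] by linarith
   from fcut_ge[OF near_lam[OF k this]] have 1: "(exp (- 16))\<^sup>2 \<le> (norm (fcut k 0 (\<theta> - real l)))\<^sup>2" by (intro real_ge_norm_sq) auto
   have "\<bar>\<theta> - real l - lam k\<bar> \<le> 1/8" using t by linarith
   from bump_ge[OF this] have 2: "(exp (- 16))\<^sup>2 \<le> (norm (bump (\<theta> - real l - lam k)))\<^sup>2" by (intro real_ge_norm_sq) auto
   have "1 / real ?N * ((exp (- 16))\<^sup>2 * (exp (- 16))\<^sup>2) \<le> (norm (spread \<delta> k ?b \<theta>))\<^sup>2"
    unfolding e by (intro mult_left_mono mult_mono 1 2) auto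
   then show "(exp (- 16) * exp (- 16))\<^sup>2 / real ?N \<le> (norm (spread \<delta> k ?b \<theta>))\<^sup>2" by (simp add: power_mult_distrib)
  qed simp
  finally show "ennreal (1 * (2 ^ rexp \<delta> k) powr \<bar>1 - r\<bar> / K) \<le> slice_norm r (spread \<delta> k ?b)" .
 qed simp
 then show ?thesis using K(3) by blast
qed

text \<open>N bumps at \<open>lam k\<close> - l with coefficients \<open>rsc\<close> have norm at
  most of order N^(1 - r). Under \<open>spread\<close> the bump with index l is moved by l to
  \<open>lam k\<close> and acquires the coefficient rsc^2 = 1 / N; all signs agree, and the N
  contributions add up to a bump of height of order 1.\<close>

lemma probe_high:
 assumes r: "1 \<le> r"
 shows "\<exists>K>0. \<forall>k. small_scale \<delta> k --> probe r \<delta> K k"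
proof -
 obtain K0 where K0: "K0 > 0" "\<And>t. (norm (bump t))\<^sup>2 \<le> K0 * indicator {- (1/4)..1/4} t" using bump_norm_bound by blast
 obtain C where C: "C > 0" "\<forall>N Q E. 0 < N --> Q \<in> borel_measurable borel --> E \<in> sets borel --> emeasure lborel E \<le> ennreal (real N)
  --> (\<forall>\<theta>. (norm (Q \<theta>))\<^sup>2 \<le> K0 / real N * indicator E \<theta>) --> slice_norm r Q \<le> ennreal (C * real N powr (1 - r))"
  using slice_norm_upper[OF K0(1) r] by (elim exE conjE)
 have e0: "(0::real) < (exp (- 16) * exp (- 16))\<^sup>2" by simp
 have r0: "0 < r" using r by simp
 obtain c where c: "c > 0" "\<forall>N Q s. 0 < N --> (\<forall>l<N. \<forall>\<theta>. \<bar>\<theta> - (s + real l)\<bar> \<le> 1/8 --> (exp (- 16) * exp (- 16))\<^sup>2 / real N \<le> (norm (Q \<theta>))\<^sup>2)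
  --> ennreal (c * real N powr (1 - r)) \<le> slice_norm r Q"
  using slice_norm_lower[OF e0 r0] by (elim exE conjE)
 define K where "K = max C (1 / c)"
 have K: "C \<le> K" "1 / c \<le> K" "0 < K" using C(1) by (auto simp: K_def)
 have "probe r \<delta> K k" if k: "small_scale \<delta> k" for k
  unfolding probe_def
 proof (intro exI conjI allI impI)
  let ?N = "2 ^ rexp \<delta> k :: nat"
  let ?R = "2 ^ rexp \<delta> k :: real"
  let ?a = "%l. rsc (rexp \<delta> k) l"
  let ?b = "%t. \<Sum>l<?N. complex_of_real (?a l) * bump (t - (lam k - real l))"
  let ?E = "\<Union>l<?N. {lam k - real l - 1/4..lam k - real l + 1/4}"
  show b: "ccs ?b" by (intro ccs_sum ccs_mult elem.const ccs_shift[OF ccs_bump]) auto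
  have one: "?b t = complex_of_real (?a l) * bump (t - (lam k - real l))" if l: "l < ?N" "\<bar>t - (lam k - real l)\<bar> \<le> 1/4" for t l
  proof -
   have "bump (t - (lam k - real j)) = 0" if "j ~= l" for j
   proof (rule bump_vanish)
    have "1 \<le> \<bar>real l - real j\<bar>" using that by linarith
    then show "1/4 \<le> \<bar>t - (lam k - real j)\<bar>" using l by linarith
   qed
   then have "?b t = (\<Sum>l\<in>{l}. complex_of_real (?a l) * bump (t - (lam k - real l)))"
    using l(1) by (intro sum.mono_neutral_right) auto
   then show ?thesis by simp
  qed
  have supp: "\<exists>l<?N. \<bar>t - (lam k - real l)\<bar> \<le> 1/4" if "?b t ~= 0" for t
  proof (rule ccontr)
   assume "\<not> (\<exists>l<?N. \<bar>t - (lam k - real l)\<bar> \<le> 1/4)"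
   then have "bump (t - (lam k - real l)) = 0" if "l < ?N" for l using that by (intro bump_vanish) (auto simp: not_le)
   then have "?b t = 0" by (intro sum.neutral) auto
   then show False using that by simp
  qed
  show "\<bar>t / lam k - 1\<bar> \<le> 1/8" if bt: "?b t ~= 0" for t
  proof (rule near_lam[OF k])
   obtain l where l: "l < ?N" "\<bar>t - (lam k - real l)\<bar> \<le> 1/4" using supp[OF bt] by (elim exE conjE)
   have "real l < real ?N" using l(1) by (rule less_imp_of_nat_less)
   then have "real l < ?R" by simp
   then show "\<bar>t - lam k\<bar> \<le> ?R + 1" using l(2) by linarith
  qed
  have rs: "0 < ?R powr (1 - r)" by simp
  then show "0 < ?R powr (1 - r)" .
  have "slice_norm r ?b \<le> ennreal (C * real ?N powr (1 - r))"
  proof (rule C(2)[rule_format, where E = ?E])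
   show "?b \<in> borel_measurable borel" using ccs_facts(2)[OF b] by auto
   have "emeasure lborel ?E \<le> (\<Sum>l<?N. emeasure lborel {lam k - real l - 1/4..lam k - real l + 1/4})"
    by (rule emeasure_subadditive_finite) auto
   also have "\<dots> = (\<Sum>l<?N. ennreal (1/2))" by (simp add: emeasure_lborel_Icc_eq)
   also have "\<dots> = ennreal (real ?N * (1/2))" by (simp only: sum_constant card_lessThan ennreal_mult'[OF of_nat_0_le_iff] ennreal_of_nat_eq_real_of_nat)
   also have "\<dots> \<le> ennreal (real ?N)" by (intro ennreal_leI) simp
   finally show "emeasure lborel ?E \<le> ennreal (real ?N)" .
   fix \<theta>
   show "(norm (?b \<theta>))\<^sup>2 \<le> K0 / real ?N * indicator ?E \<theta>"
   proof (cases "?b \<theta> = 0")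
    case True
    then show ?thesis using K0(1) by simp
   next
    case False
    obtain l where l: "l < ?N" "\<bar>\<theta> - (lam k - real l)\<bar> \<le> 1/4" using supp[OF False] by (elim exE conjE)
    have "\<theta> \<in> {lam k - real l - 1/4..lam k - real l + 1/4}" using l(2) unfolding abs_diff_le_iff by simp
    then have E: "\<theta> \<in> ?E" using l(1) by (intro UN_I[of l]) auto
    have "(norm (?b \<theta>))\<^sup>2 = (?a l)\<^sup>2 * (norm (bump (\<theta> - (lam k - real l))))\<^sup>2"
     unfolding one[OF l] by (simp add: norm_mult power_mult_distrib)
    also have "(?a l)\<^sup>2 = 1 / real ?N" by (simp add: power2_eq_square rsc_sq)
    also have "1 / real ?N * (norm (bump (\<theta> - (lam k - real l))))\<^sup>2 \<le> 1 / real ?N * K0"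
     using order_trans[OF K0(2), of _ K0] K0(1) by (intro mult_left_mono) (auto simp: indicator_def)
    finally show ?thesis using E by simp
   qed
  qed auto
  also have "\<dots> \<le> ennreal (K * ?R powr (1 - r))" using K rs by (intro ennreal_leI) (auto intro: mult_right_mono)
  finally show "slice_norm r ?b \<le> ennreal (K * ?R powr (1 - r))" .
  have "?R powr (1 - r) * ?R powr \<bar>1 - r\<bar> / K = 1 / K" using r by (simp add: powr_add[symmetric])
  also have "\<dots> \<le> c * real (1::nat) powr (1 - r)" using K c(1) by (simp add: field_simps)
  finally have "ennreal (?R powr (1 - r) * ?R powr \<bar>1 - r\<bar> / K) \<le> ennreal (c * real (1::nat) powr (1 - r))" by (rule ennreal_leI)
  also have "\<dots> \<le> slice_norm r (spread \<delta> k ?b)"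
  \<comment> \<open>The image is examined on the single interval around \<open>lam k\<close>, where
    the contributions coincide.\<close>
  proof (rule c(2)[rule_format, where N = 1 and s = "lam k"])
   fix l :: nat and \<theta> assume "l < 1" and "\<bar>\<theta> - (lam k + real l)\<bar> \<le> 1/8"
   then have t: "\<bar>\<theta> - lam k\<bar> \<le> 1/8" by simp
   have fr: "fcut k 0 s = complex_of_real (Re (fcut k 0 s))" for s unfolding fcut_0 by (rule bump_real)
   have ge: "exp (- 16) \<le> Re (fcut k 0 (\<theta> - real l))" if "l < ?N" for l
   proof (rule fcut_ge, rule near_lam[OF k])
    have "real l < real ?N" using that by (rule less_imp_of_nat_less)
    then have "real l < ?R" by simp
    then show "\<bar>\<theta> - real l - lam k\<bar> \<le> ?R + 1" using t by linarith
   qed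
   have "spread \<delta> k ?b \<theta> = (\<Sum>l<?N. complex_of_real (1 / ?R) * (complex_of_real (Re (fcut k 0 (\<theta> - real l))) * bump (\<theta> - lam k)))"
    unfolding spread_def
   proof (intro sum.cong refl)
    fix l assume "l \<in> {..<?N}"
    then have bl: "?b (\<theta> - real l) = complex_of_real (?a l) * bump (\<theta> - lam k)"
     using one[of l "\<theta> - real l"] t by simp
    have "complex_of_real (?a l) * (fcut k 0 (\<theta> - real l) * ?b (\<theta> - real l)) = complex_of_real (?a l * ?a l) * (fcut k 0 (\<theta> - real l) * bump (\<theta> - lam k))"
     unfolding bl of_real_mult by (simp only: mult_ac)
    then show "complex_of_real (?a l) * (fcut k 0 (\<theta> - real l) * ?b (\<theta> - real l)) = complex_of_real (1 / ?R) * (complex_of_real (Re (fcut k 0 (\<theta> - real l))) * bump (\<theta> - lam k))"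
     unfolding rsc_sq fr[symmetric] .
   qed
   also have "\<dots> = complex_of_real (1 / ?R * (\<Sum>l<?N. Re (fcut k 0 (\<theta> - real l)))) * bump (\<theta> - lam k)"
    by (simp only: sum_distrib_left sum_distrib_right of_real_mult of_real_sum mult.assoc)
   finally have e: "(norm (spread \<delta> k ?b \<theta>))\<^sup>2 = (1 / ?R * (\<Sum>l<?N. Re (fcut k 0 (\<theta> - real l))))\<^sup>2 * (norm (bump (\<theta> - lam k)))\<^sup>2"
    by (simp only: norm_mult norm_of_real power_mult_distrib power2_abs)
   have "(\<Sum>l<?N. exp (- 16 :: real)) \<le> (\<Sum>l<?N. Re (fcut k 0 (\<theta> - real l)))" by (intro sum_mono ge) auto
   then have "?R * exp (- 16) \<le> (\<Sum>l<?N. Re (fcut k 0 (\<theta> - real l)))" by simp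
   then have "1 / ?R * (?R * exp (- 16)) \<le> 1 / ?R * (\<Sum>l<?N. Re (fcut k 0 (\<theta> - real l)))" by (intro mult_left_mono) auto
   then have "exp (- 16) \<le> 1 / ?R * (\<Sum>l<?N. Re (fcut k 0 (\<theta> - real l)))" by simp
   then have 1: "(exp (- 16))\<^sup>2 \<le> (1 / ?R * (\<Sum>l<?N. Re (fcut k 0 (\<theta> - real l))))\<^sup>2" by (intro power_mono) auto
   from bump_ge[OF t] have 2: "(exp (- 16))\<^sup>2 \<le> (norm (bump (\<theta> - lam k)))\<^sup>2" by (intro real_ge_norm_sq) auto
   have "(exp (- 16))\<^sup>2 * (exp (- 16))\<^sup>2 \<le> (norm (spread \<delta> k ?b \<theta>))\<^sup>2"
    unfolding e by (intro mult_mono 1 2) auto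
   then show "(exp (- 16) * exp (- 16))\<^sup>2 / real (1::nat) \<le> (norm (spread \<delta> k ?b \<theta>))\<^sup>2" by (simp add: power_mult_distrib)
  qed simp
  finally show "ennreal (?R powr (1 - r) * ?R powr \<bar>1 - r\<bar> / K) \<le> slice_norm r (spread \<delta> k ?b)" .
 qed
 then show ?thesis using K(3) by blast
qed

section \<open>Growth in k and the threshold\<close>

text \<open>2 ^ \<open>rexp\<close> + 1 \<le> 2 lam^\<delta>, which is at most lam / 8 as soon as
  lam^(1 - \<delta>) \<ge> 16.\<close>

lemma small_scale_eventually:
 assumes "0 \<le> \<delta>" "2 \<le> real k * (1 - \<delta>)"
 shows "small_scale \<delta> k"
proof -
 have "(2::real) powr 4 \<le> lam k powr (1 - \<delta>)" unfolding lam_powr using assms(2) by (intro powr_mono) auto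
 then have "16 \<le> lam k powr (1 - \<delta>)" by simp
 then have "16 * lam k powr \<delta> \<le> lam k powr (1 - \<delta>) * lam k powr \<delta>" by (intro mult_right_mono) auto
 also have "\<dots> = lam k" using lam_ge_1[of k] by (simp add: powr_add[symmetric])
 finally have 1: "16 * lam k powr \<delta> \<le> lam k" .
 have "1 \<le> (2::real) ^ rexp \<delta> k" by simp
 then show ?thesis unfolding small_scale_def using 1 rexp_bounds(1)[OF assms(1), of k] by linarith
qed

text \<open>The scale y of the test function and the constant P of the norm formula occur on both
  sides and cancel.\<close>

lemma tensor_power_cancel:
 fixes A P y K S c :: real
 assumes "A * P * (y * S / K) ^ n \<le> c * (P * (K * y) ^ n)" "0 < P" "0 < y"
 shows "A * (S / K) ^ n \<le> c * K ^ n"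
proof -
 have "y * S / K = y * (S / K)" by simp
 then have "A * P * (y * S / K) ^ n = (P * y ^ n) * (A * (S / K) ^ n)" by (simp only: power_mult_distrib mult_ac)
 moreover have "c * (P * (K * y) ^ n) = (P * y ^ n) * (c * K ^ n)" by (simp only: power_mult_distrib mult_ac)
 moreover have "0 < P * y ^ n" using assms(2,3) by simp
 ultimately show ?thesis using assms(1) by (simp only: mult_le_cancel_left_pos)
qed

text \<open>\<open>rexp\<close> rounds down by a factor of at most 2, which is moved into the
  constant together with K.\<close>

lemma lam_powr_le_rexp:
 assumes "0 < K" "0 \<le> a" "0 \<le> \<delta>"
 shows "lam k powr (\<delta> * a * real n) \<le> (2 powr a * K) ^ n * ((2 ^ rexp \<delta> k) powr a / K) ^ n"
proof -
 have l: "0 < lam k powr (\<delta> * a)" using lam_ge_1[of k] by simp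
 have "lam k powr (\<delta> * a) = (lam k powr \<delta>) powr a" by (simp only: powr_powr)
 also have "\<dots> \<le> (2 * 2 ^ rexp \<delta> k) powr a" by (rule powr_mono2[OF assms(2) powr_ge_zero rexp_bounds(2)[OF assms(3)]])
 also have "\<dots> = (2 powr a * K) * ((2 ^ rexp \<delta> k) powr a / K)"
 proof -
  have "(2 * 2 ^ rexp \<delta> k :: real) powr a = 2 powr a * (2 ^ rexp \<delta> k) powr a" by (rule powr_mult; simp)
  then show ?thesis using assms(1) by simp
 qed
 finally have "(lam k powr (\<delta> * a)) ^ n \<le> ((2 powr a * K) * ((2 ^ rexp \<delta> k) powr a / K)) ^ n" by (rule power_mono) simp
 moreover have "(lam k powr (\<delta> * a)) ^ n = lam k powr (\<delta> * a * real n)"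
 proof -
  have "(lam k powr (\<delta> * a)) ^ n = (lam k powr (\<delta> * a)) powr real n" by (rule powr_realpow[OF l, symmetric])
  then show ?thesis by (simp only: powr_powr)
 qed
 ultimately show ?thesis by (simp only: power_mult_distrib)
qed

lemma mult_bounds_combine:
 fixes A B E T c :: real
 assumes "A * T \<le> c" "B \<le> E * T" "0 \<le> A" "0 \<le> E"
 shows "A * B \<le> E * c"
proof -
 have "A * B \<le> A * (E * T)" by (rule mult_left_mono[OF assms(2,3)])
 also have "\<dots> = E * (A * T)" by (rule mult.left_commute)
 also have "\<dots> \<le> E * c" by (rule mult_left_mono[OF assms(1,4)])
 finally show ?thesis .
qed

text \<open>Linear growth is enough to contradict boundedness in k.\<close>

lemma half_le_two_powr:
 assumes "0 \<le> x" shows "x / 2 \<le> 2 powr (x::real)"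
proof -
 have "x * (1 / 2) \<le> x * ln 2" using assms ln2_ge_two_thirds by (intro mult_left_mono) auto
 also have "\<dots> \<le> exp (x * ln 2)" using exp_ge_add_one_self[of "x * ln 2"] by linarith
 also have "\<dots> = 2 powr x" by (simp add: powr_def)
 finally show ?thesis by simp
qed

lemma power2_powr_mult:
 assumes "0 < \<kappa>" shows "((lam k powr m)\<^sup>2 * \<kappa>) powr (q / 2) = lam k powr (m * q) * \<kappa> powr (q / 2)"
proof -
 have "(lam k powr m)\<^sup>2 = lam k powr (m + m)" by (simp only: power2_eq_square powr_add)
 moreover have "(lam k powr (m + m) * \<kappa>) powr (q / 2) = (lam k powr (m + m)) powr (q / 2) * \<kappa> powr (q / 2)"
  by (rule powr_mult)
 moreover have "(m + m) * (q / 2) = m * q" by (simp add: field_simps)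
 ultimately show ?thesis by (simp only: powr_powr)
qed

text \<open>|1 - q/2| = q |1/q - 1/2|.\<close>

lemma exponent_bound:
 fixes q m \<delta> n :: real
 assumes q: "1 < q" and e: "m * q + \<delta> * \<bar>1 - q / 2\<bar> * n \<le> 0"
 shows "m \<le> - \<bar>1 / q - 1 / 2\<bar> * \<delta> * n"
proof -
 have "1 - q / 2 = q * (1 / q - 1 / 2)" using q by (simp add: right_diff_distrib)
 then have "\<bar>1 - q / 2\<bar> = q * \<bar>1 / q - 1 / 2\<bar>" using q by (simp only: abs_mult)
 then have "q * (m + \<bar>1 / q - 1 / 2\<bar> * \<delta> * n) \<le> 0" using e by (simp only: distrib_left mult_ac)
 then have "m + \<bar>1 / q - 1 / 2\<bar> * \<delta> * n \<le> 0" using q by (simp add: mult_le_0_iff)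
 then show ?thesis by simp
qed

text \<open>The q-th power of the operator bound, applied to the test functions, keeps lam^(m q)
  N^(|1 - r| n) bounded in k. Since N is comparable to lam^\<delta> and lam = 4^k tends to infinity,
  the exponent m q + \<delta> |1 - r| n cannot be positive.\<close>

lemma csym_unbounded:
 assumes q: "1 < q" and \<delta>: "0 \<le> \<delta>" "\<delta> < 1"
  and bd: "bounded_on_M2q q (psido (csym m \<delta> :: real^'n => real^'n => complex))"
 shows "m \<le> - \<bar>1 / q - 1 / 2\<bar> * \<delta> * real CARD('n)"
proof -
 define r where "r = q / 2"
 define n where "n = CARD('n)"
 have r: "0 < r" using q by (simp add: r_def)
 obtain C where C: "0 < C" "\<And>f :: real^'n => complex. schwartz f ==> mod_norm_2q q (psido (csym m \<delta>) f) \<le> ennreal C * mod_norm_2q q f"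
  using bd unfolding bounded_on_M2q_def by blast
 have "\<exists>K>0. \<forall>k. small_scale \<delta> k --> probe r \<delta> K k"
  using probe_low[of r \<delta>] probe_high[of r \<delta>] r by (cases "r \<le> 1") (simp_all only: not_le less_imp_le)
 then obtain K where K: "0 < K" "\<And>k. small_scale \<delta> k ==> probe r \<delta> K k" by blast
 define a where "a = \<bar>1 - r\<bar>"
 have q0: "0 < q" using q by simp
 have iq: "enn_powr (enn_powr z (1 / q)) q = z" for z using enn_powr_powr[of "1 / q" q z] q by simp
 \<comment> \<open>The operator norm contributes C^q, the input K^n, the output another K^n and the
   rounding in \<open>rexp\<close> the power of 2.\<close>
 define D where "D = C powr q * K ^ n * (2 powr a * K) ^ n"
 have main: "lam k powr (m * q + \<delta> * a * real n) \<le> D" if k: "small_scale \<delta> k" for k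
 proof -
  obtain b y where b: "ccs b" "0 < y" "\<And>t. b t ~= 0 ==> \<bar>t / lam k - 1\<bar> \<le> 1/8"
   and up: "slice_norm r b \<le> ennreal (K * y)" and lo: "ennreal (y * (2 ^ rexp \<delta> k) powr a / K) \<le> slice_norm r (spread \<delta> k b)"
   using K(2)[OF k] unfolding a_def probe_def by (elim exE conjE) blast
  let ?R = "2 ^ rexp \<delta> k :: real"
  define \<kappa> where "\<kappa> = (1 / (2 * pi)) ^ n"
  have \<kappa>: "0 < \<kappa>" by (simp add: \<kappa>_def)
  let ?L = "lam k powr m"
  have L: "0 < ?L" using lam_ge_1[of k] by simp
  have "mod_norm_2q q (%x::real^'n. complex_of_real ?L * tens (itt (spread \<delta> k b)) x) \<le> ennreal C * mod_norm_2q q (tens (itt b) :: real^'n => complex)"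
  proof -
   have "schwartz (tens (itt b) :: real^'n => complex)" unfolding itt_def by (rule schwartz_tens_ett[OF b(1)])
   from C(2)[OF this]
   have "mod_norm_2q q (psido (csym m \<delta>) (tens (itt b) :: real^'n => complex)) \<le> ennreal C * mod_norm_2q q (tens (itt b) :: real^'n => complex)" .
   moreover have "psido (csym m \<delta>) (tens (itt b)) = (%x::real^'n. complex_of_real ?L * tens (itt (spread \<delta> k b)) x)"
    by (rule psido_csym_tens[OF b(1)]) (rule b(3))
   ultimately show ?thesis by (simp only:)
  qed
  then have "enn_powr (mod_norm_2q q (%x::real^'n. complex_of_real ?L * tens (itt (spread \<delta> k b)) x)) q
    \<le> enn_powr (ennreal C * mod_norm_2q q (%x::real^'n. complex_of_real 1 * tens (itt b) x)) q"
   using q by (intro enn_powr_mono) auto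
  then have "ennreal ((?L\<^sup>2 * \<kappa>) powr r) * slice_norm r (spread \<delta> k b) ^ n \<le> ennreal (C powr q) * (ennreal (\<kappa> powr r) * slice_norm r b ^ n)"
   unfolding mod_norm_tens[OF b(1) zero_le_one q] mod_norm_tens[OF ccs_spread[OF b(1)] less_imp_le[OF L] q] r_def[symmetric] n_def[symmetric] \<kappa>_def[symmetric]
    enn_powr_mult[OF q0] iq
   using C(1) by simp
  moreover have "ennreal ((?L\<^sup>2 * \<kappa>) powr r * (y * ?R powr a / K) ^ n) \<le> ennreal ((?L\<^sup>2 * \<kappa>) powr r) * slice_norm r (spread \<delta> k b) ^ n"
   using b(2) K(1) lo by (subst ennreal_mult') (auto intro!: mult_left_mono power_mono simp: ennreal_power[symmetric] simp del: ennreal_power)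
  moreover have "ennreal (C powr q) * (ennreal (\<kappa> powr r) * slice_norm r b ^ n) \<le> ennreal (C powr q * (\<kappa> powr r * (K * y) ^ n))"
  proof -
   have "slice_norm r b ^ n \<le> ennreal (K * y) ^ n" by (intro power_mono up) simp
   also have "\<dots> = ennreal ((K * y) ^ n)" using b(2) K(1) by (intro ennreal_power) simp
   finally show ?thesis unfolding ennreal_mult'[OF powr_ge_zero] by (intro mult_left_mono) auto
  qed
  ultimately have "ennreal ((?L\<^sup>2 * \<kappa>) powr r * (y * ?R powr a / K) ^ n) \<le> ennreal (C powr q * (\<kappa> powr r * (K * y) ^ n))"
   by (meson order_trans)
  moreover have "0 \<le> C powr q * (\<kappa> powr r * (K * y) ^ n)" using b(2) K(1) by simp
  ultimately have "(?L\<^sup>2 * \<kappa>) powr r * (y * ?R powr a / K) ^ n \<le> C powr q * (\<kappa> powr r * (K * y) ^ n)"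
   by (simp only: ennreal_le_iff)
  moreover have "(?L\<^sup>2 * \<kappa>) powr r = lam k powr (m * q) * \<kappa> powr r" unfolding r_def by (rule power2_powr_mult[OF \<kappa>])
  ultimately have le: "lam k powr (m * q) * \<kappa> powr r * (y * ?R powr a / K) ^ n \<le> C powr q * (\<kappa> powr r * (K * y) ^ n)" by (simp only:)
  have "0 < \<kappa> powr r" using \<kappa> by simp
  from tensor_power_cancel[OF le this b(2)] have 1: "lam k powr (m * q) * (?R powr a / K) ^ n \<le> C powr q * K ^ n" .
  have a0: "0 \<le> a" by (simp add: a_def)
  have "lam k powr (m * q) * lam k powr (\<delta> * a * real n) \<le> (2 powr a * K) ^ n * (C powr q * K ^ n)"
   by (rule mult_bounds_combine[OF 1 lam_powr_le_rexp[OF K(1) a0 \<delta>(1)]]) (use K(1) in auto)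
  then show ?thesis unfolding powr_add D_def by (simp only: mult_ac)
 qed
 have e: "m * q + \<delta> * a * real n \<le> 0"
 proof (rule ccontr)
  assume "\<not> m * q + \<delta> * a * real n \<le> 0"
  define e where "e = m * q + \<delta> * a * real n"
  have e: "0 < e" using \<open>\<not> m * q + \<delta> * a * real n \<le> 0\<close> by (simp add: e_def)
  obtain k1 where k1: "2 / (1 - \<delta>) \<le> real k1" using real_arch_simple by blast
  obtain k2 where k2: "D / e \<le> real k2" using real_arch_simple by blast
  \<comment> \<open>Large enough for \<open>small_scale\<close> and for k e > D; the added 1 makes
    the latter strict.\<close>
  define k where "k = max k1 k2 + 1"
  have "2 / (1 - \<delta>) \<le> real k" using k1 by (simp add: k_def)
  then have "small_scale \<delta> k" using \<delta> by (intro small_scale_eventually) (auto simp: pos_divide_le_eq)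
  from main[OF this] have "2 powr (2 * real k * e) \<le> D" unfolding e_def[symmetric] lam_powr .
  moreover have "D < real k * e"
  proof -
   have "D / e < real k" using k2 by (simp add: k_def)
   then show ?thesis using e by (simp only: pos_divide_less_eq)
  qed
  moreover have "real k * e \<le> 2 powr (2 * real k * e)" using half_le_two_powr[of "2 * real k * e"] e by simp
  ultimately show False by linarith
 qed
 show ?thesis using exponent_bound[OF q e[unfolded a_def r_def]] unfolding n_def .
qed

section \<open>The equivalence\<close>

theorem theorem1p1:
  fixes q m \<rho> \<delta> :: real
  assumes "1 < q" and "0 \<le> \<delta>" and "\<delta> \<le> \<rho>" and "\<rho> \<le> 1" and "\<delta> < 1"
  shows "(\<forall>\<sigma> \<in> (symbol_class m \<rho> \<delta> :: (real^'n \<Rightarrow> real^'n \<Rightarrow> complex) set).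
            bounded_on_M2q q (psido \<sigma>))
         \<longleftrightarrow> m \<le> - \<bar>1 / q - 1 / 2\<bar> * \<delta> * real CARD('n)"
proof
  assume "\<forall>\<sigma> \<in> (symbol_class m \<rho> \<delta> :: (real^'n \<Rightarrow> real^'n \<Rightarrow> complex) set). bounded_on_M2q q (psido \<sigma>)"
  \<comment> \<open>The assumption on the whole class is applied to one symbol, which is the same
    for every \<rho>.\<close>
  then have "bounded_on_M2q q (psido (csym m \<delta> :: real^'n \<Rightarrow> real^'n \<Rightarrow> complex))"
    using csym_symbol_class[OF assms(2,4)] by (rule bspec)
  from csym_unbounded[OF assms(1,2,5) this] show "m \<le> - \<bar>1 / q - 1 / 2\<bar> * \<delta> * real CARD('n)" .
next
  assume "m \<le> - \<bar>1 / q - 1 / 2\<bar> * \<delta> * real CARD('n)"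
  from psido_bounded_M2q[OF assms(1,2,3,5) this]
  show "\<forall>\<sigma> \<in> (symbol_class m \<rho> \<delta> :: (real^'n \<Rightarrow> real^'n \<Rightarrow> complex) set). bounded_on_M2q q (psido \<sigma>)" by (rule ballI)
qed

end
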